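(* Let the coefficients and weights satisfy the standing boundedness assumption of the context, and suppose that $B(\cdot)=0$, $C(\cdot)=0$, $E(\cdot,\cdot)=0$, $S(\cdot)=0$. Let $\Phi=\{\Phi(s):0\le s\le T\}$ be the solution of the random ODE $\mathrm d\Phi(s)=A(s)\Phi(s)\,\mathrm ds$, $\Phi(0)=I_n$. Let $\lambda_G$ and $\lambda_Q(s)$ be the essential infimum (over $\Omega$) of the smallest eigenvalue of $G$ and of $Q(s)$, respectively, and assume $\lambda_G\ge0$ and $\lambda_Q(s)\ge0$ for a.e. $s$. Set $$H(r):=D(r)^\top D(r)+\int_{\mathsf Z}F(r,z)^\top F(r,z)\,\lambda(\mathrm dz).$$ If there exists $\delta>0$ such that $$\left[\frac{\lambda_G}{\|\Phi(T)^{-1}\|_\infty^2}+\int_r^T\frac{\lambda_Q(s)}{\|\Phi(s)^{-1}\|_\infty^2}\,\mathrm ds\right]\frac{H(r)}{\|\Phi(r)\|_\infty^2}+R(r)\ge\delta I_m$$ a.s. for a.e. $r\in[0,T]$, then $u\mapsto J(t,0;u)$ is uniformly convex for every $t\in[0,T)$.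
   Context: Probabilistic setting. Fix $T>0$ and positive integers $n,m$. $(\Omega,\mathcal F,\mathbb P)$ is a complete probability space carrying a standard one-dimensional Brownian motion $W$ and, independent of $W$, a Poisson random measure $N(\mathrm dt,\mathrm dz)$ with characteristic measure $\lambda(\mathrm dz)$ on a measurable space $(\mathsf Z,\mathcal B(\mathsf Z))$, $\lambda(\mathsf Z)<\infty$ (compensator $\lambda(\mathrm dz)\mathrm dt$); $\widetilde N=N-\lambda(\mathrm dz)\mathrm dt$. $\mathbb F=\{\mathcal F_t\}$ is the natural filtration of $W$ and $N$ augmented by the $\mathbb P$-null sets, $\mathcal P$ its predictable $\sigma$-field on $[0,T]\times\Omega$. $\mathbb S^n$ is the space of symmetric $n\times n$ real matrices with its usual order. $\|\cdot\|_\infty$ of a bounded random matrix denotes the essential supremum over $\Omega$ of its Frobenius norm. Standing boundedness assumption. $A,C$ ($\mathbb R^{n\times n}$-valued), $B,D$ ($\mathbb R^{n\times m}$-valued), $Q$ ($\mathbb S^n$-valued), $S$ ($\mathbb R^{m\times n}$-valued), $R$ ($\mathbb S^m$-valued) are essentially bounded $\mathbb F$-predictable processes on $[0,T]\times\Omega$; $E$ ($\mathbb R^{n\times n}$-valued) and $F$ ($\mathbb R^{n\times m}$-valued) are essentially bounded $\mathcal B(\mathsf Z)\otimes\mathcal P$-measurable functions on $[0,T]\times\Omega\times\mathsf Z$; $G$ is an essentially bounded $\mathcal F_T$-measurable $\mathbb S^n$-valued random variable. State and cost. $\mathcal U[t,T]$ is the set of $\mathbb R^m$-valued $\mathbb F$-predictable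 $u$ with $\mathbb E\int_t^T|u|^2\mathrm ds<\infty$. For square-integrable $\mathcal F_t$-measurable $\xi$ and $u\in\mathcal U[t,T]$, $X$ solves on $[t,T]$ $$\mathrm dX(s)=[AX(s-)+Bu]\mathrm ds+[CX(s-)+Du]\mathrm dW(s)+\int_{\mathsf Z}[E(s,z)X(s-)+F(s,z)u]\widetilde N(\mathrm ds,\mathrm dz),\quad X(t)=\xi,$$ and $$J(t,\xi;u)=\mathbb E\Big[\langle GX(T),X(T)\rangle+\int_t^T\big(\langle QX,X\rangle+2\langle SX,u\rangle+\langle Ru,u\rangle\big)\mathrm ds\Big].$$ "$u\mapsto J(t,0;u)$ is uniformly convex" means: there is $\varepsilon>0$ with $J(t,0;u)\ge\varepsilon\,\mathbb E\int_t^T|u(s)|^2\mathrm ds$ for all $u\in\mathcal U[t,T]$. *)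

theory Defs
  imports "HOL-Probability.Probability"
begin

section \<open>Driving noise and filtration\<close>

definition time_measure :: "real \<Rightarrow> real measure" where
  "time_measure T = restrict_space lborel {0..T}"

definition brownian_events :: "'w measure \<Rightarrow> (real \<Rightarrow> 'w \<Rightarrow> real) \<Rightarrow> real \<Rightarrow> 'w set set" where
  "brownian_events M W t =
     {W s -` A \<inter> space M | s A. s \<in> {0..t} \<and> A \<in> sets borel}"

definition jump_events ::
  "'w measure \<Rightarrow> real \<Rightarrow> 'z measure \<Rightarrow> ('w \<Rightarrow> (real \<times> 'z) measure) \<Rightarrow> real \<Rightarrow> 'w set set" where
  "jump_events M T \<Lambda> N t =
     {(\<lambda>\<omega>. emeasure (N \<omega>) B) -` A \<inter> space M | B A.
        B \<in> sets (time_measure T \<Otimes>\<^sub>M \<Lambda>) \<and> B \<subseteq> {0..t} \<times> space \<Lambda> \<and> A \<in> sets borel}"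

definition brownian_motion :: "'w measure \<Rightarrow> real \<Rightarrow> (real \<Rightarrow> 'w \<Rightarrow> real) \<Rightarrow> bool" where
  "brownian_motion M T W \<longleftrightarrow>
     (\<forall>s\<in>{0..T}. W s \<in> borel_measurable M) \<and>
     (AE \<omega> in M. W 0 \<omega> = 0) \<and>
     (AE \<omega> in M. continuous_on {0..T} (\<lambda>s. W s \<omega>)) \<and>
     (\<forall>s r. 0 \<le> s \<and> s < r \<and> r \<le> T \<longrightarrow>
        distributed M lborel (\<lambda>\<omega>. W r \<omega> - W s \<omega>) (normal_density 0 (sqrt (r - s)))) \<and>
     (\<forall>(k::nat) \<tau>. (\<forall>i\<le>k. \<tau> i \<in> {0..T}) \<and> (\<forall>i<k. \<tau> i \<le> \<tau> (Suc i)) \<longrightarrow>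
        prob_space.indep_vars M (\<lambda>_. borel) (\<lambda>i \<omega>. W (\<tau> (Suc i)) \<omega> - W (\<tau> i) \<omega>) {..<k})"

definition poisson_random_measure ::
  "'w measure \<Rightarrow> real \<Rightarrow> 'z measure \<Rightarrow> ('w \<Rightarrow> (real \<times> 'z) measure) \<Rightarrow> bool" where
  "poisson_random_measure M T \<Lambda> N \<longleftrightarrow>
     (\<forall>\<omega>\<in>space M. sets (N \<omega>) = sets (time_measure T \<Otimes>\<^sub>M \<Lambda>)) \<and>
     (\<forall>B\<in>sets (time_measure T \<Otimes>\<^sub>M \<Lambda>). (\<lambda>\<omega>. emeasure (N \<omega>) B) \<in> borel_measurable M \<and>
        (let c = measure (time_measure T \<Otimes>\<^sub>M \<Lambda>) B in
         \<forall>k::nat. measure M {\<omega> \<in> space M. emeasure (N \<omega>) B = of_nat k}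
                    = c ^ k / fact k * exp (- c))) \<and>
     (\<forall>(k::nat) B. (\<forall>i<k. B i \<in> sets (time_measure T \<Otimes>\<^sub>M \<Lambda>)) \<and> disjoint_family_on B {..<k} \<longrightarrow>
        prob_space.indep_vars M (\<lambda>_. borel) (\<lambda>i \<omega>. emeasure (N \<omega>) (B i)) {..<k})"

definition independent_noises ::
  "'w measure \<Rightarrow> real \<Rightarrow> 'z measure \<Rightarrow> (real \<Rightarrow> 'w \<Rightarrow> real) \<Rightarrow> ('w \<Rightarrow> (real \<times> 'z) measure) \<Rightarrow> bool" where
  "independent_noises M T \<Lambda> W N \<longleftrightarrow>
     prob_space.indep_set M (sigma_sets (space M) (brownian_events M W T))
                            (sigma_sets (space M) (jump_events M T \<Lambda> N T))"

definition augmented_filtration ::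
  "'w measure \<Rightarrow> real \<Rightarrow> 'z measure \<Rightarrow> (real \<Rightarrow> 'w \<Rightarrow> real) \<Rightarrow> ('w \<Rightarrow> (real \<times> 'z) measure)
     \<Rightarrow> real \<Rightarrow> 'w measure" where
  "augmented_filtration M T \<Lambda> W N t =
     sigma (space M) (brownian_events M W t \<union> jump_events M T \<Lambda> N t \<union> null_sets M)"

text \<open>In the following \<open>\<F>\<close> stands for a filtration on \<open>[0,T]\<close>. The predictable
  \<open>\<sigma>\<close>-field is a measurable space only; it carries the zero measure.\<close>

definition predictable_sigma :: "'w measure \<Rightarrow> real \<Rightarrow> (real \<Rightarrow> 'w measure) \<Rightarrow> (real \<times> 'w) measure" where
  "predictable_sigma M T \<F> =
     sigma ({0..T} \<times> space M)
       ({{0} \<times> A | A. A \<in> sets (\<F> 0)} \<union>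
        {{a<..b} \<times> A | a b A. 0 \<le> a \<and> a < b \<and> b \<le> T \<and> A \<in> sets (\<F> a)})"


section \<open>Stochastic integrals\<close>

text \<open>Both stochastic integrals over \<open>(t,s]\<close> are the \<open>L\<^sup>2\<close> extensions of the integrals of
  elementary predictable integrands. An elementary integrand against \<open>W\<close> is a list of triples
  \<open>(a, b, \<xi>)\<close> standing for the sum of the processes \<open>\<xi> 1\<^bsub>(a,b]\<^esub>\<close>; against the compensated
  measure it is a list of \<open>(a, b, B, \<xi>)\<close> standing for the sum of the \<open>\<xi> 1\<^bsub>(a,b] \<times> B\<^esub>\<close>.\<close>

definition elementary_W ::
  "'w measure \<Rightarrow> real \<Rightarrow> (real \<Rightarrow> 'w measure) \<Rightarrow> real
     \<Rightarrow> (real \<times> real \<times> ('w \<Rightarrow> 'b::euclidean_space)) list \<Rightarrow> bool" where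
  "elementary_W M T \<F> t h \<longleftrightarrow>
     (\<forall>(a, b, \<xi>) \<in> set h. t \<le> a \<and> a \<le> b \<and> b \<le> T \<and>
        \<xi> \<in> borel_measurable (\<F> a) \<and> bounded (\<xi> ` space M))"

definition elementary_process_W ::
  "(real \<times> real \<times> ('w \<Rightarrow> 'b::euclidean_space)) list \<Rightarrow> real \<Rightarrow> 'w \<Rightarrow> 'b" where
  "elementary_process_W h s \<omega> = (\<Sum>(a, b, \<xi>)\<leftarrow>h. indicator {a<..b} s *\<^sub>R \<xi> \<omega>)"

definition elementary_integral_W ::
  "(real \<Rightarrow> 'w \<Rightarrow> real) \<Rightarrow> (real \<times> real \<times> ('w \<Rightarrow> 'b::euclidean_space)) list \<Rightarrow> real \<Rightarrow> 'w \<Rightarrow> 'b" where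
  "elementary_integral_W W h s \<omega> =
     (\<Sum>(a, b, \<xi>)\<leftarrow>h. (W (min b s) \<omega> - W (min a s) \<omega>) *\<^sub>R \<xi> \<omega>)"

definition is_integral_W ::
  "'w measure \<Rightarrow> real \<Rightarrow> (real \<Rightarrow> 'w measure) \<Rightarrow> (real \<Rightarrow> 'w \<Rightarrow> real) \<Rightarrow> real
     \<Rightarrow> (real \<Rightarrow> 'w \<Rightarrow> 'b::euclidean_space) \<Rightarrow> (real \<Rightarrow> 'w \<Rightarrow> 'b) \<Rightarrow> bool" where
  "is_integral_W M T \<F> W t H I \<longleftrightarrow>
     (\<lambda>(s, \<omega>). H s \<omega>)
        \<in> borel_measurable (restrict_space (predictable_sigma M T \<F>) ({t<..T} \<times> space M)) \<and>
     (\<forall>s\<in>{t..T}. I s \<in> borel_measurable (\<F> s)) \<and>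
     (\<forall>\<omega>\<in>space M. continuous_on {t..T} (\<lambda>s. I s \<omega>)) \<and>
     (\<exists>h. (\<forall>k::nat. elementary_W M T \<F> t (h k)) \<and>
        ((\<lambda>k. \<integral>\<^sup>+\<omega>. (\<integral>\<^sup>+s\<in>{t<..T}. ennreal ((norm (elementary_process_W (h k) s \<omega> - H s \<omega>))\<^sup>2)
              \<partial>lborel) \<partial>M) \<longlonglongrightarrow> 0) \<and>
        (\<forall>s\<in>{t..T}.
          (\<lambda>k. \<integral>\<^sup>+\<omega>. ennreal ((norm (elementary_integral_W W (h k) s \<omega> - I s \<omega>))\<^sup>2) \<partial>M)
            \<longlonglongrightarrow> 0))"

definition cadlag_on :: "real \<Rightarrow> real \<Rightarrow> (real \<Rightarrow> 'b::topological_space) \<Rightarrow> bool" where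
  "cadlag_on a b f \<longleftrightarrow>
     (\<forall>s\<in>{a..<b}. (f \<longlongrightarrow> f s) (at_right s)) \<and>
     (\<forall>s\<in>{a<..b}. \<exists>l. (f \<longlongrightarrow> l) (at_left s))"

definition compensated ::
  "'z measure \<Rightarrow> ('w \<Rightarrow> (real \<times> 'z) measure) \<Rightarrow> real \<Rightarrow> real \<Rightarrow> 'z set \<Rightarrow> 'w \<Rightarrow> real" where
  "compensated \<Lambda> N a b B \<omega> = measure (N \<omega>) ({a<..b} \<times> B) - (b - a) * measure \<Lambda> B"

definition elementary_N ::
  "'w measure \<Rightarrow> real \<Rightarrow> 'z measure \<Rightarrow> (real \<Rightarrow> 'w measure) \<Rightarrow> real
     \<Rightarrow> (real \<times> real \<times> 'z set \<times> ('w \<Rightarrow> 'b::euclidean_space)) list \<Rightarrow> bool" where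
  "elementary_N M T \<Lambda> \<F> t h \<longleftrightarrow>
     (\<forall>(a, b, B, \<xi>) \<in> set h. t \<le> a \<and> a \<le> b \<and> b \<le> T \<and> B \<in> sets \<Lambda> \<and>
        \<xi> \<in> borel_measurable (\<F> a) \<and> bounded (\<xi> ` space M))"

definition elementary_process_N ::
  "(real \<times> real \<times> 'z set \<times> ('w \<Rightarrow> 'b::euclidean_space)) list \<Rightarrow> real \<Rightarrow> 'w \<Rightarrow> 'z \<Rightarrow> 'b" where
  "elementary_process_N h s \<omega> z =
     (\<Sum>(a, b, B, \<xi>)\<leftarrow>h. (indicator {a<..b} s * indicator B z) *\<^sub>R \<xi> \<omega>)"

definition elementary_integral_N ::
  "'z measure \<Rightarrow> ('w \<Rightarrow> (real \<times> 'z) measure)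
     \<Rightarrow> (real \<times> real \<times> 'z set \<times> ('w \<Rightarrow> 'b::euclidean_space)) list \<Rightarrow> real \<Rightarrow> 'w \<Rightarrow> 'b" where
  "elementary_integral_N \<Lambda> N h s \<omega> =
     (\<Sum>(a, b, B, \<xi>)\<leftarrow>h. compensated \<Lambda> N (min a s) (min b s) B \<omega> *\<^sub>R \<xi> \<omega>)"

definition is_integral_N ::
  "'w measure \<Rightarrow> real \<Rightarrow> 'z measure \<Rightarrow> (real \<Rightarrow> 'w measure) \<Rightarrow> ('w \<Rightarrow> (real \<times> 'z) measure) \<Rightarrow> real
     \<Rightarrow> (real \<Rightarrow> 'w \<Rightarrow> 'z \<Rightarrow> 'b::euclidean_space) \<Rightarrow> (real \<Rightarrow> 'w \<Rightarrow> 'b) \<Rightarrow> bool" where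
  "is_integral_N M T \<Lambda> \<F> N t K I \<longleftrightarrow>
     (\<lambda>((s, \<omega>), z). K s \<omega> z)
        \<in> borel_measurable
            (restrict_space (predictable_sigma M T \<F>) ({t<..T} \<times> space M) \<Otimes>\<^sub>M \<Lambda>) \<and>
     (\<forall>s\<in>{t..T}. I s \<in> borel_measurable (\<F> s)) \<and>
     (\<forall>\<omega>\<in>space M. cadlag_on t T (\<lambda>s. I s \<omega>)) \<and>
     (\<exists>h. (\<forall>k::nat. elementary_N M T \<Lambda> \<F> t (h k)) \<and>
        ((\<lambda>k. \<integral>\<^sup>+\<omega>. (\<integral>\<^sup>+s\<in>{t<..T}.
              (\<integral>\<^sup>+z. ennreal ((norm (elementary_process_N (h k) s \<omega> z - K s \<omega> z))\<^sup>2) \<partial>\<Lambda>)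
              \<partial>lborel) \<partial>M) \<longlonglongrightarrow> 0) \<and>
        (\<forall>s\<in>{t..T}.
          (\<lambda>k. \<integral>\<^sup>+\<omega>. ennreal ((norm (elementary_integral_N \<Lambda> N (h k) s \<omega> - I s \<omega>))\<^sup>2) \<partial>M)
            \<longlonglongrightarrow> 0))"


section \<open>Coefficients\<close>

definition bounded_predictable ::
  "'w measure \<Rightarrow> real \<Rightarrow> (real \<Rightarrow> 'w measure) \<Rightarrow> (real \<Rightarrow> 'w \<Rightarrow> 'b::euclidean_space) \<Rightarrow> bool" where
  "bounded_predictable M T \<F> A \<longleftrightarrow>
     (\<lambda>(s, \<omega>). A s \<omega>) \<in> borel_measurable (predictable_sigma M T \<F>) \<and>
     (\<exists>c. AE (s, \<omega>) in time_measure T \<Otimes>\<^sub>M M. norm (A s \<omega>) \<le> c)"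

definition bounded_predictable_mark ::
  "'w measure \<Rightarrow> real \<Rightarrow> 'z measure \<Rightarrow> (real \<Rightarrow> 'w measure)
     \<Rightarrow> (real \<Rightarrow> 'w \<Rightarrow> 'z \<Rightarrow> 'b::euclidean_space) \<Rightarrow> bool" where
  "bounded_predictable_mark M T \<Lambda> \<F> E \<longleftrightarrow>
     (\<lambda>((s, \<omega>), z). E s \<omega> z) \<in> borel_measurable (predictable_sigma M T \<F> \<Otimes>\<^sub>M \<Lambda>) \<and>
     (\<exists>c. AE ((s, \<omega>), z) in (time_measure T \<Otimes>\<^sub>M M) \<Otimes>\<^sub>M \<Lambda>. norm (E s \<omega> z) \<le> c)"

definition symmetric_matrix :: "real^'n^'n \<Rightarrow> bool" where
  "symmetric_matrix A \<longleftrightarrow> transpose A = A"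

text \<open>The order of symmetric matrices.\<close>

definition loewner_le :: "real^'n^'n \<Rightarrow> real^'n^'n \<Rightarrow> bool" where
  "loewner_le A B \<longleftrightarrow> (\<forall>x. 0 \<le> ((B - A) *v x) \<bullet> x)"

definition smallest_eigenvalue :: "real^'n^'n \<Rightarrow> real" where
  "smallest_eigenvalue A = (LEAST l. \<exists>v. v \<noteq> 0 \<and> A *v v = l *\<^sub>R v)"

text \<open>The norm of type \<open>real^'n^'m\<close> is the Frobenius norm.\<close>

definition essnorm :: "'w measure \<Rightarrow> ('w \<Rightarrow> 'b::euclidean_space) \<Rightarrow> real" where
  "essnorm M f = real_of_ereal (esssup M (\<lambda>\<omega>. ereal (norm (f \<omega>))))"

definition essinf :: "'w measure \<Rightarrow> ('w \<Rightarrow> real) \<Rightarrow> real" where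
  "essinf M f = real_of_ereal (- esssup M (\<lambda>\<omega>. - ereal (f \<omega>)))"

definition fundamental_solution ::
  "'w measure \<Rightarrow> real \<Rightarrow> (real \<Rightarrow> 'w measure) \<Rightarrow> (real \<Rightarrow> 'w \<Rightarrow> real^'n^'n)
     \<Rightarrow> (real \<Rightarrow> 'w \<Rightarrow> real^'n^'n) \<Rightarrow> bool" where
  "fundamental_solution M T \<F> A \<Phi> \<longleftrightarrow>
     (\<forall>s\<in>{0..T}. \<Phi> s \<in> borel_measurable (\<F> s)) \<and>
     (AE \<omega> in M. continuous_on {0..T} (\<lambda>s. \<Phi> s \<omega>) \<and>
        (\<forall>s\<in>{0..T}. \<Phi> s \<omega> = mat 1 + (LINT r:{0..s}|lborel. A r \<omega> ** \<Phi> r \<omega>)))"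


section \<open>The control problem\<close>

definition controls :: "'w measure \<Rightarrow> real \<Rightarrow> (real \<Rightarrow> 'w measure) \<Rightarrow> real \<Rightarrow> (real \<Rightarrow> 'w \<Rightarrow> real^'m) set" where
  "controls M T \<F> t =
     {u. (\<lambda>(s, \<omega>). u s \<omega>)
           \<in> borel_measurable (restrict_space (predictable_sigma M T \<F>) ({t..T} \<times> space M)) \<and>
         (\<integral>\<^sup>+\<omega>. (\<integral>\<^sup>+s\<in>{t..T}. ennreal ((norm (u s \<omega>))\<^sup>2) \<partial>lborel) \<partial>M) < \<infinity>}"

text \<open>The left limit; its value at the initial time \<open>t\<close> is irrelevant, as the integrals
  in the state equation do not see \<open>s = t\<close>.\<close>

definition left_lim :: "(real \<Rightarrow> 'w \<Rightarrow> 'b::t2_space) \<Rightarrow> real \<Rightarrow> 'w \<Rightarrow> 'b" where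
  "left_lim X s \<omega> = Lim (at_left s) (\<lambda>r. X r \<omega>)"

definition is_state ::
  "'w measure \<Rightarrow> real \<Rightarrow> 'z measure \<Rightarrow> (real \<Rightarrow> 'w measure)
     \<Rightarrow> (real \<Rightarrow> 'w \<Rightarrow> real) \<Rightarrow> ('w \<Rightarrow> (real \<times> 'z) measure)
     \<Rightarrow> (real \<Rightarrow> 'w \<Rightarrow> real^'n^'n) \<Rightarrow> (real \<Rightarrow> 'w \<Rightarrow> real^'m^'n)
     \<Rightarrow> (real \<Rightarrow> 'w \<Rightarrow> real^'n^'n) \<Rightarrow> (real \<Rightarrow> 'w \<Rightarrow> real^'m^'n)
     \<Rightarrow> (real \<Rightarrow> 'w \<Rightarrow> 'z \<Rightarrow> real^'n^'n) \<Rightarrow> (real \<Rightarrow> 'w \<Rightarrow> 'z \<Rightarrow> real^'m^'n)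
     \<Rightarrow> real \<Rightarrow> ('w \<Rightarrow> real^'n) \<Rightarrow> (real \<Rightarrow> 'w \<Rightarrow> real^'m) \<Rightarrow> (real \<Rightarrow> 'w \<Rightarrow> real^'n) \<Rightarrow> bool" where
  "is_state M T \<Lambda> \<F> W N A B C D E F t \<xi> u X \<longleftrightarrow>
     (\<forall>s\<in>{t..T}. X s \<in> borel_measurable (\<F> s)) \<and>
     (\<forall>\<omega>\<in>space M. cadlag_on t T (\<lambda>s. X s \<omega>)) \<and>
     (\<integral>\<^sup>+\<omega>. (\<integral>\<^sup>+s\<in>{t..T}. ennreal ((norm (X s \<omega>))\<^sup>2) \<partial>lborel) \<partial>M) < \<infinity> \<and>
     (\<exists>I\<^sub>W I\<^sub>N.
        is_integral_W M T \<F> W t (\<lambda>s \<omega>. C s \<omega> *v left_lim X s \<omega> + D s \<omega> *v u s \<omega>) I\<^sub>W \<and>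
        is_integral_N M T \<Lambda> \<F> N t (\<lambda>s \<omega> z. E s \<omega> z *v left_lim X s \<omega> + F s \<omega> z *v u s \<omega>) I\<^sub>N \<and>
        (AE \<omega> in M. \<forall>s\<in>{t..T}.
           X s \<omega> = \<xi> \<omega> + (LINT r:{t..s}|lborel. A r \<omega> *v left_lim X r \<omega> + B r \<omega> *v u r \<omega>)
                   + I\<^sub>W s \<omega> + I\<^sub>N s \<omega>))"

definition cost ::
  "'w measure \<Rightarrow> real \<Rightarrow> (real \<Rightarrow> 'w \<Rightarrow> real^'n^'n) \<Rightarrow> (real \<Rightarrow> 'w \<Rightarrow> real^'n^'m)
     \<Rightarrow> (real \<Rightarrow> 'w \<Rightarrow> real^'m^'m) \<Rightarrow> ('w \<Rightarrow> real^'n^'n)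
     \<Rightarrow> real \<Rightarrow> (real \<Rightarrow> 'w \<Rightarrow> real^'m) \<Rightarrow> (real \<Rightarrow> 'w \<Rightarrow> real^'n) \<Rightarrow> real" where
  "cost M T Q S R G t u X =
     (LINT \<omega>|M. (G \<omega> *v X T \<omega>) \<bullet> X T \<omega> +
        (LINT s:{t..T}|lborel.
           (Q s \<omega> *v X s \<omega>) \<bullet> X s \<omega> + 2 * ((S s \<omega> *v X s \<omega>) \<bullet> u s \<omega>) + (R s \<omega> *v u s \<omega>) \<bullet> u s \<omega>))"

text \<open>The value \<open>J(t,0;u)\<close> is the cost along the solution \<open>X\<close> of the state equation with
  \<open>X(t) = 0\<close>. That solution is unique up to indistinguishability only, so the inequality is
  stated for each of its versions.\<close>

definition uniformly_convex_cost ::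
  "'w measure \<Rightarrow> real \<Rightarrow> 'z measure \<Rightarrow> (real \<Rightarrow> 'w measure)
     \<Rightarrow> (real \<Rightarrow> 'w \<Rightarrow> real) \<Rightarrow> ('w \<Rightarrow> (real \<times> 'z) measure)
     \<Rightarrow> (real \<Rightarrow> 'w \<Rightarrow> real^'n^'n) \<Rightarrow> (real \<Rightarrow> 'w \<Rightarrow> real^'m^'n)
     \<Rightarrow> (real \<Rightarrow> 'w \<Rightarrow> real^'n^'n) \<Rightarrow> (real \<Rightarrow> 'w \<Rightarrow> real^'m^'n)
     \<Rightarrow> (real \<Rightarrow> 'w \<Rightarrow> 'z \<Rightarrow> real^'n^'n) \<Rightarrow> (real \<Rightarrow> 'w \<Rightarrow> 'z \<Rightarrow> real^'m^'n)
     \<Rightarrow> (real \<Rightarrow> 'w \<Rightarrow> real^'n^'n) \<Rightarrow> (real \<Rightarrow> 'w \<Rightarrow> real^'n^'m)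
     \<Rightarrow> (real \<Rightarrow> 'w \<Rightarrow> real^'m^'m) \<Rightarrow> ('w \<Rightarrow> real^'n^'n) \<Rightarrow> real \<Rightarrow> bool" where
  "uniformly_convex_cost M T \<Lambda> \<F> W N A B C D E F Q S R G t \<longleftrightarrow>
     (\<exists>\<epsilon>>0. \<forall>u\<in>controls M T \<F> t. \<forall>X. is_state M T \<Lambda> \<F> W N A B C D E F t (\<lambda>_. 0) u X \<longrightarrow>
        cost M T Q S R G t u X \<ge> \<epsilon> * (LINT \<omega>|M. (LINT s:{t..T}|lborel. (norm (u s \<omega>))\<^sup>2)))"

end

theory Submission
  imports Defs
begin

text \<open>
  Let \<open>I\<close> be the sum of the two stochastic integrals in the state equation. Since \<open>B\<close>, \<open>C\<close> and \<open>E\<close> vanish,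
  \<open>V = \<Phi>\<^sup>-\<^sup>1 X\<close> has the increments \<open>dV = \<Phi>\<^sup>-\<^sup>1 dI\<close>, which are orthogonal to the past and satisfy
  \<open>|\<Phi>\<^sup>-\<^sup>1 \<eta>| \<ge> |\<eta>| / |\<Phi>|\<close>. Hence \<open>V\<close>, and then \<open>X = \<Phi> V\<close>, grows at least as
  \<open>|\<Phi>(s)\<^sup>-\<^sup>1|\<^sup>2 E |X(s)|\<^sup>2 \<ge> \<integral> |\<Phi>(r)|\<^sup>-\<^sup>2 E \<langle>H(r) u(r), u(r)\<rangle> dr\<close>, the integral extending over
  \<open>t \<le> r \<le> s\<close> and the norms of \<open>\<Phi>\<close> being essential suprema. Estimating \<open>G\<close> and \<open>Q\<close> from below by \<open>\<lambda>\<^sub>G\<close> and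
  \<open>\<lambda>\<^sub>Q\<close> and exchanging the order of integration over \<open>r \<le> s\<close>, the cost is at least the integral of the
  expected quadratic form in the hypothesis, and \<open>\<epsilon> = \<delta>\<close> works. Instead of Ito's formula, the growth of \<open>V\<close>
  is obtained by summing over fine partitions, on whose intervals \<open>\<Phi>\<close> may be frozen.
\<close>

section \<open>Matrices\<close>

text \<open>The norms in the hypothesis are essential suprema, hence deterministic: they can be
  pulled out of expectations, and second moments are all that is estimated. Of the noise only two
  properties of the increments of \<open>I\<close> enter: their second moments have a density
  \<open>h\<close> in time, and they are orthogonal to square integrable variables of the past.
  Freezing \<open>\<Phi>\<close> on an interval of length d leaves an error in \<open>V\<close>
  whose second moment is of order d^2 (d^2 + kappa), where kappa is the integral of \<open>h\<close>
  over the interval. In the cross term of this error, Young's inequality with a parameter eps splits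
  off a part proportional to eps d, which sums to a multiple of eps; the rest sums to O(1/n) over n
  intervals for fixed eps. So the partition is refined first and eps sent to 0 afterwards. All
  constants have to be uniform in omega; they come from Gronwall estimates with the essential bound
  of \<open>A\<close>. The weight 1 / |\<Phi>|^2 must also be frozen on each interval, so it has to
  be Lipschitz in time, and for that |\<Phi>| must stay away from 0.\<close>

lemma norm_matrix_vector_mult_le:
  fixes A :: "real^'n^'m"
  shows "norm (A *v x) \<le> norm A * norm x"
proof -
  have "norm (A *v x) = L2_set (\<lambda>i. \<bar>A $ i \<bullet> x\<bar>) UNIV"
    by (simp add: matrix_mult_dot norm_vec_def)
  also have "\<dots> \<le> L2_set (\<lambda>i. norm (A $ i) * norm x) UNIV"
    by (intro L2_set_mono) (auto intro: Cauchy_Schwarz_ineq2)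
  also have "\<dots> = norm A * norm x"
    by (simp add: L2_set_left_distrib norm_vec_def)
  finally show ?thesis .
qed

lemma norm_matrix_matrix_mult_le:
  fixes A :: "real^'n^'m" and B :: "real^'k^'n"
  shows "norm (A ** B) \<le> norm A * norm B"
proof -
  have "norm ((A ** B) $ i) \<le> norm (A $ i) * norm B" for i
  proof -
    have "(A ** B) $ i = (\<Sum>k\<in>UNIV. A $ i $ k *\<^sub>R B $ k)"
      by (simp add: vec_eq_iff matrix_matrix_mult_def)
    then have "norm ((A ** B) $ i) \<le> (\<Sum>k\<in>UNIV. \<bar>A $ i $ k\<bar> * \<bar>norm (B $ k)\<bar>)"
      by (auto intro!: order_trans[OF norm_sum])
    also have "\<dots> \<le> L2_set (\<lambda>k. A $ i $ k) UNIV * L2_set (\<lambda>k. norm (B $ k)) UNIV"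
      by (rule L2_set_mult_ineq)
    also have "\<dots> = norm (A $ i) * norm B"
      unfolding norm_vec_def[of "A $ i"] norm_vec_def[of B] by (simp add: L2_set_def)
    finally show ?thesis .
  qed
  then have "norm (A ** B) \<le> L2_set (\<lambda>i. norm (A $ i) * norm B) UNIV"
    unfolding norm_vec_def[of "A ** B"] by (intro L2_set_mono) auto
  also have "\<dots> = norm A * norm B"
    by (simp add: L2_set_left_distrib norm_vec_def)
  finally show ?thesis .
qed

text \<open>Every entry is bounded by the image of a basis vector. The dimensional constant is
  crude, but only some deterministic bound on the Frobenius norm of an inverse is wanted, and what
  the differential equation yields is an operator bound.\<close>

lemma norm_matrix_le_of_operator_bound:
  fixes A :: "real^'n^'m"
  assumes "\<And>x. norm (A *v x) \<le> K * norm x"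
  shows "norm A \<le> real CARD('n) * real CARD('m) * K"
proof -
  have entry: "\<bar>A $ i $ j\<bar> \<le> K" for i j
  proof -
    have "\<bar>A $ i $ j\<bar> = \<bar>(A *v axis j 1) $ i\<bar>"
      by (simp add: matrix_vector_mult_basis column_def)
    also have "\<dots> \<le> norm (A *v axis j 1)" by (rule component_le_norm_cart)
    also have "\<dots> \<le> K" using assms[of "axis j 1"] by simp
    finally show ?thesis .
  qed
  have "norm A \<le> (\<Sum>i\<in>UNIV. norm (A $ i))"
    unfolding norm_vec_def[of A] by (intro L2_set_le_sum) auto
  also have "\<dots> \<le> (\<Sum>i\<in>(UNIV::'m set). \<Sum>j\<in>(UNIV::'n set). \<bar>A $ i $ j\<bar>)"
    by (intro sum_mono norm_le_l1_cart)
  also have "\<dots> \<le> (\<Sum>i\<in>(UNIV::'m set). \<Sum>j\<in>(UNIV::'n set). K)"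
    by (intro sum_mono entry)
  also have "\<dots> = real CARD('n) * real CARD('m) * K" by simp
  finally show ?thesis .
qed

lemma bounded_bilinear_matrix_vector_mult:
  "bounded_bilinear ((*v) :: real^'n^'m \<Rightarrow> real^'n \<Rightarrow> real^'m)"
proof
  show "\<exists>K. \<forall>(a::real^'n^'m) b. norm (a *v b) \<le> norm a * norm b * K"
    by (rule exI[of _ 1]) (simp add: norm_matrix_vector_mult_le)
qed (simp_all add: matrix_vector_mult_add_rdistrib matrix_vector_right_distrib
    scaleR_matrix_vector_assoc matrix_vector_mult_scaleR)

lemma bounded_bilinear_matrix_matrix_mult:
  "bounded_bilinear ((**) :: real^'n^'m \<Rightarrow> real^'k^'n \<Rightarrow> real^'k^'m)"
proof
  show "\<exists>K. \<forall>(a::real^'n^'m) (b::real^'k^'n). norm (a ** b) \<le> norm a * norm b * K"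
    by (rule exI[of _ 1]) (simp add: norm_matrix_matrix_mult_le)
qed (simp_all add: matrix_matrix_mult_def vec_eq_iff distrib_right distrib_left sum.distrib
    sum_distrib_left mult_ac)

lemma borel_measurable_matrix_vector_mult [measurable (raw)]:
  fixes A :: "'a \<Rightarrow> real^'n^'m"
  assumes "A \<in> borel_measurable M" "x \<in> borel_measurable M"
  shows "(\<lambda>\<omega>. A \<omega> *v x \<omega>) \<in> borel_measurable M"
  by (rule borel_measurable_continuous_Pair[OF assms])
     (intro bounded_bilinear.continuous_on[OF bounded_bilinear_matrix_vector_mult] continuous_intros)

lemma borel_measurable_matrix_matrix_mult [measurable (raw)]:
  fixes A :: "'a \<Rightarrow> real^'n^'m" and B :: "'a \<Rightarrow> real^'k^'n"
  assumes "A \<in> borel_measurable M" "B \<in> borel_measurable M"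
  shows "(\<lambda>\<omega>. A \<omega> ** B \<omega>) \<in> borel_measurable M"
  by (rule borel_measurable_continuous_Pair[OF assms])
     (intro bounded_bilinear.continuous_on[OF bounded_bilinear_matrix_matrix_mult] continuous_intros)

lemma borel_measurable_vec_iff:
  fixes f :: "'a \<Rightarrow> ('b::euclidean_space)^'n"
  shows "f \<in> borel_measurable M \<longleftrightarrow> (\<forall>i. (\<lambda>x. f x $ i) \<in> borel_measurable M)"
proof safe
  fix i assume [measurable]: "f \<in> borel_measurable M"
  show "(\<lambda>x. f x $ i) \<in> borel_measurable M"
    by (rule measurable_compose[OF \<open>f \<in> _\<close>])
       (intro borel_measurable_continuous_onI continuous_intros)
next
  assume f: "\<forall>i. (\<lambda>x. f x $ i) \<in> borel_measurable M"
  show "f \<in> borel_measurable M"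
  proof (subst borel_measurable_euclidean_space, safe)
    fix b :: "'b^'n" assume "b \<in> Basis"
    have "(\<lambda>x. f x \<bullet> b) = (\<lambda>x. \<Sum>i\<in>UNIV. f x $ i \<bullet> b $ i)" by (simp add: inner_vec_def)
    then show "(\<lambda>x. f x \<bullet> b) \<in> borel_measurable M"
      using f by (auto intro!: borel_measurable_sum borel_measurable_inner)
  qed
qed

section \<open>Measurability of the matrix inverse\<close>

lemma matrix_inv_inverse:
  fixes A :: "real^'n^'n"
  assumes "invertible A"
  shows "A ** matrix_inv A = mat 1" "matrix_inv A ** A = mat 1"
  using someI_ex[OF assms[unfolded invertible_def]] unfolding matrix_inv_def by auto

text \<open>Cramer's rule is applied to each column of the inverse. \<open>matrix_inv\<close> is
  defined by choice, so an explicit formula in the entries is the way to its measurability.\<close>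

lemma matrix_inv_cramer:
  fixes A :: "real^'n^'n"
  assumes "det A \<noteq> 0"
  shows "matrix_inv A = (\<chi> k j. det (\<chi> i l. if l = k then axis j 1 $ i else A $ i $ l) / det A)"
proof -
  have A: "A ** matrix_inv A = mat 1"
    using assms unfolding invertible_det_nz[symmetric] by (rule matrix_inv_inverse)
  have "column j (matrix_inv A) = (\<chi> k. det (\<chi> i l. if l = k then axis j 1 $ i else A $ i $ l) / det A)" for j
  proof (subst cramer[OF assms, symmetric])
    have "A *v column j (matrix_inv A) = A *v (matrix_inv A *v axis j 1)"
      by (simp add: matrix_vector_mult_basis)
    also have "\<dots> = axis j 1" by (simp add: matrix_vector_mul_assoc A)
    finally show "A *v column j (matrix_inv A) = axis j 1" .
  qed
  then have "column j (matrix_inv A) $ k = det (\<chi> i l. if l = k then axis j 1 $ i else A $ i $ l) / det A" for j k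
    by simp
  then show ?thesis
    by (simp add: vec_eq_iff column_def)
qed

lemma borel_measurable_matrix_entry:
  fixes f :: "'a \<Rightarrow> real^'n^'m"
  assumes "f \<in> borel_measurable M" shows "(\<lambda>x. f x $ i $ j) \<in> borel_measurable M"
  using assms by (auto simp: borel_measurable_vec_iff)

lemma borel_measurable_det:
  fixes f :: "'a \<Rightarrow> real^'n^'n"
  assumes "f \<in> borel_measurable M" shows "(\<lambda>x. det (f x)) \<in> borel_measurable M"
  unfolding det_def using borel_measurable_matrix_entry[OF assms]
  by (intro borel_measurable_sum borel_measurable_times borel_measurable_prod) auto

lemma borel_measurable_matrix_inv [measurable (raw)]:
  fixes f :: "'a \<Rightarrow> real^'n^'n"
  assumes [measurable]: "f \<in> borel_measurable M"
  shows "(\<lambda>x. matrix_inv (f x)) \<in> borel_measurable M"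
proof -
  define g where "g A = (\<chi> k j. det (\<chi> i l. if l = k then axis j 1 $ i else A $ i $ l) / det A)"
    for A :: "real^'n^'n"
  \<comment> \<open>For a singular matrix the choice defining \<open>matrix_inv\<close> ranges over
    an empty predicate. All singular matrices therefore share this one value, and the function is
    constant on them.\<close>
  define N :: "real^'n^'n" where "N = (SOME B. False)"
  have eq: "matrix_inv (f x) = (if det (f x) = 0 then N else g (f x))" for x
  proof (cases "det (f x) = 0")
    case True
    then have "\<not> invertible (f x)" by (simp add: invertible_det_nz)
    then have "(\<lambda>A'. f x ** A' = mat 1 \<and> A' ** f x = mat 1) = (\<lambda>_. False)"
      unfolding invertible_def by blast
    with True show ?thesis by (simp add: matrix_inv_def N_def)
  qed (simp add: matrix_inv_cramer g_def)
  have [measurable]: "(\<lambda>x. det (f x)) \<in> borel_measurable M" by (rule borel_measurable_det) fact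
  have [measurable]: "(\<lambda>x. g (f x)) \<in> borel_measurable M"
    unfolding g_def borel_measurable_vec_iff using borel_measurable_matrix_entry[OF assms]
    by (auto intro!: borel_measurable_divide borel_measurable_det simp: borel_measurable_vec_iff)
  show ?thesis unfolding eq by measurable
qed

section \<open>The smallest eigenvalue as the minimum of the quadratic form\<close>

lemma quadratic_form_null_vector:
  fixes B :: "real^'n^'n"
  assumes sym: "symmetric_matrix B" and psd: "\<And>y. 0 \<le> (B *v y) \<bullet> y" and x: "(B *v x) \<bullet> x = 0"
  shows "B *v x = 0"
proof -
  let ?z = "B *v x"
  have swap: "(B *v y) \<bullet> x = ?z \<bullet> y" for y
    using sym unfolding symmetric_matrix_def by (metis dot_lmul_matrix inner_commute transpose_matrix_vector)
  \<comment> \<open>On the line \<open>x + t *\<^sub>R ?z\<close> the form is a nonnegative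
    quadratic polynomial in \<open>t\<close> without constant term, so its linear coefficient
    \<open>2 * (?z \<bullet> ?z)\<close> has to vanish.\<close>
  have "0 \<le> 2 * t * (?z \<bullet> ?z) + t\<^sup>2 * ((B *v ?z) \<bullet> ?z)" for t
    using psd[of "x + t *\<^sub>R ?z"] x swap[of "?z"]
    by (simp add: matrix_vector_right_distrib matrix_vector_mult_scaleR inner_add_left inner_add_right
        power2_eq_square algebra_simps)
  note q = this
  define a where "a = ?z \<bullet> ?z" define b where "b = (B *v ?z) \<bullet> ?z"
  have a: "a \<ge> 0" and b: "b \<ge> 0" by (auto simp: a_def b_def psd)
  have "a = 0"
  proof (rule ccontr)
    assume "a \<noteq> 0" with a have "a > 0" by simp
    \<comment> \<open>With this \<open>k\<close> the polynomial takes the value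
      \<open>k\<^sup>2 * (- b - 2)\<close> at \<open>- k\<close>. The summand 1 in the denominator
      covers \<open>b = 0\<close>.\<close>
    define k where "k = a / (b + 1)"
    have k: "k > 0" "a = k * (b + 1)" using \<open>a > 0\<close> b by (auto simp: k_def)
    have "0 \<le> 2 * (- k) * a + (- k)\<^sup>2 * b"
      using q[of "- k"] unfolding a_def b_def .
    also have "\<dots> = k\<^sup>2 * (- b - 2)"
      by (simp add: k(2) power2_eq_square algebra_simps)
    also have "\<dots> < 0" using k(1) b by (intro mult_pos_neg) auto
    finally show False by simp
  qed
  then show ?thesis by (simp add: a_def)
qed

text \<open>Stands in for \<open>smallest_eigenvalue\<close>, whose definition by
  \<open>LEAST\<close> gives no access to measurability or bounds. As an infimum of functions that
  are Lipschitz in the matrix it is Lipschitz itself.\<close>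

definition rayleigh_min :: "real^'n^'n \<Rightarrow> real" where
  "rayleigh_min A = (INF x\<in>sphere 0 1. (A *v x) \<bullet> x)"

lemma rayleigh_bdd:
  fixes A :: "real^'n^'n"
  shows "bdd_below ((\<lambda>x. (A *v x) \<bullet> x) ` sphere 0 1)"
proof (rule bdd_belowI2)
  fix x :: "real^'n" assume "x \<in> sphere 0 1"
  then have "\<bar>(A *v x) \<bullet> x\<bar> \<le> norm A"
    using Cauchy_Schwarz_ineq2[of "A *v x" x] norm_matrix_vector_mult_le[of A x] by simp
  then show "- norm A \<le> (A *v x) \<bullet> x" by linarith
qed

lemma rayleigh_min_attained:
  fixes A :: "real^'n^'n"
  obtains x where "norm x = 1" "(A *v x) \<bullet> x = rayleigh_min A"
proof -
  have "sphere (0::real^'n) 1 \<noteq> {}" by simp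
  moreover have "continuous_on (sphere 0 1) (\<lambda>x. (A *v x) \<bullet> x)"
    by (intro continuous_intros bounded_bilinear.continuous_on[OF bounded_bilinear_matrix_vector_mult])
  ultimately obtain x where x: "x \<in> sphere 0 1" "\<And>y. y \<in> sphere 0 1 \<Longrightarrow> (A *v x) \<bullet> x \<le> (A *v y) \<bullet> y"
    using continuous_attains_inf[of "sphere 0 1" "\<lambda>x. (A *v x) \<bullet> x"] compact_sphere by blast
  have "rayleigh_min A = (A *v x) \<bullet> x"
    unfolding rayleigh_min_def
    by (intro antisym cINF_lower[OF rayleigh_bdd x(1)] cINF_greatest x) auto
  with x(1) show ?thesis by (intro that[of x]) auto
qed

lemma rayleigh_min_le:
  fixes A :: "real^'n^'n"
  shows "rayleigh_min A * (norm x)\<^sup>2 \<le> (A *v x) \<bullet> x"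
proof (cases "x = 0")
  case False
  define y where "y = x /\<^sub>R norm x"
  have "norm y = 1" using False by (simp add: y_def)
  then have "rayleigh_min A \<le> (A *v y) \<bullet> y"
    unfolding rayleigh_min_def by (intro cINF_lower[OF rayleigh_bdd]) simp
  then have "rayleigh_min A * (norm x)\<^sup>2 \<le> ((A *v y) \<bullet> y) * (norm x)\<^sup>2" by (rule mult_right_mono) simp
  also have "\<dots> = (A *v (norm x *\<^sub>R y)) \<bullet> (norm x *\<^sub>R y)"
    by (simp add: matrix_vector_mult_scaleR power2_eq_square)
  also have "norm x *\<^sub>R y = x" using False by (simp add: y_def)
  finally show ?thesis .
qed simp

text \<open>At a minimiser \<open>x\<close> the nonnegative form of
  \<open>A - ?m *\<^sub>R mat 1\<close> vanishes, so \<open>x\<close> is a null vector of this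
  matrix and the minimum is an eigenvalue. Any other eigenvalue is a value of the quotient at its
  eigenvector and cannot lie below.\<close>

lemma smallest_eigenvalue_eq_rayleigh_min:
  fixes A :: "real^'n^'n"
  assumes "symmetric_matrix A"
  shows "smallest_eigenvalue A = rayleigh_min A"
  unfolding smallest_eigenvalue_def
proof (rule Least_equality)
  let ?m = "rayleigh_min A" let ?B = "A - ?m *\<^sub>R mat 1"
  obtain x where x: "norm x = 1" "(A *v x) \<bullet> x = ?m" by (rule rayleigh_min_attained)
  have B: "?B *v y = A *v y - ?m *\<^sub>R y" for y
    by (simp add: matrix_vector_mult_diff_rdistrib scaleR_matrix_vector_assoc[symmetric])
  have "transpose (A - ?m *\<^sub>R mat 1) = transpose A - ?m *\<^sub>R transpose (mat 1)"
    by (simp add: transpose_def vec_eq_iff)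
  then have "symmetric_matrix ?B" using assms by (simp add: symmetric_matrix_def)
  moreover have "0 \<le> (?B *v y) \<bullet> y" for y
    using rayleigh_min_le[of A y] by (simp add: B inner_diff_left dot_square_norm)
  moreover have "(?B *v x) \<bullet> x = 0" using x by (simp add: B inner_diff_left dot_square_norm)
  ultimately have "?B *v x = 0" by (rule quadratic_form_null_vector)
  then have "A *v x = ?m *\<^sub>R x" using B by simp
  then show "\<exists>v. v \<noteq> 0 \<and> A *v v = ?m *\<^sub>R v" using x(1) by (intro exI[of _ x]) auto
next
  fix l assume "\<exists>v. v \<noteq> 0 \<and> A *v v = l *\<^sub>R v"
  then obtain v where v: "v \<noteq> 0" "A *v v = l *\<^sub>R v" by blast
  have "rayleigh_min A * (norm v)\<^sup>2 \<le> l * (norm v)\<^sup>2"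
    using rayleigh_min_le[of A v] v by (simp add: dot_square_norm)
  then show "rayleigh_min A \<le> l" using v(1) by simp
qed

lemma rayleigh_min_diff_le:
  fixes A B :: "real^'n^'n"
  shows "rayleigh_min A \<le> rayleigh_min B + norm (A - B)"
proof -
  obtain x where x: "norm x = 1" "(B *v x) \<bullet> x = rayleigh_min B" by (rule rayleigh_min_attained)
  have "rayleigh_min A \<le> (A *v x) \<bullet> x" using rayleigh_min_le[of A x] x(1) by simp
  also have "\<dots> = (B *v x) \<bullet> x + ((A - B) *v x) \<bullet> x"
    by (simp add: matrix_vector_mult_diff_rdistrib inner_diff_left)
  also have "((A - B) *v x) \<bullet> x \<le> norm (A - B)"
    using norm_cauchy_schwarz[of "(A - B) *v x" x] norm_matrix_vector_mult_le[of "A - B" x] x(1) by simp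
  finally show ?thesis using x by simp
qed

lemma abs_rayleigh_min_le: "\<bar>rayleigh_min A\<bar> \<le> norm (A :: real^'n^'n)"
proof -
  have "rayleigh_min (0::real^'n^'n) = 0" by (rule rayleigh_min_attained[of 0]) simp
  then show ?thesis using rayleigh_min_diff_le[of A 0] rayleigh_min_diff_le[of 0 A] by simp
qed

lemma borel_measurable_rayleigh_min [measurable (raw)]:
  fixes f :: "'a \<Rightarrow> real^'n^'n"
  assumes "f \<in> borel_measurable M" shows "(\<lambda>x. rayleigh_min (f x)) \<in> borel_measurable M"
proof (rule measurable_compose[OF assms])
  have "1-lipschitz_on UNIV (rayleigh_min :: real^'n^'n \<Rightarrow> real)"
  proof (rule lipschitz_onI)
    fix A B :: "real^'n^'n"
    show "dist (rayleigh_min A) (rayleigh_min B) \<le> 1 * dist A B"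
      using rayleigh_min_diff_le[of A B] rayleigh_min_diff_le[of B A]
      by (simp add: dist_norm norm_minus_commute abs_le_iff)
  qed simp
  then show "(rayleigh_min :: real^'n^'n \<Rightarrow> real) \<in> borel_measurable borel"
    by (intro borel_measurable_continuous_onI lipschitz_on_continuous_on)
qed

section \<open>The driving noises and their filtration\<close>

context prob_space
begin

lemma indep_var_cong_space:
  assumes "indep_var S X T Y" "\<And>\<omega>. \<omega> \<in> space M \<Longrightarrow> X \<omega> = X' \<omega>" "\<And>\<omega>. \<omega> \<in> space M \<Longrightarrow> Y \<omega> = Y' \<omega>"
  shows "indep_var S X' T Y'"
proof -
  have "X -` A \<inter> space M = X' -` A \<inter> space M" "Y -` B \<inter> space M = Y' -` B \<inter> space M" for A B
    using assms(2,3) by auto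
  then show ?thesis
    using assms(1) measurable_cong[of M X X' S, OF assms(2)] measurable_cong[of M Y Y' T, OF assms(3)]
    unfolding indep_var_eq by simp
qed

text \<open>The cylinder events over finitely many indices of \<open>U\<close>. Events of a single
  coordinate are not stable under intersection; these are, so independence on them extends to the
  generated sigma-algebras.\<close>

definition fin_dim_events :: "('i \<Rightarrow> 'a \<Rightarrow> 'b::topological_space) \<Rightarrow> 'i set \<Rightarrow> 'a set set" where
  "fin_dim_events X U = {(\<lambda>\<omega>. \<lambda>s\<in>S. X s \<omega>) -` C \<inter> space M | S C.
     finite S \<and> S \<subseteq> U \<and> C \<in> sets (PiM S (\<lambda>_. borel))}"

text \<open>Two cylinders become events of one vector over the union of their index sets.\<close>

lemma Int_stable_fin_dim_events: "Int_stable (fin_dim_events X U)"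
proof (rule Int_stableI)
  fix a b assume "a \<in> fin_dim_events X U" "b \<in> fin_dim_events X U"
  then obtain S C S' C' where
    a: "a = (\<lambda>\<omega>. \<lambda>s\<in>S. X s \<omega>) -` C \<inter> space M" "finite S" "S \<subseteq> U" "C \<in> sets (PiM S (\<lambda>_. borel))" and
    b: "b = (\<lambda>\<omega>. \<lambda>s\<in>S'. X s \<omega>) -` C' \<inter> space M" "finite S'" "S' \<subseteq> U" "C' \<in> sets (PiM S' (\<lambda>_. borel))"
    unfolding fin_dim_events_def by blast
  let ?P = "PiM (S \<union> S') (\<lambda>_. borel :: 'c measure)"
  let ?D = "((\<lambda>f. restrict f S) -` C \<inter> space ?P) \<inter> ((\<lambda>f. restrict f S') -` C' \<inter> space ?P)"
  have "?D \<in> sets ?P"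
    using a(4) b(4) by (intro sets.Int measurable_sets[OF measurable_restrict_subset]) auto
  moreover have "a \<inter> b = (\<lambda>\<omega>. \<lambda>s\<in>S \<union> S'. X s \<omega>) -` ?D \<inter> space M"
    by (auto simp: a b space_PiM restrict_restrict Int_absorb1 Int_absorb2 Int_commute)
  ultimately show "a \<inter> b \<in> fin_dim_events X U"
    unfolding fin_dim_events_def using a(2,3) b(2,3)
    by (intro CollectI exI[of _ "S \<union> S'"] exI[of _ ?D]) auto
qed

lemma generator_in_fin_dim_events:
  assumes "s \<in> U" "A \<in> sets borel"
  shows "X s -` A \<inter> space M \<in> fin_dim_events X U"
proof -
  let ?C = "(\<lambda>f. f s) -` A \<inter> space (PiM {s} (\<lambda>_. borel :: 'c measure))"
  have C: "?C \<in> sets (PiM {s} (\<lambda>_. borel))"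
    by (rule measurable_sets[OF measurable_component_singleton]) (auto simp: assms)
  have "X s -` A \<inter> space M = (\<lambda>\<omega>. \<lambda>s\<in>{s}. X s \<omega>) -` ?C \<inter> space M"
    by (auto simp: space_PiM)
  with C show ?thesis
    unfolding fin_dim_events_def using assms(1)
    by (intro CollectI exI[of _ "{s}"] exI[of _ ?C] conjI) auto
qed

text \<open>Independence of all finite-dimensional vectors is independence of the cylinder events,
  which are intersection-stable and contain the given generators.\<close>

lemma indep_set_generated:
  fixes X Y :: "'i \<Rightarrow> 'a \<Rightarrow> 'b::topological_space"
  assumes "\<And>S S'. finite S \<Longrightarrow> S \<subseteq> U \<Longrightarrow> finite S' \<Longrightarrow> S' \<subseteq> U' \<Longrightarrow>
    indep_var (PiM S (\<lambda>_. borel)) (\<lambda>\<omega>. \<lambda>s\<in>S. X s \<omega>) (PiM S' (\<lambda>_. borel)) (\<lambda>\<omega>. \<lambda>s\<in>S'. Y s \<omega>)"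
  shows "indep_set (sigma_sets (space M) {X s -` A \<inter> space M | s A. s \<in> U \<and> A \<in> sets borel})
                   (sigma_sets (space M) {Y s -` A \<inter> space M | s A. s \<in> U' \<and> A \<in> sets borel})"
proof -
  have "indep_set (fin_dim_events X U) (fin_dim_events Y U')"
    unfolding indep_sets2_eq
  proof (intro conjI subsetI ballI)
    fix a assume "a \<in> fin_dim_events X U"
    then obtain S C where a: "a = (\<lambda>\<omega>. \<lambda>s\<in>S. X s \<omega>) -` C \<inter> space M" "finite S" "S \<subseteq> U" "C \<in> sets (PiM S (\<lambda>_. borel))"
      unfolding fin_dim_events_def by blast
    \<comment> \<open>The hypothesis is taken with the empty index set on the other side, for the
      measurability that \<open>indep_var\<close> contains.\<close>
    show "a \<in> events"
      unfolding a(1) by (rule measurable_sets[OF indep_var_rv1[OF assms[OF a(2,3), of "{}"]] a(4)]) auto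
  next
    fix b assume "b \<in> fin_dim_events Y U'"
    then obtain S C where b: "b = (\<lambda>\<omega>. \<lambda>s\<in>S. Y s \<omega>) -` C \<inter> space M" "finite S" "S \<subseteq> U'" "C \<in> sets (PiM S (\<lambda>_. borel))"
      unfolding fin_dim_events_def by blast
    show "b \<in> events"
      unfolding b(1) by (rule measurable_sets[OF indep_var_rv2[OF assms[of "{}", OF _ _ b(2,3)]] b(4)]) auto
  next
    fix a b assume "a \<in> fin_dim_events X U" "b \<in> fin_dim_events Y U'"
    then obtain S C S' C' where
      a: "a = (\<lambda>\<omega>. \<lambda>s\<in>S. X s \<omega>) -` C \<inter> space M" "finite S" "S \<subseteq> U" "C \<in> sets (PiM S (\<lambda>_. borel))" and
      b: "b = (\<lambda>\<omega>. \<lambda>s\<in>S'. Y s \<omega>) -` C' \<inter> space M" "finite S'" "S' \<subseteq> U'" "C' \<in> sets (PiM S' (\<lambda>_. borel))"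
      unfolding fin_dim_events_def by blast
    have "a \<inter> b = (\<lambda>\<omega>. ((\<lambda>s\<in>S. X s \<omega>), (\<lambda>s\<in>S'. Y s \<omega>))) -` (C \<times> C') \<inter> space M"
      unfolding a(1) b(1) by auto
    then show "prob (a \<inter> b) = prob a * prob b"
      using indep_varD[OF assms[OF a(2,3) b(2,3)] a(4) b(4)] unfolding a(1) b(1) by simp
  qed
  from indep_set_sigma_sets[OF this Int_stable_fin_dim_events Int_stable_fin_dim_events]
  have "indep_set (sigma_sets (space M) (fin_dim_events X U)) (sigma_sets (space M) (fin_dim_events Y U'))" .
  moreover have "sigma_sets (space M) {X s -` A \<inter> space M | s A. s \<in> U \<and> A \<in> sets borel}
      \<subseteq> sigma_sets (space M) (fin_dim_events X U)"
    by (rule sigma_sets_mono') (auto intro: generator_in_fin_dim_events)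
  moreover have "sigma_sets (space M) {Y s -` A \<inter> space M | s A. s \<in> U' \<and> A \<in> sets borel}
      \<subseteq> sigma_sets (space M) (fin_dim_events Y U')"
    by (rule sigma_sets_mono') (auto intro: generator_in_fin_dim_events)
  ultimately show ?thesis unfolding indep_sets2_eq by blast
qed

end

section \<open>Independence of past and future of the two noises\<close>

locale lq_noise = prob_space M
  for M :: "'w measure" and T :: real and \<Lambda> :: "'z measure"
    and W :: "real \<Rightarrow> 'w \<Rightarrow> real" and N :: "'w \<Rightarrow> (real \<times> 'z) measure" +
  assumes T: "0 < T" and finite_\<Lambda>: "finite_measure \<Lambda>"
    and bm: "brownian_motion M T W" and prm: "poisson_random_measure M T \<Lambda> N"
    and noises: "independent_noises M T \<Lambda> W N"
begin

sublocale \<Lambda>: finite_measure \<Lambda> by (rule finite_\<Lambda>)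

abbreviation \<F> where "\<F> \<equiv> augmented_filtration M T \<Lambda> W N"

abbreviation TZ where "TZ \<equiv> time_measure T \<Otimes>\<^sub>M \<Lambda>"

lemma space_time_measure [simp]: "space (time_measure T) = {0..T}"
  by (simp add: time_measure_def)

lemma finite_time_measure: "finite_measure (time_measure T)"
  by (rule finite_measureI) (simp add: time_measure_def emeasure_restrict_space emeasure_lborel_Icc_eq)

sublocale TM: finite_measure "time_measure T" by (rule finite_time_measure)

lemma space_TZ: "space TZ = {0..T} \<times> space \<Lambda>"
  by (simp add: space_pair_measure)

lemma interval_in_time_measure: "0 \<le> a \<Longrightarrow> b \<le> T \<Longrightarrow> {a<..b} \<in> sets (time_measure T)"
  by (auto simp: time_measure_def sets_restrict_space_iff)

lemma rectangle_in_TZ: "0 \<le> a \<Longrightarrow> b \<le> T \<Longrightarrow> B \<in> sets \<Lambda> \<Longrightarrow> {a<..b} \<times> B \<in> sets TZ"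
  by (intro pair_measureI interval_in_time_measure)

lemma measure_TZ_rectangle:
  assumes "0 \<le> a" "a \<le> b" "b \<le> T" "B \<in> sets \<Lambda>"
  shows "measure TZ ({a<..b} \<times> B) = (b - a) * measure \<Lambda> B"
proof -
  have "emeasure TZ ({a<..b} \<times> B) = emeasure (time_measure T) {a<..b} * emeasure \<Lambda> B"
    using assms by (intro \<Lambda>.emeasure_pair_measure_Times interval_in_time_measure)
  also have "emeasure (time_measure T) {a<..b} = ennreal (b - a)"
    using assms unfolding time_measure_def by (subst emeasure_restrict_space) auto
  also have "\<dots> * emeasure \<Lambda> B = ennreal ((b - a) * measure \<Lambda> B)"
    using assms by (simp add: \<Lambda>.emeasure_eq_measure ennreal_mult)
  finally show ?thesis using assms by (simp add: measure_def)
qed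

lemma W_measurable: "0 \<le> s \<Longrightarrow> s \<le> T \<Longrightarrow> W s \<in> borel_measurable M"
  using bm unfolding brownian_motion_def by auto

lemma sets_N: "\<omega> \<in> space M \<Longrightarrow> sets (N \<omega>) = sets TZ"
  using prm unfolding poisson_random_measure_def by blast

lemma N_measurable: "B \<in> sets TZ \<Longrightarrow> (\<lambda>\<omega>. emeasure (N \<omega>) B) \<in> borel_measurable M"
  using prm unfolding poisson_random_measure_def by blast

lemma prob_N_eq:
  "B \<in> sets TZ \<Longrightarrow> prob {\<omega> \<in> space M. emeasure (N \<omega>) B = of_nat k}
     = measure TZ B ^ k / fact k * exp (- measure TZ B)"
  using prm unfolding poisson_random_measure_def Let_def by blast

lemma indep_N:
  fixes k :: nat
  assumes "\<And>i. i < k \<Longrightarrow> B i \<in> sets TZ" "disjoint_family_on B {..<k}"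
  shows "indep_vars (\<lambda>_. borel) (\<lambda>i \<omega>. emeasure (N \<omega>) (B i)) {..<k}"
  using prm assms unfolding poisson_random_measure_def by blast

text \<open>Generated by increments from time 0, because independence is assumed for increments and
  \<open>W 0 = 0\<close> holds only almost surely. The difference is made up for by null sets in
  \<open>filtration_subset_past\<close>.\<close>

definition W_past where
  "W_past a = sigma_sets (space M) {(\<lambda>\<omega>. W s \<omega> - W 0 \<omega>) -` A \<inter> space M | s A. s \<in> {0..a} \<and> A \<in> sets borel}"

text \<open>The index \<open>s\<close> runs over a single dummy value to match the shape of
  \<open>indep_set_generated\<close>.\<close>

definition W_future where
  "W_future a b = sigma_sets (space M) {(\<lambda>\<omega>. W b \<omega> - W a \<omega>) -` A \<inter> space M | s A. s \<in> {0::real} \<and> A \<in> sets borel}"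

definition N_events where
  "N_events U = sigma_sets (space M) {(\<lambda>\<omega>. emeasure (N \<omega>) B) -` A \<inter> space M | B A.
     B \<in> {B \<in> sets TZ. B \<subseteq> U} \<and> A \<in> sets borel}"

text \<open>The chosen past times, together with 0 and \<open>a\<close>, are sorted into a grid to
  which \<open>b\<close> is appended. Past values are partial sums of the grid increments before
  \<open>a\<close>, the future increment is the last one, and increments with disjoint sets of
  indices are independent.\<close>

lemma W_increments_indep:
  assumes "0 \<le> a" "a \<le> b" "b \<le> T"
  shows "indep_set (W_past a) (W_future a b)"
  unfolding W_past_def W_future_def
proof (rule indep_set_generated)
  fix S :: "real set" and S' :: "real set"
  assume S: "finite S" "S \<subseteq> {0..a}"
  define xs where "xs = sorted_list_of_set (S \<union> {0, a})"
  define n where "n = length xs"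
  \<comment> \<open>The indices below \<open>n\<close> enumerate the past grid, which ends with
    \<open>a\<close>, and index \<open>n\<close> is \<open>b\<close>. So the increment of index
    \<open>n - 1\<close> is the future one and those of smaller index make up the past. The grid is
    only weakly monotone, which admits \<open>a = b\<close>.\<close>
  define \<tau> where "\<tau> i = (if i < n then xs ! i else b)" for i
  have xs: "sorted xs" "distinct xs" "set xs = S \<union> {0, a}"
    using S(1) unfolding xs_def
    by (simp_all only: set_sorted_list_of_set sorted_sorted_list_of_set distinct_sorted_list_of_set
        finite_Un finite.emptyI finite.insertI simp_thms)
  have n: "n \<ge> 1" using xs(3) by (cases xs) (auto simp: n_def)
  have xs_range: "0 \<le> xs ! i" "xs ! i \<le> a" if "i < n" for i
    using nth_mem[of i xs] that S(2) assms xs(3) unfolding n_def by auto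
  have \<tau>0: "\<tau> 0 = 0"
  proof -
    obtain j where "j < n" "xs ! j = 0" using xs(3) unfolding n_def by (metis UnCI in_set_conv_nth insertI1)
    then have "xs ! 0 \<le> 0" using sorted_nth_mono[OF xs(1), of 0 j] by (simp add: n_def)
    then show ?thesis using xs_range[of 0] n by (simp add: \<tau>_def)
  qed
  have \<tau>a: "\<tau> (n - 1) = a"
  proof -
    obtain j where "j < n" "xs ! j = a" using xs(3) unfolding n_def by (metis UnCI in_set_conv_nth insertI1 insertI2)
    then have "a \<le> xs ! (n - 1)" using sorted_nth_mono[OF xs(1), of j "n - 1"] by (simp add: n_def)
    then show ?thesis using xs_range[of "n - 1"] n by (simp add: \<tau>_def)
  qed
  have \<tau>b: "\<tau> n = b" by (simp add: \<tau>_def)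
  have \<tau>_range: "\<forall>i\<le>n. \<tau> i \<in> {0..T}"
    using xs_range assms unfolding \<tau>_def by fastforce
  have \<tau>_mono: "\<forall>i<n. \<tau> i \<le> \<tau> (Suc i)"
    using xs_range assms sorted_nth_mono[OF xs(1)] by (auto simp: \<tau>_def n_def intro: order_trans)
  define inc where "inc i \<omega> = W (\<tau> (Suc i)) \<omega> - W (\<tau> i) \<omega>" for i \<omega>
  have ind: "indep_vars (\<lambda>_. borel) inc {..<n}"
    using bm \<tau>_range \<tau>_mono unfolding brownian_motion_def inc_def by auto
  have "\<forall>s\<in>S. \<exists>j<n. \<tau> j = s"
    using xs(3) unfolding n_def \<tau>_def by (metis UnCI in_set_conv_nth)
  then obtain j where j: "\<And>s. s \<in> S \<Longrightarrow> j s < n \<and> \<tau> (j s) = s" by metis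
  define Y1 where "Y1 f = (\<lambda>s\<in>S. \<Sum>i<j s. f i)" for f :: "nat \<Rightarrow> real"
  define Y2 where "Y2 f = (\<lambda>_\<in>S'. f (n - 1))" for f :: "nat \<Rightarrow> real"
  have "indep_var (PiM {..<n - 1} (\<lambda>_. borel)) (\<lambda>\<omega>. \<lambda>i\<in>{..<n - 1}. inc i \<omega>)
      (PiM {n - 1} (\<lambda>_. borel)) (\<lambda>\<omega>. \<lambda>i\<in>{n - 1}. inc i \<omega>)"
    using n by (intro indep_var_restrict[OF ind]) auto
  then have "indep_var (PiM S (\<lambda>_. borel)) (Y1 \<circ> (\<lambda>\<omega>. \<lambda>i\<in>{..<n - 1}. inc i \<omega>))
      (PiM S' (\<lambda>_. borel)) (Y2 \<circ> (\<lambda>\<omega>. \<lambda>i\<in>{n - 1}. inc i \<omega>))"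
  proof (rule indep_var_compose)
    show "Y1 \<in> measurable (PiM {..<n - 1} (\<lambda>_. borel)) (PiM S (\<lambda>_. borel))"
      unfolding Y1_def
    proof (intro measurable_restrict borel_measurable_sum measurable_component_singleton)
      fix s i assume "s \<in> S" "i \<in> {..<j s}"
      then show "i \<in> {..<n - 1}" using j[of s] by auto
    qed
    show "Y2 \<in> measurable (PiM {n - 1} (\<lambda>_. borel)) (PiM S' (\<lambda>_. borel))"
      unfolding Y2_def by (intro measurable_restrict measurable_component_singleton) auto
  qed
  then show "indep_var (PiM S (\<lambda>_. borel)) (\<lambda>\<omega>. \<lambda>s\<in>S. W s \<omega> - W 0 \<omega>)
      (PiM S' (\<lambda>_. borel)) (\<lambda>\<omega>. \<lambda>s\<in>S'. W b \<omega> - W a \<omega>)"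
  proof (rule indep_var_cong_space)
    fix \<omega>
    have "(\<Sum>i<j s. inc i \<omega>) = W s \<omega> - W 0 \<omega>" if "s \<in> S" for s
      using sum_lessThan_telescope[of "\<lambda>i. W (\<tau> i) \<omega>" "j s"] j[OF that] \<tau>0 by (simp add: inc_def)
    moreover have "{..<n - 1} \<supseteq> {..<j s}" if "s \<in> S" for s using j[OF that] by auto
    ultimately show "(Y1 \<circ> (\<lambda>\<omega>. \<lambda>i\<in>{..<n - 1}. inc i \<omega>)) \<omega> = (\<lambda>s\<in>S. W s \<omega> - W 0 \<omega>)"
      unfolding Y1_def comp_def
      by (intro restrict_ext) (metis (mono_tags, lifting) restrict_apply' subsetD sum.cong)
    have "inc (n - 1) \<omega> = W b \<omega> - W a \<omega>" using n \<tau>a \<tau>b by (simp add: inc_def)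
    then show "(Y2 \<circ> (\<lambda>\<omega>. \<lambda>i\<in>{n - 1}. inc i \<omega>)) \<omega> = (\<lambda>s\<in>S'. W b \<omega> - W a \<omega>)"
      by (simp add: Y2_def)
  qed
qed

text \<open>Independence is assumed for the counts of pairwise disjoint sets, whereas the members of
  \<open>S\<close> may overlap. Both finite families are therefore cut into the atoms of the algebra
  that they generate together, and every count is a sum of atom counts.\<close>

lemma N_disjoint_indep:
  assumes disj: "U \<inter> U' = {}"
  shows "indep_set (N_events U) (N_events U')"
  unfolding N_events_def
proof (rule indep_set_generated)
  fix S S' assume S: "finite S" "S \<subseteq> {B \<in> sets TZ. B \<subseteq> U}" and S': "finite S'" "S' \<subseteq> {B \<in> sets TZ. B \<subseteq> U'}"
  define FF where "FF = S \<union> S'"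
  define atom where "atom J = {x \<in> space TZ. \<forall>B\<in>FF. x \<in> B \<longleftrightarrow> B \<in> J}" for J
  have FF: "finite FF" "\<And>B. B \<in> FF \<Longrightarrow> B \<in> sets TZ" using S S' by (auto simp: FF_def)
  obtain h where h: "bij_betw h {0..<card (Pow FF)} (Pow FF)"
    using ex_bij_betw_nat_finite[of "Pow FF"] FF(1) by auto
  define k where "k = card (Pow FF)"
  have h: "bij_betw h {..<k} (Pow FF)" using h by (simp add: k_def atLeast0LessThan)
  have at_sets: "atom J \<in> sets TZ" for J
  proof -
    have "{x \<in> space TZ. x \<in> B \<longleftrightarrow> B \<in> J} \<in> sets TZ" if "B \<in> FF" for B
      using FF(2)[OF that] by measurable
    then show ?thesis unfolding atom_def using FF(1) by (intro sets.sets_Collect_finite_All) auto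
  qed
  have disj_at: "atom J \<inter> atom J' = {}" if "J \<in> Pow FF" "J' \<in> Pow FF" "J \<noteq> J'" for J J'
    using that unfolding atom_def by blast
  have disjf: "disjoint_family_on (\<lambda>i. atom (h i)) {..<k}"
    unfolding disjoint_family_on_def
  proof (intro ballI impI disj_at)
    fix i j assume ij: "i \<in> {..<k}" "j \<in> {..<k}" "i \<noteq> j"
    show "h i \<in> Pow FF" "h j \<in> Pow FF" using bij_betw_apply[OF h] ij by auto
    show "h i \<noteq> h j" using bij_betw_imp_inj_on[OF h] ij by (auto dest: inj_onD)
  qed
  have ind: "indep_vars (\<lambda>_. borel) (\<lambda>i \<omega>. emeasure (N \<omega>) (atom (h i))) {..<k}"
    by (rule indep_N) (auto simp: at_sets disjf)
  have decomp: "emeasure (N \<omega>) B = (\<Sum>i\<in>{i\<in>{..<k}. B \<in> h i}. emeasure (N \<omega>) (atom (h i)))"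
    if "B \<in> FF" "\<omega> \<in> space M" for B \<omega>
  proof -
    have "B = (\<Union>i\<in>{i\<in>{..<k}. B \<in> h i}. atom (h i))"
    proof safe
      fix x assume x: "x \<in> B"
      define J where "J = {B\<in>FF. x \<in> B}"
      have "J \<in> Pow FF" by (auto simp: J_def)
      then obtain i where i: "i < k" "h i = J" using h unfolding bij_betw_def by (metis imageE lessThan_iff)
      have "x \<in> space TZ" using x that(1) FF(2) sets.sets_into_space by blast
      then have "x \<in> atom (h i)" unfolding i atom_def J_def by auto
      then show "x \<in> (\<Union>i\<in>{i\<in>{..<k}. B \<in> h i}. atom (h i))" using i x that(1) by (auto simp: J_def)
    qed (use that in \<open>auto simp: atom_def\<close>)
    moreover have "(\<Sum>i\<in>{i\<in>{..<k}. B \<in> h i}. emeasure (N \<omega>) (atom (h i))) = emeasure (N \<omega>) (\<Union>i\<in>{i\<in>{..<k}. B \<in> h i}. atom (h i))"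
      using that(2) by (intro sum_emeasure) (auto simp: sets_N at_sets intro: disjoint_family_on_mono[OF _ disjf])
    ultimately show ?thesis by simp
  qed
  \<comment> \<open>\<open>A1\<close> indexes the atoms inside some set of \<open>S\<close>. An atom
    inside both a set of \<open>S\<close> and a set of \<open>S'\<close> would lie in
    \<open>U \<inter> U'\<close> and is empty, so the sets of \<open>S'\<close> lose no mass when
    only the atoms of \<open>A2\<close> are summed.\<close>
  define A1 where "A1 = {i\<in>{..<k}. h i \<inter> S \<noteq> {}}"
  define A2 where "A2 = {i\<in>{..<k}. h i \<inter> S = {}}"
  have decomp1: "emeasure (N \<omega>) B = (\<Sum>i\<in>{i\<in>A1. B \<in> h i}. emeasure (N \<omega>) (atom (h i)))" if "B \<in> S" "\<omega> \<in> space M" for B \<omega>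
    using decomp[of B \<omega>] that by (auto simp: A1_def FF_def intro!: sum.cong)
  have decomp2: "emeasure (N \<omega>) B = (\<Sum>i\<in>{i\<in>A2. B \<in> h i}. emeasure (N \<omega>) (atom (h i)))" if "B \<in> S'" "\<omega> \<in> space M" for B \<omega>
  proof -
    have "(\<Sum>i\<in>{i\<in>{..<k}. B \<in> h i}. emeasure (N \<omega>) (atom (h i))) = (\<Sum>i\<in>{i\<in>A2. B \<in> h i}. emeasure (N \<omega>) (atom (h i)))"
    proof (rule sum.mono_neutral_right)
      show "\<forall>i\<in>{i \<in> {..<k}. B \<in> h i} - {i \<in> A2. B \<in> h i}. emeasure (N \<omega>) (atom (h i)) = 0"
      proof
        fix i assume "i \<in> {i \<in> {..<k}. B \<in> h i} - {i \<in> A2. B \<in> h i}"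
        then obtain B' where B': "B' \<in> h i" "B' \<in> S" "B \<in> h i" by (auto simp: A2_def)
        then have "B' \<inter> B = {}" using S(2) S'(2) that(1) disj by blast
        then have "atom (h i) = {}" using B' that(1) unfolding atom_def FF_def by blast
        then show "emeasure (N \<omega>) (atom (h i)) = 0" by simp
      qed
    qed (auto simp: A2_def)
    then show ?thesis using decomp[of B \<omega>] that by (simp add: FF_def)
  qed
  define Y1 where "Y1 f = (\<lambda>B\<in>S. \<Sum>i\<in>{i\<in>A1. B \<in> h i}. f i)" for f :: "nat \<Rightarrow> ennreal"
  define Y2 where "Y2 f = (\<lambda>B\<in>S'. \<Sum>i\<in>{i\<in>A2. B \<in> h i}. f i)" for f :: "nat \<Rightarrow> ennreal"
  let ?X = "\<lambda>i \<omega>. emeasure (N \<omega>) (atom (h i))"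
  have "indep_var (PiM A1 (\<lambda>_. borel)) (\<lambda>\<omega>. \<lambda>i\<in>A1. ?X i \<omega>) (PiM A2 (\<lambda>_. borel)) (\<lambda>\<omega>. \<lambda>i\<in>A2. ?X i \<omega>)"
    by (intro indep_var_restrict[OF ind]) (auto simp: A1_def A2_def)
  then have "indep_var (PiM S (\<lambda>_. borel)) (Y1 \<circ> (\<lambda>\<omega>. \<lambda>i\<in>A1. ?X i \<omega>)) (PiM S' (\<lambda>_. borel)) (Y2 \<circ> (\<lambda>\<omega>. \<lambda>i\<in>A2. ?X i \<omega>))"
  proof (rule indep_var_compose)
    show "Y1 \<in> measurable (PiM A1 (\<lambda>_. borel)) (PiM S (\<lambda>_. borel))"
      unfolding Y1_def by (intro measurable_restrict borel_measurable_sum measurable_component_singleton) auto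
    show "Y2 \<in> measurable (PiM A2 (\<lambda>_. borel)) (PiM S' (\<lambda>_. borel))"
      unfolding Y2_def by (intro measurable_restrict borel_measurable_sum measurable_component_singleton) auto
  qed
  then show "indep_var (PiM S (\<lambda>_. borel)) (\<lambda>\<omega>. \<lambda>s\<in>S. emeasure (N \<omega>) s) (PiM S' (\<lambda>_. borel)) (\<lambda>\<omega>. \<lambda>s\<in>S'. emeasure (N \<omega>) s)"
    by (rule indep_var_cong_space)
       (auto simp: Y1_def Y2_def decomp1 decomp2 intro!: restrict_ext sum.cong)
qed

text \<open>An intersection-stable generator of the augmented past. The null sets have to be
  included since the filtration contains them, and intersecting an event with a null set gives a
  null set again.\<close>

definition past_events where
  "past_events a = {w \<inter> j | w j. w \<in> W_past a \<and> j \<in> N_events ({0..a} \<times> space \<Lambda>)} \<union> null_sets M"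

definition future_events where
  "future_events a b = {w \<inter> j | w j. w \<in> W_future a b \<and> j \<in> N_events ({a<..b} \<times> space \<Lambda>)}"

definition future where "future a b = sigma (space M) (future_events a b)"

lemma brownian_generators: "brownian_events M W t \<subseteq> Pow (space M)"
  by (auto simp: brownian_events_def)

lemma W_measurable_brownian:
  assumes "s \<in> {0..t}"
  shows "W s \<in> borel_measurable (sigma (space M) (brownian_events M W t))"
proof (rule measurableI)
  fix A :: "real set" assume "A \<in> sets borel"
  then have "W s -` A \<inter> space M \<in> brownian_events M W t"
    using assms unfolding brownian_events_def by blast
  then show "W s -` A \<inter> space (sigma (space M) (brownian_events M W t)) \<in> sets (sigma (space M) (brownian_events M W t))"
    using brownian_generators by (simp add: space_measure_of sets_measure_of sigma_sets.Basic)
qed simp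

lemma W_past_subset:
  assumes "0 \<le> a" "a \<le> T"
  shows "W_past a \<subseteq> sigma_sets (space M) (brownian_events M W T)"
proof -
  let ?B = "sigma (space M) (brownian_events M W T)"
  note gen = brownian_generators[of T] and W = W_measurable_brownian[of _ T]
  have "(\<lambda>\<omega>. W s \<omega> - W 0 \<omega>) -` A \<inter> space M \<in> sets ?B" if "s \<in> {0..a}" "A \<in> sets borel" for s A
    using measurable_sets[of "\<lambda>\<omega>. W s \<omega> - W 0 \<omega>" ?B borel A] W[of s] W[of 0] that assms gen
    by (simp add: borel_measurable_diff)
  then show ?thesis
    unfolding W_past_def using gen by (intro sigma_sets_mono) auto
qed

lemma W_future_subset:
  assumes "0 \<le> a" "a \<le> b" "b \<le> T"
  shows "W_future a b \<subseteq> sigma_sets (space M) (brownian_events M W T)"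
proof -
  let ?B = "sigma (space M) (brownian_events M W T)"
  note gen = brownian_generators[of T] and W = W_measurable_brownian[of _ T]
  have "(\<lambda>\<omega>. W b \<omega> - W a \<omega>) -` A \<inter> space M \<in> sets ?B" if "A \<in> sets borel" for A
    using measurable_sets[of "\<lambda>\<omega>. W b \<omega> - W a \<omega>" ?B borel A] W[of a] W[of b] that assms gen
    by (simp add: borel_measurable_diff)
  then show ?thesis
    unfolding W_future_def using gen by (intro sigma_sets_mono) auto
qed

lemma N_events_subset: "N_events U \<subseteq> sigma_sets (space M) (jump_events M T \<Lambda> N T)"
  unfolding N_events_def
proof (rule sigma_sets_mono')
  have "B \<subseteq> {0..T} \<times> space \<Lambda>" if "B \<in> sets TZ" for B
    using sets.sets_into_space[OF that] by (simp add: space_TZ)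
  then show "{(\<lambda>\<omega>. emeasure (N \<omega>) B) -` A \<inter> space M | B A. B \<in> {B \<in> sets TZ. B \<subseteq> U} \<and> A \<in> sets borel}
      \<subseteq> jump_events M T \<Lambda> N T"
    unfolding jump_events_def by blast
qed

lemma prob_W_N:
  assumes "w \<in> sigma_sets (space M) (brownian_events M W T)" "j \<in> sigma_sets (space M) (jump_events M T \<Lambda> N T)"
  shows "prob (w \<inter> j) = prob w * prob j"
  using noises assms unfolding independent_noises_def by (rule indep_setD)

lemma sigma_sets_Int':
  assumes "G \<subseteq> Pow (space M)" "x \<in> sigma_sets (space M) G" "y \<in> sigma_sets (space M) G"
  shows "x \<inter> y \<in> sigma_sets (space M) G"
proof -
  interpret sigma_algebra "space M" "sigma_sets (space M) G"
    by (rule sigma_algebra_sigma_sets[OF assms(1)])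
  show ?thesis by (rule Int[OF assms(2,3)])
qed

text \<open>A product formula with four factors: the Brownian events split off because the two
  noises are independent, and then each noise has an independent past and future. Null sets are
  independent of everything, so the augmentation does no harm.\<close>

lemma indep_past_future:
  assumes "0 \<le> a" "a \<le> b" "b \<le> T"
  shows "indep_set (sigma_sets (space M) (past_events a)) (sigma_sets (space M) (future_events a b))"
proof (rule indep_set_sigma_sets)
  have dis: "({0..a} \<times> space \<Lambda>) \<inter> ({a<..b} \<times> space \<Lambda>) = {}" by auto
  note WW = W_increments_indep[OF assms] and NN = N_disjoint_indep[OF dis]
  have aT: "a \<le> T" using assms by simp
  have ev: "W_past a \<subseteq> events" "W_future a b \<subseteq> events"
    using WW by (auto simp: indep_sets2_eq)
  have evN: "N_events ({0..a} \<times> space \<Lambda>) \<subseteq> events" "N_events ({a<..b} \<times> space \<Lambda>) \<subseteq> events"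
    using NN by (auto simp: indep_sets2_eq)
  have sub: "x \<in> W_past a \<Longrightarrow> x \<in> sigma_sets (space M) (brownian_events M W T)"
     "x \<in> W_future a b \<Longrightarrow> x \<in> sigma_sets (space M) (brownian_events M W T)"
     "x \<in> N_events U \<Longrightarrow> x \<in> sigma_sets (space M) (jump_events M T \<Lambda> N T)" for x U
    using W_past_subset[OF assms(1) aT] W_future_subset[OF assms] N_events_subset by auto
  note genB = brownian_generators[of T]
  have genJ: "jump_events M T \<Lambda> N T \<subseteq> Pow (space M)" by (auto simp: jump_events_def)
  have st: "x \<in> W_past a \<Longrightarrow> y \<in> W_past a \<Longrightarrow> x \<inter> y \<in> W_past a"
     "x \<in> W_future a b \<Longrightarrow> y \<in> W_future a b \<Longrightarrow> x \<inter> y \<in> W_future a b"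
     "x \<in> N_events U \<Longrightarrow> y \<in> N_events U \<Longrightarrow> x \<inter> y \<in> N_events U" for x y U
    unfolding W_past_def W_future_def N_events_def by (auto intro!: sigma_sets_Int')
  show "indep_set (past_events a) (future_events a b)"
  proof (rule indep_setI)
    show "past_events a \<subseteq> events" "future_events a b \<subseteq> events"
      using ev evN unfolding past_events_def future_events_def by auto
    fix x y assume x: "x \<in> past_events a" and y: "y \<in> future_events a b"
    from y obtain w' j' where y: "y = w' \<inter> j'" "w' \<in> W_future a b" "j' \<in> N_events ({a<..b} \<times> space \<Lambda>)"
      unfolding future_events_def by blast
    have yev: "y \<in> events" using y ev evN by auto
    from x consider (null) "x \<in> null_sets M" |
      (wj) w j where "x = w \<inter> j" "w \<in> W_past a" "j \<in> N_events ({0..a} \<times> space \<Lambda>)"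
      unfolding past_events_def by blast
    then show "prob (x \<inter> y) = prob x * prob y"
    proof cases
      case null
      then have "x \<inter> y \<in> null_sets M" using yev by (simp add: null_set_Int2)
      with null show ?thesis by (simp add: null_setsD1 measure_def)
    next
      case wj
      have "x \<inter> y = (w \<inter> w') \<inter> (j \<inter> j')" using wj y by auto
      also have "prob \<dots> = prob (w \<inter> w') * prob (j \<inter> j')"
        using wj y by (intro prob_W_N sigma_sets_Int' genB genJ sub)
      also have "\<dots> = (prob w * prob w') * (prob j * prob j')"
        using indep_setD[OF WW wj(2) y(2)] indep_setD[OF NN wj(3) y(3)] by simp
      also have "\<dots> = prob x * prob y"
        using prob_W_N[OF sub(1)[OF wj(2)] sub(3)[OF wj(3)]] prob_W_N[OF sub(2)[OF y(2)] sub(3)[OF y(3)]]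
        by (simp add: wj(1) y(1))
      finally show ?thesis .
    qed
  qed
  show "Int_stable (future_events a b)"
  proof (rule Int_stableI)
    fix x y assume "x \<in> future_events a b" "y \<in> future_events a b"
    then obtain w j w' j' where xy: "x = w \<inter> j" "y = w' \<inter> j'" "w \<in> W_future a b" "w' \<in> W_future a b"
      "j \<in> N_events ({a<..b} \<times> space \<Lambda>)" "j' \<in> N_events ({a<..b} \<times> space \<Lambda>)"
      unfolding future_events_def by blast
    have "x \<inter> y = (w \<inter> w') \<inter> (j \<inter> j')" unfolding xy by auto
    then show "x \<inter> y \<in> future_events a b"
      unfolding future_events_def using st(2)[OF xy(3,4)] st(3)[OF xy(5,6)] by blast
  qed
  show "Int_stable (past_events a)"
  proof (rule Int_stableI)
    fix x y assume xy: "x \<in> past_events a" "y \<in> past_events a"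
    have pe: "past_events a \<subseteq> events" using ev evN unfolding past_events_def by auto
    show "x \<inter> y \<in> past_events a"
    proof (cases "x \<in> null_sets M \<or> y \<in> null_sets M")
      case True
      then have "x \<inter> y \<in> null_sets M" using xy pe by (metis null_set_Int1 null_set_Int2 subsetD)
      then show ?thesis by (simp add: past_events_def)
    next
      case False
      with xy obtain w j w' j' where xy: "x = w \<inter> j" "y = w' \<inter> j'" "w \<in> W_past a" "w' \<in> W_past a"
        "j \<in> N_events ({0..a} \<times> space \<Lambda>)" "j' \<in> N_events ({0..a} \<times> space \<Lambda>)"
        unfolding past_events_def by blast
      have "x \<inter> y = (w \<inter> w') \<inter> (j \<inter> j')" unfolding xy by auto
      then show "x \<inter> y \<in> past_events a"
        unfolding past_events_def using st(1)[OF xy(3,4)] st(3)[OF xy(5,6)] by blast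
    qed
  qed
qed

lemma filtration_generators:
  "brownian_events M W t \<union> jump_events M T \<Lambda> N t \<union> null_sets M \<subseteq> Pow (space M)"
  using sets.sets_into_space by (auto simp: brownian_events_def jump_events_def)

lemma space_\<F> [simp]: "space (\<F> t) = space M"
  unfolding augmented_filtration_def by (rule space_measure_of[OF filtration_generators])

lemma sets_\<F>: "sets (\<F> t) = sigma_sets (space M) (brownian_events M W t \<union> jump_events M T \<Lambda> N t \<union> null_sets M)"
  unfolding augmented_filtration_def by (rule sets_measure_of[OF filtration_generators])

text \<open>A generator in terms of \<open>W s\<close> differs from the one in terms of
  \<open>W s - W 0\<close> only on the null set of paths that do not start at 0.\<close>

lemma filtration_subset_past:
  assumes "0 \<le> a" "a \<le> T"
  shows "sets (\<F> a) \<subseteq> sigma_sets (space M) (past_events a)"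
proof -
  have N0: "{} \<inter> ({0..a} \<times> space \<Lambda>) = {}" by simp
  have pe: "past_events a \<subseteq> events"
    using indep_past_future[OF assms(1) order_refl assms(2)] unfolding indep_sets2_eq by blast
  then have pow: "past_events a \<subseteq> Pow (space M)" using sets.sets_into_space by blast
  interpret S: sigma_algebra "space M" "sigma_sets (space M) (past_events a)"
    by (rule sigma_algebra_sigma_sets[OF pow])
  have nulls: "n \<in> sigma_sets (space M) (past_events a)" if "n \<in> null_sets M" for n
    using that by (auto simp: past_events_def)
  have top: "space M \<in> N_events U" "space M \<in> W_past a" for U
    unfolding N_events_def W_past_def by (auto intro!: sigma_sets_top)
  have Wp: "w \<in> sigma_sets (space M) (past_events a)" if "w \<in> W_past a" for w
  proof -
    have "w \<subseteq> space M"
      using that unfolding W_past_def by (rule sigma_sets_into_sp[rotated]) auto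
    then have "w = w \<inter> space M" by auto
    then have "w \<in> past_events a" using that top(1) unfolding past_events_def by blast
    then show ?thesis by auto
  qed
  have Jp: "j \<in> sigma_sets (space M) (past_events a)" if "j \<in> N_events ({0..a} \<times> space \<Lambda>)" for j
  proof -
    have "j \<subseteq> space M"
      using that unfolding N_events_def by (rule sigma_sets_into_sp[rotated]) auto
    then have "j = space M \<inter> j" by auto
    then have "j \<in> past_events a" using that top(2) unfolding past_events_def by blast
    then show ?thesis by auto
  qed
  have E: "{\<omega> \<in> space M. W 0 \<omega> \<noteq> 0} \<in> null_sets M" (is "?E \<in> _")
  proof (rule null_setsI)
    have [measurable]: "W 0 \<in> borel_measurable M" using W_measurable[of 0] T by simp
    show "?E \<in> sets M" by measurable
    have "AE \<omega> in M. \<not> W 0 \<omega> \<noteq> 0" using bm unfolding brownian_motion_def by simp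
    then show "emeasure M ?E = 0" by (intro AE_iff_measurable[THEN iffD1, of ?E]) (auto simp: \<open>?E \<in> sets M\<close>)
  qed
  show ?thesis
    unfolding sets_\<F>
  proof (rule sigma_sets_mono, safe)
    fix x assume "x \<in> brownian_events M W a"
    then obtain s A where x: "x = W s -` A \<inter> space M" "s \<in> {0..a}" "A \<in> sets borel"
      unfolding brownian_events_def by blast
    let ?V = "(\<lambda>\<omega>. W s \<omega> - W 0 \<omega>) -` A \<inter> space M"
    have "?V \<in> W_past a" unfolding W_past_def using x by (intro sigma_sets.Basic) blast
    then have V: "?V - ?E \<in> sigma_sets (space M) (past_events a)"
      using Wp nulls[OF E] by (intro S.Diff)
    have x_ev: "x \<in> sets M"
      unfolding x(1) using x assms by (intro measurable_sets[OF W_measurable]) auto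
    have "x \<inter> ?E \<in> null_sets M"
      using E x_ev by (intro null_set_Int1)
    then have "(?V - ?E) \<union> (x \<inter> ?E) \<in> sigma_sets (space M) (past_events a)"
      using V nulls by (intro S.Un)
    moreover have "x = (?V - ?E) \<union> (x \<inter> ?E)" unfolding x(1) by auto
    ultimately show "x \<in> sigma_sets (space M) (past_events a)" by metis
  next
    fix x assume "x \<in> jump_events M T \<Lambda> N a"
    then have "x \<in> N_events ({0..a} \<times> space \<Lambda>)"
      unfolding jump_events_def N_events_def by (intro sigma_sets.Basic) blast
    then show "x \<in> sigma_sets (space M) (past_events a)" by (rule Jp)
  qed (rule nulls)
qed

lemma \<F>_subset: "t \<le> T \<Longrightarrow> sets (\<F> t) \<subseteq> sets M"
  unfolding sets_\<F>
proof (rule sets.sigma_sets_subset, safe)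
  fix x assume "t \<le> T" "x \<in> brownian_events M W t"
  then show "x \<in> sets M" unfolding brownian_events_def
    by (auto intro!: measurable_sets[OF W_measurable])
next
  fix x assume "x \<in> jump_events M T \<Lambda> N t"
  then show "x \<in> sets M" unfolding jump_events_def by (auto intro!: measurable_sets[OF N_measurable])
qed auto

lemma \<F>_mono: "s \<le> t \<Longrightarrow> sets (\<F> s) \<subseteq> sets (\<F> t)"
  unfolding sets_\<F>
proof (rule sigma_sets_mono')
  assume "s \<le> t"
  then have sub: "{0..s} \<subseteq> {0..t}" "{0..s} \<times> space \<Lambda> \<subseteq> {0..t} \<times> space \<Lambda>" by auto
  have "brownian_events M W s \<subseteq> brownian_events M W t"
  proof
    fix x assume "x \<in> brownian_events M W s"
    then obtain r A where "x = W r -` A \<inter> space M" "r \<in> {0..s}" "A \<in> sets borel"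
      unfolding brownian_events_def by auto
    then show "x \<in> brownian_events M W t"
      unfolding brownian_events_def using sub(1) by (intro CollectI exI[of _ r] exI[of _ A]) auto
  qed
  moreover have "jump_events M T \<Lambda> N s \<subseteq> jump_events M T \<Lambda> N t"
  proof
    fix x assume "x \<in> jump_events M T \<Lambda> N s"
    then obtain B A where BA: "x = (\<lambda>\<omega>. emeasure (N \<omega>) B) -` A \<inter> space M" "B \<in> sets TZ"
        "B \<subseteq> {0..s} \<times> space \<Lambda>" "A \<in> sets borel"
      unfolding jump_events_def by (elim CollectE exE conjE)
    then show "x \<in> jump_events M T \<Lambda> N t"
      unfolding jump_events_def using subset_trans[OF BA(3) sub(2)]
      by (intro CollectI exI[of _ B] exI[of _ A] conjI)
  qed
  ultimately show "brownian_events M W s \<union> jump_events M T \<Lambda> N s \<union> null_sets M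
      \<subseteq> brownian_events M W t \<union> jump_events M T \<Lambda> N t \<union> null_sets M" by blast
qed

lemma measurable_\<F>_mono: "f \<in> measurable (\<F> s) L \<Longrightarrow> s \<le> t \<Longrightarrow> f \<in> measurable (\<F> t) L"
  using \<F>_mono[of s t] by (auto simp: measurable_def)

lemma measurable_\<F>_M: "f \<in> measurable (\<F> s) L \<Longrightarrow> s \<le> T \<Longrightarrow> f \<in> measurable M L"
  using \<F>_subset[of s] by (auto simp: measurable_def)

lemma W_measurable_\<F>: "0 \<le> s \<Longrightarrow> s \<le> t \<Longrightarrow> W s \<in> borel_measurable (\<F> t)"
  by (rule measurableI) (auto simp: sets_\<F> brownian_events_def intro!: sigma_sets.Basic)

lemma N_measurable_\<F>:
  "B \<in> sets TZ \<Longrightarrow> B \<subseteq> {0..t} \<times> space \<Lambda> \<Longrightarrow> (\<lambda>\<omega>. emeasure (N \<omega>) B) \<in> borel_measurable (\<F> t)"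
  by (rule measurableI) (auto simp: sets_\<F> jump_events_def intro!: sigma_sets.Basic)

lemma future_generators:
  assumes "0 \<le> a" "a \<le> b" "b \<le> T" shows "future_events a b \<subseteq> Pow (space M)"
proof -
  have "future_events a b \<subseteq> events"
    using indep_past_future[OF assms] unfolding indep_sets2_eq by blast
  then show ?thesis using sets.sets_into_space by blast
qed

lemma W_measurable_future:
  assumes "0 \<le> a" "a \<le> b" "b \<le> T"
  shows "(\<lambda>\<omega>. W b \<omega> - W a \<omega>) \<in> borel_measurable (future a b)"
proof (rule measurableI)
  fix A :: "real set" assume "A \<in> sets borel"
  let ?x = "(\<lambda>\<omega>. W b \<omega> - W a \<omega>) -` A \<inter> space M"
  have "?x \<in> W_future a b" unfolding W_future_def using \<open>A \<in> _\<close> by (intro sigma_sets.Basic) blast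
  moreover have "space M \<in> N_events U" for U unfolding N_events_def by (rule sigma_sets_top)
  moreover have "?x = ?x \<inter> space M" by auto
  ultimately have "?x \<in> future_events a b" unfolding future_events_def by blast
  then show "(\<lambda>\<omega>. W b \<omega> - W a \<omega>) -` A \<inter> space (future a b) \<in> sets (future a b)"
    unfolding future_def using future_generators[OF assms] by auto
qed simp

lemma N_measurable_future:
  assumes "0 \<le> a" "a \<le> b" "b \<le> T" "B \<in> sets TZ" "B \<subseteq> {a<..b} \<times> space \<Lambda>"
  shows "(\<lambda>\<omega>. emeasure (N \<omega>) B) \<in> borel_measurable (future a b)"
proof (rule measurableI)
  fix A :: "ennreal set" assume "A \<in> sets borel"
  let ?x = "(\<lambda>\<omega>. emeasure (N \<omega>) B) -` A \<inter> space M"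
  have "?x \<in> N_events ({a<..b} \<times> space \<Lambda>)"
    unfolding N_events_def using \<open>A \<in> _\<close> assms(4,5) by (intro sigma_sets.Basic) blast
  moreover have "space M \<in> W_future a b" unfolding W_future_def by (rule sigma_sets_top)
  moreover have "?x = space M \<inter> ?x" by auto
  ultimately have "?x \<in> future_events a b" unfolding future_events_def by blast
  then show "(\<lambda>\<omega>. emeasure (N \<omega>) B) -` A \<inter> space (future a b) \<in> sets (future a b)"
    unfolding future_def using future_generators[OF assms(1-3)] by auto
qed simp

text \<open>The form in which the independence enters expectations: a coefficient known at time
  \<open>a\<close> is multiplied by a function of the noise over \<open>(a, b]\<close>, and the
  expectation of the product factorises.\<close>

lemma indep_var_past_future:
  fixes \<zeta> Y :: "'w \<Rightarrow> real"
  assumes "0 \<le> a" "a \<le> b" "b \<le> T" "\<zeta> \<in> borel_measurable (\<F> a)" "Y \<in> borel_measurable (future a b)"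
  shows "indep_var borel \<zeta> borel Y"
proof -
  note ind = indep_past_future[OF assms(1-3), unfolded indep_sets2_eq]
  have pow: "past_events a \<subseteq> Pow (space M)"
  proof -
    have "past_events a \<subseteq> events" using ind by blast
    then show ?thesis using sets.sets_into_space by blast
  qed
  have sf: "sets (future a b) = sigma_sets (space M) (future_events a b)" "space (future a b) = space M"
    unfolding future_def using future_generators[OF assms(1-3)] by auto
  have "a \<le> T" using assms by simp
  have \<zeta>: "\<zeta> \<in> borel_measurable M" by (rule measurable_\<F>_M[OF assms(4) \<open>a \<le> T\<close>])
  have Y: "Y \<in> borel_measurable M"
    using assms(5) ind sf by (auto simp: measurable_def)
  have s1: "sigma_sets (space M) {\<zeta> -` A \<inter> space M |A. A \<in> sets borel} \<subseteq> sigma_sets (space M) (past_events a)"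
  proof (rule sigma_sets_mono, safe)
    fix A :: "real set" assume "A \<in> sets borel"
    then have "\<zeta> -` A \<inter> space M \<in> sets (\<F> a)" using measurable_sets[OF assms(4)] by simp
    then show "\<zeta> -` A \<inter> space M \<in> sigma_sets (space M) (past_events a)"
      using filtration_subset_past[OF assms(1) \<open>a \<le> T\<close>] by blast
  qed
  have s2: "sigma_sets (space M) {Y -` A \<inter> space M |A. A \<in> sets borel} \<subseteq> sigma_sets (space M) (future_events a b)"
  proof (rule sigma_sets_mono, safe)
    fix A :: "real set" assume "A \<in> sets borel"
    then show "Y -` A \<inter> space M \<in> sigma_sets (space M) (future_events a b)"
      using measurable_sets[OF assms(5)] sf by auto
  qed
  show ?thesis
    unfolding indep_var_eq indep_sets2_eq using \<zeta> Y s1 s2 ind by blast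
qed

end

section \<open>Moments and covariances of the noise increments\<close>

lemma poisson_sums:
  fixes c :: real
  shows "(\<lambda>k. c ^ k / fact k * exp (- c)) sums 1"
    and "(\<lambda>k. real k * (c ^ k / fact k * exp (- c))) sums c"
    and "(\<lambda>k. (real k)\<^sup>2 * (c ^ k / fact k * exp (- c))) sums (c\<^sup>2 + c)"
proof -
  have "(\<lambda>k. c ^ k / fact k) sums exp c"
    using exp_converges[of c] by (simp add: divide_inverse mult.commute)
  from sums_mult2[OF this, of "exp (- c)"]
  show p0: "(\<lambda>k. c ^ k / fact k * exp (- c)) sums 1"
    by (simp add: exp_minus)
  \<comment> \<open>The factor cancels against the factorial and shifts the index. Used repeatedly,
    this reduces the first and second moments to the total mass 1.\<close>
  have s: "real (Suc k) * (c ^ Suc k / fact (Suc k) * exp (- c)) = c * (c ^ k / fact k * exp (- c))" for k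
    by (simp add: field_simps del: of_nat_Suc)
  have "(\<lambda>k. real (Suc k) * (c ^ Suc k / fact (Suc k) * exp (- c))) sums c"
    unfolding s using sums_mult[OF p0, of c] by simp
  then show p1: "(\<lambda>k. real k * (c ^ k / fact k * exp (- c))) sums c"
    by (subst (asm) sums_Suc_iff) simp
  have "(real (Suc k))\<^sup>2 * (c ^ Suc k / fact (Suc k) * exp (- c))
      = c * (real k * (c ^ k / fact k * exp (- c))) + c * (c ^ k / fact k * exp (- c))" for k
  proof -
    have "(real (Suc k))\<^sup>2 * (c ^ Suc k / fact (Suc k) * exp (- c))
        = real (Suc k) * (real (Suc k) * (c ^ Suc k / fact (Suc k) * exp (- c)))"
      by (simp only: power2_eq_square mult.assoc)
    also have "\<dots> = real (Suc k) * (c * (c ^ k / fact k * exp (- c)))" by (simp only: s)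
    also have "\<dots> = c * (real k * (c ^ k / fact k * exp (- c))) + c * (c ^ k / fact k * exp (- c))"
      unfolding of_nat_Suc distrib_right by (simp add: mult_ac)
    finally show ?thesis .
  qed
  then have "(\<lambda>k. (real (Suc k))\<^sup>2 * (c ^ Suc k / fact (Suc k) * exp (- c))) sums (c * c + c * 1)"
    using sums_add[OF sums_mult[OF p1, of c] sums_mult[OF p0, of c]] by simp
  then show "(\<lambda>k. (real k)\<^sup>2 * (c ^ k / fact k * exp (- c))) sums (c\<^sup>2 + c)"
    by (subst (asm) sums_Suc_iff) (simp add: power2_eq_square)
qed

lemma integrable_mult_of_squares:
  fixes f g :: "'a \<Rightarrow> real"
  assumes "f \<in> borel_measurable M" "g \<in> borel_measurable M"
    "integrable M (\<lambda>x. (f x)\<^sup>2)" "integrable M (\<lambda>x. (g x)\<^sup>2)"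
  shows "integrable M (\<lambda>x. f x * g x)"
proof (rule Bochner_Integration.integrable_bound)
  show "integrable M (\<lambda>x. (f x)\<^sup>2 + (g x)\<^sup>2)" using assms by simp
  have "\<bar>x * y\<bar> \<le> x\<^sup>2 + y\<^sup>2" for x y :: real
    using sum_squares_bound[of "\<bar>x\<bar>" "\<bar>y\<bar>"] zero_le_power2[of x] zero_le_power2[of y]
    unfolding abs_mult power2_abs by linarith
  then show "AE x in M. norm (f x * g x) \<le> norm ((f x)\<^sup>2 + (g x)\<^sup>2)" by simp
qed (use assms in measurable)

context lq_noise
begin

text \<open>The mass of a set is an extended real, but its Poisson probabilities of being a natural
  number sum to 1.\<close>

lemma AE_N_nat:
  assumes B: "B \<in> sets TZ"
  shows "AE \<omega> in M. \<exists>k. emeasure (N \<omega>) B = of_nat k"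
proof -
  note [measurable] = N_measurable[OF B]
  let ?A = "\<lambda>k. {\<omega> \<in> space M. emeasure (N \<omega>) B = of_nat k}"
  have "(\<lambda>k. prob (?A k)) sums prob (\<Union>k. ?A k)"
    by (rule finite_measure_UNION) (auto simp: disjoint_family_on_def)
  then have "prob (\<Union>k. ?A k) = 1"
    using poisson_sums(1)[of "measure TZ B"] unfolding prob_N_eq[OF B] by (rule sums_unique2)
  then have "AE \<omega> in M. \<omega> \<in> (\<Union>k. ?A k)"
    by (subst (asm) prob_eq_1) auto
  then show ?thesis by auto
qed

lemma nn_integral_N:
  fixes f :: "ennreal \<Rightarrow> ennreal"
  assumes B: "B \<in> sets TZ"
  shows "(\<integral>\<^sup>+\<omega>. f (emeasure (N \<omega>) B) \<partial>M)
    = (\<Sum>k. f (of_nat k) * ennreal (measure TZ B ^ k / fact k * exp (- measure TZ B)))"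
proof -
  note [measurable] = N_measurable[OF B]
  let ?A = "\<lambda>k. {\<omega> \<in> space M. emeasure (N \<omega>) B = of_nat k}"
  have "(\<integral>\<^sup>+\<omega>. f (emeasure (N \<omega>) B) \<partial>M) = (\<integral>\<^sup>+\<omega>. (\<Sum>k. f (of_nat k) * indicator (?A k) \<omega>) \<partial>M)"
  proof (rule nn_integral_cong_AE)
    show "AE \<omega> in M. f (emeasure (N \<omega>) B) = (\<Sum>k. f (of_nat k) * indicator (?A k) \<omega>)"
      using AE_N_nat[OF B] AE_space
    proof eventually_elim
      case (elim \<omega>)
      then obtain k where k: "emeasure (N \<omega>) B = of_nat k" by blast
      have "(\<Sum>j. f (of_nat j) * indicator (?A j) \<omega>) = (\<Sum>j\<in>{k}. f (of_nat j) * indicator (?A j) \<omega>)"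
        by (rule suminf_finite) (auto simp: k)
      then show ?case using elim(2) k by simp
    qed
  qed
  also have "\<dots> = (\<Sum>k. \<integral>\<^sup>+\<omega>. f (of_nat k) * indicator (?A k) \<omega> \<partial>M)"
    by (intro nn_integral_suminf) measurable
  also have "\<dots> = (\<Sum>k. f (of_nat k) * emeasure M (?A k))"
    by (intro suminf_cong nn_integral_cmult_indicator) measurable
  also have "\<dots> = (\<Sum>k. f (of_nat k) * ennreal (measure TZ B ^ k / fact k * exp (- measure TZ B)))"
    unfolding emeasure_eq_measure prob_N_eq[OF B] ..
  finally show ?thesis .
qed

lemma N_measure_measurable: "B \<in> sets TZ \<Longrightarrow> (\<lambda>\<omega>. measure (N \<omega>) B) \<in> borel_measurable M"
  unfolding measure_def using N_measurable by measurable

lemma N_moments: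
  assumes B: "B \<in> sets TZ"
  shows "has_bochner_integral M (\<lambda>\<omega>. measure (N \<omega>) B) (measure TZ B)"
    and "has_bochner_integral M (\<lambda>\<omega>. (measure (N \<omega>) B)\<^sup>2) ((measure TZ B)\<^sup>2 + measure TZ B)"
proof -
  let ?c = "measure TZ B"
  have nat: "enn2real (of_nat k) = real k" for k
    by (simp flip: ennreal_of_nat_eq_real_of_nat)
  have mult: "ennreal x * ennreal (?c ^ k / fact k * exp (- ?c)) = ennreal (x * (?c ^ k / fact k * exp (- ?c)))"
    if "0 \<le> x" for x k
    by (rule ennreal_mult[symmetric]) (use that in auto)
  have "(\<integral>\<^sup>+\<omega>. ennreal (measure (N \<omega>) B) \<partial>M) = ennreal ?c"
    unfolding measure_def[of "N _"] nn_integral_N[OF B, of "\<lambda>x. ennreal (enn2real x)"] nat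
    by (subst mult) (auto simp del: times_divide_eq_left times_divide_eq_right intro!: suminf_ennreal_eq poisson_sums(2))
  then show "has_bochner_integral M (\<lambda>\<omega>. measure (N \<omega>) B) ?c"
    by (intro has_bochner_integral_nn_integral N_measure_measurable[OF B]) auto
  have "(\<integral>\<^sup>+\<omega>. ennreal ((measure (N \<omega>) B)\<^sup>2) \<partial>M) = ennreal (?c\<^sup>2 + ?c)"
    unfolding measure_def[of "N _"] nn_integral_N[OF B, of "\<lambda>x. ennreal ((enn2real x)\<^sup>2)"] nat
    by (subst mult) (auto simp del: times_divide_eq_left times_divide_eq_right ennreal_plus intro!: suminf_ennreal_eq poisson_sums(3))
  then show "has_bochner_integral M (\<lambda>\<omega>. (measure (N \<omega>) B)\<^sup>2) (?c\<^sup>2 + ?c)"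
    using N_measure_measurable[OF B] by (intro has_bochner_integral_nn_integral) auto
qed

text \<open>The index \<open>None\<close> stands for the Brownian motion and \<open>Some B\<close> for the compensated Poisson
  measure of the mark set \<open>B\<close>, so that both integrators can be treated at once.\<close>

definition Z :: "real \<Rightarrow> real \<Rightarrow> 'z set option \<Rightarrow> 'w \<Rightarrow> real" where
  "Z a b j = (case j of None \<Rightarrow> (\<lambda>\<omega>. W b \<omega> - W a \<omega>) | Some B \<Rightarrow> compensated \<Lambda> N a b B)"

definition mark_ok :: "'z set option \<Rightarrow> bool" where
  "mark_ok j \<longleftrightarrow> (\<forall>B. j = Some B \<longrightarrow> B \<in> sets \<Lambda>)"

text \<open>The covariance of two increments per unit of time. The mixed entries are 0 because the
  noises are independent.\<close>

definition cov :: "'z set option \<Rightarrow> 'z set option \<Rightarrow> real" where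
  "cov j k = (case (j, k) of (None, None) \<Rightarrow> 1 | (Some B, Some B') \<Rightarrow> measure \<Lambda> (B \<inter> B') | _ \<Rightarrow> 0)"

lemma cov_commute: "cov j k = cov k j"
  by (simp add: cov_def Int_commute split: option.split)

lemma Z_self: "Z a a j \<omega> = 0"
  by (simp add: Z_def compensated_def split: option.split)

lemma compensated_moments:
  assumes "0 \<le> a" "a \<le> b" "b \<le> T" "B \<in> sets \<Lambda>"
  shows "has_bochner_integral M (compensated \<Lambda> N a b B) 0"
    and "has_bochner_integral M (\<lambda>\<omega>. (compensated \<Lambda> N a b B \<omega>)\<^sup>2) ((b - a) * measure \<Lambda> B)"
proof -
  let ?R = "{a<..b} \<times> B" and ?c = "(b - a) * measure \<Lambda> B"
  have R: "?R \<in> sets TZ" using assms by (intro rectangle_in_TZ) auto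
  have c: "measure TZ ?R = ?c" using assms by (intro measure_TZ_rectangle)
  note m = N_moments[OF R, unfolded c]
  have "has_bochner_integral M (\<lambda>\<omega>. measure (N \<omega>) ?R - ?c) (?c - ?c)"
    using has_bochner_integral_diff[OF m(1), of "\<lambda>_. ?c" ?c] by (simp add: has_bochner_integral_iff prob_space)
  then show "has_bochner_integral M (compensated \<Lambda> N a b B) 0"
    by (simp add: compensated_def[abs_def])
  have "has_bochner_integral M (\<lambda>\<omega>. (measure (N \<omega>) ?R)\<^sup>2 - 2 * ?c * measure (N \<omega>) ?R + ?c\<^sup>2)
      (?c\<^sup>2 + ?c - 2 * ?c * ?c + ?c\<^sup>2)"
    using m by (intro has_bochner_integral_add has_bochner_integral_diff has_bochner_integral_mult_right)
      (auto simp: has_bochner_integral_iff prob_space)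
  then show "has_bochner_integral M (\<lambda>\<omega>. (compensated \<Lambda> N a b B \<omega>)\<^sup>2) ?c"
    by (simp add: compensated_def[abs_def] power2_eq_square algebra_simps)
qed

lemma W_moments:
  assumes "0 \<le> a" "a \<le> b" "b \<le> T"
  shows "has_bochner_integral M (\<lambda>\<omega>. W b \<omega> - W a \<omega>) 0"
    and "has_bochner_integral M (\<lambda>\<omega>. (W b \<omega> - W a \<omega>)\<^sup>2) (b - a)"
proof -
  have "has_bochner_integral M (\<lambda>\<omega>. W b \<omega> - W a \<omega>) 0 \<and> has_bochner_integral M (\<lambda>\<omega>. (W b \<omega> - W a \<omega>)\<^sup>2) (b - a)"
  \<comment> \<open>The normal law is available for \<open>a < b\<close>; for \<open>a = b\<close>
    the increment is 0 and has no density.\<close>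
  proof (cases "a = b")
    case False
    with assms have "a < b" by simp
    let ?n = "normal_density 0 (sqrt (b - a))"
    have D: "distributed M lborel (\<lambda>\<omega>. W b \<omega> - W a \<omega>) ?n"
      using bm assms \<open>a < b\<close> unfolding brownian_motion_def by auto
    have s: "0 < sqrt (b - a)" using \<open>a < b\<close> by simp
    have 1: "has_bochner_integral lborel (\<lambda>x. ?n x * x) 0"
      using normal_moment_nz_1[OF s, of 0] .
    have 2: "has_bochner_integral lborel (\<lambda>x. ?n x * x\<^sup>2) (b - a)"
    proof -
      have "fact (2 * 1) / ((2 / (sqrt (b - a))\<^sup>2) ^ 1 * fact 1) = b - a"
        using \<open>a < b\<close> by (simp add: fact_2 field_simps)
      then show ?thesis using normal_moment_even[OF s, of 0 1] by (simp only: diff_zero mult_1_right)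
    qed
    show ?thesis
      using distributed_integrable[OF D, of "\<lambda>x. x"] distributed_integral[OF D, of "\<lambda>x. x"]
        distributed_integrable[OF D, of "\<lambda>x. x\<^sup>2"] distributed_integral[OF D, of "\<lambda>x. x\<^sup>2"] 1 2
      unfolding has_bochner_integral_iff by simp
  qed (simp add: has_bochner_integral_zero)
  then show "has_bochner_integral M (\<lambda>\<omega>. W b \<omega> - W a \<omega>) 0" "has_bochner_integral M (\<lambda>\<omega>. (W b \<omega> - W a \<omega>)\<^sup>2) (b - a)"
    by auto
qed

lemma compensated_measurable_\<F>:
  assumes "0 \<le> a" "a \<le> b" "b \<le> t" "b \<le> T" "B \<in> sets \<Lambda>"
  shows "compensated \<Lambda> N a b B \<in> borel_measurable (\<F> t)"
proof -
  have "{a<..b} \<times> B \<subseteq> {0..t} \<times> space \<Lambda>" using assms sets.sets_into_space[of B \<Lambda>] by auto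
  then have [measurable]: "(\<lambda>\<omega>. emeasure (N \<omega>) ({a<..b} \<times> B)) \<in> borel_measurable (\<F> t)"
    using assms by (intro N_measurable_\<F> rectangle_in_TZ)
  show ?thesis unfolding compensated_def[abs_def] measure_def by measurable
qed

lemma compensated_measurable_future:
  assumes "0 \<le> a" "a \<le> b" "b \<le> T" "B \<in> sets \<Lambda>"
  shows "compensated \<Lambda> N a b B \<in> borel_measurable (future a b)"
proof -
  have "{a<..b} \<times> B \<subseteq> {a<..b} \<times> space \<Lambda>" using assms sets.sets_into_space[of B \<Lambda>] by auto
  then have [measurable]: "(\<lambda>\<omega>. emeasure (N \<omega>) ({a<..b} \<times> B)) \<in> borel_measurable (future a b)"
    using assms by (intro N_measurable_future rectangle_in_TZ)
  show ?thesis unfolding compensated_def[abs_def] measure_def by measurable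
qed

lemma Z_measurable_\<F>:
  "0 \<le> a \<Longrightarrow> a \<le> b \<Longrightarrow> b \<le> t \<Longrightarrow> b \<le> T \<Longrightarrow> mark_ok j \<Longrightarrow> Z a b j \<in> borel_measurable (\<F> t)"
  using compensated_measurable_\<F>[of a b t] W_measurable_\<F>[of a t] W_measurable_\<F>[of b t]
  by (auto simp: Z_def mark_ok_def split: option.split intro!: borel_measurable_diff)

lemma Z_measurable_future:
  "0 \<le> a \<Longrightarrow> a \<le> b \<Longrightarrow> b \<le> T \<Longrightarrow> mark_ok j \<Longrightarrow> Z a b j \<in> borel_measurable (future a b)"
  using compensated_measurable_future[of a b] W_measurable_future[of a b]
  by (auto simp: Z_def mark_ok_def split: option.split)

lemma Z_measurable: "0 \<le> a \<Longrightarrow> a \<le> b \<Longrightarrow> b \<le> T \<Longrightarrow> mark_ok j \<Longrightarrow> Z a b j \<in> borel_measurable M"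
  using measurable_\<F>_M[OF Z_measurable_\<F>[of a b b j]] by auto

lemma Z_mean:
  "0 \<le> a \<Longrightarrow> a \<le> b \<Longrightarrow> b \<le> T \<Longrightarrow> mark_ok j \<Longrightarrow> has_bochner_integral M (Z a b j) 0"
  using compensated_moments(1)[of a b] W_moments(1)[of a b]
  by (auto simp: Z_def mark_ok_def split: option.split)

lemma Z_square_integrable:
  "0 \<le> a \<Longrightarrow> a \<le> b \<Longrightarrow> b \<le> T \<Longrightarrow> mark_ok j \<Longrightarrow> integrable M (\<lambda>\<omega>. (Z a b j \<omega>)\<^sup>2)"
  using compensated_moments(2)[of a b] W_moments(2)[of a b]
  by (auto simp: Z_def mark_ok_def has_bochner_integral_iff split: option.split)

lemma AE_N_finite:
  assumes "B \<in> sets TZ" shows "AE \<omega> in M. emeasure (N \<omega>) B < \<infinity>"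
  using AE_N_nat[OF assms] by eventually_elim (auto simp: of_nat_less_top)

text \<open>\<open>measure\<close> sends infinite mass to 0, so additivity requires both counts to
  be finite, which they are almost surely.\<close>

lemma AE_N_measure_Un:
  assumes "B \<in> sets TZ" "B' \<in> sets TZ" "B \<inter> B' = {}"
  shows "AE \<omega> in M. measure (N \<omega>) (B \<union> B') = measure (N \<omega>) B + measure (N \<omega>) B'"
  using AE_N_finite[OF assms(1)] AE_N_finite[OF assms(2)] AE_space
proof eventually_elim
  case (elim \<omega>)
  then show ?case using assms sets_N by (intro measure_Union) auto
qed

text \<open>The counts of disjoint rectangles are independent, and compensation makes their means
  0.\<close>

lemma compensated_disjoint_cov:
  assumes "0 \<le> a" "a \<le> b" "b \<le> T" "B \<in> sets \<Lambda>" "B' \<in> sets \<Lambda>" "B \<inter> B' = {}"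
  shows "has_bochner_integral M (\<lambda>\<omega>. compensated \<Lambda> N a b B \<omega> * compensated \<Lambda> N a b B' \<omega>) 0"
proof -
  let ?c = "\<lambda>B. compensated \<Lambda> N a b B"
  have R: "{a<..b} \<times> B \<in> sets TZ" "{a<..b} \<times> B' \<in> sets TZ" using assms by (auto intro!: rectangle_in_TZ)
  have ind: "indep_set (N_events ({a<..b} \<times> B)) (N_events ({a<..b} \<times> B'))"
    by (rule N_disjoint_indep) (use assms in auto)
  have meas: "?c B \<in> borel_measurable M" if "B \<in> sets \<Lambda>" for B
    using compensated_moments(1)[OF assms(1-3) that] by (auto simp: has_bochner_integral_iff)
  have sub: "sigma_sets (space M) {?c B -` A \<inter> space M |A. A \<in> sets borel} \<subseteq> N_events ({a<..b} \<times> B)"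
    if "{a<..b} \<times> B \<in> sets TZ" for B
    unfolding N_events_def
  proof (rule sigma_sets_mono', safe)
    fix A :: "real set" assume A: "A \<in> sets borel"
    let ?g = "\<lambda>x. enn2real x - (b - a) * measure \<Lambda> B"
    have "?g \<in> borel_measurable borel" by measurable
    then have "?g -` A \<in> sets borel" using A by (rule measurable_sets_borel)
    moreover have "?c B -` A \<inter> space M = (\<lambda>\<omega>. emeasure (N \<omega>) ({a<..b} \<times> B)) -` (?g -` A) \<inter> space M"
      by (auto simp: compensated_def measure_def)
    ultimately show "\<exists>B' A'. ?c B -` A \<inter> space M = (\<lambda>\<omega>. emeasure (N \<omega>) B') -` A' \<inter> space M \<and>
        B' \<in> {B' \<in> sets TZ. B' \<subseteq> {a<..b} \<times> B} \<and> A' \<in> sets borel"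
      using that by blast
  qed
  have "indep_var borel (?c B) borel (?c B')"
    unfolding indep_var_eq indep_sets2_eq
    using meas assms ind[unfolded indep_sets2_eq] sub[OF R(1)] sub[OF R(2)] by blast
  then show ?thesis
    using compensated_moments(1)[OF assms(1-4)] compensated_moments(1)[OF assms(1-3,5)]
    by (simp add: has_bochner_integral_iff indep_var_lebesgue_integral indep_var_integrable)
qed

text \<open>Splitting off the common part reduces the covariance of overlapping mark sets to one
  variance and to covariances of disjoint mark sets.\<close>

lemma compensated_split:
  assumes "0 \<le> a" "a \<le> b" "b \<le> T" "B \<in> sets \<Lambda>" "B' \<in> sets \<Lambda>"
  shows "AE \<omega> in M. compensated \<Lambda> N a b B \<omega> = compensated \<Lambda> N a b (B \<inter> B') \<omega> + compensated \<Lambda> N a b (B - B') \<omega>"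
proof -
  have "AE \<omega> in M. measure (N \<omega>) ({a<..b} \<times> (B \<inter> B') \<union> {a<..b} \<times> (B - B'))
      = measure (N \<omega>) ({a<..b} \<times> (B \<inter> B')) + measure (N \<omega>) ({a<..b} \<times> (B - B'))"
    using assms by (intro AE_N_measure_Un rectangle_in_TZ) auto
  moreover have "{a<..b} \<times> (B \<inter> B') \<union> {a<..b} \<times> (B - B') = {a<..b} \<times> B" by auto
  moreover have "measure \<Lambda> B = measure \<Lambda> (B \<inter> B') + measure \<Lambda> (B - B')"
    using assms by (subst \<Lambda>.finite_measure_Union[symmetric]) (auto intro!: arg_cong[where f="measure \<Lambda>"])
  ultimately show ?thesis by (simp add: compensated_def algebra_simps)
qed

lemma W_N_cov:
  assumes "0 \<le> a" "a \<le> b" "b \<le> T" "B \<in> sets \<Lambda>"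
  shows "has_bochner_integral M (\<lambda>\<omega>. (W b \<omega> - W a \<omega>) * compensated \<Lambda> N a b B \<omega>) 0"
proof -
  let ?c = "compensated \<Lambda> N a b B" let ?w = "\<lambda>\<omega>. W b \<omega> - W a \<omega>"
  have R: "{a<..b} \<times> B \<in> sets TZ" using assms by (auto intro!: rectangle_in_TZ)
  have "sigma_sets (space M) {?w -` A \<inter> space M |A. A \<in> sets borel} \<subseteq> W_future a b"
    unfolding W_future_def by (rule sigma_sets_mono') auto
  then have s1: "sigma_sets (space M) {?w -` A \<inter> space M |A. A \<in> sets borel} \<subseteq> sigma_sets (space M) (brownian_events M W T)"
    using W_future_subset[OF assms(1-3)] by blast
  have s2: "sigma_sets (space M) {?c -` A \<inter> space M |A. A \<in> sets borel} \<subseteq> sigma_sets (space M) (jump_events M T \<Lambda> N T)"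
  proof (rule sigma_sets_mono', safe)
    fix A :: "real set" assume A: "A \<in> sets borel"
    let ?g = "\<lambda>x. enn2real x - (b - a) * measure \<Lambda> B"
    have "?g \<in> borel_measurable borel" by measurable
    then have "?g -` A \<in> sets borel" using A by (rule measurable_sets_borel)
    moreover have "?c -` A \<inter> space M = (\<lambda>\<omega>. emeasure (N \<omega>) ({a<..b} \<times> B)) -` (?g -` A) \<inter> space M"
      by (auto simp: compensated_def measure_def)
    moreover have "{a<..b} \<times> B \<subseteq> {0..T} \<times> space \<Lambda>" using sets.sets_into_space[OF R] by (simp add: space_TZ)
    ultimately show "?c -` A \<inter> space M \<in> jump_events M T \<Lambda> N T"
      unfolding jump_events_def using R by blast
  qed
  have m: "?w \<in> borel_measurable M" "?c \<in> borel_measurable M"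
    using W_moments(1)[OF assms(1-3)] compensated_moments(1)[OF assms] by (auto simp: has_bochner_integral_iff)
  have "indep_var borel ?w borel ?c"
    unfolding indep_var_eq indep_sets2_eq
    using m s1 s2 noises[unfolded independent_noises_def indep_sets2_eq] by blast
  then show ?thesis
    using compensated_moments(1)[OF assms] W_moments(1)[OF assms(1-3)]
    by (simp add: has_bochner_integral_iff indep_var_lebesgue_integral indep_var_integrable)
qed

lemma Z_cov:
  assumes "0 \<le> a" "a \<le> b" "b \<le> T" "mark_ok j" "mark_ok k"
  shows "has_bochner_integral M (\<lambda>\<omega>. Z a b j \<omega> * Z a b k \<omega>) ((b - a) * cov j k)"
proof (cases j)
  case None
  then show ?thesis
    using assms W_moments(2)[OF assms(1-3)] W_N_cov[OF assms(1-3)]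
    by (cases k) (auto simp: Z_def cov_def power2_eq_square mark_ok_def)
next
  case (Some B)
  then have B: "B \<in> sets \<Lambda>" using assms by (auto simp: mark_ok_def)
  show ?thesis
  proof (cases k)
    case None
    then show ?thesis using W_N_cov[OF assms(1-3) B] Some by (auto simp: Z_def cov_def mult.commute)
  next
    case (Some B')
    note j = \<open>j = Some B\<close>
    have B': "B' \<in> sets \<Lambda>" using Some assms by (auto simp: mark_ok_def)
    let ?c = "\<lambda>B. compensated \<Lambda> N a b B"
    \<comment> \<open>Both factors are split along \<open>B \<inter> B'\<close>. The square of the
      common part gives the covariance; the three mixed products concern disjoint mark sets and have
      mean 0.\<close>
    let ?f = "\<lambda>\<omega>. (?c (B \<inter> B') \<omega>)\<^sup>2 + (?c (B \<inter> B') \<omega> * ?c (B' - B) \<omega> + (?c (B - B') \<omega> * ?c (B \<inter> B') \<omega>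
        + ?c (B - B') \<omega> * ?c (B' - B) \<omega>))"
    have f: "has_bochner_integral M ?f ((b - a) * measure \<Lambda> (B \<inter> B') + (0 + (0 + 0)))"
      using B B' by (intro has_bochner_integral_add compensated_moments(2) compensated_disjoint_cov assms) auto
    have eq: "AE \<omega> in M. ?c B \<omega> * ?c B' \<omega> = ?f \<omega>"
      using compensated_split[OF assms(1-3) B B'] compensated_split[OF assms(1-3) B' B]
    proof eventually_elim
      case (elim \<omega>)
      then show ?case by (simp add: Int_commute power2_eq_square algebra_simps)
    qed
    have m: "?c B \<in> borel_measurable M" "?c B' \<in> borel_measurable M"
      using compensated_moments(1)[OF assms(1-3)] B B' by (auto simp: has_bochner_integral_iff)
    have "has_bochner_integral M (\<lambda>\<omega>. ?c B \<omega> * ?c B' \<omega>) ((b - a) * measure \<Lambda> (B \<inter> B'))"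
      using f eq m has_bochner_integral_cong_AE[of "\<lambda>\<omega>. ?c B \<omega> * ?c B' \<omega>" M ?f] by (auto simp: has_bochner_integral_iff)
    then show ?thesis using j Some by (simp add: Z_def cov_def)
  qed
qed

lemma Z_add:
  assumes "0 \<le> a" "a \<le> b" "b \<le> c" "c \<le> T" "mark_ok j"
  shows "AE \<omega> in M. Z a c j \<omega> = Z a b j \<omega> + Z b c j \<omega>"
proof (cases j)
  case (Some B)
  then have B: "B \<in> sets \<Lambda>" using assms by (auto simp: mark_ok_def)
  have "AE \<omega> in M. measure (N \<omega>) ({a<..b} \<times> B \<union> {b<..c} \<times> B)
      = measure (N \<omega>) ({a<..b} \<times> B) + measure (N \<omega>) ({b<..c} \<times> B)"
    using assms B by (intro AE_N_measure_Un rectangle_in_TZ) auto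
  moreover have "{a<..b} \<times> B \<union> {b<..c} \<times> B = {a<..c} \<times> B" using assms by auto
  ultimately show ?thesis using Some by (simp add: compensated_def Z_def algebra_simps)
qed (simp add: Z_def)

lemma Z_past_mean:
  assumes "0 \<le> a" "a \<le> b" "b \<le> T" "mark_ok j" "\<zeta> \<in> borel_measurable (\<F> a)" "integrable M \<zeta>"
  shows "has_bochner_integral M (\<lambda>\<omega>. \<zeta> \<omega> * Z a b j \<omega>) 0"
proof -
  have "indep_var borel \<zeta> borel (Z a b j)"
    by (rule indep_var_past_future[OF assms(1-3,5) Z_measurable_future[OF assms(1-4)]])
  then show ?thesis
    using Z_mean[OF assms(1-4)] assms(6)
    by (simp add: has_bochner_integral_iff indep_var_lebesgue_integral indep_var_integrable)
qed

lemma Z_past_cov: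
  assumes "0 \<le> a" "a \<le> b" "b \<le> T" "mark_ok j" "mark_ok k" "\<zeta> \<in> borel_measurable (\<F> a)" "integrable M \<zeta>"
  shows "has_bochner_integral M (\<lambda>\<omega>. \<zeta> \<omega> * (Z a b j \<omega> * Z a b k \<omega>)) ((\<integral>\<omega>. \<zeta> \<omega> \<partial>M) * ((b - a) * cov j k))"
proof -
  have "indep_var borel \<zeta> borel (\<lambda>\<omega>. Z a b j \<omega> * Z a b k \<omega>)"
    by (intro indep_var_past_future[OF assms(1-3,6)] borel_measurable_times Z_measurable_future assms)
  then show ?thesis
    using Z_cov[OF assms(1-5)] assms(7)
    by (simp add: has_bochner_integral_iff indep_var_lebesgue_integral indep_var_integrable)
qed

lemma integrable_bounded_mult_Z:
  assumes "0 \<le> a" "a \<le> b" "b \<le> T" "mark_ok j" "\<eta> \<in> borel_measurable M" "\<And>\<omega>. \<omega> \<in> space M \<Longrightarrow> \<bar>\<eta> \<omega>\<bar> \<le> K"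
  shows "integrable M (\<lambda>\<omega>. Z a b j \<omega> * \<eta> \<omega>)"
proof (rule integrable_mult_of_squares)
  show "integrable M (\<lambda>\<omega>. (\<eta> \<omega>)\<^sup>2)"
  proof (rule integrable_const_bound[of _ "K\<^sup>2"])
    show "AE \<omega> in M. norm ((\<eta> \<omega>)\<^sup>2) \<le> K\<^sup>2"
      using assms(6) by (intro AE_I2) (auto simp: abs_le_square_iff[symmetric] intro: order_trans[OF _ abs_ge_self])
  qed (use assms(5) in measurable)
qed (intro Z_measurable Z_square_integrable assms)+

text \<open>Both intervals are cut at \<open>a'\<close> and at the end \<open>m\<close> of their
  overlap. Apart from the product of the two increments over the overlap, each product that does not
  vanish contains an increment that starts at a time when all other factors are known, and so has
  mean 0. This replaces conditional expectations by independence of past and future.\<close>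

lemma Z_cross_aux:
  assumes ab: "0 \<le> a" "a \<le> b" "b \<le> T" and ab': "a \<le> a'" "a' \<le> b'" "b' \<le> T"
    and jk: "mark_ok j" "mark_ok k"
    and \<eta>: "\<eta> \<in> borel_measurable (\<F> a')" "\<And>\<omega>. \<omega> \<in> space M \<Longrightarrow> \<bar>\<eta> \<omega>\<bar> \<le> K"
  shows "has_bochner_integral M (\<lambda>\<omega>. Z a b j \<omega> * Z a' b' k \<omega> * \<eta> \<omega>)
     (max 0 (min b b' - a') * cov j k * (\<integral>\<omega>. \<eta> \<omega> \<partial>M))"
proof -
  have a': "0 \<le> a'" "a' \<le> T" using ab ab' by auto
  have \<eta>M: "\<eta> \<in> borel_measurable M" by (rule measurable_\<F>_M[OF \<eta>(1) a'(2)])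
  have \<eta>i: "integrable M \<eta>"
    by (rule integrable_const_bound[of _ K]) (use \<eta>(2) \<eta>M in auto)
  show ?thesis
  proof (cases "b \<le> a'")
    case True
    have "has_bochner_integral M (\<lambda>\<omega>. (Z a b j \<omega> * \<eta> \<omega>) * Z a' b' k \<omega>) 0"
      using True ab ab' jk \<eta> \<eta>M
      by (intro Z_past_mean borel_measurable_times Z_measurable_\<F> integrable_bounded_mult_Z) auto
    then show ?thesis using True by (simp add: mult_ac)
  next
    case False
    define m where "m = min b b'"
    have m: "a' \<le> m" "m \<le> b" "m \<le> b'" "m \<le> T" "0 \<le> m" using False ab ab' by (auto simp: m_def)
    note ok = jk ab ab' m a' \<eta>(2) \<eta>M
    have \<eta>m: "\<eta> \<in> borel_measurable (\<F> m)" using measurable_\<F>_mono[OF \<eta>(1) m(1)] .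
    \<comment> \<open>The six products of the expansion; the one over the two pieces beyond
      \<open>m\<close> is written as the final 0.\<close>
    let ?f = "\<lambda>\<omega>. (Z a a' j \<omega> * \<eta> \<omega>) * Z a' m k \<omega> + ((Z a a' j \<omega> * \<eta> \<omega>) * Z m b' k \<omega> +
        (\<eta> \<omega> * (Z a' m j \<omega> * Z a' m k \<omega>) + ((Z a' m j \<omega> * \<eta> \<omega>) * Z m b' k \<omega> +
        ((Z a' m k \<omega> * \<eta> \<omega>) * Z m b j \<omega> + 0))))"
    have f: "has_bochner_integral M ?f (0 + (0 + ((\<integral>\<omega>. \<eta> \<omega> \<partial>M) * ((m - a') * cov j k) + (0 + (0 + 0)))))"
    proof (intro has_bochner_integral_add)
      show "has_bochner_integral M (\<lambda>\<omega>. (Z a a' j \<omega> * \<eta> \<omega>) * Z a' m k \<omega>) 0"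
        using ok \<eta>(1) by (intro Z_past_mean borel_measurable_times Z_measurable_\<F> integrable_bounded_mult_Z) auto
      show "has_bochner_integral M (\<lambda>\<omega>. (Z a a' j \<omega> * \<eta> \<omega>) * Z m b' k \<omega>) 0"
        using ok \<eta>m by (intro Z_past_mean borel_measurable_times Z_measurable_\<F> integrable_bounded_mult_Z) auto
      show "has_bochner_integral M (\<lambda>\<omega>. \<eta> \<omega> * (Z a' m j \<omega> * Z a' m k \<omega>)) ((\<integral>\<omega>. \<eta> \<omega> \<partial>M) * ((m - a') * cov j k))"
        using ok \<eta>(1) \<eta>i by (intro Z_past_cov) auto
      show "has_bochner_integral M (\<lambda>\<omega>. (Z a' m j \<omega> * \<eta> \<omega>) * Z m b' k \<omega>) 0"
        using ok \<eta>m by (intro Z_past_mean borel_measurable_times Z_measurable_\<F> integrable_bounded_mult_Z) auto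
      show "has_bochner_integral M (\<lambda>\<omega>. (Z a' m k \<omega> * \<eta> \<omega>) * Z m b j \<omega>) 0"
        using ok \<eta>m by (intro Z_past_mean borel_measurable_times Z_measurable_\<F> integrable_bounded_mult_Z) auto
    qed (rule has_bochner_integral_zero)
    have a'b: "a' \<le> b" using False by simp
    have "AE \<omega> in M. Z a b j \<omega> * Z a' b' k \<omega> * \<eta> \<omega> = ?f \<omega>"
      using Z_add[OF ab(1) ab'(1) a'b ab(3) jk(1)] Z_add[OF a'(1) m(1,2) ab(3) jk(1)]
        Z_add[OF a'(1) m(1,3) ab'(3) jk(2)]
    proof eventually_elim
      case (elim \<omega>)
      \<comment> \<open>Since \<open>m = min b b'\<close>, one of the two increments beyond \<open>m\<close> vanishes.\<close>
      have "Z m b j \<omega> * Z m b' k \<omega> = 0"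
        by (cases "b \<le> b'") (simp_all add: m_def min_def Z_self)
      then have "Z m b j \<omega> * (Z m b' k \<omega> * \<eta> \<omega>) = 0" unfolding mult.assoc[symmetric] by simp
      then show ?case unfolding elim by (simp add: algebra_simps)
    qed
    moreover have "Z a b j \<in> borel_measurable M" "Z a' b' k \<in> borel_measurable M"
      using ok by (auto intro!: Z_measurable)
    ultimately have "has_bochner_integral M (\<lambda>\<omega>. Z a b j \<omega> * Z a' b' k \<omega> * \<eta> \<omega>)
        ((\<integral>\<omega>. \<eta> \<omega> \<partial>M) * ((m - a') * cov j k))"
      using f \<eta>M has_bochner_integral_cong_AE[of "\<lambda>\<omega>. Z a b j \<omega> * Z a' b' k \<omega> * \<eta> \<omega>" M ?f]
      by (auto simp: has_bochner_integral_iff)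
    then show ?thesis using m(1) by (simp add: m_def[symmetric] mult_ac)
  qed
qed

lemma Z_cross:
  assumes "0 \<le> a" "a \<le> b" "b \<le> T" "0 \<le> a'" "a' \<le> b'" "b' \<le> T" "mark_ok j" "mark_ok k"
    and "\<eta> \<in> borel_measurable (\<F> (max a a'))" "\<And>\<omega>. \<omega> \<in> space M \<Longrightarrow> \<bar>\<eta> \<omega>\<bar> \<le> K"
  shows "has_bochner_integral M (\<lambda>\<omega>. Z a b j \<omega> * Z a' b' k \<omega> * \<eta> \<omega>)
     (max 0 (min b b' - max a a') * cov j k * (\<integral>\<omega>. \<eta> \<omega> \<partial>M))"
proof (cases "a \<le> a'")
  case True
  then show ?thesis using Z_cross_aux[of a b a' b' j k \<eta> K] assms by (simp add: max_def)
next
  case False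
  then show ?thesis using Z_cross_aux[of a' b' a b k j \<eta> K] assms
    by (simp add: max_def min.commute cov_commute mult.commute)
qed

end

section \<open>Square integrability\<close>

definition square_integrable :: "'a measure \<Rightarrow> ('a \<Rightarrow> 'b::euclidean_space) \<Rightarrow> bool" where
  "square_integrable M f \<longleftrightarrow> f \<in> borel_measurable M \<and> integrable M (\<lambda>x. (norm (f x))\<^sup>2)"

lemma square_integrable_measurable: "square_integrable M f \<Longrightarrow> f \<in> borel_measurable M"
  and square_integrable_integrable: "square_integrable M f \<Longrightarrow> integrable M (\<lambda>x. (norm (f x))\<^sup>2)"
  by (auto simp: square_integrable_def)

lemma square_integrable_iff_nn_integral:
  assumes "f \<in> borel_measurable M"
  shows "square_integrable M f \<longleftrightarrow> (\<integral>\<^sup>+x. ennreal ((norm (f x))\<^sup>2) \<partial>M) < \<infinity>"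
  using assms by (auto simp: square_integrable_def integrable_iff_bounded)

lemma square_integrable_nn_integral:
  "square_integrable M f \<Longrightarrow> (\<integral>\<^sup>+x. ennreal ((norm (f x))\<^sup>2) \<partial>M) = ennreal (\<integral>x. (norm (f x))\<^sup>2 \<partial>M)"
  by (intro nn_integral_eq_integral) (auto simp: square_integrable_def)

lemma square_integrable_bound:
  fixes f :: "'a \<Rightarrow> 'b::euclidean_space" and g :: "'a \<Rightarrow> 'c::euclidean_space"
  assumes "square_integrable M g" "f \<in> borel_measurable M" "AE x in M. norm (f x) \<le> C * norm (g x)"
  shows "square_integrable M f" and "(\<integral>x. (norm (f x))\<^sup>2 \<partial>M) \<le> C\<^sup>2 * (\<integral>x. (norm (g x))\<^sup>2 \<partial>M)"
proof -
  have i: "integrable M (\<lambda>x. C\<^sup>2 * (norm (g x))\<^sup>2)"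
    using assms(1) by (auto simp: square_integrable_def)
  have b: "AE x in M. (norm (f x))\<^sup>2 \<le> C\<^sup>2 * (norm (g x))\<^sup>2"
    using assms(3)
  proof eventually_elim
    case (elim x)
    then show ?case using power_mono[OF elim, of 2] by (simp add: power_mult_distrib)
  qed
  have [measurable]: "f \<in> borel_measurable M" by fact
  have j: "integrable M (\<lambda>x. (norm (f x))\<^sup>2)"
    by (rule Bochner_Integration.integrable_bound[OF i]) (use b in auto)
  with assms(2) show "square_integrable M f" by (simp add: square_integrable_def)
  show "(\<integral>x. (norm (f x))\<^sup>2 \<partial>M) \<le> C\<^sup>2 * (\<integral>x. (norm (g x))\<^sup>2 \<partial>M)"
    using integral_mono_AE[OF j i b] by simp
qed

lemma norm_add_square_le: "(norm (x + y))\<^sup>2 \<le> 2 * (norm x)\<^sup>2 + 2 * (norm (y::'a::real_normed_vector))\<^sup>2"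
proof -
  have "(norm (x + y))\<^sup>2 \<le> (norm x + norm y)\<^sup>2" by (intro power_mono norm_triangle_ineq) auto
  also have "\<dots> \<le> 2 * (norm x)\<^sup>2 + 2 * (norm y)\<^sup>2"
    using sum_squares_bound[of "norm x" "norm y"] by (simp add: power2_sum)
  finally show ?thesis .
qed

lemma square_integrable_add:
  assumes "square_integrable M f" "square_integrable M g"
  shows "square_integrable M (\<lambda>x. f x + g x)"
    and "(\<integral>x. (norm (f x + g x))\<^sup>2 \<partial>M) \<le> 2 * (\<integral>x. (norm (f x))\<^sup>2 \<partial>M) + 2 * (\<integral>x. (norm (g x))\<^sup>2 \<partial>M)"
proof -
  have [measurable]: "f \<in> borel_measurable M" "g \<in> borel_measurable M"
    using assms by (auto simp: square_integrable_def)
  have i: "integrable M (\<lambda>x. 2 * (norm (f x))\<^sup>2 + 2 * (norm (g x))\<^sup>2)"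
    using assms by (auto simp: square_integrable_def)
  have j: "integrable M (\<lambda>x. (norm (f x + g x))\<^sup>2)"
    by (rule Bochner_Integration.integrable_bound[OF i]) (auto intro: order_trans[OF norm_add_square_le])
  then show "square_integrable M (\<lambda>x. f x + g x)" by (simp add: square_integrable_def)
  show "(\<integral>x. (norm (f x + g x))\<^sup>2 \<partial>M) \<le> 2 * (\<integral>x. (norm (f x))\<^sup>2 \<partial>M) + 2 * (\<integral>x. (norm (g x))\<^sup>2 \<partial>M)"
    using integral_mono[OF j i norm_add_square_le] assms by (simp add: square_integrable_def)
qed

lemma square_integrable_minus: "square_integrable M f \<Longrightarrow> square_integrable M (\<lambda>x. - f x)"
  by (auto simp: square_integrable_def)

lemma square_integrable_diff:
  "square_integrable M f \<Longrightarrow> square_integrable M g \<Longrightarrow> square_integrable M (\<lambda>x. f x - g x)"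
  using square_integrable_add(1)[OF _ square_integrable_minus] by fastforce

lemma square_integrable_inner:
  assumes "square_integrable M f" "square_integrable M g"
  shows "integrable M (\<lambda>x. f x \<bullet> g x)"
proof -
  have [measurable]: "f \<in> borel_measurable M" "g \<in> borel_measurable M"
    using assms by (auto simp: square_integrable_def)
  have "integrable M (\<lambda>x. norm (f x) * norm (g x))"
    using assms by (intro integrable_mult_of_squares) (auto simp: square_integrable_def)
  then show ?thesis
    by (rule Bochner_Integration.integrable_bound) (auto intro: Cauchy_Schwarz_ineq2)
qed

lemma integral_norm_add_square:
  assumes "square_integrable M f" "square_integrable M g"
  shows "(\<integral>x. (norm (f x + g x))\<^sup>2 \<partial>M)
    = (\<integral>x. (norm (f x))\<^sup>2 \<partial>M) + 2 * (\<integral>x. f x \<bullet> g x \<partial>M) + (\<integral>x. (norm (g x))\<^sup>2 \<partial>M)"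
proof -
  have "(norm (x + y))\<^sup>2 = (norm x)\<^sup>2 + 2 * (x \<bullet> y) + (norm y)\<^sup>2" for x y :: 'b
    by (simp add: power2_norm_eq_inner inner_add_left inner_add_right inner_commute)
  then show ?thesis
    using assms square_integrable_inner[OF assms] by (simp add: square_integrable_def)
qed

text \<open>The second moment of f + t g is a nonnegative quadratic polynomial in t, so its
  discriminant is not positive.\<close>

lemma integral_cauchy_schwarz:
  assumes f: "square_integrable M f" and g: "square_integrable M g"
  shows "(\<integral>x. f x \<bullet> g x \<partial>M)\<^sup>2 \<le> (\<integral>x. (norm (f x))\<^sup>2 \<partial>M) * (\<integral>x. (norm (g x))\<^sup>2 \<partial>M)"
proof -
  let ?a = "\<integral>x. (norm (f x))\<^sup>2 \<partial>M" and ?b = "\<integral>x. f x \<bullet> g x \<partial>M" and ?c = "\<integral>x. (norm (g x))\<^sup>2 \<partial>M"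
  have g': "square_integrable M (\<lambda>x. t *\<^sub>R g x)" for t
    using g by (auto simp: square_integrable_def power_mult_distrib)
  have q: "0 \<le> ?a + 2 * t * ?b + t\<^sup>2 * ?c" for t
    using integral_norm_add_square[OF f g'[of t]] integral_nonneg_AE[of "\<lambda>x. (norm (f x + t *\<^sub>R g x))\<^sup>2" M]
    by (simp add: power_mult_distrib mult.assoc)
  have c: "0 \<le> ?c" "0 \<le> ?a" by (simp_all add: integral_nonneg_AE)
  show ?thesis
  proof (cases "?c = 0")
    case True
    have "?b = 0"
    proof (rule ccontr)
      assume "?b \<noteq> 0"
      \<comment> \<open>If the leading coefficient is 0, the polynomial is affine; with a nonzero
        slope it would take the value -1 at this point.\<close>
      then have "?a + 2 * (- (?a + 1) / (2 * ?b)) * ?b = -1" by (simp add: field_simps)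
      then show False using q[of "- (?a + 1) / (2 * ?b)"] True by simp
    qed
    then show ?thesis using True by simp
  next
    case False
    with c(1) have "0 < ?c" by (metis less_le)
    have "0 \<le> (?a + 2 * (- ?b / ?c) * ?b + (- ?b / ?c)\<^sup>2 * ?c) * ?c"
      using q[of "- ?b / ?c"] c by (intro mult_nonneg_nonneg)
    also have "\<dots> = ?a * ?c - ?b\<^sup>2" using \<open>0 < ?c\<close> by (simp add: field_simps power2_eq_square)
    finally show ?thesis by simp
  qed
qed

text \<open>The convergence is assumed in the extended nonnegative form in which the stochastic
  integrals are defined. A single approximation at finite distance makes the limit square
  integrable, and from then on real integrals and Cauchy-Schwarz are available.\<close>

lemma square_integrable_limit:
  assumes fk: "\<And>k. square_integrable M (f k)" and g[measurable]: "g \<in> borel_measurable M"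
    and lim: "(\<lambda>k. \<integral>\<^sup>+x. ennreal ((norm (f k x - g x))\<^sup>2) \<partial>M) \<longlonglongrightarrow> 0"
  shows "square_integrable M g"
    and "(\<lambda>k. \<integral>x. (norm (f k x - g x))\<^sup>2 \<partial>M) \<longlonglongrightarrow> 0"
    and "(\<lambda>k. \<integral>x. (norm (f k x))\<^sup>2 \<partial>M) \<longlonglongrightarrow> (\<integral>x. (norm (g x))\<^sup>2 \<partial>M)"
    and "square_integrable M \<eta> \<Longrightarrow> (\<lambda>k. \<integral>x. \<eta> x \<bullet> f k x \<partial>M) \<longlonglongrightarrow> (\<integral>x. \<eta> x \<bullet> g x \<partial>M)"
proof -
  have [measurable]: "f k \<in> borel_measurable M" for k using fk[of k] by (simp add: square_integrable_def)
  have "eventually (\<lambda>k. (\<integral>\<^sup>+x. ennreal ((norm (f k x - g x))\<^sup>2) \<partial>M) < 1) sequentially"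
    using lim by (rule order_tendstoD) simp
  then obtain k where "(\<integral>\<^sup>+x. ennreal ((norm (f k x - g x))\<^sup>2) \<partial>M) < 1"
    unfolding eventually_sequentially by blast
  then have "square_integrable M (\<lambda>x. f k x - g x)"
    by (subst square_integrable_iff_nn_integral) (auto intro: less_trans)
  from square_integrable_diff[OF fk[of k] this] show G: "square_integrable M g" by simp
  have d: "square_integrable M (\<lambda>x. f k x - g x)" for k using fk G by (intro square_integrable_diff)
  show D: "(\<lambda>k. \<integral>x. (norm (f k x - g x))\<^sup>2 \<partial>M) \<longlonglongrightarrow> 0"
    using lim unfolding square_integrable_nn_integral[OF d]
    by (subst (asm) ennreal_tendsto_0_iff) (auto simp: integral_nonneg_AE)
  have inner: "(\<lambda>k. \<integral>x. \<eta> x \<bullet> (f k x - g x) \<partial>M) \<longlonglongrightarrow> 0" if \<eta>: "square_integrable M \<eta>" for \<eta>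
  proof -
    have "(\<lambda>k. (\<integral>x. (norm (\<eta> x))\<^sup>2 \<partial>M) * (\<integral>x. (norm (f k x - g x))\<^sup>2 \<partial>M)) \<longlonglongrightarrow> 0"
      using tendsto_mult[OF tendsto_const D] by simp
    then have "(\<lambda>k. sqrt ((\<integral>x. (norm (\<eta> x))\<^sup>2 \<partial>M) * (\<integral>x. (norm (f k x - g x))\<^sup>2 \<partial>M))) \<longlonglongrightarrow> sqrt 0"
      by (rule tendsto_real_sqrt)
    moreover have "norm (\<integral>x. \<eta> x \<bullet> (f k x - g x) \<partial>M)
        \<le> sqrt ((\<integral>x. (norm (\<eta> x))\<^sup>2 \<partial>M) * (\<integral>x. (norm (f k x - g x))\<^sup>2 \<partial>M))" for k
      unfolding real_norm_def
      by (rule real_le_rsqrt) (use integral_cauchy_schwarz[OF \<eta> d[of k]] in simp)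
    ultimately show ?thesis
      using Lim_null_comparison[OF always_eventually] by (metis (no_types, lifting) real_sqrt_zero)
  qed
  have "(\<lambda>k. (\<integral>x. (norm (g x))\<^sup>2 \<partial>M) + 2 * (\<integral>x. g x \<bullet> (f k x - g x) \<partial>M) + (\<integral>x. (norm (f k x - g x))\<^sup>2 \<partial>M))
     \<longlonglongrightarrow> (\<integral>x. (norm (g x))\<^sup>2 \<partial>M) + 2 * 0 + 0"
    by (intro tendsto_intros inner[OF G] D)
  moreover have "(\<integral>x. (norm (g x))\<^sup>2 \<partial>M) + 2 * (\<integral>x. g x \<bullet> (f k x - g x) \<partial>M) + (\<integral>x. (norm (f k x - g x))\<^sup>2 \<partial>M)
      = (\<integral>x. (norm (f k x))\<^sup>2 \<partial>M)" for k
    using integral_norm_add_square[OF G d[of k]] by simp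
  ultimately show "(\<lambda>k. \<integral>x. (norm (f k x))\<^sup>2 \<partial>M) \<longlonglongrightarrow> (\<integral>x. (norm (g x))\<^sup>2 \<partial>M)" by simp
  assume \<eta>: "square_integrable M \<eta>"
  have "(\<integral>x. \<eta> x \<bullet> (f k x - g x) \<partial>M) + (\<integral>x. \<eta> x \<bullet> g x \<partial>M) = (\<integral>x. \<eta> x \<bullet> f k x \<partial>M)" for k
    using square_integrable_inner[OF \<eta> fk[of k]] square_integrable_inner[OF \<eta> G] by (simp add: inner_diff_right)
  then show "(\<lambda>k. \<integral>x. \<eta> x \<bullet> f k x \<partial>M) \<longlonglongrightarrow> (\<integral>x. \<eta> x \<bullet> g x \<partial>M)"
    using tendsto_add[OF inner[OF \<eta>] tendsto_const[of "\<integral>x. \<eta> x \<bullet> g x \<partial>M"]] by simp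
qed

text \<open>By polarisation the inner product is recovered from the second moments of the two
  functions and of their sum, each of which converges.\<close>

lemma square_integrable_limit_inner:
  assumes f: "\<And>k. square_integrable M (f k)" "F \<in> borel_measurable M"
      "(\<lambda>k. \<integral>\<^sup>+x. ennreal ((norm (f k x - F x))\<^sup>2) \<partial>M) \<longlonglongrightarrow> 0"
    and g: "\<And>k. square_integrable M (g k)" "G \<in> borel_measurable M"
      "(\<lambda>k. \<integral>\<^sup>+x. ennreal ((norm (g k x - G x))\<^sup>2) \<partial>M) \<longlonglongrightarrow> 0"
  shows "(\<lambda>k. \<integral>x. f k x \<bullet> g k x \<partial>M) \<longlonglongrightarrow> (\<integral>x. F x \<bullet> G x \<partial>M)"
proof -
  have [measurable]: "f k \<in> borel_measurable M" "g k \<in> borel_measurable M" for k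
    using f(1)[of k] g(1)[of k] by (auto simp: square_integrable_def)
  note [measurable] = f(2) g(2)
  have F: "square_integrable M F" and G: "square_integrable M G"
    using square_integrable_limit(1)[OF f] square_integrable_limit(1)[OF g] by auto
  have sum: "(\<lambda>k. \<integral>\<^sup>+x. ennreal ((norm ((f k x + g k x) - (F x + G x)))\<^sup>2) \<partial>M) \<longlonglongrightarrow> 0"
  proof (rule tendsto_sandwich[OF _ _ tendsto_const])
    have "(\<lambda>k. 2 * (\<integral>\<^sup>+x. ennreal ((norm (f k x - F x))\<^sup>2) \<partial>M) + 2 * (\<integral>\<^sup>+x. ennreal ((norm (g k x - G x))\<^sup>2) \<partial>M))
        \<longlonglongrightarrow> 2 * 0 + 2 * 0"
      using f(3) g(3) by (intro tendsto_add ennreal_tendsto_cmult) auto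
    then show "(\<lambda>k. 2 * (\<integral>\<^sup>+x. ennreal ((norm (f k x - F x))\<^sup>2) \<partial>M) + 2 * (\<integral>\<^sup>+x. ennreal ((norm (g k x - G x))\<^sup>2) \<partial>M))
        \<longlonglongrightarrow> 0" by simp
    show "\<forall>\<^sub>F k in sequentially. (\<integral>\<^sup>+x. ennreal ((norm ((f k x + g k x) - (F x + G x)))\<^sup>2) \<partial>M)
        \<le> 2 * (\<integral>\<^sup>+x. ennreal ((norm (f k x - F x))\<^sup>2) \<partial>M) + 2 * (\<integral>\<^sup>+x. ennreal ((norm (g k x - G x))\<^sup>2) \<partial>M)"
    proof (intro always_eventually allI)
      fix k
      have "ennreal ((norm ((f k x + g k x) - (F x + G x)))\<^sup>2)
          \<le> 2 * ennreal ((norm (f k x - F x))\<^sup>2) + 2 * ennreal ((norm (g k x - G x))\<^sup>2)" for x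
      proof -
        have "(norm ((f k x + g k x) - (F x + G x)))\<^sup>2 \<le> 2 * (norm (f k x - F x))\<^sup>2 + 2 * (norm (g k x - G x))\<^sup>2"
          using norm_add_square_le[of "f k x - F x" "g k x - G x"] by (simp add: algebra_simps)
        then have "ennreal ((norm ((f k x + g k x) - (F x + G x)))\<^sup>2)
            \<le> ennreal (2 * (norm (f k x - F x))\<^sup>2 + 2 * (norm (g k x - G x))\<^sup>2)" by (rule ennreal_leI)
        then show ?thesis by (simp add: ennreal_plus ennreal_mult)
      qed
      then have "(\<integral>\<^sup>+x. ennreal ((norm ((f k x + g k x) - (F x + G x)))\<^sup>2) \<partial>M)
          \<le> (\<integral>\<^sup>+x. 2 * ennreal ((norm (f k x - F x))\<^sup>2) + 2 * ennreal ((norm (g k x - G x))\<^sup>2) \<partial>M)"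
        by (rule nn_integral_mono)
      also have "\<dots> = 2 * (\<integral>\<^sup>+x. ennreal ((norm (f k x - F x))\<^sup>2) \<partial>M) + 2 * (\<integral>\<^sup>+x. ennreal ((norm (g k x - G x))\<^sup>2) \<partial>M)"
        by (simp add: nn_integral_add nn_integral_cmult)
      finally show "(\<integral>\<^sup>+x. ennreal ((norm ((f k x + g k x) - (F x + G x)))\<^sup>2) \<partial>M)
        \<le> 2 * (\<integral>\<^sup>+x. ennreal ((norm (f k x - F x))\<^sup>2) \<partial>M) + 2 * (\<integral>\<^sup>+x. ennreal ((norm (g k x - G x))\<^sup>2) \<partial>M)" .
    qed
  qed simp
  have fg: "square_integrable M (\<lambda>x. f k x + g k x)" for k by (intro square_integrable_add f g)
  have "(\<lambda>k. ((\<integral>x. (norm (f k x + g k x))\<^sup>2 \<partial>M) - (\<integral>x. (norm (f k x))\<^sup>2 \<partial>M) - (\<integral>x. (norm (g k x))\<^sup>2 \<partial>M)) / 2)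
     \<longlonglongrightarrow> ((\<integral>x. (norm (F x + G x))\<^sup>2 \<partial>M) - (\<integral>x. (norm (F x))\<^sup>2 \<partial>M) - (\<integral>x. (norm (G x))\<^sup>2 \<partial>M)) / 2"
    by (intro tendsto_intros square_integrable_limit(3)[OF f] square_integrable_limit(3)[OF g]
        square_integrable_limit(3)[OF fg _ sum]) auto
  then show ?thesis
    by (simp add: integral_norm_add_square[OF F G] integral_norm_add_square[OF f(1) g(1)])
qed

lemma inner_sum_list:
  "(\<Sum>x\<leftarrow>xs. f x) \<bullet> (\<Sum>y\<leftarrow>ys. g y) = (\<Sum>x\<leftarrow>xs. \<Sum>y\<leftarrow>ys. f x \<bullet> g y)"
proof -
  have r: "u \<bullet> (\<Sum>y\<leftarrow>ys. g y) = (\<Sum>y\<leftarrow>ys. u \<bullet> g y)" for u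
    by (induction ys) (auto simp: inner_add_right)
  have l: "(\<Sum>x\<leftarrow>xs. f x) \<bullet> v = (\<Sum>x\<leftarrow>xs. f x \<bullet> v)" for v
    by (induction xs) (auto simp: inner_add_left)
  show ?thesis unfolding l unfolding r ..
qed

lemma has_bochner_integral_sum_list:
  assumes "\<And>x. x \<in> set xs \<Longrightarrow> has_bochner_integral M (f x) (I x)"
  shows "has_bochner_integral M (\<lambda>\<omega>. \<Sum>x\<leftarrow>xs. f x \<omega>) (\<Sum>x\<leftarrow>xs. I x)"
  using assms by (induction xs) (auto intro!: has_bochner_integral_add)

lemma borel_measurable_sum_list:
  fixes f :: "'c \<Rightarrow> 'a \<Rightarrow> 'b::{second_countable_topology, topological_monoid_add}"
  assumes "\<And>x. x \<in> set xs \<Longrightarrow> f x \<in> borel_measurable M"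
  shows "(\<lambda>\<omega>. \<Sum>x\<leftarrow>xs. f x \<omega>) \<in> borel_measurable M"
  using assms by (induction xs) auto

lemma has_bochner_integral_product:
  fixes f :: "'a \<Rightarrow> real" and g :: "'b \<Rightarrow> real"
  assumes M: "sigma_finite_measure M" and N: "sigma_finite_measure N"
    and f: "has_bochner_integral M f x" and g: "has_bochner_integral N g y"
  shows "has_bochner_integral (M \<Otimes>\<^sub>M N) (\<lambda>(a, b). f a * g b) (x * y)"
proof -
  interpret pair_sigma_finite M N using M N by (rule pair_sigma_finite.intro)
  have [measurable]: "f \<in> borel_measurable M" "g \<in> borel_measurable N"
    and fi: "integrable M f" "integrable N g" and xy: "integral\<^sup>L M f = x" "integral\<^sup>L N g = y"
    using f g by (auto simp: has_bochner_integral_iff)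
  have i: "integrable (M \<Otimes>\<^sub>M N) (\<lambda>(a, b). f a * g b)"
    by (rule Fubini_integrable) (use fi in \<open>auto simp: abs_mult\<close>)
  with integral_fst[OF i] fi xy show ?thesis by (simp add: has_bochner_integral_iff)
qed

section \<open>Stochastic integrals\<close>

lemma has_bochner_integral_interval_overlap:
  fixes a a' b b' :: real
  shows "has_bochner_integral lborel (\<lambda>s. indicator {a<..b} s * indicator {a'<..b'} s)
     (max 0 (min b b' - max a a') :: real)"
proof -
  have "has_bochner_integral lborel (indicator {max a a'<..min b b'} :: real \<Rightarrow> real)
      (measure lborel {max a a'<..min b b'})"
  proof (rule has_bochner_integral_real_indicator)
    have "emeasure lborel {max a a'<..min b b'} \<le> emeasure lborel {max a a'..min b b'}"
      by (rule emeasure_mono) auto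
    also have "\<dots> < \<infinity>" by (simp add: emeasure_lborel_Icc_eq)
    finally show "emeasure lborel {max a a'<..min b b'} < \<infinity>" .
  qed simp
  moreover have "measure lborel {max a a'<..min b b'} = max 0 (min b b' - max a a')"
    by (cases "max a a' \<le> min b b'") auto
  moreover have "(\<lambda>s. indicator {a<..b} s * indicator {a'<..b'} s) = (indicator {max a a'<..min b b'} :: real \<Rightarrow> real)"
    by (auto simp: indicator_def fun_eq_iff)
  ultimately show ?thesis by simp
qed

text \<open>A common format for elementary integrands against both noises; the optional mark set
  names the integrator as in \<open>Z\<close>. Isometry and orthogonality are then proved once for
  both.\<close>

type_synonym ('u, 'v, 'x) elementary = "(real \<times> real \<times> 'v set option \<times> ('u \<Rightarrow> 'x)) list"

section \<open>Elementary integrals: isometry, orthogonality and passage to the limit\<close>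

context lq_noise
begin

definition EI :: "('w, 'z, 'x::euclidean_space) elementary \<Rightarrow> 'w \<Rightarrow> 'x" where
  "EI L \<omega> = (\<Sum>(a, b, j, \<xi>)\<leftarrow>L. Z a b j \<omega> *\<^sub>R \<xi> \<omega>)"

definition EI_upto :: "real \<Rightarrow> ('w, 'z, 'x::euclidean_space) elementary \<Rightarrow> 'w \<Rightarrow> 'x" where
  "EI_upto s L \<omega> = (\<Sum>(a, b, j, \<xi>)\<leftarrow>L. Z (min a s) (min b s) j \<omega> *\<^sub>R \<xi> \<omega>)"

definition EI_ok :: "real \<Rightarrow> ('w, 'z, 'x::euclidean_space) elementary \<Rightarrow> bool" where
  "EI_ok t L \<longleftrightarrow> (\<forall>(a, b, j, \<xi>)\<in>set L. t \<le> a \<and> a \<le> b \<and> b \<le> T \<and> mark_ok j \<and>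
     \<xi> \<in> borel_measurable (\<F> a) \<and> bounded (\<xi> ` space M))"

lemma EI_okD:
  assumes "EI_ok t L" "(a, b, j, \<xi>) \<in> set L"
  shows "t \<le> a" "a \<le> b" "b \<le> T" "mark_ok j" "\<xi> \<in> borel_measurable (\<F> a)" "bounded (\<xi> ` space M)"
  using assms by (auto simp: EI_ok_def)

text \<open>The part of an elementary integrand that lives on \<open>(s\<^sub>1, s\<^sub>2]\<close>. The coefficient is replaced by
  \<open>0\<close> on intervals to the right of \<open>s\<^sub>2\<close>: there it need not be measurable at the clamped left end.\<close>

definition clamp_list :: "real \<Rightarrow> real \<Rightarrow> ('w, 'z, 'x::euclidean_space) elementary \<Rightarrow> ('w, 'z, 'x) elementary" where
  "clamp_list s1 s2 L = map (\<lambda>(a, b, j, \<xi>).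
     (max s1 (min a s2), max s1 (min b s2), j, if a \<le> s2 then \<xi> else (\<lambda>_. 0))) L"

lemma EI_ok_clamp:
  assumes "EI_ok t L" "s1 \<le> s2" "s2 \<le> T" shows "EI_ok s1 (clamp_list s1 s2 L)"
proof -
  have "s1 \<le> max s1 (min a s2) \<and> max s1 (min a s2) \<le> max s1 (min b s2) \<and> max s1 (min b s2) \<le> T \<and>
      mark_ok j \<and> (if a \<le> s2 then \<xi> else (\<lambda>_. 0)) \<in> borel_measurable (\<F> (max s1 (min a s2))) \<and>
      bounded ((if a \<le> s2 then \<xi> else (\<lambda>_. 0)) ` space M)"
    if mem: "(a, b, j, \<xi>) \<in> set L" for a b j \<xi>
  proof (intro conjI)
    note D = EI_okD[OF assms(1) mem]
    show "max s1 (min a s2) \<le> max s1 (min b s2)" "max s1 (min b s2) \<le> T"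
      using D(2) assms by (auto simp: max_def min_def)
    show "mark_ok j" by (rule D)
    show "(if a \<le> s2 then \<xi> else (\<lambda>_. 0)) \<in> borel_measurable (\<F> (max s1 (min a s2)))"
    proof (cases "a \<le> s2")
      case True
      then have "a \<le> max s1 (min a s2)" by auto
      from measurable_\<F>_mono[OF D(5) this] True show ?thesis by simp
    qed simp
    show "bounded ((if a \<le> s2 then \<xi> else (\<lambda>_. 0)) ` space M)"
      using D(6) by (auto simp: bounded_iff)
  qed simp
  then show ?thesis unfolding EI_ok_def clamp_list_def by (auto split del: if_split)
qed

text \<open>The three cases are the positions of \<open>s1\<close> relative to the interval. When
  \<open>s1\<close> cuts it, additivity of increments is invoked, which for the jump part holds only
  almost surely.\<close>

lemma Z_clamp:
  assumes "0 \<le> a" "a \<le> b" "b \<le> T" "0 \<le> s1" "s1 \<le> s2" "s2 \<le> T" "mark_ok j"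
  shows "AE \<omega> in M. Z (min a s2) (min b s2) j \<omega> - Z (min a s1) (min b s1) j \<omega>
     = Z (max s1 (min a s2)) (max s1 (min b s2)) j \<omega>"
proof -
  consider "b \<le> s1" | "a \<le> s1" "s1 \<le> b" | "s1 \<le> a" using assms by linarith
  then show ?thesis
  proof cases
    case 1
    then have "min b s1 = min b s2" "min a s1 = min a s2" "max s1 (min a s2) = s1" "max s1 (min b s2) = s1"
      using assms by auto
    then show ?thesis by (simp only:) (simp add: Z_self)
  next
    case 2
    have eq: "min a s2 = a" "min a s1 = a" "min b s1 = s1" "max s1 a = s1" "max s1 (min b s2) = min b s2"
      using 2 assms by auto
    have "AE \<omega> in M. Z a (min b s2) j \<omega> = Z a s1 j \<omega> + Z s1 (min b s2) j \<omega>"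
      using 2 assms by (intro Z_add) auto
    then show ?thesis unfolding eq by eventually_elim simp
  next
    case 3
    then have "min a s1 = s1" "min b s1 = s1" "max s1 (min a s2) = min a s2" "max s1 (min b s2) = min b s2"
      using assms by auto
    then show ?thesis by (simp only:) (simp add: Z_self)
  qed
qed

lemma EI_upto_diff:
  assumes "EI_ok t L" "0 \<le> t" "0 \<le> s1" "s1 \<le> s2" "s2 \<le> T"
  shows "AE \<omega> in M. EI_upto s2 L \<omega> - EI_upto s1 L \<omega> = EI (clamp_list s1 s2 L) \<omega>"
  using assms(1)
proof (induction L)
  case Nil
  then show ?case by (simp add: EI_upto_def EI_def clamp_list_def)
next
  case (Cons x L)
  obtain a b j \<xi> where x: "x = (a, b, j, \<xi>)" by (cases x)
  have ok: "EI_ok t L" using Cons.prems by (auto simp: EI_ok_def)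
  note D = EI_okD[OF Cons.prems, of a b j \<xi>, unfolded x, simplified]
  have "AE \<omega> in M. Z (min a s2) (min b s2) j \<omega> - Z (min a s1) (min b s1) j \<omega>
     = Z (max s1 (min a s2)) (max s1 (min b s2)) j \<omega>"
    using D assms by (intro Z_clamp) auto
  with Cons.IH[OF ok] show ?case
  proof eventually_elim
    case (elim \<omega>)
    have "(Z (min a s2) (min b s2) j \<omega> *\<^sub>R \<xi> \<omega> - Z (min a s1) (min b s1) j \<omega> *\<^sub>R \<xi> \<omega>)
        = Z (max s1 (min a s2)) (max s1 (min b s2)) j \<omega> *\<^sub>R (if a \<le> s2 then \<xi> else (\<lambda>_. 0)) \<omega>"
      using elim(2) D assms by (auto simp: scaleR_diff_left[symmetric] Z_self min_def)
    with elim(1) show ?case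
      by (simp add: EI_upto_def EI_def clamp_list_def x algebra_simps)
  qed
qed

text \<open>No interval starts before \<open>t\<close>, so clamping at \<open>t\<close> cuts nothing
  and the equality holds at every point, in contrast to \<open>EI_upto_diff\<close>.\<close>

lemma EI_upto_eq_clamp:
  assumes "EI_ok t L" "t \<le> s"
  shows "EI_upto s L \<omega> = EI (clamp_list t s L) \<omega>"
proof -
  have "Z (min a s) (min b s) j \<omega> *\<^sub>R \<xi> \<omega> =
      Z (max t (min a s)) (max t (min b s)) j \<omega> *\<^sub>R (if a \<le> s then \<xi> else (\<lambda>_. 0)) \<omega>"
    if "(a, b, j, \<xi>) \<in> set L" for a b j \<xi>
    using EI_okD[OF assms(1) that] assms(2) by (auto simp: max_def min_def Z_self)
  then show ?thesis
    unfolding EI_upto_def EI_def clamp_list_def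
    by (auto simp: comp_def split_beta intro!: arg_cong[of _ _ sum_list] map_cong)
qed

text \<open>The two sides of the Ito isometry are both computed to this expression: the expected
  product of two elementary integrals and the integral of the product of their integrands.\<close>

definition overlap_sum :: "('w, 'z, 'x::euclidean_space) elementary \<Rightarrow> ('w, 'z, 'x) elementary \<Rightarrow> real" where
  "overlap_sum L L' = (\<Sum>x\<leftarrow>L. \<Sum>y\<leftarrow>L'. (case x of (a, b, j, \<xi>) \<Rightarrow> case y of (a', b', k, \<xi>') \<Rightarrow>
     max 0 (min b b' - max a a') * cov j k * (\<integral>\<omega>. \<xi> \<omega> \<bullet> \<xi>' \<omega> \<partial>M)))"

lemma bounded_inner:
  assumes "bounded (\<xi> ` space M)" "bounded (\<xi>' ` space M)"
  obtains K where "\<And>\<omega>. \<omega> \<in> space M \<Longrightarrow> \<bar>\<xi> \<omega> \<bullet> \<xi>' \<omega>\<bar> \<le> K"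
proof -
  obtain a b where a: "\<And>\<omega>. \<omega> \<in> space M \<Longrightarrow> norm (\<xi> \<omega>) \<le> a" and b: "\<And>\<omega>. \<omega> \<in> space M \<Longrightarrow> norm (\<xi>' \<omega>) \<le> b"
    using assms unfolding bounded_iff by auto
  have "\<bar>\<xi> \<omega> \<bullet> \<xi>' \<omega>\<bar> \<le> a * b" if "\<omega> \<in> space M" for \<omega>
    using Cauchy_Schwarz_ineq2[of "\<xi> \<omega>" "\<xi>' \<omega>"] mult_mono[OF a[OF that] b[OF that]] a[OF that] norm_ge_zero[of "\<xi> \<omega>"]
    by (meson norm_ge_zero order_trans)
  then show ?thesis by (rule that)
qed

lemma EI_inner:
  assumes L: "EI_ok 0 L" and L': "EI_ok 0 L'"
  shows "has_bochner_integral M (\<lambda>\<omega>. EI L \<omega> \<bullet> EI L' \<omega>) (overlap_sum L L')"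
  unfolding EI_def overlap_sum_def inner_sum_list
proof (intro has_bochner_integral_sum_list)
  fix x y assume "x \<in> set L" "y \<in> set L'"
  moreover obtain a b j \<xi> where x: "x = (a, b, j, \<xi>)" by (cases x)
  moreover obtain a' b' k \<xi>' where y: "y = (a', b', k, \<xi>')" by (cases y)
  ultimately have D: "(a, b, j, \<xi>) \<in> set L" "(a', b', k, \<xi>') \<in> set L'" by auto
  note D = EI_okD[OF L D(1)] EI_okD[OF L' D(2)]
  obtain K where K: "\<And>\<omega>. \<omega> \<in> space M \<Longrightarrow> \<bar>\<xi> \<omega> \<bullet> \<xi>' \<omega>\<bar> \<le> K"
    using bounded_inner D(6,12) by blast
  have "has_bochner_integral M (\<lambda>\<omega>. Z a b j \<omega> * Z a' b' k \<omega> * (\<xi> \<omega> \<bullet> \<xi>' \<omega>))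
     (max 0 (min b b' - max a a') * cov j k * (\<integral>\<omega>. \<xi> \<omega> \<bullet> \<xi>' \<omega> \<partial>M))"
    using D K by (intro Z_cross borel_measurable_inner measurable_\<F>_mono[of _ a _ "max a a'"]
        measurable_\<F>_mono[of _ a' _ "max a a'"]) auto
  then show "has_bochner_integral M (\<lambda>\<omega>. (case x of (a, b, j, \<xi>) \<Rightarrow> Z a b j \<omega> *\<^sub>R \<xi> \<omega>) \<bullet>
      (case y of (a, b, j, \<xi>) \<Rightarrow> Z a b j \<omega> *\<^sub>R \<xi> \<omega>))
     (case x of (a, b, j, \<xi>) \<Rightarrow> case y of (a', b', k, \<xi>') \<Rightarrow>
        max 0 (min b b' - max a a') * cov j k * (\<integral>\<omega>. \<xi> \<omega> \<bullet> \<xi>' \<omega> \<partial>M))"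
    by (simp add: x y mult_ac)
qed

lemma EI_square_integrable:
  assumes "EI_ok 0 L" shows "square_integrable M (EI L)"
  unfolding square_integrable_def
proof
  show "EI L \<in> borel_measurable M"
    unfolding EI_def[abs_def]
  proof (rule borel_measurable_sum_list)
    fix x assume "x \<in> set L"
    moreover obtain a b j \<xi> where x: "x = (a, b, j, \<xi>)" by (cases x)
    ultimately have D: "(a, b, j, \<xi>) \<in> set L" by simp
    note D = EI_okD[OF assms D]
    have [measurable]: "\<xi> \<in> borel_measurable M" "Z a b j \<in> borel_measurable M"
      using measurable_\<F>_M[OF D(5)] D by (auto intro!: Z_measurable)
    show "(\<lambda>\<omega>. case x of (a, b, j, \<xi>) \<Rightarrow> Z a b j \<omega> *\<^sub>R \<xi> \<omega>) \<in> borel_measurable M"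
      unfolding x by simp
  qed
  show "integrable M (\<lambda>\<omega>. (norm (EI L \<omega>))\<^sup>2)"
    using EI_inner[OF assms assms] by (simp add: power2_norm_eq_inner has_bochner_integral_iff)
qed

text \<open>Every interval of \<open>L\<close> starts at or after \<open>s\<close>, so the product
  of \<open>\<eta>\<close> with each coefficient is still known when the increment begins.\<close>

lemma EI_orthogonal_past:
  assumes s: "0 \<le> s" "s \<le> T" and L: "EI_ok s L"
    and \<eta>: "square_integrable M \<eta>" "\<eta> \<in> borel_measurable (\<F> s)"
  shows "has_bochner_integral M (\<lambda>\<omega>. \<eta> \<omega> \<bullet> EI L \<omega>) 0"
proof -
  have "has_bochner_integral M (\<lambda>\<omega>. \<Sum>x\<leftarrow>L. \<eta> \<omega> \<bullet> (case x of (a, b, j, \<xi>) \<Rightarrow> Z a b j \<omega> *\<^sub>R \<xi> \<omega>)) (\<Sum>x\<leftarrow>L. 0)"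
  proof (rule has_bochner_integral_sum_list)
    fix x assume "x \<in> set L"
    moreover obtain a b j \<xi> where x: "x = (a, b, j, \<xi>)" by (cases x)
    ultimately have D: "(a, b, j, \<xi>) \<in> set L" by simp
    note D = EI_okD[OF L D]
    have [measurable]: "\<xi> \<in> borel_measurable M" "\<eta> \<in> borel_measurable M"
      using measurable_\<F>_M[OF D(5)] D measurable_\<F>_M[OF \<eta>(2) s(2)] by auto
    have "square_integrable M \<xi>"
    proof -
      obtain K where "\<And>\<omega>. \<omega> \<in> space M \<Longrightarrow> \<bar>\<xi> \<omega> \<bullet> \<xi> \<omega>\<bar> \<le> K" using bounded_inner D(6) by blast
      then show ?thesis unfolding square_integrable_def power2_norm_eq_inner
        by (auto intro!: integrable_const_bound[of _ K])
    qed
    then have i: "integrable M (\<lambda>\<omega>. \<eta> \<omega> \<bullet> \<xi> \<omega>)" by (rule square_integrable_inner[OF \<eta>(1)])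
    have "(\<lambda>\<omega>. \<eta> \<omega> \<bullet> \<xi> \<omega>) \<in> borel_measurable (\<F> a)"
      by (intro borel_measurable_inner D(5) measurable_\<F>_mono[OF \<eta>(2) D(1)])
    then have "has_bochner_integral M (\<lambda>\<omega>. (\<eta> \<omega> \<bullet> \<xi> \<omega>) * Z a b j \<omega>) 0"
      using i D s by (intro Z_past_mean) auto
    then show "has_bochner_integral M (\<lambda>\<omega>. \<eta> \<omega> \<bullet> (case x of (a, b, j, \<xi>) \<Rightarrow> Z a b j \<omega> *\<^sub>R \<xi> \<omega>)) 0"
      by (simp add: x mult.commute)
  qed
  moreover have "\<eta> \<omega> \<bullet> EI L \<omega> = (\<Sum>x\<leftarrow>L. \<eta> \<omega> \<bullet> (case x of (a, b, j, \<xi>) \<Rightarrow> Z a b j \<omega> *\<^sub>R \<xi> \<omega>))" for \<omega>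
    unfolding EI_def by (induction L) (auto simp: inner_add_right)
  moreover have "(\<Sum>x\<leftarrow>L. 0::real) = 0" by (induction L) auto
  ultimately show ?thesis by simp
qed

text \<open>\<open>m\<close> realises the marks as subsets of a measure space in which
  \<open>cov\<close> becomes the measure of intersections: a single point for the Brownian motion,
  the mark space itself for the jumps.\<close>

definition process :: "('z set option \<Rightarrow> 'q set) \<Rightarrow> ('w, 'z, 'x::euclidean_space) elementary \<Rightarrow> real \<Rightarrow> 'w \<Rightarrow> 'q \<Rightarrow> 'x" where
  "process m L s \<omega> z = (\<Sum>(a, b, j, \<xi>)\<leftarrow>L. (indicator {a<..b} s * indicator (m j) z) *\<^sub>R \<xi> \<omega>)"

lemma process_clamp:
  fixes L :: "('w, 'z, 'x::euclidean_space) elementary"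
  assumes "s1 \<le> s2"
  shows "process m (clamp_list s1 s2 L) s \<omega> z = indicator {s1<..s2} s *\<^sub>R process m L s \<omega> z"
proof -
  have "(indicator {max s1 (min a s2)<..max s1 (min b s2)} s * indicator (m j) z) *\<^sub>R (if a \<le> s2 then \<xi> else (\<lambda>_. 0)) \<omega>
      = indicator {s1<..s2} s *\<^sub>R ((indicator {a<..b} s * indicator (m j) z) *\<^sub>R \<xi> \<omega>)"
    for a b j and \<xi> :: "'w \<Rightarrow> 'x"
    using assms by (auto simp: indicator_def max_def min_def)
  then show ?thesis
    unfolding process_def clamp_list_def by (induction L) (auto simp: scaleR_add_right)
qed

text \<open>Once the marks are sets, the product of two elementary terms is a product of functions
  of omega, time and mark, and Fubini yields the summands of \<open>overlap_sum\<close>. Together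
  with \<open>EI_inner\<close> this is the isometry on elementary integrands.\<close>

lemma process_isometry:
  fixes Q :: "'q measure"
  assumes L: "EI_ok 0 L" and Q: "finite_measure Q"
    and m: "\<forall>(a, b, j, \<xi>)\<in>set L. j \<in> J" "\<And>j. j \<in> J \<Longrightarrow> m j \<in> sets Q"
      "\<And>j k. j \<in> J \<Longrightarrow> k \<in> J \<Longrightarrow> cov j k = measure Q (m j \<inter> m k)"
  shows "square_integrable ((M \<Otimes>\<^sub>M lborel) \<Otimes>\<^sub>M Q) (\<lambda>((\<omega>, s), z). process m L s \<omega> z)"
    and "(\<integral>x. (norm (case x of ((\<omega>, s), z) \<Rightarrow> process m L s \<omega> z))\<^sup>2 \<partial>((M \<Otimes>\<^sub>M lborel) \<Otimes>\<^sub>M Q)) = overlap_sum L L"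
proof -
  let ?P = "(M \<Otimes>\<^sub>M lborel) \<Otimes>\<^sub>M Q"
  interpret Q: finite_measure Q by fact
  interpret MT: pair_sigma_finite M lborel ..
  have sf: "sigma_finite_measure (M \<Otimes>\<^sub>M (lborel :: real measure))"
    by (rule sigma_finite_pair_measure) unfold_locales
  have "has_bochner_integral ?P (\<lambda>x. \<Sum>p\<leftarrow>L. \<Sum>q\<leftarrow>L.
      (case x of ((\<omega>, s), z) \<Rightarrow> (case p of (a, b, j, \<xi>) \<Rightarrow> (indicator {a<..b} s * indicator (m j) z) *\<^sub>R \<xi> \<omega>) \<bullet>
       (case q of (a, b, j, \<xi>) \<Rightarrow> (indicator {a<..b} s * indicator (m j) z) *\<^sub>R \<xi> \<omega>))) (overlap_sum L L)"
    unfolding overlap_sum_def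
  proof (intro has_bochner_integral_sum_list)
    fix p q assume pq: "p \<in> set L" "q \<in> set L"
    obtain a b j \<xi> where p: "p = (a, b, j, \<xi>)" by (cases p)
    obtain a' b' k \<xi>' where q: "q = (a', b', k, \<xi>')" by (cases q)
    note D = EI_okD[OF L pq(1)[unfolded p]] EI_okD[OF L pq(2)[unfolded q]]
    have jk: "j \<in> J" "k \<in> J" using bspec[OF m(1) pq(1)] bspec[OF m(1) pq(2)] by (auto simp: p q)
    obtain K where K: "\<And>\<omega>. \<omega> \<in> space M \<Longrightarrow> \<bar>\<xi> \<omega> \<bullet> \<xi>' \<omega>\<bar> \<le> K"
      using bounded_inner D(6,12) by blast
    have [measurable]: "\<xi> \<in> borel_measurable M" "\<xi>' \<in> borel_measurable M"
      using measurable_\<F>_M[OF D(5)] measurable_\<F>_M[OF D(11)] D by auto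
    have "has_bochner_integral M (\<lambda>\<omega>. \<xi> \<omega> \<bullet> \<xi>' \<omega>) (\<integral>\<omega>. \<xi> \<omega> \<bullet> \<xi>' \<omega> \<partial>M)"
      using K by (intro has_bochner_integral_integrable integrable_const_bound[of _ K]) auto
    from has_bochner_integral_product[OF _ _ this has_bochner_integral_interval_overlap]
    have 1: "has_bochner_integral (M \<Otimes>\<^sub>M lborel) (\<lambda>(\<omega>, s). (\<xi> \<omega> \<bullet> \<xi>' \<omega>) * (indicator {a<..b} s * indicator {a'<..b'} s))
        ((\<integral>\<omega>. \<xi> \<omega> \<bullet> \<xi>' \<omega> \<partial>M) * max 0 (min b b' - max a a'))"
      by (simp add: sigma_finite_measure_axioms lborel.sigma_finite_measure_axioms)
    have "has_bochner_integral Q (indicator (m j \<inter> m k) :: 'q \<Rightarrow> real) (measure Q (m j \<inter> m k))"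
      using m(2) jk by (intro has_bochner_integral_real_indicator) (auto simp: Q.emeasure_eq_measure)
    from has_bochner_integral_product[OF sf Q.sigma_finite_measure_axioms 1 this]
    have "has_bochner_integral ?P (\<lambda>((\<omega>, s), z). (\<xi> \<omega> \<bullet> \<xi>' \<omega>) * (indicator {a<..b} s * indicator {a'<..b'} s) * indicator (m j \<inter> m k) z)
        ((\<integral>\<omega>. \<xi> \<omega> \<bullet> \<xi>' \<omega> \<partial>M) * max 0 (min b b' - max a a') * cov j k)"
      using m(3)[OF jk] by (simp add: case_prod_unfold)
    moreover have "(\<lambda>((\<omega>, s), z). (\<xi> \<omega> \<bullet> \<xi>' \<omega>) * (indicator {a<..b} s * indicator {a'<..b'} s) * indicator (m j \<inter> m k) z)
       = (\<lambda>x. case x of ((\<omega>, s), z) \<Rightarrow> (case p of (a, b, j, \<xi>) \<Rightarrow> (indicator {a<..b} s * indicator (m j) z) *\<^sub>R \<xi> \<omega>) \<bullet>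
       (case q of (a, b, j, \<xi>) \<Rightarrow> (indicator {a<..b} s * indicator (m j) z) *\<^sub>R \<xi> \<omega>))"
      by (auto simp: p q fun_eq_iff indicator_def)
    ultimately show "has_bochner_integral ?P (\<lambda>x. case x of ((\<omega>, s), z) \<Rightarrow>
        (case p of (a, b, j, \<xi>) \<Rightarrow> (indicator {a<..b} s * indicator (m j) z) *\<^sub>R \<xi> \<omega>) \<bullet>
       (case q of (a, b, j, \<xi>) \<Rightarrow> (indicator {a<..b} s * indicator (m j) z) *\<^sub>R \<xi> \<omega>))
       (case p of (a, b, j, \<xi>) \<Rightarrow> case q of (a', b', k, \<xi>') \<Rightarrow>
        max 0 (min b b' - max a a') * cov j k * (\<integral>\<omega>. \<xi> \<omega> \<bullet> \<xi>' \<omega> \<partial>M))"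
      by (simp add: p q mult_ac)
  qed
  moreover have "(\<lambda>x. \<Sum>p\<leftarrow>L. \<Sum>q\<leftarrow>L.
      (case x of ((\<omega>, s), z) \<Rightarrow> (case p of (a, b, j, \<xi>) \<Rightarrow> (indicator {a<..b} s * indicator (m j) z) *\<^sub>R \<xi> \<omega>) \<bullet>
       (case q of (a, b, j, \<xi>) \<Rightarrow> (indicator {a<..b} s * indicator (m j) z) *\<^sub>R \<xi> \<omega>)))
     = (\<lambda>x. (norm (case x of ((\<omega>, s), z) \<Rightarrow> process m L s \<omega> z))\<^sup>2)"
    by (auto simp: fun_eq_iff power2_norm_eq_inner process_def inner_sum_list)
  ultimately have "has_bochner_integral ?P (\<lambda>x. (norm (case x of ((\<omega>, s), z) \<Rightarrow> process m L s \<omega> z))\<^sup>2) (overlap_sum L L)"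
    by simp
  moreover have "(\<lambda>((\<omega>, s), z). process m L s \<omega> z) \<in> borel_measurable ?P"
    unfolding process_def case_prod_beta
  proof (rule borel_measurable_sum_list)
    fix p assume "p \<in> set L"
    moreover obtain a b j \<xi> where p: "p = (a, b, j, \<xi>)" by (cases p)
    ultimately have mem: "(a, b, j, \<xi>) \<in> set L" by simp
    note D = EI_okD[OF L mem]
    have [measurable]: "\<xi> \<in> borel_measurable M" "m j \<in> sets Q"
      using measurable_\<F>_M[OF D(5)] D m(2) bspec[OF m(1) mem] by auto
    show "(\<lambda>x. (indicator {fst p<..fst (snd p)} (snd (fst x)) * indicator (m (fst (snd (snd p)))) (snd x))
        *\<^sub>R snd (snd (snd p)) (fst (fst x))) \<in> borel_measurable ?P"
      unfolding p by simp
  qed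
  ultimately show "square_integrable ?P (\<lambda>((\<omega>, s), z). process m L s \<omega> z)"
    and "(\<integral>x. (norm (case x of ((\<omega>, s), z) \<Rightarrow> process m L s \<omega> z))\<^sup>2 \<partial>?P) = overlap_sum L L"
    by (auto simp: square_integrable_def has_bochner_integral_iff case_prod_unfold)
qed

text \<open>Isometry and orthogonality survive the limit in the square mean. Clamping localises the
  approximation to \<open>(s1, s2]\<close>, which yields both statements for increments and not only
  for integrals that start at \<open>t\<close>.\<close>

lemma integral_limit:
  fixes Q :: "'q measure" and I :: "real \<Rightarrow> 'w \<Rightarrow> 'x::euclidean_space" and L :: "nat \<Rightarrow> ('w, 'z, 'x) elementary"
  assumes t: "0 \<le> t" and Q: "finite_measure Q"
    and L: "\<And>k. EI_ok t (L k)" "\<And>k. \<forall>(a, b, j, \<xi>)\<in>set (L k). j \<in> J"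
    and m: "\<forall>j\<in>J. m j \<in> sets Q" "\<forall>i\<in>J. \<forall>j\<in>J. cov i j = measure Q (m i \<inter> m j)"
    and H: "(\<lambda>((\<omega>, s), z). indicator {t<..T} s *\<^sub>R H s \<omega> z) \<in> borel_measurable ((M \<Otimes>\<^sub>M lborel) \<Otimes>\<^sub>M Q)"
    and lim: "(\<lambda>k. \<integral>\<^sup>+x. ennreal ((norm (case x of ((\<omega>, s), z) \<Rightarrow>
       indicator {t<..T} s *\<^sub>R (process m (L k) s \<omega> z - H s \<omega> z)))\<^sup>2) \<partial>((M \<Otimes>\<^sub>M lborel) \<Otimes>\<^sub>M Q)) \<longlonglongrightarrow> 0"
    and I: "\<forall>s\<in>{t..T}. I s \<in> borel_measurable (\<F> s)"
    and I_lim: "\<forall>s\<in>{t..T}. (\<lambda>k. \<integral>\<^sup>+\<omega>. ennreal ((norm (EI_upto s (L k) \<omega> - I s \<omega>))\<^sup>2) \<partial>M) \<longlonglongrightarrow> 0"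
  shows "\<And>s. s \<in> {t..T} \<Longrightarrow> square_integrable M (I s)"
    and "\<And>s1 s2. t \<le> s1 \<Longrightarrow> s1 \<le> s2 \<Longrightarrow> s2 \<le> T \<Longrightarrow>
       (\<lambda>k. \<integral>\<^sup>+\<omega>. ennreal ((norm (EI (clamp_list s1 s2 (L k)) \<omega> - (I s2 \<omega> - I s1 \<omega>)))\<^sup>2) \<partial>M) \<longlonglongrightarrow> 0"
    and "\<And>s1 s2. t \<le> s1 \<Longrightarrow> s1 \<le> s2 \<Longrightarrow> s2 \<le> T \<Longrightarrow>
       (\<integral>\<^sup>+x. ennreal ((norm (case x of ((\<omega>, s), z) \<Rightarrow> indicator {s1<..s2} s *\<^sub>R H s \<omega> z))\<^sup>2) \<partial>((M \<Otimes>\<^sub>M lborel) \<Otimes>\<^sub>M Q))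
         = ennreal (\<integral>\<omega>. (norm (I s2 \<omega> - I s1 \<omega>))\<^sup>2 \<partial>M)"
    and "\<And>s1 s2 \<eta>. t \<le> s1 \<Longrightarrow> s1 \<le> s2 \<Longrightarrow> s2 \<le> T \<Longrightarrow> square_integrable M \<eta> \<Longrightarrow> \<eta> \<in> borel_measurable (\<F> s1) \<Longrightarrow>
       (\<integral>\<omega>. \<eta> \<omega> \<bullet> (I s2 \<omega> - I s1 \<omega>) \<partial>M) = 0"
proof -
  let ?P = "(M \<Otimes>\<^sub>M lborel) \<Otimes>\<^sub>M Q"
  have IM: "I s \<in> borel_measurable M" if "s \<in> {t..T}" for s
    using measurable_\<F>_M[OF bspec[OF I that]] that by auto
  have ok0: "EI_ok t K \<Longrightarrow> t \<ge> s \<Longrightarrow> EI_ok s K" for s t and K :: "('w, 'z, 'x) elementary"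
    by (fastforce simp: EI_ok_def)
  have okc: "EI_ok s1 (clamp_list s1 s2 (L k))" if "s1 \<le> s2" "s2 \<le> T" for s1 s2 k
    by (rule EI_ok_clamp[OF L(1) that])
  have ok0c: "EI_ok 0 (clamp_list s1 s2 (L k))" if "0 \<le> s1" "s1 \<le> s2" "s2 \<le> T" for s1 s2 k
    using ok0[OF okc] that by blast
  show sq: "square_integrable M (I s)" if s: "s \<in> {t..T}" for s
  proof (rule square_integrable_limit(1))
    show "square_integrable M (EI_upto s (L k))" for k
    proof -
      have "EI_upto s (L k) = EI (clamp_list t s (L k))" using EI_upto_eq_clamp[OF L(1)] s by (auto simp: fun_eq_iff)
      then show ?thesis using EI_square_integrable[OF ok0c[of t s k]] s t by simp
    qed
  qed (use bspec[OF I_lim s] IM[OF s] in auto)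
  {
    fix s1 s2 assume s: "t \<le> s1" "s1 \<le> s2" "s2 \<le> T"
    then have s': "s1 \<in> {t..T}" "s2 \<in> {t..T}" "0 \<le> s1" using t by auto
    note [measurable] = IM[OF s'(1)] IM[OF s'(2)]
    let ?f = "\<lambda>k. EI (clamp_list s1 s2 (L k))" and ?D = "\<lambda>\<omega>. I s2 \<omega> - I s1 \<omega>"
    have f: "square_integrable M (?f k)" for k using s s' by (intro EI_square_integrable ok0c)
    have upto: "EI_upto s (L k) \<in> borel_measurable M" if "s \<in> {t..T}" for s k
    proof -
      have "EI_upto s (L k) = EI (clamp_list t s (L k))" using EI_upto_eq_clamp[OF L(1)] that by (auto simp: fun_eq_iff)
      then show ?thesis using EI_square_integrable[OF ok0c[of t s k]] that t by (simp add: square_integrable_def)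
    qed
    note [measurable] = upto[OF s'(1)] upto[OF s'(2)]
    show lim_f: "(\<lambda>k. \<integral>\<^sup>+\<omega>. ennreal ((norm (?f k \<omega> - ?D \<omega>))\<^sup>2) \<partial>M) \<longlonglongrightarrow> 0"
    proof (rule tendsto_sandwich[OF _ _ tendsto_const])
      have "(\<lambda>k. 2 * (\<integral>\<^sup>+\<omega>. ennreal ((norm (EI_upto s2 (L k) \<omega> - I s2 \<omega>))\<^sup>2) \<partial>M)
          + 2 * (\<integral>\<^sup>+\<omega>. ennreal ((norm (EI_upto s1 (L k) \<omega> - I s1 \<omega>))\<^sup>2) \<partial>M)) \<longlonglongrightarrow> 2 * 0 + 2 * 0"
        using I_lim s' by (intro tendsto_add ennreal_tendsto_cmult) auto
      then show "(\<lambda>k. 2 * (\<integral>\<^sup>+\<omega>. ennreal ((norm (EI_upto s2 (L k) \<omega> - I s2 \<omega>))\<^sup>2) \<partial>M)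
          + 2 * (\<integral>\<^sup>+\<omega>. ennreal ((norm (EI_upto s1 (L k) \<omega> - I s1 \<omega>))\<^sup>2) \<partial>M)) \<longlonglongrightarrow> 0" by simp
      show "\<forall>\<^sub>F k in sequentially. (\<integral>\<^sup>+\<omega>. ennreal ((norm (?f k \<omega> - ?D \<omega>))\<^sup>2) \<partial>M)
        \<le> 2 * (\<integral>\<^sup>+\<omega>. ennreal ((norm (EI_upto s2 (L k) \<omega> - I s2 \<omega>))\<^sup>2) \<partial>M)
          + 2 * (\<integral>\<^sup>+\<omega>. ennreal ((norm (EI_upto s1 (L k) \<omega> - I s1 \<omega>))\<^sup>2) \<partial>M)"
      proof (intro always_eventually allI)
        fix k
        have "(\<integral>\<^sup>+\<omega>. ennreal ((norm (?f k \<omega> - ?D \<omega>))\<^sup>2) \<partial>M)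
           \<le> (\<integral>\<^sup>+\<omega>. 2 * ennreal ((norm (EI_upto s2 (L k) \<omega> - I s2 \<omega>))\<^sup>2) + 2 * ennreal ((norm (EI_upto s1 (L k) \<omega> - I s1 \<omega>))\<^sup>2) \<partial>M)"
        proof (rule nn_integral_mono_AE)
          have "AE \<omega> in M. EI_upto s2 (L k) \<omega> - EI_upto s1 (L k) \<omega> = ?f k \<omega>"
            using s s' t by (intro EI_upto_diff[OF L(1)])
          then show "AE \<omega> in M. ennreal ((norm (?f k \<omega> - ?D \<omega>))\<^sup>2)
              \<le> 2 * ennreal ((norm (EI_upto s2 (L k) \<omega> - I s2 \<omega>))\<^sup>2) + 2 * ennreal ((norm (EI_upto s1 (L k) \<omega> - I s1 \<omega>))\<^sup>2)"
          proof eventually_elim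
            case (elim \<omega>)
            have "(norm (?f k \<omega> - ?D \<omega>))\<^sup>2
                \<le> 2 * (norm (EI_upto s2 (L k) \<omega> - I s2 \<omega>))\<^sup>2 + 2 * (norm (EI_upto s1 (L k) \<omega> - I s1 \<omega>))\<^sup>2"
              using norm_add_square_le[of "EI_upto s2 (L k) \<omega> - I s2 \<omega>" "- (EI_upto s1 (L k) \<omega> - I s1 \<omega>)"]
              by (simp add: elim[symmetric] algebra_simps norm_minus_commute)
            then have "ennreal ((norm (?f k \<omega> - ?D \<omega>))\<^sup>2)
                \<le> ennreal (2 * (norm (EI_upto s2 (L k) \<omega> - I s2 \<omega>))\<^sup>2 + 2 * (norm (EI_upto s1 (L k) \<omega> - I s1 \<omega>))\<^sup>2)"
              by (rule ennreal_leI)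
            then show ?case by (simp add: ennreal_plus ennreal_mult)
          qed
        qed
        also have "\<dots> = 2 * (\<integral>\<^sup>+\<omega>. ennreal ((norm (EI_upto s2 (L k) \<omega> - I s2 \<omega>))\<^sup>2) \<partial>M)
          + 2 * (\<integral>\<^sup>+\<omega>. ennreal ((norm (EI_upto s1 (L k) \<omega> - I s1 \<omega>))\<^sup>2) \<partial>M)"
          by (simp add: nn_integral_add nn_integral_cmult)
        finally show "(\<integral>\<^sup>+\<omega>. ennreal ((norm (?f k \<omega> - ?D \<omega>))\<^sup>2) \<partial>M)
          \<le> 2 * (\<integral>\<^sup>+\<omega>. ennreal ((norm (EI_upto s2 (L k) \<omega> - I s2 \<omega>))\<^sup>2) \<partial>M)
          + 2 * (\<integral>\<^sup>+\<omega>. ennreal ((norm (EI_upto s1 (L k) \<omega> - I s1 \<omega>))\<^sup>2) \<partial>M)" .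
      qed
    qed simp
    have D: "?D \<in> borel_measurable M" by measurable
    have marks: "\<forall>(a, b, j, \<xi>)\<in>set (clamp_list s1 s2 (L k)). j \<in> J" for k
      using L(2)[of k] by (fastforce simp: clamp_list_def)
    let ?p = "\<lambda>k ((\<omega>, s), z). process m (clamp_list s1 s2 (L k)) s \<omega> z"
    let ?H = "\<lambda>((\<omega>, s), z). indicator {s1<..s2} s *\<^sub>R H s \<omega> z"
    have p: "square_integrable ?P (?p k)"
      and p_iso: "(\<integral>x. (norm (?p k x))\<^sup>2 \<partial>?P) = overlap_sum (clamp_list s1 s2 (L k)) (clamp_list s1 s2 (L k))" for k
      using process_isometry[where J = J and m = m, OF ok0c[OF s'(3) s(2,3)] Q marks bspec[OF m(1)] bspec[OF bspec[OF m(2)]], of k]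
      by (auto simp: case_prod_unfold)
    have H_eq: "?H = (\<lambda>x. indicator {s1<..s2} (snd (fst x)) *\<^sub>R (case x of ((\<omega>, s), z) \<Rightarrow> indicator {t<..T} s *\<^sub>R H s \<omega> z))"
      using s by (auto simp: fun_eq_iff indicator_def)
    have Hm: "?H \<in> borel_measurable ?P"
    proof -
      have "(\<lambda>x. indicator {s1<..s2} (snd (fst x)) :: real) \<in> borel_measurable ?P" by measurable
      from borel_measurable_scaleR[OF this H] show ?thesis unfolding H_eq by (simp add: case_prod_unfold)
    qed
    \<comment> \<open>On \<open>(s1, s2]\<close> the error of the clamped integrands is the original
      error, and elsewhere it is 0; so it is dominated by the error that tends to 0 by
      assumption.\<close>
    have lim_p: "(\<lambda>k. \<integral>\<^sup>+x. ennreal ((norm (?p k x - ?H x))\<^sup>2) \<partial>?P) \<longlonglongrightarrow> 0"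
    proof (rule tendsto_sandwich[OF _ _ tendsto_const lim])
      show "\<forall>\<^sub>F k in sequentially. (\<integral>\<^sup>+x. ennreal ((norm (?p k x - ?H x))\<^sup>2) \<partial>?P)
        \<le> (\<integral>\<^sup>+x. ennreal ((norm (case x of ((\<omega>, s), z) \<Rightarrow>
             indicator {t<..T} s *\<^sub>R (process m (L k) s \<omega> z - H s \<omega> z)))\<^sup>2) \<partial>?P)"
        using s by (intro always_eventually allI nn_integral_mono ennreal_leI power_mono)
          (auto simp: process_clamp scaleR_diff_right[symmetric] indicator_def split: if_splits)
    qed simp
    have "(\<lambda>k. \<integral>x. (norm (?p k x))\<^sup>2 \<partial>?P) \<longlonglongrightarrow> (\<integral>x. (norm (?H x))\<^sup>2 \<partial>?P)"
      by (rule square_integrable_limit(3)[OF p Hm lim_p])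
    moreover have "(\<integral>x. (norm (?p k x))\<^sup>2 \<partial>?P) = (\<integral>\<omega>. (norm (?f k \<omega>))\<^sup>2 \<partial>M)" for k
      using EI_inner[OF ok0c[OF s'(3) s(2,3)] ok0c[OF s'(3) s(2,3)], of k k]
      unfolding p_iso by (simp add: power2_norm_eq_inner has_bochner_integral_iff)
    ultimately have "(\<lambda>k. \<integral>\<omega>. (norm (?f k \<omega>))\<^sup>2 \<partial>M) \<longlonglongrightarrow> (\<integral>x. (norm (?H x))\<^sup>2 \<partial>?P)" by simp
    then have "(\<integral>x. (norm (?H x))\<^sup>2 \<partial>?P) = (\<integral>\<omega>. (norm (?D \<omega>))\<^sup>2 \<partial>M)"
      using square_integrable_limit(3)[OF f D lim_f] by (rule LIMSEQ_unique)
    then show "(\<integral>\<^sup>+x. ennreal ((norm (case x of ((\<omega>, s), z) \<Rightarrow> indicator {s1<..s2} s *\<^sub>R H s \<omega> z))\<^sup>2) \<partial>?P)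
         = ennreal (\<integral>\<omega>. (norm (?D \<omega>))\<^sup>2 \<partial>M)"
      using square_integrable_nn_integral[OF square_integrable_limit(1)[OF p Hm lim_p]] by (simp add: case_prod_unfold)
    fix \<eta> :: "'w \<Rightarrow> 'x" assume \<eta>: "square_integrable M \<eta>" "\<eta> \<in> borel_measurable (\<F> s1)"
    have "(\<lambda>k. \<integral>\<omega>. \<eta> \<omega> \<bullet> ?f k \<omega> \<partial>M) \<longlonglongrightarrow> (\<integral>\<omega>. \<eta> \<omega> \<bullet> ?D \<omega> \<partial>M)"
      by (rule square_integrable_limit(4)[OF f D lim_f \<eta>(1)])
    moreover have "(\<integral>\<omega>. \<eta> \<omega> \<bullet> ?f k \<omega> \<partial>M) = 0" for k
      using EI_orthogonal_past[OF _ _ okc[OF s(2,3)] \<eta>, of k] s s' by (auto simp: has_bochner_integral_iff)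
    ultimately show "(\<integral>\<omega>. \<eta> \<omega> \<bullet> ?D \<omega> \<partial>M) = 0" by (simp add: LIMSEQ_const_iff)
  }
qed

section \<open>Joint measurability of predictable processes; the two stochastic integrals\<close>

lemma predictable_generators:
  "{{0} \<times> A | A. A \<in> sets (\<F> 0)} \<union> {{a<..b} \<times> A | a b A. 0 \<le> a \<and> a < b \<and> b \<le> T \<and> A \<in> sets (\<F> a)}
     \<subseteq> Pow ({0..T} \<times> space M)"
  using T sets.sets_into_space[of _ "\<F> _"] by auto

text \<open>The generators are rectangles with measurable sides. Joint measurability of everything
  predictable is what makes Fubini available for the integrands and the cost.\<close>

lemma predictable_sets:
  assumes "x \<in> sets (predictable_sigma M T \<F>)"
  shows "x \<in> sets (lborel \<Otimes>\<^sub>M M)" and "x \<subseteq> {0..T} \<times> space M"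
proof -
  let ?G = "{{0} \<times> A | A. A \<in> sets (\<F> 0)} \<union> {{a<..b} \<times> A | a b A. 0 \<le> a \<and> a < b \<and> b \<le> T \<and> A \<in> sets (\<F> a)}"
  have A: "A \<in> sets (\<F> a) \<Longrightarrow> a \<le> T \<Longrightarrow> A \<in> sets M" for A a using \<F>_subset by blast
  note G = predictable_generators
  have eq: "sets (predictable_sigma M T \<F>) = sigma_sets ({0..T} \<times> space M) ?G"
    unfolding predictable_sigma_def using G by (rule sets_measure_of)
  have "x \<in> sigma_sets ({0..T} \<times> space M) ?G" using assms eq by simp
  then show "x \<in> sets (lborel \<Otimes>\<^sub>M M)"
  proof induction
    case (Basic a)
    then show ?case using T A[of _ 0] A by (auto intro!: pair_measureI)
  next
    case (Compl a)
    have "{0..T} \<times> space M \<in> sets (lborel \<Otimes>\<^sub>M M)" by (intro pair_measureI) auto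
    then show ?case using Compl by (intro sets.Diff)
  qed auto
  show "x \<subseteq> {0..T} \<times> space M"
    using assms unfolding eq by (rule sigma_sets_into_sp[OF G])
qed

lemma space_predictable: "space (predictable_sigma M T \<F>) = {0..T} \<times> space M"
  unfolding predictable_sigma_def
  by (rule space_measure_of[OF predictable_generators])

text \<open>Composition with this map turns measurability on the restricted predictable space into joint
  measurability.\<close>

lemma predictable_redirect:
  assumes S: "S \<in> sets borel" "S \<subseteq> {0..T}" "s0 \<in> S"
  shows "(\<lambda>(\<omega>, s). (if s \<in> S then s else s0, \<omega>)) \<in> measurable (M \<Otimes>\<^sub>M lborel)
     (restrict_space (predictable_sigma M T \<F>) (S \<times> space M))"
proof (rule measurableI)
  fix x assume "x \<in> space (M \<Otimes>\<^sub>M (lborel :: real measure))"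
  then show "(\<lambda>(\<omega>, s). (if s \<in> S then s else s0, \<omega>)) x \<in> space (restrict_space (predictable_sigma M T \<F>) (S \<times> space M))"
    using S by (auto simp: space_restrict_space space_predictable space_pair_measure)
next
  fix A assume "A \<in> sets (restrict_space (predictable_sigma M T \<F>) (S \<times> space M))"
  then obtain B where B: "B \<in> sets (predictable_sigma M T \<F>)" "A = (S \<times> space M) \<inter> B"
    unfolding sets_restrict_space by auto
  have A: "A \<in> sets (lborel \<Otimes>\<^sub>M M)"
    unfolding B(2) using predictable_sets(1)[OF B(1)] S by (intro sets.Int pair_measureI) auto
  have [measurable]: "S \<in> sets borel" by fact
  have "(\<lambda>(\<omega>, s). (if s \<in> S then s else s0, \<omega>)) \<in> measurable (M \<Otimes>\<^sub>M lborel) (lborel \<Otimes>\<^sub>M M)"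
    by measurable
  from measurable_sets[OF this A]
  show "(\<lambda>(\<omega>, s). (if s \<in> S then s else s0, \<omega>)) -` A \<inter> space (M \<Otimes>\<^sub>M lborel) \<in> sets (M \<Otimes>\<^sub>M lborel)" .
qed

lemma predictable_joint_measurable:
  fixes f :: "real \<Rightarrow> 'w \<Rightarrow> 'x::euclidean_space"
  assumes S: "S \<in> sets borel" "S \<subseteq> {0..T}"
    and f: "(\<lambda>(s, \<omega>). f s \<omega>) \<in> borel_measurable (restrict_space (predictable_sigma M T \<F>) (S \<times> space M))"
  shows "(\<lambda>(\<omega>, s). indicator S s *\<^sub>R f s \<omega>) \<in> borel_measurable (M \<Otimes>\<^sub>M lborel)"
proof (cases "S = {}")
  case False
  then obtain s0 where "s0 \<in> S" by blast
  from measurable_compose[OF predictable_redirect[OF S this] f]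
  have [measurable]: "(\<lambda>x. case (case x of (\<omega>, s) \<Rightarrow> (if s \<in> S then s else s0, \<omega>)) of (s, \<omega>) \<Rightarrow> f s \<omega>)
     \<in> borel_measurable (M \<Otimes>\<^sub>M lborel)" .
  have [measurable]: "S \<in> sets borel" by fact
  have "(\<lambda>x. indicator S (snd x) *\<^sub>R (case (case x of (\<omega>, s) \<Rightarrow> (if s \<in> S then s else s0, \<omega>)) of (s, \<omega>) \<Rightarrow> f s \<omega>))
     \<in> borel_measurable (M \<Otimes>\<^sub>M lborel)" by measurable
  also have "(\<lambda>x. indicator S (snd x) *\<^sub>R (case (case x of (\<omega>, s) \<Rightarrow> (if s \<in> S then s else s0, \<omega>)) of (s, \<omega>) \<Rightarrow> f s \<omega>))
     = (\<lambda>(\<omega>, s). indicator S s *\<^sub>R f s \<omega>)"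
    by (auto simp: fun_eq_iff indicator_def)
  finally show ?thesis .
qed simp

lemma predictable_mark_joint_measurable:
  fixes f :: "real \<Rightarrow> 'w \<Rightarrow> 'q \<Rightarrow> 'x::euclidean_space"
  assumes S: "S \<in> sets borel" "S \<subseteq> {0..T}"
    and f: "(\<lambda>((s, \<omega>), z). f s \<omega> z) \<in> borel_measurable (restrict_space (predictable_sigma M T \<F>) (S \<times> space M) \<Otimes>\<^sub>M Q)"
  shows "(\<lambda>((\<omega>, s), z). indicator S s *\<^sub>R f s \<omega> z) \<in> borel_measurable ((M \<Otimes>\<^sub>M lborel) \<Otimes>\<^sub>M Q)"
proof (cases "S = {}")
  case False
  then obtain s0 where "s0 \<in> S" by blast
  let ?\<psi> = "\<lambda>(\<omega>, s). (if s \<in> S then s else s0, \<omega>)"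
  note [measurable] = predictable_redirect[OF S \<open>s0 \<in> S\<close>]
  have "(\<lambda>x. (?\<psi> (fst x), snd x)) \<in> measurable ((M \<Otimes>\<^sub>M lborel) \<Otimes>\<^sub>M Q)
      (restrict_space (predictable_sigma M T \<F>) (S \<times> space M) \<Otimes>\<^sub>M Q)"
    by (intro measurable_Pair measurable_compose[OF measurable_fst predictable_redirect[OF S \<open>s0 \<in> S\<close>]] measurable_snd)
  from measurable_compose[OF this f]
  have [measurable]: "(\<lambda>x. case (?\<psi> (fst x), snd x) of ((s, \<omega>), z) \<Rightarrow> f s \<omega> z) \<in> borel_measurable ((M \<Otimes>\<^sub>M lborel) \<Otimes>\<^sub>M Q)"
    by (simp add: case_prod_unfold)
  have [measurable]: "S \<in> sets borel" by fact
  have "(\<lambda>x. indicator S (snd (fst x)) *\<^sub>R (case (?\<psi> (fst x), snd x) of ((s, \<omega>), z) \<Rightarrow> f s \<omega> z))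
     \<in> borel_measurable ((M \<Otimes>\<^sub>M lborel) \<Otimes>\<^sub>M Q)" by (intro borel_measurable_scaleR) measurable
  also have "(\<lambda>x. indicator S (snd (fst x)) *\<^sub>R (case (?\<psi> (fst x), snd x) of ((s, \<omega>), z) \<Rightarrow> f s \<omega> z))
     = (\<lambda>((\<omega>, s), z). indicator S s *\<^sub>R f s \<omega> z)"
    by (auto simp: fun_eq_iff indicator_def)
  finally show ?thesis .
qed (simp add: case_prod_unfold)

text \<open>Records elementary approximations of an integral together with the convergence of their
  clamped increments; the orthogonality of the Brownian and the jump integral is deduced from
  this.\<close>

definition approximates :: "real \<Rightarrow> (nat \<Rightarrow> ('w, 'z, 'x::euclidean_space) elementary) \<Rightarrow> (real \<Rightarrow> 'w \<Rightarrow> 'x) \<Rightarrow> bool" where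
  "approximates t L I \<longleftrightarrow> (\<forall>k. EI_ok t (L k)) \<and> (\<forall>s\<in>{t..T}. square_integrable M (I s)) \<and>
     (\<forall>s1 s2. t \<le> s1 \<and> s1 \<le> s2 \<and> s2 \<le> T \<longrightarrow>
       (\<lambda>k. \<integral>\<^sup>+\<omega>. ennreal ((norm (EI (clamp_list s1 s2 (L k)) \<omega> - (I s2 \<omega> - I s1 \<omega>)))\<^sup>2) \<partial>M) \<longlonglongrightarrow> 0)"

lemma is_integral_W_limit:
  fixes H I :: "real \<Rightarrow> 'w \<Rightarrow> 'x::euclidean_space"
  assumes t: "0 \<le> t" and int: "is_integral_W M T \<F> W t H I"
  shows "(\<lambda>(\<omega>, s). indicator {t<..T} s *\<^sub>R H s \<omega>) \<in> borel_measurable (M \<Otimes>\<^sub>M lborel)"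
    and "\<exists>L. approximates t L I \<and> (\<forall>k a b j \<xi>. (a, b, j, \<xi>) \<in> set (L k) \<longrightarrow> j = None)"
    and "\<And>s1 s2. t \<le> s1 \<Longrightarrow> s1 \<le> s2 \<Longrightarrow> s2 \<le> T \<Longrightarrow>
       (\<integral>\<^sup>+x. ennreal ((norm (case x of (\<omega>, s) \<Rightarrow> indicator {s1<..s2} s *\<^sub>R H s \<omega>))\<^sup>2) \<partial>(M \<Otimes>\<^sub>M lborel))
         = ennreal (\<integral>\<omega>. (norm (I s2 \<omega> - I s1 \<omega>))\<^sup>2 \<partial>M)"
    and "\<And>s1 s2 \<eta>. t \<le> s1 \<Longrightarrow> s1 \<le> s2 \<Longrightarrow> s2 \<le> T \<Longrightarrow> square_integrable M \<eta> \<Longrightarrow> \<eta> \<in> borel_measurable (\<F> s1) \<Longrightarrow>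
       (\<integral>\<omega>. \<eta> \<omega> \<bullet> (I s2 \<omega> - I s1 \<omega>) \<partial>M) = 0"
proof -
  from int obtain h where
    Hm: "(\<lambda>(s, \<omega>). H s \<omega>) \<in> borel_measurable (restrict_space (predictable_sigma M T \<F>) ({t<..T} \<times> space M))" and
    I: "\<forall>s\<in>{t..T}. I s \<in> borel_measurable (\<F> s)" and
    h: "\<And>k::nat. elementary_W M T \<F> t (h k)" and
    lim: "(\<lambda>k. \<integral>\<^sup>+\<omega>. (\<integral>\<^sup>+s\<in>{t<..T}. ennreal ((norm (elementary_process_W (h k) s \<omega> - H s \<omega>))\<^sup>2)
              \<partial>lborel) \<partial>M) \<longlonglongrightarrow> 0" and
    I_lim: "\<forall>s\<in>{t..T}. (\<lambda>k. \<integral>\<^sup>+\<omega>. ennreal ((norm (elementary_integral_W W (h k) s \<omega> - I s \<omega>))\<^sup>2) \<partial>M) \<longlonglongrightarrow> 0"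
    unfolding is_integral_W_def by blast
  show Hj[measurable]: "(\<lambda>(\<omega>, s). indicator {t<..T} s *\<^sub>R H s \<omega>) \<in> borel_measurable (M \<Otimes>\<^sub>M lborel)"
    by (rule predictable_joint_measurable[OF _ _ Hm]) (use t in auto)
  \<comment> \<open>A one-point mark space of mass 1 brings the Brownian integral into the form of
    \<open>integral_limit\<close>; integrating over it changes nothing.\<close>
  let ?Q = "return (count_space UNIV) () :: unit measure"
  interpret Q: prob_space ?Q by (rule prob_space_return) simp
  have sQ: "space ?Q = UNIV" by simp
  define L where "L k = map (\<lambda>(a, b, \<xi>). (a, b, None :: 'z set option, \<xi>)) (h k)" for k
  have ok: "EI_ok t (L k)" for k
    using h[of k] unfolding EI_ok_def elementary_W_def L_def by (auto simp: mark_ok_def)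
  have upto: "EI_upto s (L k) \<omega> = elementary_integral_W W (h k) s \<omega>" for s k \<omega>
    unfolding EI_upto_def elementary_integral_W_def L_def by (simp add: Z_def comp_def case_prod_unfold)
  have proc: "process (\<lambda>_. UNIV :: unit set) (L k) s \<omega> z = elementary_process_W (h k) s \<omega>" for s k \<omega> z
    unfolding process_def elementary_process_W_def L_def by (simp add: comp_def case_prod_unfold)
  have mark: "\<forall>(a, b, j, \<xi>)\<in>set (L k). j \<in> {None}" for k
    by (auto simp: L_def)
  have collapse: "(\<integral>\<^sup>+x. ennreal ((norm (case x of ((\<omega>, s), z) \<Rightarrow> f \<omega> s))\<^sup>2) \<partial>((M \<Otimes>\<^sub>M lborel) \<Otimes>\<^sub>M ?Q))
     = (\<integral>\<^sup>+x. ennreal ((norm (case x of (\<omega>, s) \<Rightarrow> f \<omega> s))\<^sup>2) \<partial>(M \<Otimes>\<^sub>M lborel))"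
    if [measurable]: "(\<lambda>(\<omega>, s). f \<omega> s) \<in> borel_measurable (M \<Otimes>\<^sub>M lborel)" for f :: "'w \<Rightarrow> real \<Rightarrow> 'x"
  proof -
    have m: "(\<lambda>x. ennreal ((norm (case_prod f (fst x)))\<^sup>2)) \<in> borel_measurable ((M \<Otimes>\<^sub>M lborel) \<Otimes>\<^sub>M ?Q)"
      by measurable
    show ?thesis
      using Q.nn_integral_fst[OF m, symmetric] Q.emeasure_space_1 by (simp add: case_prod_unfold)
  qed
  have Hj': "(\<lambda>((\<omega>, s), z). indicator {t<..T} s *\<^sub>R H s \<omega>) \<in> borel_measurable ((M \<Otimes>\<^sub>M lborel) \<Otimes>\<^sub>M ?Q)"
    using measurable_compose[OF measurable_fst Hj] by (simp add: case_prod_unfold)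
  have pm[measurable]: "(\<lambda>(\<omega>, s). elementary_process_W (h k) s \<omega>) \<in> borel_measurable (M \<Otimes>\<^sub>M lborel)" for k
    unfolding elementary_process_W_def case_prod_unfold
  proof (rule borel_measurable_sum_list)
    fix p assume "p \<in> set (h k)"
    then have "snd (snd p) \<in> borel_measurable (\<F> (fst p))" "fst p \<le> T"
      using h[of k] by (auto simp: elementary_W_def)
    then have [measurable]: "snd (snd p) \<in> borel_measurable M" using measurable_\<F>_M by auto
    show "(\<lambda>x. indicator {fst p<..fst (snd p)} (snd x) *\<^sub>R snd (snd p) (fst x)) \<in> borel_measurable (M \<Otimes>\<^sub>M lborel)"
      by measurable
  qed
  have "(\<integral>\<^sup>+\<omega>. (\<integral>\<^sup>+s\<in>{t<..T}. ennreal ((norm (elementary_process_W (h k) s \<omega> - H s \<omega>))\<^sup>2) \<partial>lborel) \<partial>M)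
     = (\<integral>\<^sup>+x. ennreal ((norm (case x of ((\<omega>, s), z) \<Rightarrow>
       indicator {t<..T} s *\<^sub>R (process (\<lambda>_. UNIV) (L k) s \<omega> z - H s \<omega>)))\<^sup>2) \<partial>((M \<Otimes>\<^sub>M lborel) \<Otimes>\<^sub>M ?Q))" for k
  proof -
    have [measurable]: "(\<lambda>(\<omega>, s). indicator {t<..T} s *\<^sub>R (elementary_process_W (h k) s \<omega> - H s \<omega>)) \<in> borel_measurable (M \<Otimes>\<^sub>M lborel)"
    proof -
      have "(\<lambda>x. indicator {t<..T} (snd x) *\<^sub>R (case x of (\<omega>, s) \<Rightarrow> elementary_process_W (h k) s \<omega>) - (case x of (\<omega>, s) \<Rightarrow> indicator {t<..T} s *\<^sub>R H s \<omega>)) \<in> borel_measurable (M \<Otimes>\<^sub>M lborel)"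
        by measurable
      then show ?thesis by (simp add: case_prod_unfold scaleR_diff_right)
    qed
    have m: "(\<lambda>x. ennreal ((norm (case x of (\<omega>, s) \<Rightarrow> indicator {t<..T} s *\<^sub>R (elementary_process_W (h k) s \<omega> - H s \<omega>)))\<^sup>2)) \<in> borel_measurable (M \<Otimes>\<^sub>M lborel)"
      by measurable
    have "(\<integral>\<^sup>+\<omega>. (\<integral>\<^sup>+s\<in>{t<..T}. ennreal ((norm (elementary_process_W (h k) s \<omega> - H s \<omega>))\<^sup>2) \<partial>lborel) \<partial>M)
      = (\<integral>\<^sup>+\<omega>. \<integral>\<^sup>+s. ennreal ((norm (case (\<omega>, s) of (\<omega>, s) \<Rightarrow> indicator {t<..T} s *\<^sub>R (elementary_process_W (h k) s \<omega> - H s \<omega>)))\<^sup>2) \<partial>lborel \<partial>M)"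
      by (intro nn_integral_cong) (auto simp: indicator_def)
    also have "\<dots> = (\<integral>\<^sup>+x. ennreal ((norm (case x of (\<omega>, s) \<Rightarrow> indicator {t<..T} s *\<^sub>R (elementary_process_W (h k) s \<omega> - H s \<omega>)))\<^sup>2) \<partial>(M \<Otimes>\<^sub>M lborel))"
      by (rule lborel.nn_integral_fst[OF m])
    finally show ?thesis
      unfolding proc by (subst collapse) measurable
  qed
  note lim' = lim[unfolded this]
  have m1: "\<forall>j\<in>{None :: 'z set option}. UNIV \<in> sets ?Q" by simp
  have m2: "\<forall>i\<in>{None}. \<forall>j\<in>{None}. cov i j = measure ?Q (UNIV \<inter> UNIV)"
    using Q.prob_space by (simp add: cov_def)
  note IL = integral_limit[where m = "\<lambda>_. UNIV" and J = "{None}", OF t Q.finite_measure_axioms ok mark m1 m2 Hj' lim' I I_lim[folded upto]]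
  show "\<exists>L. approximates t L I \<and> (\<forall>k a b j \<xi>. (a, b, j, \<xi>) \<in> set (L k) \<longrightarrow> j = None)"
  proof (intro exI[of _ L] conjI)
    show "approximates t L I" unfolding approximates_def using ok IL(1,2) by auto
    show "\<forall>k a b j \<xi>. (a, b, j, \<xi>) \<in> set (L k) \<longrightarrow> j = None" using mark by fastforce
  qed
  fix s1 s2 assume s: "t \<le> s1" "s1 \<le> s2" "s2 \<le> T"
  have m: "(\<lambda>(\<omega>, s). indicator {s1<..s2} s *\<^sub>R H s \<omega>) \<in> borel_measurable (M \<Otimes>\<^sub>M lborel)"
  proof -
    have "(\<lambda>x. indicator {s1<..s2} (snd x) *\<^sub>R (case x of (\<omega>, s) \<Rightarrow> indicator {t<..T} s *\<^sub>R H s \<omega>)) \<in> borel_measurable (M \<Otimes>\<^sub>M lborel)"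
      by measurable
    also have "(\<lambda>x. indicator {s1<..s2} (snd x) *\<^sub>R (case x of (\<omega>, s) \<Rightarrow> indicator {t<..T} s *\<^sub>R H s \<omega>)) = (\<lambda>(\<omega>, s). indicator {s1<..s2} s *\<^sub>R H s \<omega>)"
      using s by (auto simp: fun_eq_iff indicator_def)
    finally show ?thesis .
  qed
  show "(\<integral>\<^sup>+x. ennreal ((norm (case x of (\<omega>, s) \<Rightarrow> indicator {s1<..s2} s *\<^sub>R H s \<omega>))\<^sup>2) \<partial>(M \<Otimes>\<^sub>M lborel))
         = ennreal (\<integral>\<omega>. (norm (I s2 \<omega> - I s1 \<omega>))\<^sup>2 \<partial>M)"
    using IL(3)[OF s] unfolding collapse[OF m] by simp
  fix \<eta> :: "'w \<Rightarrow> 'x" assume "square_integrable M \<eta>" "\<eta> \<in> borel_measurable (\<F> s1)"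
  then show "(\<integral>\<omega>. \<eta> \<omega> \<bullet> (I s2 \<omega> - I s1 \<omega>) \<partial>M) = 0"
    by (rule IL(4)[OF s])
qed

lemma is_integral_N_limit:
  fixes H :: "real \<Rightarrow> 'w \<Rightarrow> 'z \<Rightarrow> 'x::euclidean_space" and I :: "real \<Rightarrow> 'w \<Rightarrow> 'x"
  assumes t: "0 \<le> t" and int: "is_integral_N M T \<Lambda> \<F> N t H I"
  shows "(\<lambda>((\<omega>, s), z). indicator {t<..T} s *\<^sub>R H s \<omega> z) \<in> borel_measurable ((M \<Otimes>\<^sub>M lborel) \<Otimes>\<^sub>M \<Lambda>)"
    and "\<exists>L. approximates t L I \<and> (\<forall>k a b j \<xi>. (a, b, j, \<xi>) \<in> set (L k) \<longrightarrow> j \<noteq> None)"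
    and "\<And>s1 s2. t \<le> s1 \<Longrightarrow> s1 \<le> s2 \<Longrightarrow> s2 \<le> T \<Longrightarrow>
       (\<integral>\<^sup>+x. ennreal ((norm (case x of ((\<omega>, s), z) \<Rightarrow> indicator {s1<..s2} s *\<^sub>R H s \<omega> z))\<^sup>2) \<partial>((M \<Otimes>\<^sub>M lborel) \<Otimes>\<^sub>M \<Lambda>))
         = ennreal (\<integral>\<omega>. (norm (I s2 \<omega> - I s1 \<omega>))\<^sup>2 \<partial>M)"
    and "\<And>s1 s2 \<eta>. t \<le> s1 \<Longrightarrow> s1 \<le> s2 \<Longrightarrow> s2 \<le> T \<Longrightarrow> square_integrable M \<eta> \<Longrightarrow> \<eta> \<in> borel_measurable (\<F> s1) \<Longrightarrow>
       (\<integral>\<omega>. \<eta> \<omega> \<bullet> (I s2 \<omega> - I s1 \<omega>) \<partial>M) = 0"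
proof -
  from int obtain h where
    Hm: "(\<lambda>((s, \<omega>), z). H s \<omega> z) \<in> borel_measurable (restrict_space (predictable_sigma M T \<F>) ({t<..T} \<times> space M) \<Otimes>\<^sub>M \<Lambda>)" and
    I: "\<forall>s\<in>{t..T}. I s \<in> borel_measurable (\<F> s)" and
    h: "\<And>k::nat. elementary_N M T \<Lambda> \<F> t (h k)" and
    lim: "(\<lambda>k. \<integral>\<^sup>+\<omega>. (\<integral>\<^sup>+s\<in>{t<..T}. (\<integral>\<^sup>+z. ennreal ((norm (elementary_process_N (h k) s \<omega> z - H s \<omega> z))\<^sup>2) \<partial>\<Lambda>)
              \<partial>lborel) \<partial>M) \<longlonglongrightarrow> 0" and
    I_lim: "\<forall>s\<in>{t..T}. (\<lambda>k. \<integral>\<^sup>+\<omega>. ennreal ((norm (elementary_integral_N \<Lambda> N (h k) s \<omega> - I s \<omega>))\<^sup>2) \<partial>M) \<longlonglongrightarrow> 0"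
    unfolding is_integral_N_def by blast
  let ?P = "(M \<Otimes>\<^sub>M lborel) \<Otimes>\<^sub>M \<Lambda>"
  show Hj[measurable]: "(\<lambda>((\<omega>, s), z). indicator {t<..T} s *\<^sub>R H s \<omega> z) \<in> borel_measurable ?P"
    by (rule predictable_mark_joint_measurable[OF _ _ Hm]) (use t in auto)
  define L where "L k = map (\<lambda>(a, b, B, \<xi>). (a, b, Some B, \<xi>)) (h k)" for k
  \<comment> \<open>The value at \<open>None\<close> is a placeholder: all marks of \<open>L\<close>
    are of the form \<open>Some B\<close>.\<close>
  define m where "m j = (case j of None \<Rightarrow> {} | Some B \<Rightarrow> B)" for j :: "'z set option"
  define J where "J = Some ` sets \<Lambda>"
  have ok: "EI_ok t (L k)" for k
    using h[of k] unfolding EI_ok_def elementary_N_def L_def by (auto simp: mark_ok_def)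
  have upto: "EI_upto s (L k) \<omega> = elementary_integral_N \<Lambda> N (h k) s \<omega>" for s k \<omega>
    unfolding EI_upto_def elementary_integral_N_def L_def by (simp add: Z_def comp_def case_prod_unfold)
  have proc: "process m (L k) s \<omega> z = elementary_process_N (h k) s \<omega> z" for s k \<omega> z
    unfolding process_def elementary_process_N_def L_def m_def by (simp add: comp_def case_prod_unfold)
  have mark: "\<forall>(a, b, j, \<xi>)\<in>set (L k). j \<in> J" for k
    using h[of k] by (auto simp: L_def J_def elementary_N_def)
  have m1: "\<forall>j\<in>J. m j \<in> sets \<Lambda>" by (auto simp: J_def m_def)
  have m2: "\<forall>i\<in>J. \<forall>j\<in>J. cov i j = measure \<Lambda> (m i \<inter> m j)"
    by (auto simp: cov_def J_def m_def)
  have pm[measurable]: "(\<lambda>((\<omega>, s), z). elementary_process_N (h k) s \<omega> z) \<in> borel_measurable ?P" for k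
    unfolding elementary_process_N_def case_prod_unfold
  proof (rule borel_measurable_sum_list)
    fix p assume "p \<in> set (h k)"
    then have D: "snd (snd (snd p)) \<in> borel_measurable (\<F> (fst p))" "fst p \<le> T" "fst (snd (snd p)) \<in> sets \<Lambda>"
      using h[of k] by (auto simp: elementary_N_def)
    then have [measurable]: "snd (snd (snd p)) \<in> borel_measurable M" "fst (snd (snd p)) \<in> sets \<Lambda>"
      using measurable_\<F>_M by auto
    show "(\<lambda>x. (indicator {fst p<..fst (snd p)} (snd (fst x)) * indicator (fst (snd (snd p))) (snd x)) *\<^sub>R snd (snd (snd p)) (fst (fst x))) \<in> borel_measurable ?P"
      by measurable
  qed
  have "(\<integral>\<^sup>+\<omega>. (\<integral>\<^sup>+s\<in>{t<..T}. (\<integral>\<^sup>+z. ennreal ((norm (elementary_process_N (h k) s \<omega> z - H s \<omega> z))\<^sup>2) \<partial>\<Lambda>) \<partial>lborel) \<partial>M)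
     = (\<integral>\<^sup>+x. ennreal ((norm (case x of ((\<omega>, s), z) \<Rightarrow>
       indicator {t<..T} s *\<^sub>R (process m (L k) s \<omega> z - H s \<omega> z)))\<^sup>2) \<partial>?P)" for k
  proof -
    have Dm: "(\<lambda>((\<omega>, s), z). indicator {t<..T} s *\<^sub>R (elementary_process_N (h k) s \<omega> z - H s \<omega> z)) \<in> borel_measurable ?P"
    proof -
      have "(\<lambda>x. indicator {t<..T} (snd (fst x)) :: real) \<in> borel_measurable ?P" by measurable
      from borel_measurable_diff[OF borel_measurable_scaleR[OF this pm] Hj]
      show ?thesis by (simp add: case_prod_unfold scaleR_diff_right)
    qed
    let ?g = "\<lambda>x. ennreal ((norm (case x of ((\<omega>, s), z) \<Rightarrow> indicator {t<..T} s *\<^sub>R (elementary_process_N (h k) s \<omega> z - H s \<omega> z)))\<^sup>2)"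
    have "(\<lambda>v::'x. ennreal ((norm v)\<^sup>2)) \<in> borel_measurable borel" by measurable
    from measurable_compose[OF Dm this] have m: "?g \<in> borel_measurable ?P"
      by (simp add: case_prod_unfold)
    have "(\<integral>\<^sup>+\<omega>. (\<integral>\<^sup>+s\<in>{t<..T}. (\<integral>\<^sup>+z. ennreal ((norm (elementary_process_N (h k) s \<omega> z - H s \<omega> z))\<^sup>2) \<partial>\<Lambda>) \<partial>lborel) \<partial>M)
      = (\<integral>\<^sup>+\<omega>. \<integral>\<^sup>+s. \<integral>\<^sup>+z. ?g ((\<omega>, s), z) \<partial>\<Lambda> \<partial>lborel \<partial>M)"
      by (intro nn_integral_cong) (auto simp: indicator_def)
    also have "\<dots> = (\<integral>\<^sup>+y. \<integral>\<^sup>+z. ?g (y, z) \<partial>\<Lambda> \<partial>(M \<Otimes>\<^sub>M lborel))"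
      by (rule lborel.nn_integral_fst[OF \<Lambda>.borel_measurable_nn_integral_fst[OF m]])
    also have "\<dots> = integral\<^sup>N ?P ?g" by (rule \<Lambda>.nn_integral_fst[OF m])
    finally show ?thesis unfolding proc .
  qed
  note lim' = lim[unfolded this]
  note IL = integral_limit[where m = m and J = J, OF t \<Lambda>.finite_measure_axioms ok mark m1 m2 Hj lim' I I_lim[folded upto]]
  show "\<exists>L. approximates t L I \<and> (\<forall>k a b j \<xi>. (a, b, j, \<xi>) \<in> set (L k) \<longrightarrow> j \<noteq> None)"
  proof (intro exI[of _ L] conjI)
    show "approximates t L I" unfolding approximates_def using ok IL(1,2) by auto
    show "\<forall>k a b j \<xi>. (a, b, j, \<xi>) \<in> set (L k) \<longrightarrow> j \<noteq> None" using mark by (fastforce simp: J_def)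
  qed
  fix s1 s2 assume s: "t \<le> s1" "s1 \<le> s2" "s2 \<le> T"
  show "(\<integral>\<^sup>+x. ennreal ((norm (case x of ((\<omega>, s), z) \<Rightarrow> indicator {s1<..s2} s *\<^sub>R H s \<omega> z))\<^sup>2) \<partial>?P)
         = ennreal (\<integral>\<omega>. (norm (I s2 \<omega> - I s1 \<omega>))\<^sup>2 \<partial>M)"
    by (rule IL(3)[OF s])
  fix \<eta> :: "'w \<Rightarrow> 'x" assume "square_integrable M \<eta>" "\<eta> \<in> borel_measurable (\<F> s1)"
  then show "(\<integral>\<omega>. \<eta> \<omega> \<bullet> (I s2 \<omega> - I s1 \<omega>) \<partial>M) = 0" by (rule IL(4)[OF s])
qed

end

section \<open>Linear differential equations\<close>

lemma set_integral_split_real: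
  fixes f :: "real \<Rightarrow> 'x::{banach, second_countable_topology}"
  assumes "set_integrable lborel {a..c} f" "a \<le> b" "b \<le> c"
  shows "(LINT x:{a..c}|lborel. f x) = (LINT x:{a..b}|lborel. f x) + (LINT x:{b..c}|lborel. f x)"
proof -
  have i: "set_integrable lborel {a..b} f" "set_integrable lborel {b..c} f"
    using assms by (auto intro: set_integrable_subset)
  have "(LINT x:{a..c}|lborel. f x) = (\<integral>x. indicator {a..b} x *\<^sub>R f x + indicator {b..c} x *\<^sub>R f x \<partial>lborel)"
    unfolding set_lebesgue_integral_def
  proof (rule integral_cong_AE)
    show "AE x in lborel. indicator {a..c} x *\<^sub>R f x = indicator {a..b} x *\<^sub>R f x + indicator {b..c} x *\<^sub>R f x"
      using AE_lborel_singleton[of b]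
    proof eventually_elim
      case (elim x)
      then show ?case using assms by (auto simp: indicator_def)
    qed
  qed (use assms(1) i in \<open>auto simp: set_integrable_def\<close>)
  then show ?thesis
    using i unfolding set_integrable_def set_lebesgue_integral_def by simp
qed

lemma integral_exp_Icc:
  fixes c :: real assumes "c \<noteq> 0" "a \<le> b"
  shows "(LINT x:{a..b}|lborel. exp (c * x)) = (exp (c * b) - exp (c * a)) / c"
proof -
  have "(\<integral>x. indicator {a..b} x *\<^sub>R exp (c * x) \<partial>lborel) = exp (c * b) / c - exp (c * a) / c"
    using assms by (intro integral_FTC_Icc)
      (auto intro!: derivative_eq_intros continuous_intros simp: has_real_derivative_iff_has_vector_derivative[symmetric])
  then show ?thesis by (simp add: set_lebesgue_integral_def diff_divide_distrib)
qed

text \<open>Both Gronwall bounds come from the maximum of the exponentially weighted function.\<close>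

lemma gronwall_forward:
  fixes f :: "real \<Rightarrow> real"
  assumes f: "continuous_on {0..s} f" "\<And>x. x \<in> {0..s} \<Longrightarrow> 0 \<le> f x" and c: "0 < c" and s: "0 \<le> s" and K: "0 \<le> K"
    and le: "\<And>x. x \<in> {0..s} \<Longrightarrow> f x \<le> K + c * (LINT r:{0..x}|lborel. f r)"
    and x: "x \<in> {0..s}"
  shows "f x \<le> 2 * K * exp (2 * c * x)"
proof -
  let ?g = "\<lambda>x. f x * exp (- 2 * c * x)"
  have "continuous_on {0..s} ?g" using f(1) by (intro continuous_intros)
  then obtain x0 where x0: "x0 \<in> {0..s}" "\<And>y. y \<in> {0..s} \<Longrightarrow> ?g y \<le> ?g x0"
    using continuous_attains_sup[of "{0..s}" ?g] s by auto
  define m where "m = ?g x0"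
  have m0: "0 \<le> m" using f(2)[OF x0(1)] by (simp add: m_def)
  have fm: "f y \<le> m * exp (2 * c * y)" if "y \<in> {0..s}" for y
  proof -
    have "f y = ?g y * exp (2 * c * y)" by (simp add: exp_minus)
    also have "\<dots> \<le> m * exp (2 * c * y)" using x0(2)[OF that] by (intro mult_right_mono) (auto simp: m_def)
    finally show ?thesis .
  qed
  \<comment> \<open>Integrating the weight of rate \<open>2 * c\<close> produces the factor
    \<open>1 / (2 * c)\<close>, so the integral term contributes at most half of \<open>f x0\<close>
    and can be absorbed on the left.\<close>
  have "(LINT r:{0..x0}|lborel. f r) \<le> (LINT r:{0..x0}|lborel. m * exp (2 * c * r))"
    using x0(1) fm f(1)
    by (intro set_integral_mono borel_integrable_atLeastAtMost' continuous_intros)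
       (auto intro: continuous_on_subset)
  also have "\<dots> = m * ((exp (2 * c * x0) - 1) / (2 * c))"
    using integral_exp_Icc[of "2 * c" 0 x0] c x0(1) by simp
  finally have "f x0 \<le> K + c * (m * ((exp (2 * c * x0) - 1) / (2 * c)))"
    using le[OF x0(1)] c by (meson add_left_mono less_imp_le mult_left_mono order_trans)
  also have "\<dots> = K + m * (exp (2 * c * x0) - 1) / 2" using c by (simp add: field_simps)
  finally have "f x0 \<le> K + m * exp (2 * c * x0) / 2"
    using m0 by (simp add: right_diff_distrib diff_divide_distrib)
  moreover have "f x0 = m * exp (2 * c * x0)" by (simp add: m_def exp_minus)
  ultimately have "m * exp (2 * c * x0) \<le> 2 * K" by simp
  moreover have "m * 1 \<le> m * exp (2 * c * x0)" using m0 c x0(1) by (intro mult_left_mono) auto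
  ultimately have "m \<le> 2 * K" by simp
  then have "m * exp (2 * c * x) \<le> 2 * K * exp (2 * c * x)" by (rule mult_right_mono) simp
  with fm[OF x] show ?thesis by (rule order_trans)
qed

lemma gronwall_backward:
  fixes f :: "real \<Rightarrow> real"
  assumes f: "continuous_on {0..s} f" "\<And>x. x \<in> {0..s} \<Longrightarrow> 0 \<le> f x" and c: "0 < c" and s: "0 \<le> s" and K: "0 \<le> K"
    and le: "\<And>x. x \<in> {0..s} \<Longrightarrow> f x \<le> K + c * (LINT r:{x..s}|lborel. f r)"
    and x: "x \<in> {0..s}"
  shows "f x \<le> 2 * K * exp (2 * c * s)"
proof -
  let ?g = "\<lambda>x. f x * exp (2 * c * x)"
  have "continuous_on {0..s} ?g" using f(1) by (intro continuous_intros)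
  then obtain x0 where x0: "x0 \<in> {0..s}" "\<And>y. y \<in> {0..s} \<Longrightarrow> ?g y \<le> ?g x0"
    using continuous_attains_sup[of "{0..s}" ?g] s by auto
  define m where "m = ?g x0"
  have m0: "0 \<le> m" using f(2)[OF x0(1)] by (simp add: m_def)
  have fm: "f y \<le> m * exp ((- 2 * c) * y)" if "y \<in> {0..s}" for y
  proof -
    have "f y = ?g y * exp ((- 2 * c) * y)" by (simp add: exp_minus)
    also have "\<dots> \<le> m * exp ((- 2 * c) * y)" using x0(2)[OF that] by (intro mult_right_mono) (auto simp: m_def)
    finally show ?thesis .
  qed
  have "(LINT r:{x0..s}|lborel. f r) \<le> (LINT r:{x0..s}|lborel. m * exp ((- 2 * c) * r))"
    using x0(1) fm f(1)
    by (intro set_integral_mono borel_integrable_atLeastAtMost' continuous_intros)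
       (auto intro: continuous_on_subset)
  also have "\<dots> = m * ((exp ((- 2 * c) * s) - exp ((- 2 * c) * x0)) / (- 2 * c))"
    using integral_exp_Icc[of "- 2 * c" x0 s] c x0(1) by simp
  finally have "f x0 \<le> K + c * (m * ((exp ((- 2 * c) * s) - exp ((- 2 * c) * x0)) / (- 2 * c)))"
    using le[OF x0(1)] c by (meson add_left_mono less_imp_le mult_left_mono order_trans)
  also have "\<dots> = K + m * (exp ((- 2 * c) * x0) - exp ((- 2 * c) * s)) / 2" using c by (simp add: field_simps)
  finally have "f x0 \<le> K + m * exp ((- 2 * c) * x0) / 2"
    using mult_nonneg_nonneg[OF m0 exp_ge_zero[of "(- 2 * c) * s"]] by (simp add: right_diff_distrib diff_divide_distrib)
  moreover have "f x0 = m * exp ((- 2 * c) * x0)" by (simp add: m_def exp_minus)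
  ultimately have *: "m * exp ((- 2 * c) * x0) \<le> 2 * K" by simp
  have "f x \<le> m * exp ((- 2 * c) * x)" by (rule fm[OF x])
  also have "\<dots> \<le> m * 1" using m0 c x by (intro mult_left_mono) auto
  also have "\<dots> = (m * exp ((- 2 * c) * x0)) * exp (2 * c * x0)" by (simp add: exp_minus)
  also have "\<dots> \<le> 2 * K * exp (2 * c * s)"
    by (rule mult_mono[OF *]) (use x0(1) c K in auto)
  finally show ?thesis .
qed

text \<open>The equation of a single path of the fundamental solution. The bound \<open>c\<close> is
  deterministic, so constants derived from it serve almost all paths at once.\<close>

definition linear_ode :: "real \<Rightarrow> real \<Rightarrow> (real \<Rightarrow> real^'n^'n) \<Rightarrow> (real \<Rightarrow> real^'n^'n) \<Rightarrow> bool" where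
  "linear_ode c T A \<Phi> \<longleftrightarrow> (\<lambda>s. indicator {0..T} s *\<^sub>R A s) \<in> borel_measurable lborel \<and>
     (AE s in lborel. s \<in> {0..T} \<longrightarrow> norm (A s) \<le> c) \<and> continuous_on {0..T} \<Phi> \<and>
     (\<forall>s\<in>{0..T}. \<Phi> s = mat 1 + (LINT r:{0..s}|lborel. A r ** \<Phi> r))"

lemma linear_ode_integrable:
  fixes A \<Phi> :: "real \<Rightarrow> real^'n^'n"
  assumes "linear_ode c T A \<Phi>" "0 \<le> r" "s \<le> T" "0 < c"
  shows "set_integrable lborel {r..s} (\<lambda>x. A x ** \<Phi> x)"
proof -
  have [measurable]: "(\<lambda>s. indicator {0..T} s *\<^sub>R A s) \<in> borel_measurable lborel"
    and Ab: "AE s in lborel. s \<in> {0..T} \<longrightarrow> norm (A s) \<le> c" and cont: "continuous_on {0..T} \<Phi>"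
    using assms(1) by (auto simp: linear_ode_def)
  obtain B where B: "\<And>x. x \<in> {0..T} \<Longrightarrow> norm (\<Phi> x) \<le> B"
    using compact_imp_bounded[OF compact_continuous_image[OF cont compact_Icc]]
    by (auto simp: bounded_iff simp del: atLeastAtMost_iff)
  have \<Phi>m[measurable]: "(\<lambda>x. indicator {r..s} x *\<^sub>R \<Phi> x) \<in> borel_measurable lborel"
    using borel_measurable_continuous_on_indicator[OF _ continuous_on_subset[OF cont], of "{r..s}"] assms(2,3) by auto
  have eq: "(\<lambda>x. indicator {r..s} x *\<^sub>R (A x ** \<Phi> x)) = (\<lambda>x. (indicator {0..T} x *\<^sub>R A x) ** (indicator {r..s} x *\<^sub>R \<Phi> x))"
    using assms(2,3) by (auto simp: fun_eq_iff indicator_def bounded_bilinear.zero_right[OF bounded_bilinear_matrix_matrix_mult])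
  show ?thesis
    unfolding set_integrable_def
  proof (rule Bochner_Integration.integrable_bound)
    show "integrable lborel (\<lambda>x. indicator {r..s} x *\<^sub>R (c * B))"
      using borel_integrable_atLeastAtMost'[of r s "\<lambda>_. c * B"] unfolding set_integrable_def by simp
    show "(\<lambda>x. indicator {r..s} x *\<^sub>R (A x ** \<Phi> x)) \<in> borel_measurable lborel"
      unfolding eq by measurable
    show "AE x in lborel. norm (indicator {r..s} x *\<^sub>R (A x ** \<Phi> x)) \<le> norm (indicator {r..s} x *\<^sub>R (c * B))"
      using Ab
    proof eventually_elim
      case (elim x)
      show ?case
      proof (cases "x \<in> {r..s}")
        case True
        then have x: "x \<in> {0..T}" using assms by auto
        have "norm (A x ** \<Phi> x) \<le> c * B"
          using elim x B[OF x] assms(4)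
          by (intro order_trans[OF norm_matrix_matrix_mult_le] mult_mono) auto
        then show ?thesis using True by simp
      qed simp
    qed
  qed
qed

lemma linear_ode_diff:
  fixes A \<Phi> :: "real \<Rightarrow> real^'n^'n"
  assumes ode: "linear_ode c T A \<Phi>" and rs: "0 \<le> r" "r \<le> s" "s \<le> T" and c: "0 < c"
  shows "\<Phi> s - \<Phi> r = (LINT x:{r..s}|lborel. A x ** \<Phi> x)"
proof -
  have "\<Phi> s = mat 1 + (LINT r:{0..s}|lborel. A r ** \<Phi> r)" "\<Phi> r = mat 1 + (LINT r:{0..r}|lborel. A r ** \<Phi> r)"
    using ode rs unfolding linear_ode_def by auto
  then show ?thesis
    using set_integral_split_real[OF linear_ode_integrable[OF ode order_refl rs(3) c] rs(1,2)] by simp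
qed

lemma linear_ode_vec_integrable:
  fixes A \<Phi> :: "real \<Rightarrow> real^'n^'n"
  assumes "linear_ode c T A \<Phi>" "0 \<le> r" "s \<le> T" "0 < c"
  shows "set_integrable lborel {r..s} (\<lambda>x. A x *v (\<Phi> x *v v))"
proof -
  have bl: "bounded_linear (\<lambda>B :: real^'n^'n. B *v v)"
    by (rule bounded_bilinear.bounded_linear_left[OF bounded_bilinear_matrix_vector_mult])
  show ?thesis
    using integrable_bounded_linear[OF bl linear_ode_integrable[OF assms, unfolded set_integrable_def]]
    by (simp add: set_integrable_def matrix_vector_mul_assoc scaleR_matrix_vector_assoc)
qed

lemma linear_ode_vec_diff:
  fixes A \<Phi> :: "real \<Rightarrow> real^'n^'n"
  assumes "linear_ode c T A \<Phi>" "0 \<le> r" "r \<le> s" "s \<le> T" "0 < c"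
  shows "\<Phi> s *v v - \<Phi> r *v v = (LINT x:{r..s}|lborel. A x *v (\<Phi> x *v v))"
proof -
  have bl: "bounded_linear (\<lambda>B :: real^'n^'n. B *v v)"
    by (rule bounded_bilinear.bounded_linear_left[OF bounded_bilinear_matrix_vector_mult])
  have "\<Phi> s *v v - \<Phi> r *v v = (LINT x:{r..s}|lborel. A x ** \<Phi> x) *v v"
    using linear_ode_diff[OF assms] by (simp add: matrix_vector_mult_diff_rdistrib[symmetric])
  also have "\<dots> = (LINT x:{r..s}|lborel. A x *v (\<Phi> x *v v))"
    using integral_bounded_linear[OF bl linear_ode_integrable[OF assms(1,2,4,5), unfolded set_integrable_def]]
    by (simp add: set_lebesgue_integral_def matrix_vector_mul_assoc scaleR_matrix_vector_assoc)
  finally show ?thesis .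
qed

lemma norm_set_integral_ode_le:
  fixes f :: "real \<Rightarrow> 'x::{banach, second_countable_topology}" and g :: "real \<Rightarrow> real"
  assumes "set_integrable lborel {r..s} f" "set_integrable lborel {r..s} g"
    "AE x in lborel. x \<in> {r..s} \<longrightarrow> norm (f x) \<le> g x"
  shows "norm (LINT x:{r..s}|lborel. f x) \<le> (LINT x:{r..s}|lborel. g x)"
proof -
  have "norm (LINT x:{r..s}|lborel. f x) \<le> (LINT x:{r..s}|lborel. norm (f x))"
    by (rule set_integral_norm_bound[OF assms(1)])
  also have "\<dots> \<le> (LINT x:{r..s}|lborel. g x)"
    unfolding set_lebesgue_integral_def
  proof (rule integral_mono_AE)
    show "integrable lborel (\<lambda>x. indicator {r..s} x *\<^sub>R norm (f x))"
      using set_integrable_norm[OF assms(1)] by (simp add: set_integrable_def)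
    show "AE x in lborel. indicator {r..s} x *\<^sub>R norm (f x) \<le> indicator {r..s} x *\<^sub>R g x"
      using assms(3) by eventually_elim (auto simp: indicator_def)
  qed (use assms(2) in \<open>simp add: set_integrable_def\<close>)
  finally show ?thesis .
qed

text \<open>\<open>K\<close> depends on \<open>c\<close>, \<open>T\<close> and the dimension alone.
  Gronwall forwards bounds the solution, Gronwall backwards its inverse, and the equation turns the
  first bound into a Lipschitz estimate.\<close>

lemma linear_ode_bounds:
  fixes T c :: real
  assumes T: "0 < T" and c: "0 < c"
  obtains K where "0 < K"
    "\<And>A (\<Phi> :: real \<Rightarrow> real^'n^'n) s. linear_ode c T A \<Phi> \<Longrightarrow> s \<in> {0..T} \<Longrightarrow>
       invertible (\<Phi> s) \<and> norm (\<Phi> s) \<le> K \<and> norm (matrix_inv (\<Phi> s)) \<le> K"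
    "\<And>A (\<Phi> :: real \<Rightarrow> real^'n^'n) r s. linear_ode c T A \<Phi> \<Longrightarrow> 0 \<le> r \<Longrightarrow> r \<le> s \<Longrightarrow> s \<le> T \<Longrightarrow>
       norm (\<Phi> s - \<Phi> r) \<le> K * (s - r) \<and> norm (matrix_inv (\<Phi> s) - matrix_inv (\<Phi> r)) \<le> K * (s - r)"
proof -
  define K1 where "K1 = 2 * norm (mat 1 :: real^'n^'n) * exp (2 * c * T)"
  define K2 where "K2 = real CARD('n) * real CARD('n) * (2 * exp (2 * c * T))"
  have K: "0 \<le> K1" "0 \<le> K2" by (auto simp: K1_def K2_def)
  \<comment> \<open>The sum dominates every constant that occurs below, and the summand 1 makes it
    positive.\<close>
  define K where "K = K1 + K2 + c * K1 + K2 * (c * K1) * K2 + 1"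
  have K': "K1 \<le> K" "K2 \<le> K" "c * K1 \<le> K" "K2 * (c * K1) * K2 \<le> K" "0 < K"
    using K c by (auto simp: K_def add_nonneg_pos)
  have \<Phi>_bound: "norm (\<Phi> s) \<le> K1" if ode: "linear_ode c T A \<Phi>" and s: "s \<in> {0..T}" for A and \<Phi> :: "real \<Rightarrow> real^'n^'n" and s
  proof -
    have cont: "continuous_on {0..T} (\<lambda>x. norm (\<Phi> x))" and Ab: "AE s in lborel. s \<in> {0..T} \<longrightarrow> norm (A s) \<le> c"
      using ode by (auto simp: linear_ode_def intro!: continuous_intros)
    have "norm (\<Phi> s) \<le> 2 * norm (mat 1 :: real^'n^'n) * exp (2 * c * s)"
    proof (rule gronwall_forward[OF cont _ c _ _ _ s])
      fix x assume x: "x \<in> {0..T}"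
      have eq: "\<Phi> x = mat 1 + (LINT r:{0..x}|lborel. A r ** \<Phi> r)" using ode x by (auto simp: linear_ode_def)
      have "norm (LINT r:{0..x}|lborel. A r ** \<Phi> r) \<le> (LINT r:{0..x}|lborel. c * norm (\<Phi> r))"
      proof (rule norm_set_integral_ode_le)
        show "set_integrable lborel {0..x} (\<lambda>x. A x ** \<Phi> x)" using linear_ode_integrable[OF ode] x c by auto
        show "set_integrable lborel {0..x} (\<lambda>r. c * norm (\<Phi> r))"
          using x by (intro borel_integrable_atLeastAtMost' continuous_on_subset[OF continuous_on_mult_left[OF cont]]) auto
        show "AE r in lborel. r \<in> {0..x} \<longrightarrow> norm (A r ** \<Phi> r) \<le> c * norm (\<Phi> r)"
          using Ab by eventually_elim (use x in \<open>auto intro!: order_trans[OF norm_matrix_matrix_mult_le] mult_right_mono\<close>)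
      qed
      then show "norm (\<Phi> x) \<le> norm (mat 1 :: real^'n^'n) + c * (LINT r:{0..x}|lborel. norm (\<Phi> r))"
        unfolding eq by (intro order_trans[OF norm_triangle_ineq]) simp
    qed (use T in auto)
    also have "\<dots> \<le> K1" unfolding K1_def using s c by (intro mult_left_mono) auto
    finally show ?thesis .
  qed
  \<comment> \<open>Followed backwards from \<open>s\<close>, the vector
    \<open>\<Phi> x *v v\<close> grows at most exponentially, and at time 0 it is \<open>v\<close>.
    This makes \<open>\<Phi> s\<close> injective and bounds its inverse without an equation for the
    inverse.\<close>
  have lower: "norm v \<le> 2 * exp (2 * c * T) * norm (\<Phi> s *v v)" if ode: "linear_ode c T A \<Phi>" and s: "s \<in> {0..T}"
    for A and \<Phi> :: "real \<Rightarrow> real^'n^'n" and s v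
  proof -
    have cont: "continuous_on {0..T} (\<lambda>x. norm (\<Phi> x *v v))" and Ab: "AE s in lborel. s \<in> {0..T} \<longrightarrow> norm (A s) \<le> c"
      using ode by (auto simp: linear_ode_def intro!: continuous_intros
          bounded_bilinear.continuous_on[OF bounded_bilinear_matrix_vector_mult])
    have "norm (\<Phi> 0 *v v) \<le> 2 * norm (\<Phi> s *v v) * exp (2 * c * s)"
    proof (rule gronwall_backward[OF continuous_on_subset[OF cont] _ c _ _ ])
      fix x assume x: "x \<in> {0..s}"
      have eq: "\<Phi> x *v v = \<Phi> s *v v - (LINT r:{x..s}|lborel. A r *v (\<Phi> r *v v))"
        using linear_ode_vec_diff[OF ode, of x s v] x s c by (simp add: algebra_simps)
      have "norm (LINT r:{x..s}|lborel. A r *v (\<Phi> r *v v)) \<le> (LINT r:{x..s}|lborel. c * norm (\<Phi> r *v v))"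
      proof (rule norm_set_integral_ode_le)
        show "set_integrable lborel {x..s} (\<lambda>r. A r *v (\<Phi> r *v v))" using linear_ode_vec_integrable[OF ode] x s c by auto
        show "set_integrable lborel {x..s} (\<lambda>r. c * norm (\<Phi> r *v v))"
          using x s by (intro borel_integrable_atLeastAtMost' continuous_on_subset[OF continuous_on_mult_left[OF cont]]) auto
        show "AE r in lborel. r \<in> {x..s} \<longrightarrow> norm (A r *v (\<Phi> r *v v)) \<le> c * norm (\<Phi> r *v v)"
          using Ab by eventually_elim (use x s in \<open>auto intro!: order_trans[OF norm_matrix_vector_mult_le] mult_right_mono\<close>)
      qed
      then show "norm (\<Phi> x *v v) \<le> norm (\<Phi> s *v v) + c * (LINT r:{x..s}|lborel. norm (\<Phi> r *v v))"
        unfolding eq by (intro order_trans[OF norm_triangle_ineq4]) simp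
    qed (use s in auto)
    moreover have "\<Phi> 0 = mat 1"
    proof -
      have "\<Phi> 0 = mat 1 + (LINT r:{0..0}|lborel. A r ** \<Phi> r)" using ode T by (auto simp: linear_ode_def)
      moreover have "(LINT r:{0..0::real}|lborel. A r ** \<Phi> r) = (\<integral>r. 0 \<partial>(lborel :: real measure))"
        unfolding set_lebesgue_integral_def
      proof (rule integral_cong_AE)
        show "(\<lambda>r. indicator {0..0} r *\<^sub>R (A r ** \<Phi> r)) \<in> borel_measurable lborel"
          using linear_ode_integrable[OF ode, of 0 0] T c by (auto simp: set_integrable_def)
        show "AE r in lborel. indicator {0..0} r *\<^sub>R (A r ** \<Phi> r) = 0"
          using AE_lborel_singleton[of 0] by eventually_elim (auto simp: indicator_def)
      qed simp
      ultimately show ?thesis by simp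
    qed
    moreover have "2 * norm (\<Phi> s *v v) * exp (2 * c * s) \<le> 2 * norm (\<Phi> s *v v) * exp (2 * c * T)"
      using s c by (intro mult_left_mono) auto
    ultimately show ?thesis by (simp add: mult_ac)
  qed
  have inv: "invertible (\<Phi> s) \<and> norm (matrix_inv (\<Phi> s)) \<le> K2" if ode: "linear_ode c T A \<Phi>" and s: "s \<in> {0..T}"
    for A and \<Phi> :: "real \<Rightarrow> real^'n^'n" and s
  proof
    have "inj ((*v) (\<Phi> s))"
    proof (rule injI)
      fix x y assume "\<Phi> s *v x = \<Phi> s *v y"
      then have "\<Phi> s *v (x - y) = 0" by (simp add: matrix_vector_mult_diff_distrib)
      then show "x = y" using lower[OF ode s, of "x - y"] by simp
    qed
    then show i: "invertible (\<Phi> s)"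
      using matrix_left_invertible_injective[of "\<Phi> s"] invertible_left_inverse by blast
    have "norm (matrix_inv (\<Phi> s) *v w) \<le> 2 * exp (2 * c * T) * norm w" for w
      using lower[OF ode s, of "matrix_inv (\<Phi> s) *v w"]
      by (simp add: matrix_vector_mul_assoc matrix_inv_inverse[OF i])
    then show "norm (matrix_inv (\<Phi> s)) \<le> K2"
      unfolding K2_def by (rule norm_matrix_le_of_operator_bound)
  qed
  have lip: "norm (\<Phi> s - \<Phi> r) \<le> c * K1 * (s - r)" if ode: "linear_ode c T A \<Phi>" and rs: "0 \<le> r" "r \<le> s" "s \<le> T"
    for A and \<Phi> :: "real \<Rightarrow> real^'n^'n" and r s
  proof -
    have Ab: "AE s in lborel. s \<in> {0..T} \<longrightarrow> norm (A s) \<le> c" using ode by (auto simp: linear_ode_def)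
    have "norm (LINT x:{r..s}|lborel. A x ** \<Phi> x) \<le> (LINT x:{r..s}|lborel. c * K1)"
    proof (rule norm_set_integral_ode_le)
      show "set_integrable lborel {r..s} (\<lambda>x. A x ** \<Phi> x)" using linear_ode_integrable[OF ode] rs c by auto
      show "set_integrable lborel {r..s} (\<lambda>r. c * K1)" by (intro borel_integrable_atLeastAtMost' continuous_intros)
      show "AE x in lborel. x \<in> {r..s} \<longrightarrow> norm (A x ** \<Phi> x) \<le> c * K1"
        using Ab by eventually_elim
          (use rs c \<Phi>_bound[OF ode] in \<open>auto intro!: order_trans[OF norm_matrix_matrix_mult_le] mult_mono\<close>)
    qed
    also have "\<dots> = c * K1 * (s - r)" using rs by (simp add: set_lebesgue_integral_def)
    finally show ?thesis using linear_ode_diff[OF ode rs c] by simp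
  qed
  show thesis
  proof (rule that[OF K'(5)])
    fix A and \<Phi> :: "real \<Rightarrow> real^'n^'n" and s assume ode: "linear_ode c T A \<Phi>" and s: "s \<in> {0..T}"
    show "invertible (\<Phi> s) \<and> norm (\<Phi> s) \<le> K \<and> norm (matrix_inv (\<Phi> s)) \<le> K"
      using \<Phi>_bound[OF ode s] inv[OF ode s] K' by linarith
  next
    fix A and \<Phi> :: "real \<Rightarrow> real^'n^'n" and r s assume ode: "linear_ode c T A \<Phi>" and rs: "0 \<le> r" "r \<le> s" "s \<le> T"
    let ?\<Psi> = "\<lambda>s. matrix_inv (\<Phi> s)"
    have r: "r \<in> {0..T}" and s: "s \<in> {0..T}" using rs by auto
    note L = lip[OF ode rs]
    \<comment> \<open>The resolvent identity passes the Lipschitz estimate on to the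
      inverse.\<close>
    have "?\<Psi> s - ?\<Psi> r = ?\<Psi> s ** (\<Phi> r - \<Phi> s) ** ?\<Psi> r"
      using matrix_inv_inverse[of "\<Phi> s"] matrix_inv_inverse[of "\<Phi> r"] inv[OF ode r] inv[OF ode s]
      by (simp add: bounded_bilinear.diff_right[OF bounded_bilinear_matrix_matrix_mult]
          bounded_bilinear.diff_left[OF bounded_bilinear_matrix_matrix_mult] matrix_mul_assoc[symmetric])
    then have "norm (?\<Psi> s - ?\<Psi> r) \<le> norm (?\<Psi> s) * norm (\<Phi> r - \<Phi> s) * norm (?\<Psi> r)"
      by (metis (no_types, lifting) norm_matrix_matrix_mult_le mult_right_mono norm_ge_zero order_trans)
    also have "\<dots> \<le> K2 * (c * K1 * (s - r)) * K2"
      using L inv[OF ode r] inv[OF ode s] K c rs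
      by (intro mult_mono mult_nonneg_nonneg) (auto simp: norm_minus_commute)
    also have "\<dots> = K2 * (c * K1) * K2 * (s - r)" by simp
    also have "\<dots> \<le> K * (s - r)" using K' rs by (intro mult_right_mono) auto
    finally show "norm (\<Phi> s - \<Phi> r) \<le> K * (s - r) \<and> norm (?\<Psi> s - ?\<Psi> r) \<le> K * (s - r)"
      using L mult_right_mono[OF K'(3), of "s - r"] rs by auto
  qed
qed

section \<open>Cadlag paths and noise increments\<close>

lemma cadlag_left_limit:
  fixes f :: "real \<Rightarrow> 'x::t2_space"
  assumes "cadlag_on a b f" "s \<in> {a<..b}"
  shows "(f \<longlongrightarrow> Lim (at_left s) f) (at_left s)"
proof -
  obtain l where l: "(f \<longlongrightarrow> l) (at_left s)" using assms unfolding cadlag_on_def by blast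
  then have "Lim (at_left s) f = l" by (intro tendsto_Lim) auto
  with l show ?thesis by simp
qed

text \<open>Near a limit point of large jumps the path would be close to a one-sided limit on a whole
  one-sided neighbourhood.\<close>

lemma cadlag_finite_large_jumps:
  fixes f :: "real \<Rightarrow> 'x::metric_space"
  assumes cad: "cadlag_on a b f" and e: "0 < e"
  shows "finite {s\<in>{a<..b}. e < dist (f s) (Lim (at_left s) f)}" (is "finite ?D")
proof (rule ccontr)
  assume inf: "infinite ?D"
  have "?D \<subseteq> {a..b}" by auto
  from Heine_Borel_imp_Bolzano_Weierstrass[OF compact_Icc inf this]
  obtain x where x: "x \<in> {a..b}" "x islimpt ?D" by blast
  have close: "dist (f s) (Lim (at_left s) f) \<le> e"
    if s: "s \<in> {a<..b}" and uv: "u < s" "s < v" and near: "\<And>r. u < r \<Longrightarrow> r < v \<Longrightarrow> dist (f r) l < e / 2" for s u v l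
  proof -
    have "eventually (\<lambda>r. u < r \<and> r < s) (at_left s)"
      using uv(1) by (auto simp: eventually_at_left_field)
    then have "eventually (\<lambda>r. dist (f r) l \<le> e / 2) (at_left s)"
      by eventually_elim (use near uv(2) in \<open>auto intro: less_imp_le\<close>)
    then have "dist (Lim (at_left s) f) l \<le> e / 2"
      by (intro tendsto_upperbound[OF tendsto_dist[OF cadlag_left_limit[OF cad s] tendsto_const]]) auto
    moreover have "dist (f s) l < e / 2" using near[of s] uv by simp
    ultimately show ?thesis
      using dist_triangle2[of "f s" "Lim (at_left s) f" l] by linarith
  qed
  have "\<exists>v>x. \<forall>s. x < s \<and> s < v \<longrightarrow> s \<notin> ?D"
  proof (cases "x < b")
    case True
    then have "(f \<longlongrightarrow> f x) (at_right x)" using cad x unfolding cadlag_on_def by auto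
    then have "eventually (\<lambda>r. dist (f r) (f x) < e / 2) (at_right x)" using e by (intro tendstoD) auto
    then obtain v where v: "v > x" "\<And>r. x < r \<Longrightarrow> r < v \<Longrightarrow> dist (f r) (f x) < e / 2"
      unfolding eventually_at_right_field by blast
    show ?thesis
      using close[of _ x v "f x"] v x(1) True by (intro exI[of _ "min v b"]) (auto simp: not_less)
  next
    case False
    then show ?thesis using x by (intro exI[of _ "x + 1"]) auto
  qed
  then obtain v where v: "x < v" "\<And>s. x < s \<Longrightarrow> s < v \<Longrightarrow> s \<notin> ?D" by blast
  have "\<exists>u<x. \<forall>s. u < s \<and> s < x \<longrightarrow> s \<notin> ?D"
  proof (cases "a < x")
    case True
    then have "x \<in> {a<..b}" using x(1) by auto
    then obtain l where "(f \<longlongrightarrow> l) (at_left x)" using cad unfolding cadlag_on_def by blast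
    then have "eventually (\<lambda>r. dist (f r) l < e / 2) (at_left x)" using e by (intro tendstoD) auto
    then obtain u where u: "u < x" "\<And>r. u < r \<Longrightarrow> r < x \<Longrightarrow> dist (f r) l < e / 2"
      unfolding eventually_at_left_field by blast
    show ?thesis
      using close[of _ u x l] u x(1) True by (intro exI[of _ "max u a"]) (auto simp: not_less)
  next
    case False
    then show ?thesis using x by (intro exI[of _ "x - 1"]) auto
  qed
  then obtain u where u: "u < x" "\<And>s. u < s \<Longrightarrow> s < x \<Longrightarrow> s \<notin> ?D" by blast
  have "x \<in> {u<..<v}" "open {u<..<v}" using u v by auto
  then obtain s where "s \<in> ?D" "s \<in> {u<..<v}" "s \<noteq> x" using x(2) unfolding islimpt_def by blast
  then show False using u(2)[of s] v(2)[of s] by (cases "s < x") auto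
qed

lemma cadlag_countable_jumps:
  fixes f :: "real \<Rightarrow> 'x::metric_space"
  assumes "cadlag_on a b f"
  shows "countable {s\<in>{a<..b}. f s \<noteq> Lim (at_left s) f}"
proof -
  have "{s\<in>{a<..b}. f s \<noteq> Lim (at_left s) f}
      \<subseteq> (\<Union>n. {s\<in>{a<..b}. inverse (real (Suc n)) < dist (f s) (Lim (at_left s) f)})"
  proof safe
    fix s assume s: "s \<in> {a<..b}" "f s \<noteq> Lim (at_left s) f"
    then have "0 < dist (f s) (Lim (at_left s) f)" by simp
    then obtain n where "inverse (real (Suc n)) < dist (f s) (Lim (at_left s) f)" using reals_Archimedean by blast
    then show "s \<in> (\<Union>n. {s\<in>{a<..b}. inverse (real (Suc n)) < dist (f s) (Lim (at_left s) f)})" using s by auto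
  qed
  then show ?thesis
    by (rule countable_subset)
       (intro countable_UN countableI_type countable_finite cadlag_finite_large_jumps assms, simp)
qed

text \<open>Right-continuity makes each value the limit of the values at the next grid point to the
  right, and evaluation at a grid point is a distinction of countably many cases in time.\<close>

lemma cadlag_joint_measurable:
  fixes X :: "real \<Rightarrow> 'w \<Rightarrow> 'x::euclidean_space"
  assumes X: "\<And>s. s \<in> {a..b} \<Longrightarrow> X s \<in> borel_measurable M"
    and cad: "\<And>\<omega>. \<omega> \<in> space M \<Longrightarrow> cadlag_on a b (\<lambda>s. X s \<omega>)" and ab: "a \<le> b"
  shows "(\<lambda>(\<omega>, s). indicator {a..b} s *\<^sub>R X s \<omega>) \<in> borel_measurable (M \<Otimes>\<^sub>M lborel)"
proof (rule borel_measurable_LIMSEQ_metric)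
  \<comment> \<open>With \<open>i\<close> the integer part of \<open>s * real (Suc n)\<close> this
    is the right end of the grid cell of \<open>s\<close>: strictly greater than \<open>s\<close> if
    \<open>s < b\<close>, as the right limit demands, and by clipping equal to \<open>b\<close> if
    \<open>s = b\<close>.\<close>
  define d where "d n i = max a (min b ((real_of_int i + 1) / real (Suc n)))" for n :: nat and i :: int
  have d: "d n i \<in> {a..b}" for n i using ab by (auto simp: d_def)
  let ?f = "\<lambda>n x. indicator {a..b} (snd x) *\<^sub>R X (d n \<lfloor>snd x * real (Suc n)\<rfloor>) (fst x)"
  show "?f n \<in> borel_measurable (M \<Otimes>\<^sub>M lborel)" for n
  proof (intro borel_measurable_scaleR)
    show "(\<lambda>x. X (d n \<lfloor>snd x * real (Suc n)\<rfloor>) (fst x)) \<in> borel_measurable (M \<Otimes>\<^sub>M (lborel :: real measure))"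
    proof (rule measurable_compose_countable[where g = "\<lambda>x. \<lfloor>snd x * real (Suc n)\<rfloor>"])
      show "(\<lambda>x. X (d n i) (fst x)) \<in> borel_measurable (M \<Otimes>\<^sub>M (lborel :: real measure))" for i
        by (rule measurable_compose[OF measurable_fst X[OF d]])
      show "(\<lambda>x. \<lfloor>snd x * real (Suc n)\<rfloor>) \<in> measurable (M \<Otimes>\<^sub>M (lborel :: real measure)) (count_space UNIV)"
        by measurable
    qed
  qed measurable
  fix x assume "x \<in> space (M \<Otimes>\<^sub>M (lborel :: real measure))"
  then obtain \<omega> s where x: "x = (\<omega>, s)" "\<omega> \<in> space M" by (auto simp: space_pair_measure)
  have "(\<lambda>n. X (d n \<lfloor>s * real (Suc n)\<rfloor>) \<omega>) \<longlonglongrightarrow> X s \<omega>" if s: "s \<in> {a..b}"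
  proof (cases "s = b")
    case True
    have "d n \<lfloor>s * real (Suc n)\<rfloor> = b" for n
    proof -
      have "s * real (Suc n) < real_of_int \<lfloor>s * real (Suc n)\<rfloor> + 1" by linarith
      then have "s < (real_of_int \<lfloor>s * real (Suc n)\<rfloor> + 1) / real (Suc n)" by (simp add: pos_less_divide_eq)
      then show ?thesis using True ab by (simp add: d_def)
    qed
    then show ?thesis using True by simp
  next
    case False
    with s have sb: "s < b" "a \<le> s" by auto
    have lim: "((\<lambda>s. X s \<omega>) \<longlongrightarrow> X s \<omega>) (at_right s)"
      using cad[OF x(2)] sb unfolding cadlag_on_def by auto
    have gt: "s < d n \<lfloor>s * real (Suc n)\<rfloor>" and le: "d n \<lfloor>s * real (Suc n)\<rfloor> \<le> s + inverse (real (Suc n))" for n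
    proof -
      have "s * real (Suc n) < real_of_int \<lfloor>s * real (Suc n)\<rfloor> + 1" "real_of_int \<lfloor>s * real (Suc n)\<rfloor> \<le> s * real (Suc n)" by linarith+
      then have 1: "s < (real_of_int \<lfloor>s * real (Suc n)\<rfloor> + 1) / real (Suc n)"
        and 2: "(real_of_int \<lfloor>s * real (Suc n)\<rfloor> + 1) / real (Suc n) \<le> (s * real (Suc n) + 1) / real (Suc n)"
        by (auto simp: pos_less_divide_eq intro!: divide_right_mono)
      have "(s * real (Suc n) + 1) / real (Suc n) = s + inverse (real (Suc n))" by (simp add: add_divide_distrib inverse_eq_divide del: of_nat_Suc)
      with 2 have 2: "(real_of_int \<lfloor>s * real (Suc n)\<rfloor> + 1) / real (Suc n) \<le> s + inverse (real (Suc n))" by simp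
      show "s < d n \<lfloor>s * real (Suc n)\<rfloor>" using 1 sb by (auto simp: d_def)
      have "a \<le> s + inverse (real (Suc n))" using sb by (simp add: add_increasing2)
      then show "d n \<lfloor>s * real (Suc n)\<rfloor> \<le> s + inverse (real (Suc n))" using 2 by (auto simp: d_def)
    qed
    have "(\<lambda>n. d n \<lfloor>s * real (Suc n)\<rfloor>) \<longlonglongrightarrow> s"
    proof (rule tendsto_sandwich[OF _ _ tendsto_const])
      have "(\<lambda>n. s + inverse (real (Suc n))) \<longlonglongrightarrow> s + 0" by (intro tendsto_intros LIMSEQ_inverse_real_of_nat)
      then show "(\<lambda>n. s + inverse (real (Suc n))) \<longlonglongrightarrow> s" by simp
    qed (use gt le in \<open>auto intro!: always_eventually less_imp_le\<close>)
    moreover have "\<forall>n. d n \<lfloor>s * real (Suc n)\<rfloor> \<in> {s<..} \<and> d n \<lfloor>s * real (Suc n)\<rfloor> \<noteq> s"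
      by (intro allI conjI) (rule greaterThan_iff[THEN iffD2, OF gt], rule less_imp_neq[OF gt, THEN not_sym])
    ultimately have "filterlim (\<lambda>n. d n \<lfloor>s * real (Suc n)\<rfloor>) (at_right s) sequentially"
      unfolding filterlim_at by (metis (mono_tags, lifting) always_eventually)
    then show ?thesis by (rule filterlim_compose[OF lim])
  qed
  then show "(\<lambda>n. ?f n x) \<longlonglongrightarrow> (case x of (\<omega>, s) \<Rightarrow> indicator {a..b} s *\<^sub>R X s \<omega>)"
    by (cases "s \<in> {a..b}") (auto simp: x)
qed

lemma AE_pair_swap:
  assumes "sigma_finite_measure A" "sigma_finite_measure B" and AE: "AE (x, y) in A \<Otimes>\<^sub>M B. P x y"
  shows "AE (y, x) in B \<Otimes>\<^sub>M A. P x y" and "AE x in A. AE y in B. P x y" and "AE y in B. AE x in A. P x y"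
proof -
  interpret pair_sigma_finite A B using assms by (intro pair_sigma_finite.intro)
  interpret Q: pair_sigma_finite B A using assms by (intro pair_sigma_finite.intro)
  have "AE z in distr (B \<Otimes>\<^sub>M A) (A \<Otimes>\<^sub>M B) (\<lambda>(x, y). (y, x)). case z of (x, y) \<Rightarrow> P x y"
    using AE unfolding distr_pair_swap[symmetric] .
  from AE_distrD[OF _ this] show swap: "AE (y, x) in B \<Otimes>\<^sub>M A. P x y"
    by (simp add: case_prod_unfold measurable_pair_swap')
  show "AE x in A. AE y in B. P x y" using AE_pair[OF AE] by simp
  show "AE y in B. AE x in A. P x y" using Q.AE_pair[OF swap] by simp
qed

lemma sum_list_eq_zero: "(\<And>x. x \<in> set xs \<Longrightarrow> f x = 0) \<Longrightarrow> (\<Sum>x\<leftarrow>xs. f x) = (0::real)"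
  by (induction xs) auto

section \<open>Increments of the sum of the two stochastic integrals\<close>

context lq_noise
begin

text \<open>The approximations of the first integral carry only Brownian marks and those of the
  second only jump marks. Every covariance in their \<open>overlap_sum\<close> is therefore 0, and
  this passes to the limit.\<close>

lemma orthogonal_approximations:
  assumes I: "approximates t L I" "\<And>k a b j \<xi>. (a, b, j, \<xi>) \<in> set (L k) \<Longrightarrow> j = None"
    and I': "approximates t L' I'" "\<And>k a b j \<xi>. (a, b, j, \<xi>) \<in> set (L' k) \<Longrightarrow> j \<noteq> None"
    and s: "0 \<le> t" "t \<le> s1" "s1 \<le> s2" "s2 \<le> T"
  shows "(\<integral>\<omega>. (I s2 \<omega> - I s1 \<omega>) \<bullet> (I' s2 \<omega> - I' s1 \<omega>) \<partial>M) = 0"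
proof -
  let ?f = "\<lambda>k. EI (clamp_list s1 s2 (L k))" and ?g = "\<lambda>k. EI (clamp_list s1 s2 (L' k))"
  have ok: "EI_ok 0 (clamp_list s1 s2 (L k))" "EI_ok 0 (clamp_list s1 s2 (L' k))" for k
  proof -
    have "EI_ok s1 (clamp_list s1 s2 (L k))" "EI_ok s1 (clamp_list s1 s2 (L' k))"
      using I(1) I'(1) s unfolding approximates_def by (auto intro!: EI_ok_clamp)
    then show "EI_ok 0 (clamp_list s1 s2 (L k))" "EI_ok 0 (clamp_list s1 s2 (L' k))"
      using s unfolding EI_ok_def by fastforce+
  qed
  have sq: "square_integrable M (\<lambda>\<omega>. I s2 \<omega> - I s1 \<omega>)" "square_integrable M (\<lambda>\<omega>. I' s2 \<omega> - I' s1 \<omega>)"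
    using I(1) I'(1) s unfolding approximates_def by (auto intro!: square_integrable_diff)
  have "(\<lambda>k. \<integral>\<omega>. ?f k \<omega> \<bullet> ?g k \<omega> \<partial>M) \<longlonglongrightarrow> (\<integral>\<omega>. (I s2 \<omega> - I s1 \<omega>) \<bullet> (I' s2 \<omega> - I' s1 \<omega>) \<partial>M)"
  proof (rule square_integrable_limit_inner)
    show "(\<lambda>k. \<integral>\<^sup>+x. ennreal ((norm (?f k x - (I s2 x - I s1 x)))\<^sup>2) \<partial>M) \<longlonglongrightarrow> 0"
      "(\<lambda>k. \<integral>\<^sup>+x. ennreal ((norm (?g k x - (I' s2 x - I' s1 x)))\<^sup>2) \<partial>M) \<longlonglongrightarrow> 0"
      using I(1) I'(1) s unfolding approximates_def by auto
  qed (use ok sq in \<open>auto intro: EI_square_integrable square_integrable_measurable\<close>)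
  moreover have "(\<integral>\<omega>. ?f k \<omega> \<bullet> ?g k \<omega> \<partial>M) = 0" for k
  proof -
    have n: "j = None" if "(a, b, j, \<xi>) \<in> set (clamp_list s1 s2 (L k))" for a b j \<xi>
      using that I(2) by (auto simp: clamp_list_def)
    have n': "j \<noteq> None" if "(a, b, j, \<xi>) \<in> set (clamp_list s1 s2 (L' k))" for a b j \<xi>
      using that I'(2) by (auto simp: clamp_list_def)
    have "overlap_sum (clamp_list s1 s2 (L k)) (clamp_list s1 s2 (L' k)) = 0"
      unfolding overlap_sum_def
    proof (rule sum_list_eq_zero)
      fix x assume x: "x \<in> set (clamp_list s1 s2 (L k))"
      show "(\<Sum>y\<leftarrow>clamp_list s1 s2 (L' k). (case x of (a, b, j, \<xi>) \<Rightarrow> case y of (a', b', k, \<xi>') \<Rightarrow>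
         max 0 (min b b' - max a a') * cov j k * (\<integral>\<omega>. \<xi> \<omega> \<bullet> \<xi>' \<omega> \<partial>M))) = 0"
      proof (rule sum_list_eq_zero)
        fix y assume y: "y \<in> set (clamp_list s1 s2 (L' k))"
        obtain a b j \<xi> a' b' j' \<xi>' where xy: "x = (a, b, j, \<xi>)" "y = (a', b', j', \<xi>')" by (cases x, cases y)
        have "cov j j' = 0" using n[OF x[unfolded xy]] n'[OF y[unfolded xy]] by (auto simp: cov_def)
        then show "(case x of (a, b, j, \<xi>) \<Rightarrow> case y of (a', b', k, \<xi>') \<Rightarrow>
         max 0 (min b b' - max a a') * cov j k * (\<integral>\<omega>. \<xi> \<omega> \<bullet> \<xi>' \<omega> \<partial>M)) = 0" by (simp add: xy)
      qed
    qed
    then show ?thesis using EI_inner[OF ok(1)[of k] ok(2)[of k]] by (simp add: has_bochner_integral_iff)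
  qed
  ultimately show ?thesis by (simp add: LIMSEQ_const_iff)
qed

text \<open>The rate at which the second moment of the two stochastic integrals together grows. It
  is kept as an extended number because finiteness is known only for almost every time.\<close>

definition noise_density :: "(real \<Rightarrow> 'w \<Rightarrow> 'x::euclidean_space) \<Rightarrow> (real \<Rightarrow> 'w \<Rightarrow> 'z \<Rightarrow> 'x) \<Rightarrow> real \<Rightarrow> ennreal" where
  "noise_density HW HN s = (\<integral>\<^sup>+\<omega>. (ennreal ((norm (HW s \<omega>))\<^sup>2) + (\<integral>\<^sup>+z. ennreal ((norm (HN s \<omega> z))\<^sup>2) \<partial>\<Lambda>)) \<partial>M)"

text \<open>Collects what the growth estimate uses of stochastic integration. The cross term of the
  two integrals drops out by \<open>orthogonal_approximations\<close>, so the densities of the two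
  isometries simply add.\<close>

lemma noise_increments:
  fixes HW IW IN :: "real \<Rightarrow> 'w \<Rightarrow> 'x::euclidean_space"
  assumes t: "0 \<le> t" and W: "is_integral_W M T \<F> W t HW IW" and NN: "is_integral_N M T \<Lambda> \<F> N t HN IN"
  defines "I \<equiv> \<lambda>s \<omega>. IW s \<omega> + IN s \<omega>"
  shows "\<And>s. s \<in> {t..T} \<Longrightarrow> square_integrable M (I s)"
    and "\<And>s. s \<in> {t..T} \<Longrightarrow> I s \<in> borel_measurable (\<F> s)"
    and "(\<lambda>s. indicator {t<..T} s * noise_density HW HN s) \<in> borel_measurable lborel"
    and "\<And>s1 s2. t \<le> s1 \<Longrightarrow> s1 \<le> s2 \<Longrightarrow> s2 \<le> T \<Longrightarrow>
       (\<integral>\<^sup>+s\<in>{s1<..s2}. noise_density HW HN s \<partial>lborel) = ennreal (\<integral>\<omega>. (norm (I s2 \<omega> - I s1 \<omega>))\<^sup>2 \<partial>M)"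
    and "\<And>s1 s2 \<eta>. t \<le> s1 \<Longrightarrow> s1 \<le> s2 \<Longrightarrow> s2 \<le> T \<Longrightarrow> square_integrable M \<eta> \<Longrightarrow> \<eta> \<in> borel_measurable (\<F> s1) \<Longrightarrow>
       (\<integral>\<omega>. \<eta> \<omega> \<bullet> (I s2 \<omega> - I s1 \<omega>) \<partial>M) = 0"
proof -
  obtain L where L: "approximates t L IW" "\<And>k a b j \<xi>. (a, b, j, \<xi>) \<in> set (L k) \<Longrightarrow> j = None"
    using is_integral_W_limit(2)[OF t W] by blast
  obtain L' where L': "approximates t L' IN" "\<And>k a b j \<xi>. (a, b, j, \<xi>) \<in> set (L' k) \<Longrightarrow> j \<noteq> None"
    using is_integral_N_limit(2)[OF t NN] by blast
  have sqW: "square_integrable M (IW s)" and sqN: "square_integrable M (IN s)" if "s \<in> {t..T}" for s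
    using L(1) L'(1) that unfolding approximates_def by auto
  show "square_integrable M (I s)" if "s \<in> {t..T}" for s
    unfolding I_def using sqW[OF that] sqN[OF that] by (rule square_integrable_add(1))
  show "I s \<in> borel_measurable (\<F> s)" if "s \<in> {t..T}" for s
  proof -
    have "IW s \<in> borel_measurable (\<F> s)" "IN s \<in> borel_measurable (\<F> s)"
      using W NN that unfolding is_integral_W_def is_integral_N_def by blast+
    then show ?thesis unfolding I_def by (rule borel_measurable_add)
  qed
  interpret MT: pair_sigma_finite M "lborel :: real measure" ..
  let ?w = "\<lambda>\<omega> s. indicator {t<..T} s *\<^sub>R HW s \<omega>" and ?n = "\<lambda>\<omega> s z. indicator {t<..T} s *\<^sub>R HN s \<omega> z"
  have wm: "(\<lambda>(\<omega>, s). ?w \<omega> s) \<in> borel_measurable (M \<Otimes>\<^sub>M lborel)" by (rule is_integral_W_limit(1)[OF t W])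
  have nm: "(\<lambda>((\<omega>, s), z). ?n \<omega> s z) \<in> borel_measurable ((M \<Otimes>\<^sub>M lborel) \<Otimes>\<^sub>M \<Lambda>)" by (rule is_integral_N_limit(1)[OF t NN])
  have sq: "(\<lambda>v::'x. ennreal ((norm v)\<^sup>2)) \<in> borel_measurable borel" by measurable
  define qw where "qw x = ennreal ((norm (?w (fst x) (snd x)))\<^sup>2)" for x
  define qn' where "qn' y = ennreal ((norm (?n (fst (fst y)) (snd (fst y)) (snd y)))\<^sup>2)" for y
  define qn where "qn x = (\<integral>\<^sup>+z. qn' (x, z) \<partial>\<Lambda>)" for x
  have qw: "qw \<in> borel_measurable (M \<Otimes>\<^sub>M lborel)"
    using measurable_compose[OF wm sq] by (simp add: qw_def[abs_def] case_prod_unfold)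
  have qn': "qn' \<in> borel_measurable ((M \<Otimes>\<^sub>M lborel) \<Otimes>\<^sub>M \<Lambda>)"
    using measurable_compose[OF nm sq] by (simp add: qn'_def[abs_def] case_prod_unfold)
  have qn: "qn \<in> borel_measurable (M \<Otimes>\<^sub>M lborel)"
    unfolding qn_def[abs_def] by (rule \<Lambda>.borel_measurable_nn_integral_fst[OF qn'])
  note [measurable] = qw qn
  have dens: "indicator {t<..T} s * noise_density HW HN s = (\<integral>\<^sup>+\<omega>. qw (\<omega>, s) + qn (\<omega>, s) \<partial>M)" for s
    by (auto simp: noise_density_def qw_def qn_def qn'_def indicator_def)
  have "(\<lambda>s. \<integral>\<^sup>+\<omega>. qw (\<omega>, s) + qn (\<omega>, s) \<partial>M) \<in> borel_measurable lborel" by measurable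
  then show "(\<lambda>s. indicator {t<..T} s * noise_density HW HN s) \<in> borel_measurable lborel"
    by (simp add: dens)
  fix s1 s2 assume s: "t \<le> s1" "s1 \<le> s2" "s2 \<le> T"
  then have s': "s1 \<in> {t..T}" "s2 \<in> {t..T}" by auto
  show "(\<integral>\<^sup>+s\<in>{s1<..s2}. noise_density HW HN s \<partial>lborel) = ennreal (\<integral>\<omega>. (norm (I s2 \<omega> - I s1 \<omega>))\<^sup>2 \<partial>M)"
  proof -
    let ?i = "\<lambda>s. indicator {s1<..s2} s :: ennreal"
    have "(\<integral>\<^sup>+s\<in>{s1<..s2}. noise_density HW HN s \<partial>lborel) = (\<integral>\<^sup>+s. \<integral>\<^sup>+\<omega>. (qw (\<omega>, s) + qn (\<omega>, s)) * ?i s \<partial>M \<partial>lborel)"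
    proof (rule nn_integral_cong)
      fix s :: real
      have m: "(\<lambda>\<omega>. qw (\<omega>, s) + qn (\<omega>, s)) \<in> borel_measurable M"
        by (rule measurable_compose[of "\<lambda>\<omega>. (\<omega>, s)" M "M \<Otimes>\<^sub>M lborel"]) measurable
      have "noise_density HW HN s * ?i s = (indicator {t<..T} s * noise_density HW HN s) * ?i s"
        using s by (auto simp: indicator_def)
      also have "\<dots> = (\<integral>\<^sup>+\<omega>. (qw (\<omega>, s) + qn (\<omega>, s)) * ?i s \<partial>M)"
        unfolding dens by (rule nn_integral_multc[OF m, symmetric])
      finally show "noise_density HW HN s * ?i s = (\<integral>\<^sup>+\<omega>. (qw (\<omega>, s) + qn (\<omega>, s)) * ?i s \<partial>M)" .
    qed
    also have "\<dots> = (\<integral>\<^sup>+x. (qw x + qn x) * ?i (snd x) \<partial>(M \<Otimes>\<^sub>M lborel))"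
      by (subst MT.nn_integral_snd[symmetric]) auto
    also have "\<dots> = (\<integral>\<^sup>+x. qw x * ?i (snd x) \<partial>(M \<Otimes>\<^sub>M lborel)) + (\<integral>\<^sup>+x. qn x * ?i (snd x) \<partial>(M \<Otimes>\<^sub>M lborel))"
      by (simp add: distrib_right nn_integral_add)
    also have "(\<integral>\<^sup>+x. qw x * ?i (snd x) \<partial>(M \<Otimes>\<^sub>M lborel)) = ennreal (\<integral>\<omega>. (norm (IW s2 \<omega> - IW s1 \<omega>))\<^sup>2 \<partial>M)"
      unfolding is_integral_W_limit(3)[OF t W s, symmetric]
      using s by (intro nn_integral_cong) (auto simp: qw_def indicator_def)
    also have "(\<integral>\<^sup>+x. qn x * ?i (snd x) \<partial>(M \<Otimes>\<^sub>M lborel)) = (\<integral>\<^sup>+x. \<integral>\<^sup>+z. qn' (x, z) * ?i (snd x) \<partial>\<Lambda> \<partial>(M \<Otimes>\<^sub>M lborel))"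
    proof (rule nn_integral_cong)
      fix x assume "x \<in> space (M \<Otimes>\<^sub>M (lborel :: real measure))"
      then have "(\<lambda>z. qn' (x, z)) \<in> borel_measurable \<Lambda>" by (intro measurable_compose[OF _ qn']) auto
      then show "qn x * ?i (snd x) = (\<integral>\<^sup>+z. qn' (x, z) * ?i (snd x) \<partial>\<Lambda>)"
        unfolding qn_def by (rule nn_integral_multc[symmetric])
    qed
    also have "\<dots> = (\<integral>\<^sup>+y. qn' y * ?i (snd (fst y)) \<partial>((M \<Otimes>\<^sub>M lborel) \<Otimes>\<^sub>M \<Lambda>))"
    proof -
      have "(\<lambda>y. qn' y * ?i (snd (fst y))) \<in> borel_measurable ((M \<Otimes>\<^sub>M lborel) \<Otimes>\<^sub>M \<Lambda>)"
        using qn' by measurable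
      from \<Lambda>.nn_integral_fst[OF this] show ?thesis by simp
    qed
    also have "\<dots> = ennreal (\<integral>\<omega>. (norm (IN s2 \<omega> - IN s1 \<omega>))\<^sup>2 \<partial>M)"
      unfolding is_integral_N_limit(3)[OF t NN s, symmetric]
      using s by (intro nn_integral_cong) (auto simp: qn'_def indicator_def)
    also have "ennreal (\<integral>\<omega>. (norm (IW s2 \<omega> - IW s1 \<omega>))\<^sup>2 \<partial>M) + ennreal (\<integral>\<omega>. (norm (IN s2 \<omega> - IN s1 \<omega>))\<^sup>2 \<partial>M)
       = ennreal (\<integral>\<omega>. (norm ((IW s2 \<omega> - IW s1 \<omega>) + (IN s2 \<omega> - IN s1 \<omega>)))\<^sup>2 \<partial>M)"
      using integral_norm_add_square[OF square_integrable_diff[OF sqW[OF s'(2)] sqW[OF s'(1)]] square_integrable_diff[OF sqN[OF s'(2)] sqN[OF s'(1)]]]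
        orthogonal_approximations[OF L L' t s] by (simp add: ennreal_plus)
    finally show ?thesis by (simp add: I_def algebra_simps)
  qed
  fix \<eta> :: "'w \<Rightarrow> 'x" assume \<eta>: "square_integrable M \<eta>" "\<eta> \<in> borel_measurable (\<F> s1)"
  have "(\<integral>\<omega>. \<eta> \<omega> \<bullet> (IW s2 \<omega> - IW s1 \<omega>) + \<eta> \<omega> \<bullet> (IN s2 \<omega> - IN s1 \<omega>) \<partial>M) = 0 + 0"
    using is_integral_W_limit(4)[OF t W s \<eta>] is_integral_N_limit(4)[OF t NN s \<eta>] sqW[OF s'(1)] sqW[OF s'(2)] sqN[OF s'(1)] sqN[OF s'(2)] \<eta>(1)
    by (subst Bochner_Integration.integral_add) (auto intro!: square_integrable_inner square_integrable_diff)
  then show "(\<integral>\<omega>. \<eta> \<omega> \<bullet> (I s2 \<omega> - I s1 \<omega>) \<partial>M) = 0" by (simp add: I_def inner_add_right inner_diff_right algebra_simps)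
qed

end

section \<open>Essential norms and time integrals\<close>

context prob_space
begin

text \<open>\<open>essnorm\<close> is a real number obtained from an extended one and has its
  intended meaning only if the essential supremum is finite; the bound \<open>b\<close> ensures
  this.\<close>

lemma essnorm_le:
  assumes "f \<in> borel_measurable M" "AE \<omega> in M. norm (f \<omega>) \<le> b"
  shows "0 \<le> essnorm M f" "essnorm M f \<le> b" "AE \<omega> in M. norm (f \<omega>) \<le> essnorm M f"
proof -
  let ?e = "esssup M (\<lambda>\<omega>. ereal (norm (f \<omega>)))"
  have m: "(\<lambda>\<omega>. ereal (norm (f \<omega>))) \<in> borel_measurable M" using assms(1) by measurable
  have le: "?e \<le> ereal b" using assms(2) by (intro esssup_I m) auto
  have "esssup M (\<lambda>_. 0 :: ereal) \<le> ?e" by (intro esssup_mono) auto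
  then have ge: "0 \<le> ?e" by (simp add: esssup_const emeasure_space_1)
  have e: "?e = ereal (essnorm M f)"
    unfolding essnorm_def using le ge by (cases ?e) auto
  show "0 \<le> essnorm M f" "essnorm M f \<le> b" using le ge unfolding e by auto
  show "AE \<omega> in M. norm (f \<omega>) \<le> essnorm M f"
    using esssup_AE[of "\<lambda>\<omega>. ereal (norm (f \<omega>))" M] unfolding e by simp
qed

lemma essnorm_ge:
  assumes "f \<in> borel_measurable M" "AE \<omega> in M. norm (f \<omega>) \<le> b" "AE \<omega> in M. a \<le> norm (f \<omega>)"
  shows "a \<le> essnorm M f"
proof -
  have "AE \<omega> in M. a \<le> essnorm M f"
    using essnorm_le(3)[OF assms(1,2)] assms(3) by eventually_elim simp
  then show ?thesis by simp
qed

lemma essnorm_diff_le: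
  assumes "f \<in> borel_measurable M" "g \<in> borel_measurable M" "AE \<omega> in M. norm (g \<omega>) \<le> b"
    "AE \<omega> in M. norm (f \<omega> - g \<omega>) \<le> d"
  shows "essnorm M f \<le> essnorm M g + d"
proof (rule essnorm_le(2)[OF assms(1)])
  show "AE \<omega> in M. norm (f \<omega>) \<le> essnorm M g + d"
    using essnorm_le(3)[OF assms(2,3)] assms(4)
  proof eventually_elim
    case (elim \<omega>)
    then show ?case using norm_triangle_ineq2[of "f \<omega>" "g \<omega>"] by linarith
  qed
qed

text \<open>Cauchy-Schwarz in time. Together with \<open>time_square_bound\<close>, where
  \<open>d\<close> carries another factor \<open>b - a\<close>, it makes drift terms quadratically
  small on short intervals.\<close>

lemma time_integral_square:
  fixes A :: "real \<Rightarrow> 'a \<Rightarrow> real^'n^'n" and Y :: "real \<Rightarrow> 'a \<Rightarrow> real^'n"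
  assumes ab: "0 \<le> a" "a \<le> b" "b \<le> T" and c: "0 \<le> c" and d: "0 \<le> d"
    and A: "(\<lambda>(\<omega>, s). indicator {0..T} s *\<^sub>R A s \<omega>) \<in> borel_measurable (M \<Otimes>\<^sub>M lborel)"
    and A_le: "AE \<omega> in M. AE s in lborel. s \<in> {0..T} \<longrightarrow> norm (A s \<omega>) \<le> c"
    and Y: "(\<lambda>(\<omega>, s). indicator {a..b} s *\<^sub>R Y s \<omega>) \<in> borel_measurable (M \<Otimes>\<^sub>M lborel)"
    and Y_le: "(\<integral>\<^sup>+\<omega>. (\<integral>\<^sup>+s\<in>{a..b}. ennreal ((norm (Y s \<omega>))\<^sup>2) \<partial>lborel) \<partial>M) \<le> ennreal d"
  shows "square_integrable M (\<lambda>\<omega>. LINT s:{a..b}|lborel. A s \<omega> *v Y s \<omega>)"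
    and "(\<integral>\<omega>. (norm (LINT s:{a..b}|lborel. A s \<omega> *v Y s \<omega>))\<^sup>2 \<partial>M) \<le> c\<^sup>2 * (b - a) * d"
    and "AE \<omega> in M. set_integrable lborel {a..b} (\<lambda>s. A s \<omega> *v Y s \<omega>)"
proof -
  let ?a = "\<lambda>\<omega> s. indicator {0..T} s *\<^sub>R A s \<omega>" and ?y = "\<lambda>\<omega> s. indicator {a..b} s *\<^sub>R Y s \<omega>"
  let ?J = "\<lambda>\<omega>. LINT s:{a..b}|lborel. A s \<omega> *v Y s \<omega>"
  have eq: "indicator {a..b} s *\<^sub>R (A s \<omega> *v Y s \<omega>) = ?a \<omega> s *v ?y \<omega> s" for s \<omega>
    using ab by (auto simp: indicator_def bounded_bilinear.zero_right[OF bounded_bilinear_matrix_vector_mult])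
  have "(\<lambda>x. (case x of (\<omega>, s) \<Rightarrow> ?a \<omega> s) *v (case x of (\<omega>, s) \<Rightarrow> ?y \<omega> s)) \<in> borel_measurable (M \<Otimes>\<^sub>M lborel)"
    by (rule borel_measurable_matrix_vector_mult[OF A Y])
  then have fm: "(\<lambda>(\<omega>, s). indicator {a..b} s *\<^sub>R (A s \<omega> *v Y s \<omega>)) \<in> borel_measurable (M \<Otimes>\<^sub>M lborel)"
    unfolding eq by (simp add: case_prod_unfold)
  have J: "?J \<in> borel_measurable M"
    unfolding set_lebesgue_integral_def by (rule lborel.borel_measurable_lebesgue_integral[OF fm])
  define g where "g \<omega> = (\<integral>\<^sup>+s. ennreal ((norm (?y \<omega> s))\<^sup>2) \<partial>lborel)" for \<omega>
  have g_eq: "g \<omega> = (\<integral>\<^sup>+s\<in>{a..b}. ennreal ((norm (Y s \<omega>))\<^sup>2) \<partial>lborel)" for \<omega>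
    unfolding g_def by (intro nn_integral_cong) (auto simp: indicator_def)
  have sq: "(\<lambda>v::real^'n. ennreal ((norm v)\<^sup>2)) \<in> borel_measurable borel" by measurable
  have g: "g \<in> borel_measurable M"
    unfolding g_def[abs_def] using measurable_compose[OF Y sq]
    by (intro lborel.borel_measurable_nn_integral) (simp add: case_prod_unfold)
  have g_int: "(\<integral>\<^sup>+\<omega>. g \<omega> \<partial>M) \<le> ennreal d" using Y_le by (simp add: g_eq)
  then have "(\<integral>\<^sup>+\<omega>. g \<omega> \<partial>M) \<noteq> \<infinity>" using ennreal_less_top[of d] by (auto simp: top_unique)
  from nn_integral_PInf_AE[OF g this] have g_fin: "AE \<omega> in M. g \<omega> \<noteq> \<infinity>" .
  have main: "AE \<omega> in M. set_integrable lborel {a..b} (\<lambda>s. A s \<omega> *v Y s \<omega>) \<and>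
      ennreal ((norm (?J \<omega>))\<^sup>2) \<le> ennreal (c\<^sup>2 * (b - a)) * g \<omega>"
    using A_le g_fin AE_space
  proof eventually_elim
    case (elim \<omega>)
    note \<omega> = elim(3)
    have pm: "(\<lambda>s. (\<omega>, s)) \<in> measurable lborel (M \<Otimes>\<^sub>M lborel)" using \<omega> by simp
    have ym: "?y \<omega> \<in> borel_measurable lborel" using measurable_compose[OF pm Y] by simp
    have fm': "(\<lambda>s. indicator {a..b} s *\<^sub>R (A s \<omega> *v Y s \<omega>)) \<in> borel_measurable lborel"
      using measurable_compose[OF pm fm] by simp
    have y: "square_integrable lborel (?y \<omega>)"
      using elim(2) unfolding g_def square_integrable_iff_nn_integral[OF ym] infinity_ennreal_def less_top[symmetric] .
    have ny: "square_integrable lborel (\<lambda>s. norm (?y \<omega> s))"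
      using y measurable_compose[OF ym borel_measurable_norm] unfolding square_integrable_def by auto
    have one: "square_integrable lborel (indicator {a..b} :: real \<Rightarrow> real)"
    proof -
      have "(\<lambda>s. (norm (indicator {a..b} s :: real))\<^sup>2) = (indicator {a..b} :: real \<Rightarrow> real)"
        by (auto simp: indicator_def fun_eq_iff)
      then show ?thesis
        using ab unfolding square_integrable_def
        by (auto intro!: integrable_real_indicator simp: emeasure_lborel_Icc_eq)
    qed
    have i: "integrable lborel (\<lambda>s. norm (?y \<omega> s) * indicator {a..b} s)"
      using square_integrable_inner[OF ny one] by simp
    have bnd: "AE s in lborel. norm (indicator {a..b} s *\<^sub>R (A s \<omega> *v Y s \<omega>)) \<le> c * (norm (?y \<omega> s) * indicator {a..b} s)"
      using elim(1)
    proof eventually_elim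
      case (elim s)
      show ?case
      proof (cases "s \<in> {a..b}")
        case True
        then have "norm (A s \<omega>) \<le> c" using elim ab by auto
        then show ?thesis using True by (auto intro!: order_trans[OF norm_matrix_vector_mult_le] mult_right_mono)
      qed simp
    qed
    have int: "integrable lborel (\<lambda>s. indicator {a..b} s *\<^sub>R (A s \<omega> *v Y s \<omega>))"
    proof (rule Bochner_Integration.integrable_bound[OF _ fm'])
      show "integrable lborel (\<lambda>s. c * (norm (?y \<omega> s) * indicator {a..b} s))" using i by simp
      show "AE s in lborel. norm (indicator {a..b} s *\<^sub>R (A s \<omega> *v Y s \<omega>)) \<le> norm (c * (norm (?y \<omega> s) * indicator {a..b} s))"
        using bnd by eventually_elim (auto intro: order_trans)
    qed
    have "norm (?J \<omega>) \<le> (\<integral>s. norm (indicator {a..b} s *\<^sub>R (A s \<omega> *v Y s \<omega>)) \<partial>lborel)"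
      unfolding set_lebesgue_integral_def by (rule integral_norm_bound)
    also have "\<dots> \<le> (\<integral>s. c * (norm (?y \<omega> s) * indicator {a..b} s) \<partial>lborel)"
      using i by (intro integral_mono_AE integrable_norm int bnd) auto
    also have "\<dots> = c * (\<integral>s. norm (?y \<omega> s) \<bullet> indicator {a..b} s \<partial>lborel)" by simp
    finally have le: "norm (?J \<omega>) \<le> c * (\<integral>s. norm (?y \<omega> s) \<bullet> indicator {a..b} s \<partial>lborel)" .
    have "(norm (?J \<omega>))\<^sup>2 \<le> c\<^sup>2 * (\<integral>s. norm (?y \<omega> s) \<bullet> indicator {a..b} s \<partial>lborel)\<^sup>2"
      using power_mono[OF le norm_ge_zero, of 2] unfolding power_mult_distrib .
    also have "\<dots> \<le> c\<^sup>2 * ((\<integral>s. (norm (norm (?y \<omega> s)))\<^sup>2 \<partial>lborel) * (\<integral>s. (norm (indicator {a..b} s :: real))\<^sup>2 \<partial>lborel))"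
      by (intro mult_left_mono integral_cauchy_schwarz[OF ny one]) auto
    also have "(\<integral>s. (norm (indicator {a..b} s :: real))\<^sup>2 \<partial>lborel) = (\<integral>s. indicator {a..b} s \<partial>lborel)"
      by (intro Bochner_Integration.integral_cong) (auto simp: indicator_def)
    also have "\<dots> = b - a" using ab by simp
    finally have "(norm (?J \<omega>))\<^sup>2 \<le> (c\<^sup>2 * (b - a)) * (\<integral>s. (norm (?y \<omega> s))\<^sup>2 \<partial>lborel)" by (simp add: mult_ac)
    then have "ennreal ((norm (?J \<omega>))\<^sup>2) \<le> ennreal (c\<^sup>2 * (b - a)) * ennreal (\<integral>s. (norm (?y \<omega> s))\<^sup>2 \<partial>lborel)"
      using ab by (subst ennreal_mult[symmetric]) (auto simp: integral_nonneg_AE intro!: ennreal_leI)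
    also have "ennreal (\<integral>s. (norm (?y \<omega> s))\<^sup>2 \<partial>lborel) = g \<omega>"
      unfolding g_def by (rule square_integrable_nn_integral[OF y, symmetric])
    finally show ?case using int by (simp add: set_integrable_def)
  qed
  then show "AE \<omega> in M. set_integrable lborel {a..b} (\<lambda>s. A s \<omega> *v Y s \<omega>)" by eventually_elim simp
  have "(\<integral>\<^sup>+\<omega>. ennreal ((norm (?J \<omega>))\<^sup>2) \<partial>M) \<le> (\<integral>\<^sup>+\<omega>. ennreal (c\<^sup>2 * (b - a)) * g \<omega> \<partial>M)"
    using main by (intro nn_integral_mono_AE) auto
  also have "\<dots> = ennreal (c\<^sup>2 * (b - a)) * (\<integral>\<^sup>+\<omega>. g \<omega> \<partial>M)" by (rule nn_integral_cmult[OF g])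
  also have "\<dots> \<le> ennreal (c\<^sup>2 * (b - a)) * ennreal d" by (rule mult_left_mono[OF g_int]) simp
  also have "\<dots> = ennreal (c\<^sup>2 * (b - a) * d)" using ab d by (simp add: ennreal_mult)
  finally have le: "(\<integral>\<^sup>+\<omega>. ennreal ((norm (?J \<omega>))\<^sup>2) \<partial>M) \<le> ennreal (c\<^sup>2 * (b - a) * d)" .
  then show sqJ: "square_integrable M ?J"
    by (subst square_integrable_iff_nn_integral[OF J]) (auto intro: le_less_trans)
  show "(\<integral>\<omega>. (norm (?J \<omega>))\<^sup>2 \<partial>M) \<le> c\<^sup>2 * (b - a) * d"
    using le ab d unfolding square_integrable_nn_integral[OF sqJ] by (subst (asm) ennreal_le_iff) auto
qed

text \<open>Tonelli turns bounds on the second moments at fixed times into the joint bound that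
  \<open>time_integral_square\<close> starts from.\<close>

lemma time_square_bound:
  fixes Y :: "real \<Rightarrow> 'a \<Rightarrow> 'x::euclidean_space"
  assumes ab: "a \<le> b" and m: "0 \<le> m"
    and Y: "(\<lambda>(\<omega>, s). indicator {a..b} s *\<^sub>R Y s \<omega>) \<in> borel_measurable (M \<Otimes>\<^sub>M lborel)"
    and Y_sq: "\<And>s. s \<in> {a..b} \<Longrightarrow> square_integrable M (Y s)" "\<And>s. s \<in> {a..b} \<Longrightarrow> (\<integral>\<omega>. (norm (Y s \<omega>))\<^sup>2 \<partial>M) \<le> m"
  shows "(\<integral>\<^sup>+\<omega>. (\<integral>\<^sup>+s\<in>{a..b}. ennreal ((norm (Y s \<omega>))\<^sup>2) \<partial>lborel) \<partial>M) \<le> ennreal ((b - a) * m)"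
proof -
  interpret MT: pair_sigma_finite M "lborel :: real measure" ..
  have sq: "(\<lambda>v::'x. ennreal ((norm v)\<^sup>2)) \<in> borel_measurable borel" by measurable
  have f: "(\<lambda>x. ennreal ((norm (case x of (\<omega>, s) \<Rightarrow> indicator {a..b} s *\<^sub>R Y s \<omega>))\<^sup>2)) \<in> borel_measurable (M \<Otimes>\<^sub>M lborel)"
    by (rule measurable_compose[OF Y sq])
  have "(\<integral>\<^sup>+\<omega>. (\<integral>\<^sup>+s\<in>{a..b}. ennreal ((norm (Y s \<omega>))\<^sup>2) \<partial>lborel) \<partial>M)
     = (\<integral>\<^sup>+\<omega>. \<integral>\<^sup>+s. ennreal ((norm (case (\<omega>, s) of (\<omega>, s) \<Rightarrow> indicator {a..b} s *\<^sub>R Y s \<omega>))\<^sup>2) \<partial>lborel \<partial>M)"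
    by (intro nn_integral_cong) (auto simp: indicator_def)
  also have "\<dots> = (\<integral>\<^sup>+s. \<integral>\<^sup>+\<omega>. ennreal ((norm (case (\<omega>, s) of (\<omega>, s) \<Rightarrow> indicator {a..b} s *\<^sub>R Y s \<omega>))\<^sup>2) \<partial>M \<partial>lborel)"
    unfolding lborel.nn_integral_fst[OF f] MT.nn_integral_snd[OF f] ..
  also have "\<dots> \<le> (\<integral>\<^sup>+s. ennreal m * indicator {a..b} s \<partial>lborel)"
  proof (rule nn_integral_mono)
    fix s :: real
    show "(\<integral>\<^sup>+\<omega>. ennreal ((norm (case (\<omega>, s) of (\<omega>, s) \<Rightarrow> indicator {a..b} s *\<^sub>R Y s \<omega>))\<^sup>2) \<partial>M) \<le> ennreal m * indicator {a..b} s"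
      using Y_sq[of s] square_integrable_nn_integral[OF Y_sq(1)[of s]]
      by (cases "s \<in> {a..b}") (auto intro: ennreal_leI)
  qed
  also have "\<dots> = ennreal m * ennreal (b - a)"
    using ab by (simp add: nn_integral_cmult_indicator)
  also have "\<dots> = ennreal ((b - a) * m)" using ab m by (simp add: ennreal_mult mult.commute)
  finally show ?thesis .
qed

end

section \<open>Growth of the state\<close>

text \<open>The setting of the growth estimate, with the noise reduced to a filtration, a density
  \<open>h\<close> for the second moments of the increments of \<open>I\<close>, and the
  orthogonality of these increments to the past.\<close>

locale state_growth = prob_space M
  for M :: "'w measure" +
  fixes Fil :: "real \<Rightarrow> 'w measure" and t T c K :: real and A \<Phi> :: "real \<Rightarrow> 'w \<Rightarrow> real^'n^'n"
    and X I :: "real \<Rightarrow> 'w \<Rightarrow> real^'n" and h :: "real \<Rightarrow> real"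
  assumes tT: "0 \<le> t" "t < T" and c: "0 < c" and K: "0 < K"
    and Fil: "\<And>s. s \<in> {0..T} \<Longrightarrow> space (Fil s) = space M \<and> sets (Fil s) \<subseteq> sets M"
    and ode: "AE \<omega> in M. linear_ode c T (\<lambda>s. A s \<omega>) (\<lambda>s. \<Phi> s \<omega>)"
    and bounds: "AE \<omega> in M. \<forall>s\<in>{0..T}. invertible (\<Phi> s \<omega>) \<and> norm (\<Phi> s \<omega>) \<le> K \<and> norm (matrix_inv (\<Phi> s \<omega>)) \<le> K"
    and lips: "AE \<omega> in M. \<forall>r s. 0 \<le> r \<and> r \<le> s \<and> s \<le> T \<longrightarrow> norm (\<Phi> s \<omega> - \<Phi> r \<omega>) \<le> K * (s - r) \<and>
       norm (matrix_inv (\<Phi> s \<omega>) - matrix_inv (\<Phi> r \<omega>)) \<le> K * (s - r)"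
    and \<Phi>_meas: "\<And>s. s \<in> {0..T} \<Longrightarrow> \<Phi> s \<in> borel_measurable (Fil s)"
    and A_joint: "(\<lambda>(\<omega>, s). indicator {0..T} s *\<^sub>R A s \<omega>) \<in> borel_measurable (M \<Otimes>\<^sub>M lborel)"
    and X_meas: "\<And>s. s \<in> {t..T} \<Longrightarrow> X s \<in> borel_measurable (Fil s)"
    and X_joint: "(\<lambda>(\<omega>, s). indicator {t..T} s *\<^sub>R X s \<omega>) \<in> borel_measurable (M \<Otimes>\<^sub>M lborel)"
    and X_sq: "(\<integral>\<^sup>+\<omega>. (\<integral>\<^sup>+s\<in>{t..T}. ennreal ((norm (X s \<omega>))\<^sup>2) \<partial>lborel) \<partial>M) < \<infinity>"
    and X_eq: "AE \<omega> in M. \<forall>s\<in>{t..T}. X s \<omega> = (LINT r:{t..s}|lborel. A r \<omega> *v X r \<omega>) + I s \<omega>"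
    and I_sq: "\<And>s. s \<in> {t..T} \<Longrightarrow> square_integrable M (I s)"
    and h: "set_integrable lborel {t..T} h" "\<And>s. 0 \<le> h s"
    and iso: "\<And>a b. t \<le> a \<Longrightarrow> a \<le> b \<Longrightarrow> b \<le> T \<Longrightarrow> (\<integral>\<omega>. (norm (I b \<omega> - I a \<omega>))\<^sup>2 \<partial>M) = (LINT r:{a..b}|lborel. h r)"
    and orth: "\<And>a b \<eta>. t \<le> a \<Longrightarrow> a \<le> b \<Longrightarrow> b \<le> T \<Longrightarrow> square_integrable M \<eta> \<Longrightarrow> \<eta> \<in> borel_measurable (Fil a) \<Longrightarrow>
       (\<integral>\<omega>. \<eta> \<omega> \<bullet> (I b \<omega> - I a \<omega>) \<partial>M) = 0"
begin

abbreviation \<Psi> where "\<Psi> s \<omega> \<equiv> matrix_inv (\<Phi> s \<omega>)"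
abbreviation V where "V s \<omega> \<equiv> \<Psi> s \<omega> *v X s \<omega>"
abbreviation \<kappa> where "\<kappa> a b \<equiv> LINT r:{a..b}|lborel. h r"
text \<open>The deterministic factor by which \<open>\<Psi> s\<close> shrinks a squared norm at
  most: a vector is recovered from its image by \<open>\<Phi> s\<close>.\<close>

definition p where "p s = 1 / (essnorm M (\<Phi> s))\<^sup>2"

lemma Fil_measurable: "s \<in> {0..T} \<Longrightarrow> f \<in> measurable (Fil s) L \<Longrightarrow> f \<in> measurable M L"
  using Fil[of s] by (auto simp: measurable_def)

lemma A_le: "AE \<omega> in M. AE s in lborel. s \<in> {0..T} \<longrightarrow> norm (A s \<omega>) \<le> c"
  using ode by eventually_elim (auto simp: linear_ode_def)

lemma \<Phi>_M: "s \<in> {0..T} \<Longrightarrow> \<Phi> s \<in> borel_measurable M"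
  using Fil_measurable[OF _ \<Phi>_meas] .

lemma \<Psi>_M: "s \<in> {0..T} \<Longrightarrow> \<Psi> s \<in> borel_measurable M"
  using \<Phi>_M by measurable

lemma X_M: "s \<in> {t..T} \<Longrightarrow> X s \<in> borel_measurable M"
  using Fil_measurable[OF _ X_meas, of s] tT by auto

lemma h_sub: "t \<le> a \<Longrightarrow> b \<le> T \<Longrightarrow> set_integrable lborel {a..b} h"
  using h(1) by (rule set_integrable_subset) auto

lemma \<kappa>_nonneg: "0 \<le> \<kappa> a b"
  using h(2) by (auto simp: set_lebesgue_integral_def intro!: integral_nonneg_AE)

lemma \<kappa>_add: "t \<le> a \<Longrightarrow> a \<le> b \<Longrightarrow> b \<le> d \<Longrightarrow> d \<le> T \<Longrightarrow> \<kappa> a d = \<kappa> a b + \<kappa> b d"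
  by (rule set_integral_split_real[OF h_sub]) auto

lemma \<kappa>_le: "t \<le> a \<Longrightarrow> a \<le> b \<Longrightarrow> b \<le> T \<Longrightarrow> \<kappa> a b \<le> \<kappa> t T"
  using \<kappa>_add[of t a T] \<kappa>_add[of a b T] \<kappa>_nonneg[of t a] \<kappa>_nonneg[of b T] by linarith

lemma dI_sq: "s \<in> {t..T} \<Longrightarrow> r \<in> {t..T} \<Longrightarrow> square_integrable M (\<lambda>\<omega>. I s \<omega> - I r \<omega>)"
  by (intro square_integrable_diff I_sq)

text \<open>The state is only assumed to be square integrable over time and omega jointly. The
  equation upgrades this to one bound for the second moments at all times.\<close>

lemma X_square_integrable:
  obtains K0 where "0 \<le> K0" "\<And>s. s \<in> {t..T} \<Longrightarrow> square_integrable M (X s) \<and> (\<integral>\<omega>. (norm (X s \<omega>))\<^sup>2 \<partial>M) \<le> K0"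
    "\<And>s. s \<in> {t..T} \<Longrightarrow> AE \<omega> in M. set_integrable lborel {t..s} (\<lambda>r. A r \<omega> *v X r \<omega>)"
proof -
  obtain d where d: "0 \<le> d" "(\<integral>\<^sup>+\<omega>. (\<integral>\<^sup>+s\<in>{t..T}. ennreal ((norm (X s \<omega>))\<^sup>2) \<partial>lborel) \<partial>M) = ennreal d"
    using X_sq by (cases "(\<integral>\<^sup>+\<omega>. (\<integral>\<^sup>+s\<in>{t..T}. ennreal ((norm (X s \<omega>))\<^sup>2) \<partial>lborel) \<partial>M)") auto
  \<comment> \<open>Drift and noise are separated by \<open>norm_add_square_le\<close>.
    \<open>I s\<close> is split once more at the initial time, since the isometry speaks of
    increments.\<close>
  define K0 where "K0 = 2 * (c\<^sup>2 * (T - t) * d) + 2 * (2 * \<kappa> t T + 2 * (\<integral>\<omega>. (norm (I t \<omega>))\<^sup>2 \<partial>M))"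
  have K0: "0 \<le> K0" unfolding K0_def using d(1) tT \<kappa>_nonneg
    by (intro add_nonneg_nonneg mult_nonneg_nonneg) (auto simp: integral_nonneg_AE)
  have main: "square_integrable M (X s) \<and> (\<integral>\<omega>. (norm (X s \<omega>))\<^sup>2 \<partial>M) \<le> K0 \<and>
     (AE \<omega> in M. set_integrable lborel {t..s} (\<lambda>r. A r \<omega> *v X r \<omega>))" if s: "s \<in> {t..T}" for s
  proof -
    let ?J = "\<lambda>\<omega>. LINT r:{t..s}|lborel. A r \<omega> *v X r \<omega>"
    have joint: "(\<lambda>(\<omega>, r). indicator {t..s} r *\<^sub>R X r \<omega>) \<in> borel_measurable (M \<Otimes>\<^sub>M lborel)"
    proof -
      have "(\<lambda>x. indicator {t..s} (snd x) :: real) \<in> borel_measurable (M \<Otimes>\<^sub>M lborel)" by measurable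
      from borel_measurable_scaleR[OF this X_joint]
      have "(\<lambda>x. indicator {t..s} (snd x) *\<^sub>R (case x of (\<omega>, r) \<Rightarrow> indicator {t..T} r *\<^sub>R X r \<omega>)) \<in> borel_measurable (M \<Otimes>\<^sub>M lborel)" .
      also have "(\<lambda>x. indicator {t..s} (snd x) *\<^sub>R (case x of (\<omega>, r) \<Rightarrow> indicator {t..T} r *\<^sub>R X r \<omega>)) = (\<lambda>(\<omega>, r). indicator {t..s} r *\<^sub>R X r \<omega>)"
        using s by (auto simp: fun_eq_iff indicator_def)
      finally show ?thesis .
    qed
    have le: "(\<integral>\<^sup>+\<omega>. (\<integral>\<^sup>+r\<in>{t..s}. ennreal ((norm (X r \<omega>))\<^sup>2) \<partial>lborel) \<partial>M) \<le> ennreal d"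
      unfolding d(2)[symmetric] using s by (intro nn_integral_mono) (auto simp: indicator_def)
    have J: "square_integrable M ?J" "(\<integral>\<omega>. (norm (?J \<omega>))\<^sup>2 \<partial>M) \<le> c\<^sup>2 * (s - t) * d"
      "AE \<omega> in M. set_integrable lborel {t..s} (\<lambda>r. A r \<omega> *v X r \<omega>)"
      using time_integral_square[OF _ _ _ _ d(1) A_joint A_le joint le] s tT c by auto
    have "c\<^sup>2 * (s - t) * d \<le> c\<^sup>2 * (T - t) * d"
      using s d(1) by (intro mult_right_mono mult_left_mono) auto
    with J have J2: "(\<integral>\<omega>. (norm (?J \<omega>))\<^sup>2 \<partial>M) \<le> c\<^sup>2 * (T - t) * d" by simp
    have t: "t \<in> {t..T}" using tT by simp
    have "(\<integral>\<omega>. (norm (I s \<omega>))\<^sup>2 \<partial>M) \<le> 2 * (\<integral>\<omega>. (norm (I s \<omega> - I t \<omega>))\<^sup>2 \<partial>M) + 2 * (\<integral>\<omega>. (norm (I t \<omega>))\<^sup>2 \<partial>M)"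
      using square_integrable_add(2)[OF dI_sq[OF s t] I_sq[OF t]] by simp
    also have "(\<integral>\<omega>. (norm (I s \<omega> - I t \<omega>))\<^sup>2 \<partial>M) \<le> \<kappa> t T"
      using iso[of t s] \<kappa>_le[of t s] s by auto
    finally have I2: "(\<integral>\<omega>. (norm (I s \<omega>))\<^sup>2 \<partial>M) \<le> 2 * \<kappa> t T + 2 * (\<integral>\<omega>. (norm (I t \<omega>))\<^sup>2 \<partial>M)" by simp
    have eq: "AE \<omega> in M. X s \<omega> = ?J \<omega> + I s \<omega>" using X_eq by eventually_elim (use s in auto)
    note JI = square_integrable_add[OF J(1) I_sq[OF s]]
    have Xs: "square_integrable M (X s)"
      by (rule square_integrable_bound(1)[OF JI(1) X_M[OF s], of 1]) (use eq in auto)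
    have "(\<integral>\<omega>. (norm (X s \<omega>))\<^sup>2 \<partial>M) \<le> 1\<^sup>2 * (\<integral>\<omega>. (norm (?J \<omega> + I s \<omega>))\<^sup>2 \<partial>M)"
      by (rule square_integrable_bound(2)[OF JI(1) X_M[OF s]]) (use eq in auto)
    also have "\<dots> \<le> K0" using JI(2) J2 I2 by (simp add: K0_def)
    finally show ?thesis using Xs J(3) by simp
  qed
  show thesis by (rule that[of K0]) (use K0 main in auto)
qed

lemma V_square_integrable:
  assumes "s \<in> {t..T}"
  shows "square_integrable M (V s)" "(\<integral>\<omega>. (norm (V s \<omega>))\<^sup>2 \<partial>M) \<le> K\<^sup>2 * (\<integral>\<omega>. (norm (X s \<omega>))\<^sup>2 \<partial>M)"
proof -
  have "square_integrable M (X s)" by (rule X_square_integrable) (use assms in auto)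
  moreover have s: "s \<in> {0..T}" using assms tT by auto
  have "V s \<in> borel_measurable M" using \<Psi>_M[OF s] X_M[OF assms] by measurable
  moreover have "AE \<omega> in M. norm (V s \<omega>) \<le> K * norm (X s \<omega>)"
    using bounds by eventually_elim (use s in \<open>auto intro!: order_trans[OF norm_matrix_vector_mult_le] mult_right_mono\<close>)
  ultimately show "square_integrable M (V s)" "(\<integral>\<omega>. (norm (V s \<omega>))\<^sup>2 \<partial>M) \<le> K\<^sup>2 * (\<integral>\<omega>. (norm (X s \<omega>))\<^sup>2 \<partial>M)"
    using square_integrable_bound by blast+
qed

lemma square_integrable_mult_bounded:
  fixes B :: "'w \<Rightarrow> real^'n^'n" and f :: "'w \<Rightarrow> real^'n"
  assumes "square_integrable M f" "B \<in> borel_measurable M" "AE \<omega> in M. norm (B \<omega>) \<le> k"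
  shows "square_integrable M (\<lambda>\<omega>. B \<omega> *v f \<omega>)" "(\<integral>\<omega>. (norm (B \<omega> *v f \<omega>))\<^sup>2 \<partial>M) \<le> k\<^sup>2 * (\<integral>\<omega>. (norm (f \<omega>))\<^sup>2 \<partial>M)"
proof -
  have m: "(\<lambda>\<omega>. B \<omega> *v f \<omega>) \<in> borel_measurable M"
    using assms(1,2) by (auto simp: square_integrable_def)
  have le: "AE \<omega> in M. norm (B \<omega> *v f \<omega>) \<le> k * norm (f \<omega>)"
    using assms(3) by eventually_elim (auto intro!: order_trans[OF norm_matrix_vector_mult_le] mult_right_mono)
  show "square_integrable M (\<lambda>\<omega>. B \<omega> *v f \<omega>)" "(\<integral>\<omega>. (norm (B \<omega> *v f \<omega>))\<^sup>2 \<partial>M) \<le> k\<^sup>2 * (\<integral>\<omega>. (norm (f \<omega>))\<^sup>2 \<partial>M)"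
    using square_integrable_bound[OF assms(1) m le] by auto
qed

text \<open>With \<open>\<Phi>\<close> frozen at \<open>a\<close> the increment of \<open>V\<close>
  would be the transported noise alone; \<open>e\<close> is the error. It consists of the drift
  acting on the deviation that the noise produces inside the interval, and of the change of
  \<open>\<Psi>\<close> from \<open>a\<close> to \<open>b\<close> applied to the noise. Both parts
  carry a factor \<open>b - a\<close>, and the noise contributes \<open>\<kappa> a b\<close> in mean
  square.\<close>

lemma V_step:
  obtains C where "0 \<le> C"
    "\<And>a b. t \<le> a \<Longrightarrow> a \<le> b \<Longrightarrow> b \<le> T \<Longrightarrow> \<exists>e. square_integrable M e \<and>
       (\<integral>\<omega>. (norm (e \<omega>))\<^sup>2 \<partial>M) \<le> C * (b - a)\<^sup>2 * ((b - a)\<^sup>2 + \<kappa> a b) \<and>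
       (AE \<omega> in M. V b \<omega> = (V a \<omega> + \<Psi> a \<omega> *v (I b \<omega> - I a \<omega>)) + e \<omega>)"
proof -
  obtain K0 where K0: "0 \<le> K0" and
    X: "\<And>s. s \<in> {t..T} \<Longrightarrow> square_integrable M (X s)" "\<And>s. s \<in> {t..T} \<Longrightarrow> (\<integral>\<omega>. (norm (X s \<omega>))\<^sup>2 \<partial>M) \<le> K0" and
    X_int: "\<And>s. s \<in> {t..T} \<Longrightarrow> AE \<omega> in M. set_integrable lborel {t..s} (\<lambda>r. A r \<omega> *v X r \<omega>)"
    by (rule X_square_integrable) (rule that, auto)
  \<comment> \<open>A crude bound, independent of the interval, for the second moment of the
    deviation \<open>Y\<close>: \<open>2 * K0\<close> comes from \<open>X\<close>, the rest from
    \<open>\<Phi> r \<omega> *v V a \<omega>\<close>.\<close>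
  define K1 where "K1 = 2 * K0 + 2 * (K\<^sup>2 * (K\<^sup>2 * K0))"
  have K1: "0 \<le> K1" using K0 by (simp add: K1_def)
  define C where "C = 2 * (K\<^sup>2 * (c\<^sup>2 * (2 * (c\<^sup>2 * K1) + 2))) + 2 * K\<^sup>2"
  have C: "0 \<le> C" using K1 by (simp add: C_def)
  show thesis
  proof (rule that[OF C])
    fix a b assume ab: "t \<le> a" "a \<le> b" "b \<le> T"
    then have in0: "a \<in> {0..T}" "b \<in> {0..T}" and int: "a \<in> {t..T}" "b \<in> {t..T}" using tT by auto
    \<comment> \<open>The deviation of the state from the noise-free motion that starts at
      \<open>X a\<close>. That motion is \<open>\<Phi> r \<omega> *v V a \<omega>\<close>, because
      \<open>\<Phi> a \<omega> *v V a \<omega>\<close> is \<open>X a \<omega>\<close>.\<close>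
    define Y where "Y r \<omega> = X r \<omega> - \<Phi> r \<omega> *v V a \<omega>" for r \<omega>
    have \<Phi>V: "square_integrable M (\<lambda>\<omega>. \<Phi> r \<omega> *v V a \<omega>) \<and> (\<integral>\<omega>. (norm (\<Phi> r \<omega> *v V a \<omega>))\<^sup>2 \<partial>M) \<le> K\<^sup>2 * (K\<^sup>2 * K0)"
      if "r \<in> {a..b}" for r
    proof -
      have r: "r \<in> {0..T}" using that ab tT by auto
      have "AE \<omega> in M. norm (\<Phi> r \<omega>) \<le> K" using bounds by eventually_elim (use r in auto)
      note * = square_integrable_mult_bounded[OF V_square_integrable(1)[OF int(1)] \<Phi>_M[OF r] this]
      have "K\<^sup>2 * (\<integral>\<omega>. (norm (V a \<omega>))\<^sup>2 \<partial>M) \<le> K\<^sup>2 * (K\<^sup>2 * K0)"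
        using order_trans[OF V_square_integrable(2)[OF int(1)] mult_left_mono[OF X(2)[OF int(1)]]]
        by (intro mult_left_mono) auto
      with * show ?thesis by auto
    qed
    have Ysq: "square_integrable M (Y r)" and Y1: "(\<integral>\<omega>. (norm (Y r \<omega>))\<^sup>2 \<partial>M) \<le> K1" if "r \<in> {a..b}" for r
    proof -
      have r: "r \<in> {t..T}" using that ab by auto
      have "square_integrable M (\<lambda>\<omega>. - (\<Phi> r \<omega> *v V a \<omega>))" using \<Phi>V[OF that] by (intro square_integrable_minus) auto
      note * = square_integrable_add[OF X(1)[OF r] this]
      then show "square_integrable M (Y r)" by (simp add: Y_def[abs_def])
      show "(\<integral>\<omega>. (norm (Y r \<omega>))\<^sup>2 \<partial>M) \<le> K1"
        using *(2) X(2)[OF r] \<Phi>V[OF that] by (simp add: Y_def K1_def)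
    qed
    text \<open>The path of \<open>Y\<close> is right-continuous only after removing a null set.\<close>
    have Yj: "\<exists>Y'. (\<lambda>(\<omega>, s). indicator {a..b} s *\<^sub>R Y' s \<omega>) \<in> borel_measurable (M \<Otimes>\<^sub>M lborel) \<and>
       (AE \<omega> in M. \<forall>s\<in>{a..b}. Y' s \<omega> = Y s \<omega>) \<and> (\<forall>s\<in>{a..b}. square_integrable M (Y' s))"
    proof -
      obtain N0 where N0: "{\<omega> \<in> space M. \<not> linear_ode c T (\<lambda>s. A s \<omega>) (\<lambda>s. \<Phi> s \<omega>)} \<subseteq> N0" "emeasure M N0 = 0" "N0 \<in> sets M"
        using ode by (rule AE_E)
      define \<Phi>' where "\<Phi>' s \<omega> = (if \<omega> \<in> N0 then 0 else \<Phi> s \<omega>)" for s \<omega>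
      have m': "\<Phi>' s \<in> borel_measurable M" if "s \<in> {a..b}" for s
      proof -
        have [measurable]: "\<Phi> s \<in> borel_measurable M" "N0 \<in> sets M" using \<Phi>_M[of s] that ab tT N0 by auto
        show ?thesis unfolding \<Phi>'_def[abs_def] by measurable
      qed
      have "(\<lambda>(\<omega>, s). indicator {a..b} s *\<^sub>R \<Phi>' s \<omega>) \<in> borel_measurable (M \<Otimes>\<^sub>M lborel)"
      proof (rule cadlag_joint_measurable[OF m' _ ab(2)])
        fix \<omega> assume \<omega>: "\<omega> \<in> space M"
        have "continuous_on {0..T} (\<lambda>s. \<Phi>' s \<omega>)"
          using N0(1) \<omega> by (cases "\<omega> \<in> N0") (auto simp: \<Phi>'_def linear_ode_def)
        then have cont: "continuous_on {a..b} (\<lambda>s. \<Phi>' s \<omega>)" by (rule continuous_on_subset) (use ab tT in auto)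
        show "cadlag_on a b (\<lambda>s. \<Phi>' s \<omega>)"
          unfolding cadlag_on_def
        proof safe
          fix s assume s: "s \<in> {a..<b}"
          then show "((\<lambda>s. \<Phi>' s \<omega>) \<longlongrightarrow> \<Phi>' s \<omega>) (at_right s)"
            using cont by (intro continuous_on_Icc_at_rightD[of s b] continuous_on_subset[OF cont]) auto
        next
          fix s assume s: "s \<in> {a<..b}"
          then show "\<exists>l. ((\<lambda>s. \<Phi>' s \<omega>) \<longlongrightarrow> l) (at_left s)"
            by (intro exI[of _ "\<Phi>' s \<omega>"] continuous_on_Icc_at_leftD[of a s] continuous_on_subset[OF cont]) auto
        qed
      qed
      note \<Phi>j = this
      have Va: "(\<lambda>x. V a (fst x)) \<in> borel_measurable (M \<Otimes>\<^sub>M (lborel :: real measure))"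
        using V_square_integrable(1)[OF int(1)] by (intro measurable_compose[OF measurable_fst]) (auto simp: square_integrable_def)
      define Y' where "Y' s \<omega> = X s \<omega> - \<Phi>' s \<omega> *v V a \<omega>" for s \<omega>
      have im: "(\<lambda>x. indicator {a..b} (snd x) :: real) \<in> borel_measurable (M \<Otimes>\<^sub>M (lborel :: real measure))" by measurable
      from borel_measurable_diff[OF borel_measurable_scaleR[OF im X_joint] borel_measurable_matrix_vector_mult[OF \<Phi>j Va]]
      have "(\<lambda>x. indicator {a..b} (snd x) *\<^sub>R (case x of (\<omega>, s) \<Rightarrow> indicator {t..T} s *\<^sub>R X s \<omega>) -
           (case x of (\<omega>, s) \<Rightarrow> indicator {a..b} s *\<^sub>R \<Phi>' s \<omega>) *v V a (fst x)) \<in> borel_measurable (M \<Otimes>\<^sub>M lborel)" .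
      also have "(\<lambda>x. indicator {a..b} (snd x) *\<^sub>R (case x of (\<omega>, s) \<Rightarrow> indicator {t..T} s *\<^sub>R X s \<omega>) -
           (case x of (\<omega>, s) \<Rightarrow> indicator {a..b} s *\<^sub>R \<Phi>' s \<omega>) *v V a (fst x)) = (\<lambda>(\<omega>, s). indicator {a..b} s *\<^sub>R Y' s \<omega>)"
        using ab by (auto simp: fun_eq_iff indicator_def Y'_def bounded_bilinear.zero_left[OF bounded_bilinear_matrix_vector_mult])
      finally have j: "(\<lambda>(\<omega>, s). indicator {a..b} s *\<^sub>R Y' s \<omega>) \<in> borel_measurable (M \<Otimes>\<^sub>M lborel)" .
      have "AE \<omega> in M. \<omega> \<notin> N0" using N0(2,3) by (intro AE_not_in) auto
      then have eq: "AE \<omega> in M. \<forall>s\<in>{a..b}. Y' s \<omega> = Y s \<omega>" by eventually_elim (auto simp: Y'_def Y_def \<Phi>'_def)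
      have "square_integrable M (Y' s)" if s: "s \<in> {a..b}" for s
      proof (rule square_integrable_bound(1)[OF Ysq[OF s], of _ 1])
        have sT: "s \<in> {t..T}" using s ab by auto
        show "Y' s \<in> borel_measurable M"
          unfolding Y'_def[abs_def]
          by (intro borel_measurable_diff borel_measurable_matrix_vector_mult X_M[OF sT] m'[OF s] \<Psi>_M[OF in0(1)] X_M[OF int(1)])
        show "AE \<omega> in M. norm (Y' s \<omega>) \<le> 1 * norm (Y s \<omega>)" using eq by eventually_elim (use s in auto)
      qed
      with j eq show ?thesis by blast
    qed
    then obtain Y' where Y'j: "(\<lambda>(\<omega>, s). indicator {a..b} s *\<^sub>R Y' s \<omega>) \<in> borel_measurable (M \<Otimes>\<^sub>M lborel)" and
      Y'eq: "AE \<omega> in M. \<forall>s\<in>{a..b}. Y' s \<omega> = Y s \<omega>" and Y'sq: "\<And>s. s \<in> {a..b} \<Longrightarrow> square_integrable M (Y' s)" by blast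
    have Y'int: "(\<integral>\<omega>. (norm (Y' s \<omega>))\<^sup>2 \<partial>M) = (\<integral>\<omega>. (norm (Y s \<omega>))\<^sup>2 \<partial>M)" if s: "s \<in> {a..b}" for s
    proof (rule integral_cong_AE)
      show "AE \<omega> in M. (norm (Y' s \<omega>))\<^sup>2 = (norm (Y s \<omega>))\<^sup>2" using Y'eq by eventually_elim (use s in auto)
    qed (use Y'sq[OF s] Ysq[OF s] in \<open>auto simp: square_integrable_def\<close>)
    \<comment> \<open>The accumulated drift of the deviation: \<open>Y\<close> is the sum of
      \<open>?\<rho>\<close> and the increment of \<open>I\<close>.\<close>
    let ?\<rho> = "\<lambda>r \<omega>. LINT s:{a..r}|lborel. A s \<omega> *v Y' s \<omega>"
    have Y'j_sub: "(\<lambda>(\<omega>, s). indicator {a..r} s *\<^sub>R Y' s \<omega>) \<in> borel_measurable (M \<Otimes>\<^sub>M lborel)" if r: "r \<in> {a..b}" for r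
    proof -
      have "(\<lambda>x. indicator {a..r} (snd x) :: real) \<in> borel_measurable (M \<Otimes>\<^sub>M (lborel :: real measure))" by measurable
      from borel_measurable_scaleR[OF this Y'j]
      have "(\<lambda>x. indicator {a..r} (snd x) *\<^sub>R (case x of (\<omega>, s) \<Rightarrow> indicator {a..b} s *\<^sub>R Y' s \<omega>)) \<in> borel_measurable (M \<Otimes>\<^sub>M lborel)" .
      also have "(\<lambda>x. indicator {a..r} (snd x) *\<^sub>R (case x of (\<omega>, s) \<Rightarrow> indicator {a..b} s *\<^sub>R Y' s \<omega>)) = (\<lambda>(\<omega>, s). indicator {a..r} s *\<^sub>R Y' s \<omega>)"
        using r by (auto simp: fun_eq_iff indicator_def)
      finally show ?thesis .
    qed
    have \<rho>: "square_integrable M (?\<rho> r)" "(\<integral>\<omega>. (norm (?\<rho> r \<omega>))\<^sup>2 \<partial>M) \<le> c\<^sup>2 * (r - a) * ((r - a) * m)"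
      if r: "r \<in> {a..b}" and m: "0 \<le> m" "\<And>s. s \<in> {a..b} \<Longrightarrow> (\<integral>\<omega>. (norm (Y s \<omega>))\<^sup>2 \<partial>M) \<le> m" for r m
    proof -
      have "(\<integral>\<^sup>+\<omega>. (\<integral>\<^sup>+s\<in>{a..r}. ennreal ((norm (Y' s \<omega>))\<^sup>2) \<partial>lborel) \<partial>M) \<le> ennreal ((r - a) * m)"
        using r m(2) Y'int Y'sq by (intro time_square_bound[OF _ m(1) Y'j_sub[OF r]]) auto
      from time_integral_square(1,2)[OF _ _ _ _ _ A_joint A_le Y'j_sub[OF r] this]
      show "square_integrable M (?\<rho> r)" "(\<integral>\<omega>. (norm (?\<rho> r \<omega>))\<^sup>2 \<partial>M) \<le> c\<^sup>2 * (r - a) * ((r - a) * m)"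
        using r ab tT c m(1) by auto
    qed
    have Y_eq: "AE \<omega> in M. Y r \<omega> = ?\<rho> r \<omega> + (I r \<omega> - I a \<omega>)" if r: "r \<in> {a..b}" for r
      using X_eq X_int[OF int(2)] ode Y'eq bounds
    proof eventually_elim
      case (elim \<omega>)
      have rT: "r \<in> {t..T}" "r \<le> T" "0 \<le> a" "a \<le> r" using r ab tT by auto
      have split: "(LINT x:{t..r}|lborel. A x \<omega> *v X x \<omega>) = (LINT x:{t..a}|lborel. A x \<omega> *v X x \<omega>) + (LINT x:{a..r}|lborel. A x \<omega> *v X x \<omega>)"
        using elim(2) r ab by (intro set_integral_split_real) (auto intro: set_integrable_subset)
      have iX: "set_integrable lborel {a..r} (\<lambda>x. A x \<omega> *v X x \<omega>)"
        using elim(2) by (rule set_integrable_subset) (use r ab in auto)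
      have iV: "set_integrable lborel {a..r} (\<lambda>x. A x \<omega> *v (\<Phi> x \<omega> *v V a \<omega>))"
        by (rule linear_ode_vec_integrable[OF elim(3) rT(3,2) c])
      have "X r \<omega> - X a \<omega> = (LINT x:{a..r}|lborel. A x \<omega> *v X x \<omega>) + (I r \<omega> - I a \<omega>)"
        using elim(1)[rule_format, OF rT(1)] elim(1)[rule_format, OF int(1)] split by simp
      moreover have "\<Phi> r \<omega> *v V a \<omega> - \<Phi> a \<omega> *v V a \<omega> = (LINT x:{a..r}|lborel. A x \<omega> *v (\<Phi> x \<omega> *v V a \<omega>))"
        by (rule linear_ode_vec_diff[OF elim(3) rT(3,4,2) c])
      moreover have "\<Phi> a \<omega> *v V a \<omega> = X a \<omega>"
        using elim(5) in0(1) by (simp add: matrix_vector_mul_assoc matrix_inv_inverse)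
      moreover have "(LINT x:{a..r}|lborel. A x \<omega> *v X x \<omega>) - (LINT x:{a..r}|lborel. A x \<omega> *v (\<Phi> x \<omega> *v V a \<omega>)) = ?\<rho> r \<omega>"
      proof -
        have "(LINT x:{a..r}|lborel. A x \<omega> *v X x \<omega>) - (LINT x:{a..r}|lborel. A x \<omega> *v (\<Phi> x \<omega> *v V a \<omega>))
           = (LINT x:{a..r}|lborel. A x \<omega> *v X x \<omega> - A x \<omega> *v (\<Phi> x \<omega> *v V a \<omega>))"
          using set_integral_diff(2)[OF iX iV] by simp
        also have "\<dots> = ?\<rho> r \<omega>"
          using elim(4) r unfolding set_lebesgue_integral_def
          by (intro Bochner_Integration.integral_cong) (auto simp: indicator_def Y_def matrix_vector_mult_diff_distrib)
        finally show ?thesis .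
      qed
      ultimately show ?case by (simp add: Y_def algebra_simps)
    qed
    \<comment> \<open>A bootstrap in two rounds: the crude bound \<open>K1\<close> put into
      \<open>?\<rho>\<close> gives this bound for \<open>Y\<close>, which is small with the
      interval, and \<open>m\<close> put into \<open>?\<rho>\<close> again gives the order required
      of \<open>e\<close>.\<close>
    define m where "m = 2 * (c\<^sup>2 * (b - a)\<^sup>2 * K1) + 2 * \<kappa> a b"
    have m0: "0 \<le> m" using K1 \<kappa>_nonneg by (auto simp: m_def)
    have Ym: "(\<integral>\<omega>. (norm (Y r \<omega>))\<^sup>2 \<partial>M) \<le> m" if r: "r \<in> {a..b}" for r
    proof -
      have rT: "r \<in> {t..T}" using r ab by auto
      note s = square_integrable_add[OF \<rho>(1)[OF r K1 Y1] dI_sq[OF rT int(1)]]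
      have "(\<integral>\<omega>. (norm (Y r \<omega>))\<^sup>2 \<partial>M) = (\<integral>\<omega>. (norm (?\<rho> r \<omega> + (I r \<omega> - I a \<omega>)))\<^sup>2 \<partial>M)"
        using Y_eq[OF r] s(1) Ysq[OF r] by (intro integral_cong_AE) (auto simp: square_integrable_def)
      also have "\<dots> \<le> 2 * (c\<^sup>2 * (r - a) * ((r - a) * K1)) + 2 * \<kappa> a r"
        using s(2) \<rho>(2)[OF r K1 Y1] iso[of a r] r ab by auto
      also have "c\<^sup>2 * (r - a) * ((r - a) * K1) = c\<^sup>2 * (r - a)\<^sup>2 * K1" by (simp add: power2_eq_square)
      also have "2 * (c\<^sup>2 * (r - a)\<^sup>2 * K1) + 2 * \<kappa> a r \<le> m"
      proof -
        have "(r - a)\<^sup>2 \<le> (b - a)\<^sup>2" using r by (intro power_mono) auto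
        then have "c\<^sup>2 * (r - a)\<^sup>2 * K1 \<le> c\<^sup>2 * (b - a)\<^sup>2 * K1" using K1 by (intro mult_right_mono mult_left_mono) auto
        moreover have "\<kappa> a r \<le> \<kappa> a b" using \<kappa>_add[of a r b] \<kappa>_nonneg[of r b] r ab by auto
        ultimately show ?thesis by (simp add: m_def)
      qed
      finally show ?thesis .
    qed
    have bb: "b \<in> {a..b}" using ab by simp
    note \<rho>b = \<rho>[OF bb m0 Ym]
    define e where "e \<omega> = \<Psi> b \<omega> *v ?\<rho> b \<omega> + (\<Psi> b \<omega> - \<Psi> a \<omega>) *v (I b \<omega> - I a \<omega>)" for \<omega>
    have "AE \<omega> in M. norm (\<Psi> b \<omega>) \<le> K" using bounds by eventually_elim (use in0 in auto)
    note e1 = square_integrable_mult_bounded[OF \<rho>b(1) \<Psi>_M[OF in0(2)] this]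
    have "AE \<omega> in M. norm (\<Psi> b \<omega> - \<Psi> a \<omega>) \<le> K * (b - a)" using lips by eventually_elim (use ab tT in auto)
    note e2 = square_integrable_mult_bounded[OF dI_sq[OF int(2,1)] borel_measurable_diff[OF \<Psi>_M[OF in0(2)] \<Psi>_M[OF in0(1)]] this]
    note e12 = square_integrable_add[OF e1(1) e2(1)]
    show "\<exists>e. square_integrable M e \<and> (\<integral>\<omega>. (norm (e \<omega>))\<^sup>2 \<partial>M) \<le> C * (b - a)\<^sup>2 * ((b - a)\<^sup>2 + \<kappa> a b) \<and>
       (AE \<omega> in M. V b \<omega> = (V a \<omega> + \<Psi> a \<omega> *v (I b \<omega> - I a \<omega>)) + e \<omega>)"
    proof (intro exI[of _ e] conjI)
      show "square_integrable M e" using e12(1) by (simp add: e_def[abs_def])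
      define D where "D = (b - a)\<^sup>2"
      have D: "0 \<le> D" by (simp add: D_def)
      have k: "0 \<le> \<kappa> a b" by (rule \<kappa>_nonneg)
      have "(\<integral>\<omega>. (norm (e \<omega>))\<^sup>2 \<partial>M) \<le> 2 * (K\<^sup>2 * (c\<^sup>2 * (b - a) * ((b - a) * m))) + 2 * ((K * (b - a))\<^sup>2 * \<kappa> a b)"
        using e12(2) e1(2) e2(2) mult_left_mono[OF \<rho>b(2), of "K\<^sup>2"] iso[OF ab] by (simp add: e_def)
      also have "\<dots> = D * (2 * (K\<^sup>2 * (c\<^sup>2 * (2 * (c\<^sup>2 * K1) * D + 2 * \<kappa> a b))) + 2 * K\<^sup>2 * \<kappa> a b)"
        unfolding m_def D_def by (simp add: power2_eq_square algebra_simps)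
      also have "\<dots> \<le> D * (C * (D + \<kappa> a b))"
      proof (rule mult_left_mono[OF _ D])
        have "2 * (c\<^sup>2 * K1) * D + 2 * \<kappa> a b \<le> (2 * (c\<^sup>2 * K1) + 2) * (D + \<kappa> a b)"
          using K1 D k by (simp add: distrib_left distrib_right)
        then have "K\<^sup>2 * (c\<^sup>2 * (2 * (c\<^sup>2 * K1) * D + 2 * \<kappa> a b)) \<le> K\<^sup>2 * (c\<^sup>2 * ((2 * (c\<^sup>2 * K1) + 2) * (D + \<kappa> a b)))"
          by (intro mult_left_mono) auto
        moreover have "2 * K\<^sup>2 * \<kappa> a b \<le> 2 * K\<^sup>2 * (D + \<kappa> a b)" using D by (intro mult_left_mono) auto
        ultimately have "2 * (K\<^sup>2 * (c\<^sup>2 * (2 * (c\<^sup>2 * K1) * D + 2 * \<kappa> a b))) + 2 * K\<^sup>2 * \<kappa> a b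
           \<le> 2 * (K\<^sup>2 * (c\<^sup>2 * ((2 * (c\<^sup>2 * K1) + 2) * (D + \<kappa> a b)))) + 2 * K\<^sup>2 * (D + \<kappa> a b)" by linarith
        also have "\<dots> = C * (D + \<kappa> a b)" by (simp add: C_def algebra_simps)
        finally show "2 * (K\<^sup>2 * (c\<^sup>2 * (2 * (c\<^sup>2 * K1) * D + 2 * \<kappa> a b))) + 2 * K\<^sup>2 * \<kappa> a b \<le> C * (D + \<kappa> a b)" .
      qed
      finally show "(\<integral>\<omega>. (norm (e \<omega>))\<^sup>2 \<partial>M) \<le> C * (b - a)\<^sup>2 * ((b - a)\<^sup>2 + \<kappa> a b)" by (simp add: D_def mult_ac)
      show "AE \<omega> in M. V b \<omega> = (V a \<omega> + \<Psi> a \<omega> *v (I b \<omega> - I a \<omega>)) + e \<omega>"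
        using Y_eq[OF bb] bounds
      proof eventually_elim
        case (elim \<omega>)
        have "X b \<omega> = \<Phi> b \<omega> *v V a \<omega> + (?\<rho> b \<omega> + (I b \<omega> - I a \<omega>))" using elim(1) by (simp add: Y_def algebra_simps)
        then have "V b \<omega> = \<Psi> b \<omega> *v (\<Phi> b \<omega> *v V a \<omega>) + (\<Psi> b \<omega> *v ?\<rho> b \<omega> + \<Psi> b \<omega> *v (I b \<omega> - I a \<omega>))"
          by (simp add: matrix_vector_right_distrib)
        also have "\<Psi> b \<omega> *v (\<Phi> b \<omega> *v V a \<omega>) = V a \<omega>"
          using elim(2) in0(2) by (simp add: matrix_vector_mul_assoc matrix_mul_assoc matrix_inv_inverse)
        finally show ?case by (simp add: e_def matrix_vector_mult_diff_rdistrib)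
      qed
    qed
  qed
qed

end

section \<open>Transposes, and Lipschitz estimates for inverse squared essential norms\<close>

lemma norm_matrix_square: "(norm (B :: real^'n^'m))\<^sup>2 = (\<Sum>i\<in>UNIV. \<Sum>j\<in>UNIV. (B $ i $ j)\<^sup>2)"
  unfolding power2_norm_eq_inner inner_vec_def inner_real_def by (simp only: power2_eq_square)

lemma norm_transpose_matrix: "norm (transpose A) = norm (A :: real^'n^'m)"
proof -
  have "(norm (transpose A))\<^sup>2 = (\<Sum>i\<in>UNIV. \<Sum>j\<in>UNIV. (A $ j $ i)\<^sup>2)"
    unfolding norm_matrix_square transpose_def by simp
  also have "\<dots> = (norm A)\<^sup>2"
    unfolding norm_matrix_square by (rule sum.swap)
  finally show ?thesis by simp
qed

lemma borel_measurable_transpose [measurable (raw)]: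
  fixes A :: "'a \<Rightarrow> real^'n^'m"
  assumes "A \<in> borel_measurable M" shows "(\<lambda>x. transpose (A x)) \<in> borel_measurable M"
  using borel_measurable_matrix_entry[OF assms] by (auto simp: borel_measurable_vec_iff transpose_def)

text \<open>In the factorised difference \<open>x + y\<close> is at most \<open>2 * k\<close> and
  each of the four reciprocals at most \<open>k\<close>, whence \<open>2 * k ^ 5\<close>. The lower
  bounds \<open>1 / k\<close> keep the denominators away from 0.\<close>

lemma inner_inverse_square_diff:
  fixes x y k :: real
  assumes "0 < k" "1 / k \<le> x" "x \<le> k" "1 / k \<le> y" "y \<le> k"
  shows "\<bar>1 / x\<^sup>2 - 1 / y\<^sup>2\<bar> \<le> 2 * k ^ 5 * \<bar>x - y\<bar>"
proof -
  have pos: "0 < x" "0 < y" using assms by (auto intro: less_le_trans[of 0 "1 / k"])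
  have xk: "1 / x \<le> k" "1 / y \<le> k"
    using assms pos by (simp_all add: divide_le_eq mult.commute)
  have "1 / x\<^sup>2 - 1 / y\<^sup>2 = (y - x) * (x + y) * ((1 / x) * (1 / x) * ((1 / y) * (1 / y)))"
    using pos by (simp add: field_simps power2_eq_square)
  then have "\<bar>1 / x\<^sup>2 - 1 / y\<^sup>2\<bar> = \<bar>x - y\<bar> * (x + y) * ((1 / x) * (1 / x) * ((1 / y) * (1 / y)))"
    using pos by (simp add: abs_mult abs_minus_commute)
  also have "\<dots> \<le> \<bar>x - y\<bar> * (k + k) * ((k * k) * (k * k))"
    using assms pos xk by (intro mult_mono mult_nonneg_nonneg add_mono) auto
  also have "\<dots> = 2 * k ^ 5 * \<bar>x - y\<bar>" by (simp add: power_numeral_odd eval_nat_numeral)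
  finally show ?thesis .
qed

lemma (in prob_space) inverse_essnorm_square_lipschitz:
  assumes f: "f \<in> borel_measurable M" "AE \<omega> in M. 1 / k \<le> norm (f \<omega>) \<and> norm (f \<omega>) \<le> k"
    and g: "g \<in> borel_measurable M" "AE \<omega> in M. 1 / k \<le> norm (g \<omega>) \<and> norm (g \<omega>) \<le> k"
    and d: "AE \<omega> in M. norm (f \<omega> - g \<omega>) \<le> d" and k: "0 < k"
  shows "\<bar>1 / (essnorm M f)\<^sup>2 - 1 / (essnorm M g)\<^sup>2\<bar> \<le> 2 * k ^ 5 * d"
proof -
  have fb: "AE \<omega> in M. norm (f \<omega>) \<le> k" "AE \<omega> in M. 1 / k \<le> norm (f \<omega>)"
    and gb: "AE \<omega> in M. norm (g \<omega>) \<le> k" "AE \<omega> in M. 1 / k \<le> norm (g \<omega>)"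
    using f(2) g(2) by auto
  have d': "AE \<omega> in M. norm (g \<omega> - f \<omega>) \<le> d" using d by (simp add: norm_minus_commute)
  have "\<bar>essnorm M f - essnorm M g\<bar> \<le> d"
    using essnorm_diff_le[OF f(1) g(1) gb(1) d] essnorm_diff_le[OF g(1) f(1) fb(1) d'] by linarith
  then have "2 * k ^ 5 * \<bar>essnorm M f - essnorm M g\<bar> \<le> 2 * k ^ 5 * d"
    using k by (intro mult_left_mono) auto
  with inner_inverse_square_diff[OF k essnorm_ge[OF f(1) fb] essnorm_le(2)[OF f(1) fb(1)] essnorm_ge[OF g(1) gb] essnorm_le(2)[OF g(1) gb(1)]]
  show ?thesis by simp
qed

section \<open>Lower bounds for the second moments of \<open>V\<close> and \<open>X\<close>\<close>

context state_growth
begin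

text \<open>The norms of \<open>\<Phi>\<close> and of its inverse have a product of at least 1, so
  each upper bound is a lower bound for the other factor. This keeps the essential norms away from
  0.\<close>

lemma two_sided_bounds:
  assumes "s \<in> {0..T}"
  shows "AE \<omega> in M. 1 / K \<le> norm (\<Phi> s \<omega>) \<and> norm (\<Phi> s \<omega>) \<le> K"
    and "AE \<omega> in M. 1 / K \<le> norm (\<Psi> s \<omega>) \<and> norm (\<Psi> s \<omega>) \<le> K"
proof -
  have main: "AE \<omega> in M. (1 / K \<le> norm (\<Phi> s \<omega>) \<and> norm (\<Phi> s \<omega>) \<le> K) \<and> (1 / K \<le> norm (\<Psi> s \<omega>) \<and> norm (\<Psi> s \<omega>) \<le> K)"
    using bounds
  proof eventually_elim
    case (elim \<omega>)
    then have i: "invertible (\<Phi> s \<omega>)" and b: "norm (\<Psi> s \<omega>) \<le> K" "norm (\<Phi> s \<omega>) \<le> K" using assms by auto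
    obtain x :: "real^'n" where x: "norm x = 1" using norm_axis_1 by blast
    have "1 = norm (\<Phi> s \<omega> *v (\<Psi> s \<omega> *v x))" using i x by (simp add: matrix_vector_mul_assoc matrix_inv_inverse)
    also have "\<dots> \<le> norm (\<Phi> s \<omega>) * (norm (\<Psi> s \<omega>) * norm x)"
      by (intro order_trans[OF norm_matrix_vector_mult_le] mult_left_mono norm_matrix_vector_mult_le) auto
    finally have 1: "1 \<le> norm (\<Phi> s \<omega>) * norm (\<Psi> s \<omega>)" using x by simp
    have "norm (\<Phi> s \<omega>) * norm (\<Psi> s \<omega>) \<le> norm (\<Phi> s \<omega>) * K" "norm (\<Phi> s \<omega>) * norm (\<Psi> s \<omega>) \<le> K * norm (\<Psi> s \<omega>)"
      using b by (auto intro: mult_left_mono mult_right_mono)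
    with 1 show ?case using b K by (simp add: divide_le_eq mult.commute)
  qed
  then show "AE \<omega> in M. 1 / K \<le> norm (\<Phi> s \<omega>) \<and> norm (\<Phi> s \<omega>) \<le> K"
    and "AE \<omega> in M. 1 / K \<le> norm (\<Psi> s \<omega>) \<and> norm (\<Psi> s \<omega>) \<le> K" by auto
qed

lemma essnorm_\<Phi>:
  assumes "s \<in> {0..T}"
  shows "0 < essnorm M (\<Phi> s)" "AE \<omega> in M. norm (\<Phi> s \<omega>) \<le> essnorm M (\<Phi> s)"
    and "0 < essnorm M (\<Psi> s)" "AE \<omega> in M. norm (\<Psi> s \<omega>) \<le> essnorm M (\<Psi> s)"
proof -
  note b = two_sided_bounds[OF assms]
  have "1 / K \<le> essnorm M (\<Phi> s)" by (rule essnorm_ge[OF \<Phi>_M[OF assms], of K]) (use b(1) in auto)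
  then show "0 < essnorm M (\<Phi> s)" using K by (auto intro: less_le_trans[of 0 "1 / K"])
  have "1 / K \<le> essnorm M (\<Psi> s)" by (rule essnorm_ge[OF \<Psi>_M[OF assms], of K]) (use b(2) in auto)
  then show "0 < essnorm M (\<Psi> s)" using K by (auto intro: less_le_trans[of 0 "1 / K"])
  show "AE \<omega> in M. norm (\<Phi> s \<omega>) \<le> essnorm M (\<Phi> s)"
    by (rule essnorm_le(3)[OF \<Phi>_M[OF assms], of K]) (use b(1) in auto)
  show "AE \<omega> in M. norm (\<Psi> s \<omega>) \<le> essnorm M (\<Psi> s)"
    by (rule essnorm_le(3)[OF \<Psi>_M[OF assms], of K]) (use b(2) in auto)
qed

lemma p_nonneg: "0 \<le> p s" by (simp add: p_def)

lemma p_lipschitz: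
  assumes "0 \<le> r" "r \<le> s" "s \<le> T"
  shows "\<bar>p s - p r\<bar> \<le> (2 * K ^ 5 * K) * (s - r)"
proof -
  have in0: "r \<in> {0..T}" "s \<in> {0..T}" using assms by auto
  have "AE \<omega> in M. norm (\<Phi> s \<omega> - \<Phi> r \<omega>) \<le> K * (s - r)" using lips by eventually_elim (use assms in auto)
  from inverse_essnorm_square_lipschitz[OF \<Phi>_M[OF in0(2)] two_sided_bounds(1)[OF in0(2)] \<Phi>_M[OF in0(1)] two_sided_bounds(1)[OF in0(1)] this K]
  show ?thesis by (simp add: p_def mult.assoc)
qed

text \<open>Continuity makes the weight bounded and measurable, so that its product with the
  eigenvalue bound of \<open>Q\<close> can be integrated in the running cost.\<close>

lemma inverse_essnorm_\<Psi>_continuous: "continuous_on {0..T} (\<lambda>s. 1 / (essnorm M (\<Psi> s))\<^sup>2)"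
proof (rule lipschitz_on_continuous_on)
  let ?w = "\<lambda>s. 1 / (essnorm M (\<Psi> s))\<^sup>2"
  have lip: "\<bar>?w s - ?w r\<bar> \<le> (2 * K ^ 5 * K) * (s - r)" if rs: "0 \<le> r" "r \<le> s" "s \<le> T" for r s
  proof -
    have in0: "r \<in> {0..T}" "s \<in> {0..T}" using rs by auto
    have "AE \<omega> in M. norm (\<Psi> s \<omega> - \<Psi> r \<omega>) \<le> K * (s - r)" using lips by eventually_elim (use rs in auto)
    from inverse_essnorm_square_lipschitz[OF \<Psi>_M[OF in0(2)] two_sided_bounds(2)[OF in0(2)] \<Psi>_M[OF in0(1)] two_sided_bounds(2)[OF in0(1)] this K]
    show ?thesis by (simp add: mult.assoc)
  qed
  show "(2 * K ^ 5 * K)-lipschitz_on {0..T} ?w"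
  proof (rule lipschitz_onI)
    fix x y assume xy: "x \<in> {0..T}" "y \<in> {0..T}"
    show "dist (?w x) (?w y) \<le> 2 * K ^ 5 * K * dist x y"
      using lip[of x y] lip[of y x] xy
      by (cases "x \<le> y") (auto simp: dist_real_def abs_minus_commute)
  qed (use K in auto)
qed

lemma p_continuous: "continuous_on {0..T} p"
proof (rule lipschitz_on_continuous_on)
  show "(2 * K ^ 5 * K)-lipschitz_on {0..T} p"
  proof (rule lipschitz_onI)
    fix x y assume xy: "x \<in> {0..T}" "y \<in> {0..T}"
    show "dist (p x) (p y) \<le> 2 * K ^ 5 * K * dist x y"
      using p_lipschitz[of x y] p_lipschitz[of y x] xy
      by (cases "x \<le> y") (auto simp: dist_real_def abs_minus_commute)
  qed (use K in auto)
qed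

lemma p_bounded: obtains B where "\<And>s. s \<in> {0..T} \<Longrightarrow> p s \<le> B" "0 \<le> B"
proof -
  have "bounded (p ` {0..T})"
    by (rule compact_imp_bounded[OF compact_continuous_image[OF p_continuous compact_Icc]])
  then obtain B where "\<forall>x\<in>p ` {0..T}. norm x \<le> B" unfolding bounded_iff by blast
  then have B: "\<And>s. s \<in> {0..T} \<Longrightarrow> \<bar>p s\<bar> \<le> B" by auto
  have "0 \<le> B" using B[of 0] tT abs_ge_zero[of "p 0"] by (auto intro: order_trans)
  then show ?thesis using B by (intro that[of B]) (auto simp: abs_le_iff)
qed

lemma ph_integrable:
  assumes "t \<le> a" "b \<le> T" shows "set_integrable lborel {a..b} (\<lambda>r. p r * h r)"
proof -
  obtain B where B: "\<And>s. s \<in> {0..T} \<Longrightarrow> p s \<le> B" "0 \<le> B" using p_bounded by blast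
  have [measurable]: "(\<lambda>r. indicator {a..b} r *\<^sub>R p r) \<in> borel_measurable lborel"
    using borel_measurable_continuous_on_indicator[OF _ continuous_on_subset[OF p_continuous], of "{a..b}"] assms tT by auto
  have hi: "integrable lborel (\<lambda>r. indicator {a..b} r *\<^sub>R h r)" using h_sub[OF assms] by (simp add: set_integrable_def)
  have "(\<lambda>r. indicator {a..b} r *\<^sub>R (p r * h r)) = (\<lambda>r. (indicator {a..b} r *\<^sub>R p r) * (indicator {a..b} r *\<^sub>R h r))"
    by (auto simp: indicator_def fun_eq_iff)
  moreover have "integrable lborel (\<lambda>r. (indicator {a..b} r *\<^sub>R p r) * (indicator {a..b} r *\<^sub>R h r))"
  proof (rule Bochner_Integration.integrable_bound)
    show "integrable lborel (\<lambda>r. B * (indicator {a..b} r *\<^sub>R h r))" using hi by simp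
    show "AE r in lborel. norm ((indicator {a..b} r *\<^sub>R p r) * (indicator {a..b} r *\<^sub>R h r)) \<le> norm (B * (indicator {a..b} r *\<^sub>R h r))"
      using B assms tT h(2) p_nonneg by (intro AE_I2) (auto simp: indicator_def abs_mult intro!: mult_right_mono)
  qed (use hi in measurable)
  ultimately show ?thesis by (simp add: set_integrable_def)
qed

text \<open>Freezing the weight at the left end costs its Lipschitz constant times
  \<open>b - a\<close>, an error that disappears for fine partitions.\<close>

lemma ph_le:
  assumes "t \<le> a" "a \<le> b" "b \<le> T"
  shows "(LINT r:{a..b}|lborel. p r * h r) \<le> p a * \<kappa> a b + (2 * K ^ 5 * K) * (b - a) * \<kappa> a b"
proof -
  let ?L = "2 * K ^ 5 * K"
  have i: "set_integrable lborel {a..b} (\<lambda>r. (p a + ?L * (b - a)) * h r)"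
    using h_sub[OF assms(1,3)] by simp
  have "(LINT r:{a..b}|lborel. p r * h r) \<le> (LINT r:{a..b}|lborel. (p a + ?L * (b - a)) * h r)"
  proof (rule set_integral_mono[OF ph_integrable[OF assms(1,3)] i])
    fix r assume r: "r \<in> {a..b}"
    have "p r \<le> p a + ?L * (r - a)" using p_lipschitz[of a r] r assms tT by (auto simp: abs_le_iff)
    also have "\<dots> \<le> p a + ?L * (b - a)" using r K by (intro add_left_mono mult_left_mono) auto
    finally show "p r * h r \<le> (p a + ?L * (b - a)) * h r" by (intro mult_right_mono h(2))
  qed
  also have "\<dots> = (p a + ?L * (b - a)) * \<kappa> a b" by (simp only: set_integral_mult_right)
  also have "\<dots> = p a * \<kappa> a b + ?L * (b - a) * \<kappa> a b" by (rule distrib_right)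
  finally show ?thesis .
qed

text \<open>The lower bound recovers the increment as \<open>\<Phi> a\<close> applied to its
  transported version. For the orthogonality, \<open>\<Psi> a\<close> is moved to the other factor
  as its transpose, where it joins a variable known at time \<open>a\<close>.\<close>

lemma noise_transport:
  assumes "t \<le> a" "a \<le> b" "b \<le> T"
  shows "square_integrable M (\<lambda>\<omega>. \<Psi> a \<omega> *v (I b \<omega> - I a \<omega>))"
    and "p a * \<kappa> a b \<le> (\<integral>\<omega>. (norm (\<Psi> a \<omega> *v (I b \<omega> - I a \<omega>)))\<^sup>2 \<partial>M)"
    and "(\<integral>\<omega>. (norm (\<Psi> a \<omega> *v (I b \<omega> - I a \<omega>)))\<^sup>2 \<partial>M) \<le> K\<^sup>2 * \<kappa> t T"
    and "(\<integral>\<omega>. V a \<omega> \<bullet> (\<Psi> a \<omega> *v (I b \<omega> - I a \<omega>)) \<partial>M) = 0"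
proof -
  have in0: "a \<in> {0..T}" and int: "a \<in> {t..T}" "b \<in> {t..T}" using assms tT by auto
  have \<Psi>K: "AE \<omega> in M. norm (\<Psi> a \<omega>) \<le> K" using bounds by eventually_elim (use in0 in auto)
  note d = dI_sq[OF int(2,1)]
  note \<Psi>d = square_integrable_mult_bounded[OF d \<Psi>_M[OF in0] \<Psi>K]
  show sq: "square_integrable M (\<lambda>\<omega>. \<Psi> a \<omega> *v (I b \<omega> - I a \<omega>))" by (rule \<Psi>d(1))
  let ?e = "essnorm M (\<Phi> a)"
  have e: "0 < ?e" by (rule essnorm_\<Phi>(1)[OF in0])
  have le: "AE \<omega> in M. norm (I b \<omega> - I a \<omega>) \<le> ?e * norm (\<Psi> a \<omega> *v (I b \<omega> - I a \<omega>))"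
    using bounds essnorm_\<Phi>(2)[OF in0]
  proof eventually_elim
    case (elim \<omega>)
    have "I b \<omega> - I a \<omega> = \<Phi> a \<omega> *v (\<Psi> a \<omega> *v (I b \<omega> - I a \<omega>))"
      using elim(1) in0 by (simp add: matrix_vector_mul_assoc matrix_inv_inverse)
    then have "norm (I b \<omega> - I a \<omega>) \<le> norm (\<Phi> a \<omega>) * norm (\<Psi> a \<omega> *v (I b \<omega> - I a \<omega>))"
      by (metis norm_matrix_vector_mult_le)
    also have "\<dots> \<le> ?e * norm (\<Psi> a \<omega> *v (I b \<omega> - I a \<omega>))" using elim(2) by (rule mult_right_mono) simp
    finally show ?case .
  qed
  have "\<kappa> a b \<le> ?e\<^sup>2 * (\<integral>\<omega>. (norm (\<Psi> a \<omega> *v (I b \<omega> - I a \<omega>)))\<^sup>2 \<partial>M)"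
    using square_integrable_bound(2)[OF sq square_integrable_measurable[OF d] le] iso[OF assms] by simp
  then show "p a * \<kappa> a b \<le> (\<integral>\<omega>. (norm (\<Psi> a \<omega> *v (I b \<omega> - I a \<omega>)))\<^sup>2 \<partial>M)"
    using e by (simp add: p_def divide_le_eq mult.commute)
  have "K\<^sup>2 * \<kappa> a b \<le> K\<^sup>2 * \<kappa> t T" using \<kappa>_le[OF assms] by (intro mult_left_mono) auto
  then show "(\<integral>\<omega>. (norm (\<Psi> a \<omega> *v (I b \<omega> - I a \<omega>)))\<^sup>2 \<partial>M) \<le> K\<^sup>2 * \<kappa> t T"
    using \<Psi>d(2) iso[OF assms] by simp
  let ?\<eta> = "\<lambda>\<omega>. transpose (\<Psi> a \<omega>) *v V a \<omega>"
  have "AE \<omega> in M. norm (transpose (\<Psi> a \<omega>)) \<le> K" using \<Psi>K by (simp add: norm_transpose_matrix)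
  then have \<eta>: "square_integrable M ?\<eta>"
    using \<Psi>_M[OF in0] by (intro square_integrable_mult_bounded(1) V_square_integrable(1) int borel_measurable_transpose)
  have "?\<eta> \<in> borel_measurable (Fil a)"
    using \<Phi>_meas[OF in0] X_meas[OF int(1)] by measurable
  from orth[OF assms \<eta> this] have "(\<integral>\<omega>. ?\<eta> \<omega> \<bullet> (I b \<omega> - I a \<omega>) \<partial>M) = 0" .
  moreover have "?\<eta> \<omega> \<bullet> (I b \<omega> - I a \<omega>) = V a \<omega> \<bullet> (\<Psi> a \<omega> *v (I b \<omega> - I a \<omega>))" for \<omega>
    by (simp add: dot_lmul_matrix transpose_matrix_vector)
  ultimately show "(\<integral>\<omega>. V a \<omega> \<bullet> (\<Psi> a \<omega> *v (I b \<omega> - I a \<omega>)) \<partial>M) = 0" by simp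
qed

text \<open>Young's inequality with weight \<open>\<epsilon> (b - a)\<close> absorbs the cross term with the error of \<open>V_step\<close>.\<close>

lemma V_growth_step:
  obtains U C where "\<And>a b \<epsilon>. t \<le> a \<Longrightarrow> a < b \<Longrightarrow> b \<le> T \<Longrightarrow> 0 < \<epsilon> \<Longrightarrow>
       (\<integral>\<omega>. (norm (V a \<omega>))\<^sup>2 \<partial>M) + (LINT r:{a..b}|lborel. p r * h r) \<le> (\<integral>\<omega>. (norm (V b \<omega>))\<^sup>2 \<partial>M)
         + \<epsilon> * U * (b - a) + (C / \<epsilon>) * (b - a) * ((b - a)\<^sup>2 + \<kappa> a b) + (2 * K ^ 5 * K) * (b - a) * \<kappa> a b"
    "0 \<le> U" "0 \<le> C"
proof -
  obtain K0 where K0: "0 \<le> K0" "\<And>s. s \<in> {t..T} \<Longrightarrow> (\<integral>\<omega>. (norm (X s \<omega>))\<^sup>2 \<partial>M) \<le> K0"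
    by (rule X_square_integrable) (rule that, auto)
  obtain C where C: "0 \<le> C" "\<And>a b. t \<le> a \<Longrightarrow> a \<le> b \<Longrightarrow> b \<le> T \<Longrightarrow> \<exists>e. square_integrable M e \<and>
       (\<integral>\<omega>. (norm (e \<omega>))\<^sup>2 \<partial>M) \<le> C * (b - a)\<^sup>2 * ((b - a)\<^sup>2 + \<kappa> a b) \<and>
       (AE \<omega> in M. V b \<omega> = (V a \<omega> + \<Psi> a \<omega> *v (I b \<omega> - I a \<omega>)) + e \<omega>)"
    by (rule V_step) (rule that, auto)
  \<comment> \<open>Bounds the second moment of \<open>V a\<close> plus the transported noise on
    every interval: the two summands are orthogonal, so their bounds add.\<close>
  define U where "U = K\<^sup>2 * K0 + K\<^sup>2 * \<kappa> t T"
  have U: "0 \<le> U" using K0(1) \<kappa>_nonneg by (auto simp: U_def)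
  show thesis
  proof (rule that[OF _ U C(1)])
    fix a b \<epsilon> :: real assume ab: "t \<le> a" "a < b" "b \<le> T" and \<epsilon>: "0 < \<epsilon>"
    then have ab': "a \<le> b" and int: "a \<in> {t..T}" "b \<in> {t..T}" by auto
    obtain e where e: "square_integrable M e" "(\<integral>\<omega>. (norm (e \<omega>))\<^sup>2 \<partial>M) \<le> C * (b - a)\<^sup>2 * ((b - a)\<^sup>2 + \<kappa> a b)"
       "AE \<omega> in M. V b \<omega> = (V a \<omega> + \<Psi> a \<omega> *v (I b \<omega> - I a \<omega>)) + e \<omega>"
      using C(2)[OF ab(1) ab' ab(3)] by blast
    define w where "w \<omega> = \<Psi> a \<omega> *v (I b \<omega> - I a \<omega>)" for \<omega>
    note nt = noise_transport[OF ab(1) ab' ab(3), folded w_def]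
    have w: "square_integrable M w" using nt(1) by (simp add: w_def[abs_def])
    note v = V_square_integrable(1)[OF int(1)]
    define y where "y \<omega> = V a \<omega> + w \<omega>" for \<omega>
    have y: "square_integrable M y" using square_integrable_add(1)[OF v w] by (simp add: y_def[abs_def])
    have y_int: "(\<integral>\<omega>. (norm (y \<omega>))\<^sup>2 \<partial>M) = (\<integral>\<omega>. (norm (V a \<omega>))\<^sup>2 \<partial>M) + (\<integral>\<omega>. (norm (w \<omega>))\<^sup>2 \<partial>M)"
      using integral_norm_add_square[OF v w] nt(4) by (simp add: y_def)
    have "(\<integral>\<omega>. (norm (V a \<omega>))\<^sup>2 \<partial>M) \<le> K\<^sup>2 * K0"
      using V_square_integrable(2)[OF int(1)] mult_left_mono[OF K0(2)[OF int(1)], of "K\<^sup>2"] by auto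
    then have yU: "(\<integral>\<omega>. (norm (y \<omega>))\<^sup>2 \<partial>M) \<le> U" using y_int nt(3) by (simp add: U_def)
    have "(\<integral>\<omega>. (norm (V b \<omega>))\<^sup>2 \<partial>M) = (\<integral>\<omega>. (norm (y \<omega> + e \<omega>))\<^sup>2 \<partial>M)"
    proof (rule integral_cong_AE)
      show "AE \<omega> in M. (norm (V b \<omega>))\<^sup>2 = (norm (y \<omega> + e \<omega>))\<^sup>2"
        using e(3) by eventually_elim (simp add: y_def w_def)
    qed (use V_square_integrable(1)[OF int(2)] square_integrable_add(1)[OF y e(1)] in \<open>auto simp: square_integrable_def\<close>)
    also have "\<dots> = (\<integral>\<omega>. (norm (y \<omega>))\<^sup>2 \<partial>M) + 2 * (\<integral>\<omega>. y \<omega> \<bullet> e \<omega> \<partial>M) + (\<integral>\<omega>. (norm (e \<omega>))\<^sup>2 \<partial>M)"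
      by (rule integral_norm_add_square[OF y e(1)])
    finally have Vb: "(\<integral>\<omega>. (norm (V b \<omega>))\<^sup>2 \<partial>M) \<ge> (\<integral>\<omega>. (norm (y \<omega>))\<^sup>2 \<partial>M) + 2 * (\<integral>\<omega>. y \<omega> \<bullet> e \<omega> \<partial>M)"
      by (simp add: integral_nonneg_AE)
    define \<theta> where "\<theta> = \<epsilon> * (b - a)"
    have \<theta>: "0 < \<theta>" using \<epsilon> ab by (simp add: \<theta>_def)
    have young: "- (2 * (u \<bullet> v)) \<le> \<theta> * (norm u)\<^sup>2 + (norm v)\<^sup>2 / \<theta>" for u v :: "real^'n"
    proof -
      have "0 \<le> (sqrt \<theta> * norm u - norm v / sqrt \<theta>)\<^sup>2" by simp
      also have "\<dots> = \<theta> * (norm u)\<^sup>2 + (norm v)\<^sup>2 / \<theta> - 2 * (norm u * norm v)"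
        using \<theta> by (simp add: power2_diff power_mult_distrib power_divide)
      finally show ?thesis using Cauchy_Schwarz_ineq2[of u v] by linarith
    qed
    have "- (2 * (\<integral>\<omega>. y \<omega> \<bullet> e \<omega> \<partial>M)) = (\<integral>\<omega>. - (2 * (y \<omega> \<bullet> e \<omega>)) \<partial>M)" by simp
    also have "\<dots> \<le> (\<integral>\<omega>. \<theta> * (norm (y \<omega>))\<^sup>2 + (norm (e \<omega>))\<^sup>2 / \<theta> \<partial>M)"
      using square_integrable_inner[OF y e(1)] y e(1) by (intro integral_mono young) (auto simp: square_integrable_def)
    also have "\<dots> = \<theta> * (\<integral>\<omega>. (norm (y \<omega>))\<^sup>2 \<partial>M) + (\<integral>\<omega>. (norm (e \<omega>))\<^sup>2 \<partial>M) / \<theta>"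
      using y e(1) by (simp add: square_integrable_def)
    also have "\<dots> \<le> \<theta> * U + C * (b - a)\<^sup>2 * ((b - a)\<^sup>2 + \<kappa> a b) / \<theta>"
      using yU e(2) \<theta> by (intro add_mono mult_left_mono divide_right_mono) auto
    also have "C * (b - a)\<^sup>2 * ((b - a)\<^sup>2 + \<kappa> a b) / \<theta> = (C / \<epsilon>) * (b - a) * ((b - a)\<^sup>2 + \<kappa> a b)"
      using \<epsilon> ab by (simp add: \<theta>_def power2_eq_square)
    finally have cross: "- (2 * (\<integral>\<omega>. y \<omega> \<bullet> e \<omega> \<partial>M)) \<le> \<epsilon> * U * (b - a) + (C / \<epsilon>) * (b - a) * ((b - a)\<^sup>2 + \<kappa> a b)"
      by (simp add: \<theta>_def mult_ac)
    show "(\<integral>\<omega>. (norm (V a \<omega>))\<^sup>2 \<partial>M) + (LINT r:{a..b}|lborel. p r * h r) \<le> (\<integral>\<omega>. (norm (V b \<omega>))\<^sup>2 \<partial>M)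
         + \<epsilon> * U * (b - a) + (C / \<epsilon>) * (b - a) * ((b - a)\<^sup>2 + \<kappa> a b) + (2 * K ^ 5 * K) * (b - a) * \<kappa> a b"
      using Vb cross y_int nt(2) ph_le[OF ab(1) ab' ab(3)] by linarith
  qed
qed

text \<open>The step estimate is summed over \<open>Suc n\<close> equal intervals. For fixed
  \<open>\<epsilon>\<close> all errors but \<open>\<epsilon> * U * (s - t)\<close> are of order
  \<open>1 / n\<close>, whereas \<open>C / \<epsilon>\<close> blows up for small
  \<open>\<epsilon>\<close>; this fixes the order of the two limits.\<close>

lemma V_lower_bound:
  assumes s: "s \<in> {t..T}"
  shows "(LINT r:{t..s}|lborel. p r * h r) \<le> (\<integral>\<omega>. (norm (V s \<omega>))\<^sup>2 \<partial>M)"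
proof -
  let ?E = "\<lambda>s. \<integral>\<omega>. (norm (V s \<omega>))\<^sup>2 \<partial>M" and ?P = "\<lambda>a b. LINT r:{a..b}|lborel. p r * h r"
  obtain U C where step': "\<And>a b \<epsilon>. t \<le> a \<Longrightarrow> a < b \<Longrightarrow> b \<le> T \<Longrightarrow> 0 < \<epsilon> \<Longrightarrow>
       ?E a + ?P a b \<le> ?E b + \<epsilon> * U * (b - a) + (C / \<epsilon>) * (b - a) * ((b - a)\<^sup>2 + \<kappa> a b) + (2 * K ^ 5 * K) * (b - a) * \<kappa> a b"
    and UC: "0 \<le> U" "0 \<le> C"
    by (rule V_growth_step) (rule that; assumption)
  define L where "L = 2 * K ^ 5 * K"
  note step = step'[folded L_def]
  have E0: "0 \<le> ?E s" for s by (simp add: integral_nonneg_AE)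
  show ?thesis
  proof (cases "s = t")
    case True
    have "?P t t = (\<integral>r. 0 \<partial>(lborel :: real measure))"
      unfolding set_lebesgue_integral_def
    proof (rule integral_cong_AE)
      show "AE r in lborel. indicator {t..t} r *\<^sub>R (p r * h r) = 0"
        using AE_lborel_singleton[of t] by eventually_elim (auto simp: indicator_def)
    qed (use ph_integrable[of t t] tT in \<open>auto simp: set_integrable_def\<close>)
    then show ?thesis using True E0 by simp
  next
    case False
    with s have ts: "t < s" "s \<le> T" by auto
    have eps: "?P t s \<le> ?E s + \<epsilon> * U * (s - t)" if \<epsilon>: "0 < \<epsilon>" for \<epsilon>
    proof -
      have bound: "?P t s \<le> ?E s + \<epsilon> * U * (s - t) + inverse (real (Suc n)) * ((C / \<epsilon>) * (s - t)\<^sup>2 * (s - t) + ((C / \<epsilon>) + L) * (s - t) * \<kappa> t s)" for n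
      proof -
        define d where "d = (s - t) * inverse (real (Suc n))"
        define x where "x i = t + real i * d" for i :: nat
        have d: "0 < d" using ts by (simp add: d_def)
        have xn: "x (Suc n) = s" by (simp add: x_def d_def field_simps del: of_nat_Suc)
        have x_le: "x i \<le> s" if "i \<le> Suc n" for i
        proof -
          have "real i * d \<le> real (Suc n) * d" using that d by (intro mult_right_mono) auto
          then show ?thesis using xn by (simp add: x_def)
        qed
        have x_ge: "t \<le> x i" for i using d by (simp add: x_def)
        \<comment> \<open>The first error is counted once per interval, while those proportional to
          \<open>\<kappa>\<close> add up to \<open>\<kappa> t (x i)\<close>. In this form the
          estimate is preserved by each step.\<close>
        have "?P t (x i) \<le> ?E (x i) + real i * (\<epsilon> * U * d + (C / \<epsilon>) * d * d\<^sup>2) + ((C / \<epsilon>) + L) * d * \<kappa> t (x i)" if "i \<le> Suc n" for i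
          using that
        proof (induction i)
          case 0
          have "?P t t = (\<integral>r. 0 \<partial>(lborel :: real measure))"
            unfolding set_lebesgue_integral_def
          proof (rule integral_cong_AE)
            show "AE r in lborel. indicator {t..t} r *\<^sub>R (p r * h r) = 0"
              using AE_lborel_singleton[of t] by eventually_elim (auto simp: indicator_def)
          qed (use ph_integrable[of t t] tT in \<open>auto simp: set_integrable_def\<close>)
          moreover have "0 \<le> ((C / \<epsilon>) + L) * d * \<kappa> t t"
            using UC \<epsilon> d K \<kappa>_nonneg[of t t] by (intro mult_nonneg_nonneg add_nonneg_nonneg) (auto simp: L_def)
          ultimately show ?case using E0[of t] by (simp add: x_def)
        next
          case (Suc i)
          have xx: "x (Suc i) - x i = d" "x i < x (Suc i)" using d by (auto simp: x_def algebra_simps)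
          have le: "x (Suc i) \<le> T" using x_le[OF Suc.prems] ts by simp
          have "?P t (x (Suc i)) = ?P t (x i) + ?P (x i) (x (Suc i))"
            using xx x_ge le by (intro set_integral_split_real ph_integrable) auto
          moreover have "\<kappa> t (x (Suc i)) = \<kappa> t (x i) + \<kappa> (x i) (x (Suc i))"
            using xx x_ge le by (intro \<kappa>_add) auto
          moreover have "?P t (x i) \<le> ?E (x i) + real i * (\<epsilon> * U * d + (C / \<epsilon>) * d * d\<^sup>2) + ((C / \<epsilon>) + L) * d * \<kappa> t (x i)"
            using Suc by simp
          moreover have "?E (x i) + ?P (x i) (x (Suc i)) \<le> ?E (x (Suc i)) + \<epsilon> * U * d + (C / \<epsilon>) * d * (d\<^sup>2 + \<kappa> (x i) (x (Suc i))) + L * d * \<kappa> (x i) (x (Suc i))"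
            using step[OF x_ge xx(2) le \<epsilon>] unfolding xx(1) .
          ultimately show ?case by (simp add: algebra_simps add_divide_distrib)
        qed
        from this[of "Suc n"] have "?P t s \<le> ?E s + real (Suc n) * (\<epsilon> * U * d + (C / \<epsilon>) * d * d\<^sup>2) + ((C / \<epsilon>) + L) * d * \<kappa> t s"
          unfolding xn by simp
        also have "real (Suc n) * (\<epsilon> * U * d + (C / \<epsilon>) * d * d\<^sup>2) = (\<epsilon> * U + (C / \<epsilon>) * d\<^sup>2) * (real (Suc n) * d)"
          by (simp add: algebra_simps del: of_nat_Suc)
        also have "real (Suc n) * d = s - t" by (simp add: d_def del: of_nat_Suc)
        also have "(\<epsilon> * U + (C / \<epsilon>) * d\<^sup>2) * (s - t) \<le> \<epsilon> * U * (s - t) + inverse (real (Suc n)) * ((C / \<epsilon>) * (s - t)\<^sup>2 * (s - t))"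
        proof -
          let ?i = "inverse (real (Suc n))"
          \<comment> \<open>\<open>d\<^sup>2\<close> decays like the square of \<open>?i\<close>; it
            is weakened to one factor \<open>?i\<close> so that all error terms have it in
            common.\<close>
          have "inverse (real (Suc n)) \<le> 1" by (simp add: inverse_le_1_iff)
          then have "?i\<^sup>2 \<le> ?i" using mult_left_mono[of ?i 1 ?i] by (simp add: power2_eq_square)
          then have "d\<^sup>2 \<le> (s - t)\<^sup>2 * ?i" unfolding d_def power_mult_distrib by (intro mult_left_mono) auto
          then have "(C / \<epsilon>) * d\<^sup>2 * (s - t) \<le> (C / \<epsilon>) * ((s - t)\<^sup>2 * ?i) * (s - t)"
            using UC \<epsilon> ts by (intro mult_right_mono mult_left_mono) auto
          then show ?thesis by (simp add: algebra_simps)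
        qed
        finally have "?P t s \<le> ?E s + (\<epsilon> * U * (s - t) + inverse (real (Suc n)) * ((C / \<epsilon>) * (s - t)\<^sup>2 * (s - t))) + ((C / \<epsilon>) + L) * d * \<kappa> t s"
          by simp
        moreover have "((C / \<epsilon>) + L) * d * \<kappa> t s = inverse (real (Suc n)) * (((C / \<epsilon>) + L) * (s - t) * \<kappa> t s)"
          unfolding d_def by (simp only: mult_ac)
        ultimately show ?thesis
          using distrib_left[of "inverse (real (Suc n))" "(C / \<epsilon>) * (s - t)\<^sup>2 * (s - t)" "((C / \<epsilon>) + L) * (s - t) * \<kappa> t s"]
          by linarith
      qed
      have "(\<lambda>n. ?E s + \<epsilon> * U * (s - t) + inverse (real (Suc n)) * ((C / \<epsilon>) * (s - t)\<^sup>2 * (s - t) + ((C / \<epsilon>) + L) * (s - t) * \<kappa> t s))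
         \<longlonglongrightarrow> ?E s + \<epsilon> * U * (s - t) + 0 * ((C / \<epsilon>) * (s - t)\<^sup>2 * (s - t) + ((C / \<epsilon>) + L) * (s - t) * \<kappa> t s)"
        by (intro tendsto_intros LIMSEQ_inverse_real_of_nat)
      then have "?P t s \<le> ?E s + \<epsilon> * U * (s - t) + 0 * ((C / \<epsilon>) * (s - t)\<^sup>2 * (s - t) + ((C / \<epsilon>) + L) * (s - t) * \<kappa> t s)"
        using bound by (intro LIMSEQ_le_const) auto
      then show ?thesis by simp
    qed
    show ?thesis
    proof (rule field_le_epsilon)
      fix e :: real assume e: "0 < e"
      \<comment> \<open>The summand 1 covers the case \<open>U * (s - t) = 0\<close>.\<close>
      define \<epsilon> where "\<epsilon> = e / (U * (s - t) + 1)"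
      have Us: "0 \<le> U * (s - t)" using UC ts by simp
      then have \<epsilon>: "0 < \<epsilon>" using e by (simp add: \<epsilon>_def)
      have "\<epsilon> * (U * (s - t)) \<le> \<epsilon> * (U * (s - t) + 1)" using \<epsilon> by (intro mult_left_mono) auto
      also have "\<dots> = e" using Us by (simp add: \<epsilon>_def)
      finally have "\<epsilon> * U * (s - t) \<le> e" by (simp add: mult.assoc)
      with eps[OF \<epsilon>] show "?P t s \<le> ?E s + e" by linarith
    qed
  qed
qed

lemma X_lower_bound:
  assumes s: "s \<in> {t..T}"
  shows "(1 / (essnorm M (\<Psi> s))\<^sup>2) * (LINT r:{t..s}|lborel. p r * h r) \<le> (\<integral>\<omega>. (norm (X s \<omega>))\<^sup>2 \<partial>M)"
proof -
  have s0: "s \<in> {0..T}" using s tT by auto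
  have Xs: "square_integrable M (X s)" by (rule X_square_integrable) (use s in auto)
  have "AE \<omega> in M. norm (V s \<omega>) \<le> essnorm M (\<Psi> s) * norm (X s \<omega>)"
    using essnorm_\<Phi>(4)[OF s0] by eventually_elim (auto intro!: order_trans[OF norm_matrix_vector_mult_le] mult_right_mono)
  from square_integrable_bound(2)[OF Xs square_integrable_measurable[OF V_square_integrable(1)[OF s]] this]
  have "(LINT r:{t..s}|lborel. p r * h r) \<le> (essnorm M (\<Psi> s))\<^sup>2 * (\<integral>\<omega>. (norm (X s \<omega>))\<^sup>2 \<partial>M)"
    using V_lower_bound[OF s] by simp
  then show ?thesis using essnorm_\<Phi>(3)[OF s0] by (simp add: divide_le_eq mult.commute)
qed

end

section \<open>The growth estimate for the controlled state\<close>

context lq_noise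
begin

lemma AE_time_measure:
  assumes "AE (s, \<omega>) in time_measure T \<Otimes>\<^sub>M M. P s \<omega>"
  shows "AE \<omega> in M. AE s in lborel. s \<in> {0..T} \<longrightarrow> P s \<omega>"
    and "AE s in lborel. s \<in> {0..T} \<longrightarrow> (AE \<omega> in M. P s \<omega>)"
proof -
  have iff: "(AE s in time_measure T. R s) \<longleftrightarrow> (AE s in lborel. s \<in> {0..T} \<longrightarrow> R s)" for R
    unfolding time_measure_def by (rule AE_restrict_space_iff) simp
  note swap = AE_pair_swap(2,3)[OF TM.sigma_finite_measure_axioms sigma_finite_measure_axioms assms]
  show "AE \<omega> in M. AE s in lborel. s \<in> {0..T} \<longrightarrow> P s \<omega>" using swap(2) unfolding iff .
  show "AE s in lborel. s \<in> {0..T} \<longrightarrow> (AE \<omega> in M. P s \<omega>)" using swap(1) unfolding iff .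
qed

lemma AE_time_mark_measure:
  assumes "AE ((s, \<omega>), z) in (time_measure T \<Otimes>\<^sub>M M) \<Otimes>\<^sub>M \<Lambda>. P s \<omega> z"
  shows "AE (s, \<omega>) in time_measure T \<Otimes>\<^sub>M M. AE z in \<Lambda>. P s \<omega> z"
proof -
  interpret TMM: pair_sigma_finite "time_measure T" M ..
  have sf: "sigma_finite_measure (time_measure T \<Otimes>\<^sub>M M)" by (rule sigma_finite_pair_measure) unfold_locales
  show ?thesis
    using AE_pair_swap(2)[OF sf \<Lambda>.sigma_finite_measure_axioms, of "\<lambda>x z. P (fst x) (snd x) z"] assms
    by (simp add: case_prod_unfold)
qed

lemma bounded_predictable_joint:
  fixes Y :: "real \<Rightarrow> 'w \<Rightarrow> 'x::euclidean_space"
  assumes "bounded_predictable M T \<F> Y"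
  shows "(\<lambda>(\<omega>, s). indicator {0..T} s *\<^sub>R Y s \<omega>) \<in> borel_measurable (M \<Otimes>\<^sub>M lborel)"
  using assms unfolding bounded_predictable_def
  by (intro predictable_joint_measurable measurable_restrict_space1) auto

lemma bounded_predictable_bound:
  fixes Y :: "real \<Rightarrow> 'w \<Rightarrow> 'x::euclidean_space"
  assumes "bounded_predictable M T \<F> Y"
  obtains c where "0 < c" "AE \<omega> in M. AE s in lborel. s \<in> {0..T} \<longrightarrow> norm (Y s \<omega>) \<le> c"
    "AE s in lborel. s \<in> {0..T} \<longrightarrow> (AE \<omega> in M. norm (Y s \<omega>) \<le> c)"
proof -
  obtain c where "AE (s, \<omega>) in time_measure T \<Otimes>\<^sub>M M. norm (Y s \<omega>) \<le> c"
    using assms unfolding bounded_predictable_def by blast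
  \<comment> \<open>The Gronwall estimates divide by this bound, so it is made positive.\<close>
  then have "AE (s, \<omega>) in time_measure T \<Otimes>\<^sub>M M. norm (Y s \<omega>) \<le> max c 1" by eventually_elim auto
  from AE_time_measure[OF this] show ?thesis by (intro that[of "max c 1"]) auto
qed

lemma joint_section:
  assumes "f \<in> borel_measurable (M \<Otimes>\<^sub>M lborel)" "\<omega> \<in> space M"
  shows "(\<lambda>s. f (\<omega>, s)) \<in> borel_measurable lborel"
  using assms(2) by (intro measurable_compose[OF _ assms(1)]) simp

lemma joint_section':
  assumes "f \<in> borel_measurable (M \<Otimes>\<^sub>M lborel)"
  shows "(\<lambda>\<omega>. f (\<omega>, s)) \<in> borel_measurable M"
  by (intro measurable_compose[OF _ assms]) simp

lemma fundamental_solution_ode: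
  assumes \<Phi>: "fundamental_solution M T \<F> A \<Phi>" and A: "bounded_predictable M T \<F> A"
    and c: "AE \<omega> in M. AE s in lborel. s \<in> {0..T} \<longrightarrow> norm (A s \<omega>) \<le> c"
  shows "AE \<omega> in M. linear_ode c T (\<lambda>s. A s \<omega>) (\<lambda>s. \<Phi> s \<omega>)"
proof -
  have "AE \<omega> in M. continuous_on {0..T} (\<lambda>s. \<Phi> s \<omega>) \<and>
        (\<forall>s\<in>{0..T}. \<Phi> s \<omega> = mat 1 + (LINT r:{0..s}|lborel. A r \<omega> ** \<Phi> r \<omega>))"
    using \<Phi> unfolding fundamental_solution_def by blast
  then show ?thesis
    using c AE_space
  proof eventually_elim
    case (elim \<omega>)
    then show ?case
      using joint_section[OF bounded_predictable_joint[OF A] elim(3)] unfolding linear_ode_def by simp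
  qed
qed

text \<open>The left limit in the state equation may be replaced by the state, as the path has countably many
  jumps.\<close>

lemma state_equation:
  fixes A :: "real \<Rightarrow> 'w \<Rightarrow> real^'n^'n" and B :: "real \<Rightarrow> 'w \<Rightarrow> real^'m^'n" and I :: "real \<Rightarrow> 'w \<Rightarrow> real^'n"
  assumes t: "0 \<le> t" "t < T"
    and A: "bounded_predictable M T \<F> A" and B: "bounded_predictable M T \<F> B"
    and B0: "AE \<omega> in M. AE s in lborel. s \<in> {0..T} \<longrightarrow> B s \<omega> = 0"
    and u: "(\<lambda>(\<omega>, s). indicator {t..T} s *\<^sub>R u s \<omega>) \<in> borel_measurable (M \<Otimes>\<^sub>M lborel)"
    and X: "(\<lambda>(\<omega>, s). indicator {t..T} s *\<^sub>R X s \<omega>) \<in> borel_measurable (M \<Otimes>\<^sub>M lborel)"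
    and cad: "\<And>\<omega>. \<omega> \<in> space M \<Longrightarrow> cadlag_on t T (\<lambda>s. X s \<omega>)"
    and eq: "AE \<omega> in M. \<forall>s\<in>{t..T}. X s \<omega> = (LINT r:{t..s}|lborel. A r \<omega> *v left_lim X r \<omega> + B r \<omega> *v u r \<omega>) + I s \<omega>"
  shows "AE \<omega> in M. \<forall>s\<in>{t..T}. X s \<omega> = (LINT r:{t..s}|lborel. A r \<omega> *v X r \<omega>) + I s \<omega>"
  using eq B0 AE_space
proof eventually_elim
  case (elim \<omega>)
  note Am = joint_section[OF bounded_predictable_joint[OF A] elim(3), simplified]
  note Bm = joint_section[OF bounded_predictable_joint[OF B] elim(3), simplified]
  note um = joint_section[OF u elim(3), simplified]
  note Xm = joint_section[OF X elim(3), simplified]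
  \<comment> \<open>The initial time joins the exceptional set because the left limit there carries
    no information about the path on \<open>{t..T}\<close>.\<close>
  define J where "J = insert t {s\<in>{t<..T}. X s \<omega> \<noteq> left_lim X s \<omega>}"
  have J: "countable J"
    using cadlag_countable_jumps[OF cad[OF elim(3)]] by (simp add: J_def left_lim_def)
  have off: "X s \<omega> = left_lim X s \<omega>" if "s \<in> {t..T}" "s \<notin> J" for s
    using that by (auto simp: J_def)
  have Lm: "(\<lambda>s. indicator {t..T} s *\<^sub>R left_lim X s \<omega>) \<in> borel_measurable lborel"
  proof (rule measurable_discrete_difference[OF _ J])
    show "(\<lambda>s. indicator {t..T} s *\<^sub>R X s \<omega>) \<in> borel_measurable lborel" using Xm by simp
    show "indicator {t..T} s *\<^sub>R X s \<omega> = indicator {t..T} s *\<^sub>R left_lim X s \<omega>" if "s \<notin> J" for s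
      using off[OF _ that] by (cases "s \<in> {t..T}") auto
  qed auto
  have nJ: "AE s in lborel. s \<notin> J"
    by (rule AE_not_in[OF countable_imp_null_set_lborel[OF J]])
  show ?case
  proof
    fix s assume s: "s \<in> {t..T}"
    have ind: "(\<lambda>r. indicator {t..s} r :: real) \<in> borel_measurable lborel" by measurable
    have m1: "(\<lambda>r. indicator {t..s} r *\<^sub>R (A r \<omega> *v X r \<omega>)) \<in> borel_measurable lborel"
    proof -
      have "(\<lambda>r. indicator {t..s} r *\<^sub>R ((indicator {0..T} r *\<^sub>R A r \<omega>) *v (indicator {t..T} r *\<^sub>R X r \<omega>))) \<in> borel_measurable lborel"
        using Am Xm by (intro borel_measurable_scaleR[OF ind] borel_measurable_matrix_vector_mult) auto
      also have "(\<lambda>r. indicator {t..s} r *\<^sub>R ((indicator {0..T} r *\<^sub>R A r \<omega>) *v (indicator {t..T} r *\<^sub>R X r \<omega>)))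
          = (\<lambda>r. indicator {t..s} r *\<^sub>R (A r \<omega> *v X r \<omega>))"
        using s t by (auto simp: fun_eq_iff indicator_def)
      finally show ?thesis .
    qed
    have m2: "(\<lambda>r. indicator {t..s} r *\<^sub>R (A r \<omega> *v left_lim X r \<omega> + B r \<omega> *v u r \<omega>)) \<in> borel_measurable lborel"
    proof -
      have "(\<lambda>r. indicator {t..s} r *\<^sub>R ((indicator {0..T} r *\<^sub>R A r \<omega>) *v (indicator {t..T} r *\<^sub>R left_lim X r \<omega>)
          + (indicator {0..T} r *\<^sub>R B r \<omega>) *v (indicator {t..T} r *\<^sub>R u r \<omega>))) \<in> borel_measurable lborel"
        using Am Lm Bm um by (intro borel_measurable_scaleR[OF ind] borel_measurable_add borel_measurable_matrix_vector_mult) auto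
      also have "(\<lambda>r. indicator {t..s} r *\<^sub>R ((indicator {0..T} r *\<^sub>R A r \<omega>) *v (indicator {t..T} r *\<^sub>R left_lim X r \<omega>)
          + (indicator {0..T} r *\<^sub>R B r \<omega>) *v (indicator {t..T} r *\<^sub>R u r \<omega>)))
          = (\<lambda>r. indicator {t..s} r *\<^sub>R (A r \<omega> *v left_lim X r \<omega> + B r \<omega> *v u r \<omega>))"
        using s t by (auto simp: fun_eq_iff indicator_def)
      finally show ?thesis .
    qed
    have "(LINT r:{t..s}|lborel. A r \<omega> *v left_lim X r \<omega> + B r \<omega> *v u r \<omega>) = (LINT r:{t..s}|lborel. A r \<omega> *v X r \<omega>)"
      unfolding set_lebesgue_integral_def
    proof (rule integral_cong_AE[OF m2 m1])
      show "AE r in lborel. indicator {t..s} r *\<^sub>R (A r \<omega> *v left_lim X r \<omega> + B r \<omega> *v u r \<omega>) = indicator {t..s} r *\<^sub>R (A r \<omega> *v X r \<omega>)"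
        using nJ elim(2)
      proof eventually_elim
        case (elim r)
        then show ?case using off[of r] s t
          by (cases "r \<in> {t..s}") (auto simp: bounded_bilinear.zero_left[OF bounded_bilinear_matrix_vector_mult])
      qed
    qed
    then show "X s \<omega> = (LINT r:{t..s}|lborel. A r \<omega> *v X r \<omega>) + I s \<omega>" using elim(1) s by simp
  qed
qed

text \<open>Here the concrete state equation is fed into the growth estimate. The density
  \<open>h\<close> remains an expectation of squared norms; the quadratic form of the hypothesis is
  compared with it only when the cost is estimated.\<close>

lemma state_lower_bound:
  fixes A \<Phi> C :: "real \<Rightarrow> 'w \<Rightarrow> real^'n^'n" and B D :: "real \<Rightarrow> 'w \<Rightarrow> real^'m^'n"
    and E :: "real \<Rightarrow> 'w \<Rightarrow> 'z \<Rightarrow> real^'n^'n" and F :: "real \<Rightarrow> 'w \<Rightarrow> 'z \<Rightarrow> real^'m^'n"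
  assumes t: "0 \<le> t" "t < T"
    and A: "bounded_predictable M T \<F> A" and B: "bounded_predictable M T \<F> B"
    and zero: "AE (s, \<omega>) in time_measure T \<Otimes>\<^sub>M M. B s \<omega> = 0 \<and> C s \<omega> = 0"
      "AE ((s, \<omega>), z) in (time_measure T \<Otimes>\<^sub>M M) \<Otimes>\<^sub>M \<Lambda>. E s \<omega> z = 0"
    and \<Phi>: "fundamental_solution M T \<F> A \<Phi>"
    and u: "u \<in> controls M T \<F> t"
    and X: "is_state M T \<Lambda> \<F> W N A B C D E F t (\<lambda>_. 0) u X"
  obtains h where "set_integrable lborel {t..T} h" "\<And>s. 0 \<le> h s"
    "AE s in lborel. s \<in> {t..T} \<longrightarrow> ennreal (h s) =
        (\<integral>\<^sup>+\<omega>. (ennreal ((norm (D s \<omega> *v u s \<omega>))\<^sup>2) + (\<integral>\<^sup>+z. ennreal ((norm (F s \<omega> z *v u s \<omega>))\<^sup>2) \<partial>\<Lambda>)) \<partial>M)"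
    "\<And>s. s \<in> {t..T} \<Longrightarrow> square_integrable M (X s)"
    "\<And>a b. t \<le> a \<Longrightarrow> b \<le> T \<Longrightarrow> set_integrable lborel {a..b} (\<lambda>r. 1 / (essnorm M (\<Phi> r))\<^sup>2 * h r)"
    "\<And>s. s \<in> {t..T} \<Longrightarrow> 1 / (essnorm M (\<lambda>\<omega>. matrix_inv (\<Phi> s \<omega>)))\<^sup>2 * (LINT r:{t..s}|lborel. 1 / (essnorm M (\<Phi> r))\<^sup>2 * h r)
        \<le> (\<integral>\<omega>. (norm (X s \<omega>))\<^sup>2 \<partial>M)"
    "continuous_on {0..T} (\<lambda>s. 1 / (essnorm M (\<lambda>\<omega>. matrix_inv (\<Phi> s \<omega>)))\<^sup>2)"
    "(\<lambda>(\<omega>, s). indicator {t..T} s *\<^sub>R X s \<omega>) \<in> borel_measurable (M \<Otimes>\<^sub>M lborel)"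
proof -
  obtain IW IN where
    Xm: "\<And>s. s \<in> {t..T} \<Longrightarrow> X s \<in> borel_measurable (\<F> s)" and
    cad: "\<And>\<omega>. \<omega> \<in> space M \<Longrightarrow> cadlag_on t T (\<lambda>s. X s \<omega>)" and
    X_sq: "(\<integral>\<^sup>+\<omega>. (\<integral>\<^sup>+s\<in>{t..T}. ennreal ((norm (X s \<omega>))\<^sup>2) \<partial>lborel) \<partial>M) < \<infinity>" and
    W: "is_integral_W M T \<F> W t (\<lambda>s \<omega>. C s \<omega> *v left_lim X s \<omega> + D s \<omega> *v u s \<omega>) IW" and
    NN: "is_integral_N M T \<Lambda> \<F> N t (\<lambda>s \<omega> z. E s \<omega> z *v left_lim X s \<omega> + F s \<omega> z *v u s \<omega>) IN" and
    eq: "AE \<omega> in M. \<forall>s\<in>{t..T}.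
           X s \<omega> = 0 + (LINT r:{t..s}|lborel. A r \<omega> *v left_lim X r \<omega> + B r \<omega> *v u r \<omega>) + IW s \<omega> + IN s \<omega>"
    using X unfolding is_state_def by blast
  define I where "I s \<omega> = IW s \<omega> + IN s \<omega>" for s \<omega>
  let ?HW = "\<lambda>s \<omega>. C s \<omega> *v left_lim X s \<omega> + D s \<omega> *v u s \<omega>"
  let ?HN = "\<lambda>s \<omega> z. E s \<omega> z *v left_lim X s \<omega> + F s \<omega> z *v u s \<omega>"
  note inc = noise_increments[OF t(1) W NN, folded I_def]
  obtain c where c: "0 < c" "AE \<omega> in M. AE s in lborel. s \<in> {0..T} \<longrightarrow> norm (A s \<omega>) \<le> c"
    by (rule bounded_predictable_bound[OF A])
  obtain K where K: "0 < K" and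
    K1: "\<And>A (\<Phi> :: real \<Rightarrow> real^'n^'n) s. linear_ode c T A \<Phi> \<Longrightarrow> s \<in> {0..T} \<Longrightarrow>
       invertible (\<Phi> s) \<and> norm (\<Phi> s) \<le> K \<and> norm (matrix_inv (\<Phi> s)) \<le> K" and
    K2: "\<And>A (\<Phi> :: real \<Rightarrow> real^'n^'n) r s. linear_ode c T A \<Phi> \<Longrightarrow> 0 \<le> r \<Longrightarrow> r \<le> s \<Longrightarrow> s \<le> T \<Longrightarrow>
       norm (\<Phi> s - \<Phi> r) \<le> K * (s - r) \<and> norm (matrix_inv (\<Phi> s) - matrix_inv (\<Phi> r)) \<le> K * (s - r)"
    using linear_ode_bounds[OF T c(1)] by blast
  note ode = fundamental_solution_ode[OF \<Phi> A c(2)]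
  have XM: "X s \<in> borel_measurable M" if "s \<in> {t..T}" for s using measurable_\<F>_M[OF Xm[OF that]] that by simp
  have Xj: "(\<lambda>(\<omega>, s). indicator {t..T} s *\<^sub>R X s \<omega>) \<in> borel_measurable (M \<Otimes>\<^sub>M lborel)"
    using t by (intro cadlag_joint_measurable[OF XM cad]) auto
  have uj: "(\<lambda>(\<omega>, s). indicator {t..T} s *\<^sub>R u s \<omega>) \<in> borel_measurable (M \<Otimes>\<^sub>M lborel)"
    using u t unfolding controls_def by (intro predictable_joint_measurable) auto
  have BC: "AE \<omega> in M. AE s in lborel. s \<in> {0..T} \<longrightarrow> B s \<omega> = 0 \<and> C s \<omega> = 0"
    by (rule AE_time_measure(1)[OF zero(1)])
  then have B0: "AE \<omega> in M. AE s in lborel. s \<in> {0..T} \<longrightarrow> B s \<omega> = 0"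
    by eventually_elim (auto elim: eventually_mono)
  have eq': "AE \<omega> in M. \<forall>s\<in>{t..T}. X s \<omega> = (LINT r:{t..s}|lborel. A r \<omega> *v X r \<omega>) + I s \<omega>"
    by (rule state_equation[OF t A B B0 uj Xj cad]) (use eq in \<open>auto simp: I_def add.assoc\<close>)
  \<comment> \<open>The cut-off gives a measurable function on the whole line: the integrands are
    known to be measurable on \<open>(t, T]\<close> only.\<close>
  define dens where "dens s = indicator {t<..T} s * noise_density ?HW ?HN s" for s
  have dens_m: "dens \<in> borel_measurable lborel" unfolding dens_def by (rule inc(3))
  \<comment> \<open>\<open>enn2real\<close> sends infinite values to 0. They occur on a null set
    only, because the density has a finite integral.\<close>
  define h where "h s = enn2real (dens s)" for s
  have dens_inc: "(\<integral>\<^sup>+s\<in>{a<..b}. dens s \<partial>lborel) = ennreal (\<integral>\<omega>. (norm (I b \<omega> - I a \<omega>))\<^sup>2 \<partial>M)"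
    if "t \<le> a" "a \<le> b" "b \<le> T" for a b
  proof -
    have "(\<integral>\<^sup>+s\<in>{a<..b}. dens s \<partial>lborel) = (\<integral>\<^sup>+s\<in>{a<..b}. noise_density ?HW ?HN s \<partial>lborel)"
      using that by (intro nn_integral_cong) (auto simp: dens_def indicator_def)
    then show ?thesis using inc(4)[OF that] by simp
  qed
  have dens_fin: "AE s in lborel. dens s \<noteq> \<infinity>"
  proof (rule nn_integral_PInf_AE[OF dens_m])
    have "(\<integral>\<^sup>+s. dens s \<partial>lborel) = (\<integral>\<^sup>+s\<in>{t<..T}. dens s \<partial>lborel)"
      by (intro nn_integral_cong) (auto simp: dens_def indicator_def)
    then show "(\<integral>\<^sup>+s. dens s \<partial>lborel) \<noteq> \<infinity>" using dens_inc[of t T] t by simp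
  qed
  have h_dens: "AE s in lborel. ennreal (h s) = dens s"
    using dens_fin by eventually_elim (simp add: h_def less_top)
  have h_m: "h \<in> borel_measurable lborel" unfolding h_def[abs_def] using dens_m by measurable
  have h_nonneg: "0 \<le> h s" for s by (simp add: h_def)
  have h_int: "set_integrable lborel {a..b} h \<and> (LINT r:{a..b}|lborel. h r) = (\<integral>\<omega>. (norm (I b \<omega> - I a \<omega>))\<^sup>2 \<partial>M)"
    if ab: "t \<le> a" "a \<le> b" "b \<le> T" for a b
  proof -
    have "(\<integral>\<^sup>+s. ennreal (indicator {a..b} s *\<^sub>R h s) \<partial>lborel) = (\<integral>\<^sup>+s\<in>{a<..b}. dens s \<partial>lborel)"
    proof (rule nn_integral_cong_AE)
      show "AE s in lborel. ennreal (indicator {a..b} s *\<^sub>R h s) = dens s * indicator {a<..b} s"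
        using h_dens AE_lborel_singleton[of a] by eventually_elim (auto simp: indicator_def)
    qed
    then have nn: "(\<integral>\<^sup>+s. ennreal (indicator {a..b} s *\<^sub>R h s) \<partial>lborel) = ennreal (\<integral>\<omega>. (norm (I b \<omega> - I a \<omega>))\<^sup>2 \<partial>M)"
      using dens_inc[OF ab] by simp
    have "has_bochner_integral lborel (\<lambda>s. indicator {a..b} s *\<^sub>R h s) (\<integral>\<omega>. (norm (I b \<omega> - I a \<omega>))\<^sup>2 \<partial>M)"
      using h_m nn h_nonneg by (intro has_bochner_integral_nn_integral) (auto simp: integral_nonneg_AE)
    then show ?thesis by (simp add: has_bochner_integral_iff set_integrable_def set_lebesgue_integral_def)
  qed
  interpret G: state_growth M \<F> t T c K A \<Phi> X I h
  proof
    show "AE \<omega> in M. \<forall>s\<in>{0..T}. invertible (\<Phi> s \<omega>) \<and> norm (\<Phi> s \<omega>) \<le> K \<and> norm (matrix_inv (\<Phi> s \<omega>)) \<le> K"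
      using ode by eventually_elim (use K1 in blast)
    show "AE \<omega> in M. \<forall>r s. 0 \<le> r \<and> r \<le> s \<and> s \<le> T \<longrightarrow> norm (\<Phi> s \<omega> - \<Phi> r \<omega>) \<le> K * (s - r) \<and>
       norm (matrix_inv (\<Phi> s \<omega>) - matrix_inv (\<Phi> r \<omega>)) \<le> K * (s - r)"
      using ode by eventually_elim (use K2 in blast)
    show "\<Phi> s \<in> borel_measurable (\<F> s)" if "s \<in> {0..T}" for s
      using \<Phi> that unfolding fundamental_solution_def by blast
    show "space (\<F> s) = space M \<and> sets (\<F> s) \<subseteq> sets M" if "s \<in> {0..T}" for s
      using \<F>_subset[of s] that by simp
    show "(\<integral>\<omega>. \<eta> \<omega> \<bullet> (I b \<omega> - I a \<omega>) \<partial>M) = 0"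
      if "t \<le> a" "a \<le> b" "b \<le> T" "square_integrable M \<eta>" "\<eta> \<in> borel_measurable (\<F> a)" for a b \<eta>
      by (rule inc(5)[OF that])
  qed (use t c K ode Xm Xj X_sq eq' inc(1) h_nonneg h_int[of t T] h_int bounded_predictable_joint[OF A] in auto)
  show thesis
  proof (rule that[of h])
    show "set_integrable lborel {t..T} h" using h_int[of t T] t by simp
    have C0: "AE s in lborel. s \<in> {0..T} \<longrightarrow> (AE \<omega> in M. B s \<omega> = 0 \<and> C s \<omega> = 0)"
      by (rule AE_time_measure(2)[OF zero(1)])
    have E0: "AE s in lborel. s \<in> {0..T} \<longrightarrow> (AE \<omega> in M. AE z in \<Lambda>. E s \<omega> z = 0)"
      by (rule AE_time_measure(2)[OF AE_time_mark_measure[OF zero(2)]])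
    show "AE s in lborel. s \<in> {t..T} \<longrightarrow> ennreal (h s) =
        (\<integral>\<^sup>+\<omega>. (ennreal ((norm (D s \<omega> *v u s \<omega>))\<^sup>2) + (\<integral>\<^sup>+z. ennreal ((norm (F s \<omega> z *v u s \<omega>))\<^sup>2) \<partial>\<Lambda>)) \<partial>M)"
      using h_dens C0 E0 AE_lborel_singleton[of t]
    proof eventually_elim
      case (elim s)
      show ?case
      proof
        assume s: "s \<in> {t..T}"
        with t have s0: "s \<in> {0..T}" by auto
        have "dens s = noise_density ?HW ?HN s" using s elim(4) by (auto simp: dens_def indicator_def)
        also have "\<dots> = (\<integral>\<^sup>+\<omega>. (ennreal ((norm (D s \<omega> *v u s \<omega>))\<^sup>2) + (\<integral>\<^sup>+z. ennreal ((norm (F s \<omega> z *v u s \<omega>))\<^sup>2) \<partial>\<Lambda>)) \<partial>M)"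
          unfolding noise_density_def
        proof (rule nn_integral_cong_AE)
          show "AE \<omega> in M. ennreal ((norm (?HW s \<omega>))\<^sup>2) + (\<integral>\<^sup>+z. ennreal ((norm (?HN s \<omega> z))\<^sup>2) \<partial>\<Lambda>)
             = ennreal ((norm (D s \<omega> *v u s \<omega>))\<^sup>2) + (\<integral>\<^sup>+z. ennreal ((norm (F s \<omega> z *v u s \<omega>))\<^sup>2) \<partial>\<Lambda>)"
            using elim(2)[rule_format, OF s0] elim(3)[rule_format, OF s0]
          proof eventually_elim
            case (elim \<omega>)
            have "(\<integral>\<^sup>+z. ennreal ((norm (?HN s \<omega> z))\<^sup>2) \<partial>\<Lambda>) = (\<integral>\<^sup>+z. ennreal ((norm (F s \<omega> z *v u s \<omega>))\<^sup>2) \<partial>\<Lambda>)"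
              by (rule nn_integral_cong_AE) (use elim(2) in eventually_elim, simp add: bounded_bilinear.zero_left[OF bounded_bilinear_matrix_vector_mult])
            then show ?case using elim(1) by (simp add: bounded_bilinear.zero_left[OF bounded_bilinear_matrix_vector_mult])
          qed
        qed
        finally show "ennreal (h s) = (\<integral>\<^sup>+\<omega>. (ennreal ((norm (D s \<omega> *v u s \<omega>))\<^sup>2) + (\<integral>\<^sup>+z. ennreal ((norm (F s \<omega> z *v u s \<omega>))\<^sup>2) \<partial>\<Lambda>)) \<partial>M)"
          using elim(1) by simp
      qed
    qed
    show "square_integrable M (X s)" if "s \<in> {t..T}" for s
      by (rule G.X_square_integrable) (use that in auto)
    show "set_integrable lborel {a..b} (\<lambda>r. 1 / (essnorm M (\<Phi> r))\<^sup>2 * h r)" if "t \<le> a" "b \<le> T" for a b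
      using G.ph_integrable[OF that] by (simp add: G.p_def)
    show "1 / (essnorm M (\<lambda>\<omega>. matrix_inv (\<Phi> s \<omega>)))\<^sup>2 * (LINT r:{t..s}|lborel. 1 / (essnorm M (\<Phi> r))\<^sup>2 * h r)
        \<le> (\<integral>\<omega>. (norm (X s \<omega>))\<^sup>2 \<partial>M)" if "s \<in> {t..T}" for s
      using G.X_lower_bound[OF that] by (simp add: G.p_def)
    show "continuous_on {0..T} (\<lambda>s. 1 / (essnorm M (\<lambda>\<omega>. matrix_inv (\<Phi> s \<omega>)))\<^sup>2)"
      by (rule G.inverse_essnorm_\<Psi>_continuous)
  qed (use h_nonneg Xj in auto)
qed

end

section \<open>The cost\<close>

text \<open>Fubini on the triangle \<open>a \<le> r \<le> s \<le> b\<close>. It turns the growth of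
  the state up to time \<open>s\<close>, weighted by \<open>f\<close>, into the tail integral of the
  weights that stands in the hypothesis of the theorem.\<close>

lemma set_integrable_triangle_swap:
  fixes f g :: "real \<Rightarrow> real"
  assumes f: "set_integrable lborel {a..b} f" and g: "set_integrable lborel {a..b} g"
  shows "set_integrable lborel {a..b} (\<lambda>s. f s * (LINT r:{a..s}|lborel. g r))"
    and "set_integrable lborel {a..b} (\<lambda>r. (LINT s:{r..b}|lborel. f s) * g r)"
    and "(LINT s:{a..b}|lborel. f s * (LINT r:{a..s}|lborel. g r)) = (LINT r:{a..b}|lborel. (LINT s:{r..b}|lborel. f s) * g r)"
proof -
  let ?f = "\<lambda>s. indicator {a..b} s *\<^sub>R f s" and ?g = "\<lambda>r. indicator {a..b} r *\<^sub>R g r"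
  define F where "F s r = (?f s * ?g r) * indicator {x. snd x \<le> fst x} (s, r)" for s r :: real
  have fi: "integrable lborel ?f" and gi: "integrable lborel ?g" using f g by (auto simp: set_integrable_def)
  have prod: "integrable (lborel \<Otimes>\<^sub>M lborel) (\<lambda>(s, r). ?f s * ?g r)"
    using has_bochner_integral_product[OF lborel.sigma_finite_measure_axioms lborel.sigma_finite_measure_axioms
        has_bochner_integral_integrable[OF fi] has_bochner_integral_integrable[OF gi]]
    by (simp add: has_bochner_integral_iff)
  have tri: "{x :: real \<times> real. snd x \<le> fst x} \<in> sets (lborel \<Otimes>\<^sub>M lborel)"
  proof -
    have "{x \<in> space (lborel \<Otimes>\<^sub>M lborel). snd x \<le> (fst x :: real)} \<in> sets (lborel \<Otimes>\<^sub>M lborel)" by measurable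
    then show ?thesis by (simp add: space_pair_measure)
  qed
  have int: "integrable (lborel \<Otimes>\<^sub>M lborel) (\<lambda>(s, r). F s r)"
    using integrable_mult_indicator[OF tri prod] by (simp add: F_def case_prod_unfold mult.commute)
  have s: "(\<integral>r. F s r \<partial>lborel) = indicator {a..b} s *\<^sub>R (f s * (LINT r:{a..s}|lborel. g r))" for s
  proof -
    have "(\<integral>r. F s r \<partial>lborel) = (\<integral>r. (indicator {a..b} s * f s) * (indicator {a..s} r *\<^sub>R g r) \<partial>lborel)"
      by (intro Bochner_Integration.integral_cong) (auto simp: F_def indicator_def)
    then show ?thesis by (simp add: set_lebesgue_integral_def)
  qed
  have r: "(\<integral>s. F s r \<partial>lborel) = indicator {a..b} r *\<^sub>R ((LINT s:{r..b}|lborel. f s) * g r)" for r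
  proof -
    have "(\<integral>s. F s r \<partial>lborel) = (\<integral>s. (indicator {r..b} s *\<^sub>R f s) * (indicator {a..b} r * g r) \<partial>lborel)"
      by (intro Bochner_Integration.integral_cong) (auto simp: F_def indicator_def)
    then show ?thesis by (simp add: set_lebesgue_integral_def)
  qed
  show "set_integrable lborel {a..b} (\<lambda>s. f s * (LINT r:{a..s}|lborel. g r))"
    using lborel_pair.integrable_fst[OF int] unfolding s set_integrable_def .
  show "set_integrable lborel {a..b} (\<lambda>r. (LINT s:{r..b}|lborel. f s) * g r)"
    using lborel_pair.integrable_snd[OF int] unfolding r set_integrable_def .
  show "(LINT s:{a..b}|lborel. f s * (LINT r:{a..s}|lborel. g r)) = (LINT r:{a..b}|lborel. (LINT s:{r..b}|lborel. f s) * g r)"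
    using lborel_pair.Fubini_integral[OF int] unfolding s r set_lebesgue_integral_def ..
qed

text \<open>\<open>ennreal\<close> cuts off negative values, so the assumption bounds the integral
  of the positive part, which dominates that of \<open>f\<close>.\<close>

lemma integral_le_of_nn_integral_le:
  fixes f :: "'a \<Rightarrow> real"
  assumes "integrable M f" "(\<integral>\<^sup>+x. ennreal (f x) \<partial>M) \<le> ennreal a" "0 \<le> a"
  shows "(\<integral>x. f x \<partial>M) \<le> a"
proof -
  have i: "integrable M (\<lambda>x. max 0 (f x))" using assms(1) by simp
  have "(\<integral>x. f x \<partial>M) \<le> (\<integral>x. max 0 (f x) \<partial>M)" by (intro integral_mono i assms(1)) auto
  also have "\<dots> \<le> a"
  proof -
    have "ennreal (\<integral>x. max 0 (f x) \<partial>M) = (\<integral>\<^sup>+x. ennreal (max 0 (f x)) \<partial>M)"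
      by (rule nn_integral_eq_integral[symmetric, OF i]) auto
    also have "\<dots> = (\<integral>\<^sup>+x. ennreal (f x) \<partial>M)"
      by (intro nn_integral_cong) (simp add: max_def ennreal_neg)
    finally have "ennreal (\<integral>x. max 0 (f x) \<partial>M) \<le> ennreal a" using assms(2) by simp
    then show ?thesis using assms(3) by (simp add: ennreal_le_iff)
  qed
  finally show ?thesis .
qed

section \<open>Essential infima and their measurability in a parameter\<close>

context prob_space
begin

text \<open>The bound on \<open>f\<close> keeps the essential infimum finite, so that passing to a
  real number loses nothing.\<close>

lemma essinf_bounds:
  fixes f :: "'a \<Rightarrow> real"
  assumes f: "f \<in> borel_measurable M" and c: "AE \<omega> in M. \<bar>f \<omega>\<bar> \<le> c"
  shows "AE \<omega> in M. essinf M f \<le> f \<omega>" and "\<bar>essinf M f\<bar> \<le> c"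
proof -
  let ?e = "esssup M (\<lambda>\<omega>. - ereal (f \<omega>))"
  have m: "(\<lambda>\<omega>. - ereal (f \<omega>)) \<in> borel_measurable M" using f by measurable
  have up: "?e \<le> ereal c" by (rule esssup_I[OF m]) (use c in \<open>auto simp: abs_le_iff elim: eventually_mono\<close>)
  have "esssup M (\<lambda>_. ereal (- c)) \<le> ?e"
    by (rule esssup_AE_mono) (use c in \<open>auto simp: abs_le_iff elim: eventually_mono\<close>)
  then have lo: "ereal (- c) \<le> ?e" by (simp add: esssup_const emeasure_space_1)
  obtain x where x: "?e = ereal x" using up lo by (cases ?e) auto
  have ei: "essinf M f = - x" unfolding essinf_def x by simp
  show "\<bar>essinf M f\<bar> \<le> c" using up lo x ei by (simp add: abs_le_iff)
  show "AE \<omega> in M. essinf M f \<le> f \<omega>"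
    using esssup_AE[of "\<lambda>\<omega>. - ereal (f \<omega>)" M] unfolding x ei by eventually_elim simp
qed

text \<open>An essential supremum is at most \<open>z\<close> iff the set where \<open>z\<close> is
  exceeded is null, and the measure of the sections of a jointly measurable set depends measurably
  on the parameter.\<close>

lemma borel_measurable_essinf:
  fixes g :: "'a \<times> 'b \<Rightarrow> real"
  assumes g: "g \<in> borel_measurable (M \<Otimes>\<^sub>M N)"
  shows "(\<lambda>s. essinf M (\<lambda>\<omega>. g (\<omega>, s))) \<in> borel_measurable N"
proof -
  let ?e = "\<lambda>s. esssup M (\<lambda>\<omega>. - ereal (g (\<omega>, s)))"
  have sec: "(\<lambda>\<omega>. - ereal (g (\<omega>, s))) \<in> borel_measurable M" if "s \<in> space N" for s
  proof -
    have "(\<lambda>\<omega>. g (\<omega>, s)) \<in> borel_measurable M" using that by (intro measurable_compose[OF _ g]) simp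
    then show ?thesis by measurable
  qed
  have "?e \<in> borel_measurable N"
    unfolding borel_measurable_iff_Iic_ereal
  proof
    fix z :: ereal
    let ?S = "{x \<in> space (N \<Otimes>\<^sub>M M). z < - ereal (g (snd x, fst x))}"
    have "(\<lambda>x. g (snd x, fst x)) \<in> borel_measurable (N \<Otimes>\<^sub>M M)"
      using measurable_pair_swap[OF g] by (simp add: case_prod_unfold)
    then have S: "?S \<in> sets (N \<Otimes>\<^sub>M M)" by measurable
    have iff: "?e s \<le> z \<longleftrightarrow> emeasure M (Pair s -` ?S) = 0" if s: "s \<in> space N" for s
    proof -
      have eq: "Pair s -` ?S = {\<omega> \<in> space M. z < - ereal (g (\<omega>, s))}" using s by (auto simp: space_pair_measure)
      show ?thesis unfolding eq
      proof
        assume le: "?e s \<le> z"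
        have "{\<omega> \<in> space M. z < - ereal (g (\<omega>, s))} \<subseteq> {\<omega> \<in> space M. ?e s < - ereal (g (\<omega>, s))}" using le by auto
        then have "emeasure M {\<omega> \<in> space M. z < - ereal (g (\<omega>, s))} \<le> emeasure M {\<omega> \<in> space M. ?e s < - ereal (g (\<omega>, s))}"
          using sec[OF s] by (intro emeasure_mono borel_measurable_less) simp_all
        then show "emeasure M {\<omega> \<in> space M. z < - ereal (g (\<omega>, s))} = 0"
          using esssup_zero_measure[of M "\<lambda>\<omega>. - ereal (g (\<omega>, s))"] by simp
      next
        assume 0: "emeasure M {\<omega> \<in> space M. z < - ereal (g (\<omega>, s))} = 0"
        then show "?e s \<le> z" unfolding esssup_eq[OF sec[OF s]] by (intro Inf_lower) simp
      qed
    qed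
    have "{s \<in> space N. emeasure M (Pair s -` ?S) = 0} \<in> sets N"
      using measurable_emeasure_Pair[OF S] by measurable
    also have "{s \<in> space N. emeasure M (Pair s -` ?S) = 0} = ?e -` {..z} \<inter> space N" using iff by auto
    finally show "?e -` {..z} \<inter> space N \<in> sets N" .
  qed
  then show ?thesis unfolding essinf_def by measurable
qed

end

context lq_noise
begin

lemma essinf_eigenvalue:
  fixes Q :: "real \<Rightarrow> 'w \<Rightarrow> real^'n^'n"
  assumes Q: "bounded_predictable M T \<F> Q"
    and sym: "\<And>s \<omega>. s \<in> {0..T} \<Longrightarrow> \<omega> \<in> space M \<Longrightarrow> symmetric_matrix (Q s \<omega>)"
  defines "l \<equiv> \<lambda>s. essinf M (\<lambda>\<omega>. smallest_eigenvalue (Q s \<omega>))"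
  obtains c where "0 < c" "(\<lambda>s. indicator {0..T} s *\<^sub>R l s) \<in> borel_measurable lborel"
    "AE s in lborel. s \<in> {0..T} \<longrightarrow> \<bar>l s\<bar> \<le> c \<and> (AE \<omega> in M. l s \<le> rayleigh_min (Q s \<omega>))"
proof -
  obtain c where c: "0 < c" "AE s in lborel. s \<in> {0..T} \<longrightarrow> (AE \<omega> in M. norm (Q s \<omega>) \<le> c)"
    by (rule bounded_predictable_bound[OF Q])
  note Qj = bounded_predictable_joint[OF Q]
  \<comment> \<open>Outside \<open>{0..T}\<close> the matrix is replaced by 0, which makes
    \<open>g\<close> jointly measurable; inside, symmetry identifies its values with the smallest
    eigenvalues.\<close>
  define g where "g x = rayleigh_min (indicator {0..T} (snd x) *\<^sub>R Q (snd x) (fst x))" for x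
  have g: "g \<in> borel_measurable (M \<Otimes>\<^sub>M lborel)"
    using borel_measurable_rayleigh_min[OF Qj] by (simp add: g_def[abs_def] case_prod_unfold)
  have l_g: "l s = essinf M (\<lambda>\<omega>. g (\<omega>, s))" if s: "s \<in> {0..T}" for s
  proof -
    have eq: "smallest_eigenvalue (Q s \<omega>) = g (\<omega>, s)" if "\<omega> \<in> space M" for \<omega>
      using smallest_eigenvalue_eq_rayleigh_min[OF sym[OF s that]] s by (simp add: g_def)
    have m: "(\<lambda>\<omega>. - ereal (g (\<omega>, s))) \<in> borel_measurable M" using joint_section'[OF g] by measurable
    then have m': "(\<lambda>\<omega>. - ereal (smallest_eigenvalue (Q s \<omega>))) \<in> borel_measurable M"
      by (subst measurable_cong[where g = "\<lambda>\<omega>. - ereal (g (\<omega>, s))"]) (auto simp: eq)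
    have "esssup M (\<lambda>\<omega>. - ereal (smallest_eigenvalue (Q s \<omega>))) = esssup M (\<lambda>\<omega>. - ereal (g (\<omega>, s)))"
      using eq by (intro esssup_AE_cong[OF m' m] AE_I2) simp
    then show ?thesis by (simp add: l_def essinf_def)
  qed
  show thesis
  proof (rule that[OF c(1)])
    have "(\<lambda>s. indicator {0..T} s *\<^sub>R essinf M (\<lambda>\<omega>. g (\<omega>, s))) \<in> borel_measurable lborel"
      using borel_measurable_essinf[OF g] by measurable
    also have "(\<lambda>s. indicator {0..T} s *\<^sub>R essinf M (\<lambda>\<omega>. g (\<omega>, s))) = (\<lambda>s. indicator {0..T} s *\<^sub>R l s)"
      using l_g by (auto simp: fun_eq_iff indicator_def)
    finally show "(\<lambda>s. indicator {0..T} s *\<^sub>R l s) \<in> borel_measurable lborel" .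
    show "AE s in lborel. s \<in> {0..T} \<longrightarrow> \<bar>l s\<bar> \<le> c \<and> (AE \<omega> in M. l s \<le> rayleigh_min (Q s \<omega>))"
      using c(2)
    proof eventually_elim
      case (elim s)
      show ?case
      proof
        assume s: "s \<in> {0..T}"
        have "AE \<omega> in M. \<bar>g (\<omega>, s)\<bar> \<le> c"
          using elim[rule_format, OF s] by eventually_elim (use s in \<open>auto simp: g_def intro: order_trans[OF abs_rayleigh_min_le]\<close>)
        from essinf_bounds[OF joint_section'[OF g] this]
        show "\<bar>l s\<bar> \<le> c \<and> (AE \<omega> in M. l s \<le> rayleigh_min (Q s \<omega>))"
          unfolding l_g[OF s] using s by (simp add: g_def)
      qed
    qed
  qed
qed

lemma quadratic_cost_integrable:
  fixes R :: "real \<Rightarrow> 'w \<Rightarrow> real^'k^'k" and x :: "real \<Rightarrow> 'w \<Rightarrow> real^'k"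
  assumes t: "0 \<le> t" and R: "bounded_predictable M T \<F> R"
    and x: "(\<lambda>(\<omega>, s). indicator {t..T} s *\<^sub>R x s \<omega>) \<in> borel_measurable (M \<Otimes>\<^sub>M lborel)"
    and x2: "(\<integral>\<^sup>+\<omega>. (\<integral>\<^sup>+s\<in>{t..T}. ennreal ((norm (x s \<omega>))\<^sup>2) \<partial>lborel) \<partial>M) < \<infinity>"
  shows "integrable (M \<Otimes>\<^sub>M lborel) (\<lambda>(\<omega>, s). indicator {t..T} s * ((R s \<omega> *v x s \<omega>) \<bullet> x s \<omega>))"
    and "integrable (M \<Otimes>\<^sub>M lborel) (\<lambda>(\<omega>, s). indicator {t..T} s * (norm (x s \<omega>))\<^sup>2)"
proof -
  interpret MT: pair_sigma_finite M "lborel :: real measure" ..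
  let ?x = "\<lambda>(\<omega>, s). indicator {t..T} s *\<^sub>R x s \<omega>" and ?R = "\<lambda>(\<omega>, s). indicator {0..T} s *\<^sub>R R s \<omega>"
  note Rj = bounded_predictable_joint[OF R]
  obtain c where c: "0 < c" "AE \<omega> in M. AE s in lborel. s \<in> {0..T} \<longrightarrow> norm (R s \<omega>) \<le> c"
    by (rule bounded_predictable_bound[OF R])
  have nx: "(\<lambda>y. ennreal ((norm (?x y))\<^sup>2)) \<in> borel_measurable (M \<Otimes>\<^sub>M lborel)"
    by (rule measurable_compose[OF x]) measurable
  have "(\<integral>\<^sup>+y. ennreal ((norm (?x y))\<^sup>2) \<partial>(M \<Otimes>\<^sub>M lborel)) = (\<integral>\<^sup>+\<omega>. (\<integral>\<^sup>+s\<in>{t..T}. ennreal ((norm (x s \<omega>))\<^sup>2) \<partial>lborel) \<partial>M)"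
    unfolding lborel.nn_integral_fst[OF nx, symmetric] by (intro nn_integral_cong) (auto simp: indicator_def)
  then have sq: "square_integrable (M \<Otimes>\<^sub>M lborel) ?x"
    using x2 by (subst square_integrable_iff_nn_integral[OF x]) simp
  have "(\<lambda>y. (norm (?x y))\<^sup>2) = (\<lambda>(\<omega>, s). indicator {t..T} s * (norm (x s \<omega>))\<^sup>2)"
    by (auto simp: fun_eq_iff indicator_def)
  with square_integrable_integrable[OF sq]
  show "integrable (M \<Otimes>\<^sub>M lborel) (\<lambda>(\<omega>, s). indicator {t..T} s * (norm (x s \<omega>))\<^sup>2)" by simp
  have Rx: "(\<lambda>y. ?R y *v ?x y) \<in> borel_measurable (M \<Otimes>\<^sub>M lborel)" by (rule borel_measurable_matrix_vector_mult[OF Rj x])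
  have bnd: "AE y in M \<Otimes>\<^sub>M lborel. norm (?R y) \<le> c"
  proof (rule MT.AE_pair_measure)
    show "{y \<in> space (M \<Otimes>\<^sub>M lborel). norm (?R y) \<le> c} \<in> sets (M \<Otimes>\<^sub>M lborel)"
      using measurable_compose[OF Rj borel_measurable_norm] by measurable
    show "AE \<omega> in M. AE s in lborel. norm (?R (\<omega>, s)) \<le> c"
      using c(2) by eventually_elim (auto elim!: eventually_mono simp: indicator_def less_imp_le[OF c(1)])
  qed
  have "square_integrable (M \<Otimes>\<^sub>M lborel) (\<lambda>y. ?R y *v ?x y)"
  proof (rule square_integrable_bound(1)[OF sq Rx])
    show "AE y in M \<Otimes>\<^sub>M lborel. norm (?R y *v ?x y) \<le> c * norm (?x y)"
      using bnd by eventually_elim (intro order_trans[OF norm_matrix_vector_mult_le] mult_right_mono, auto)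
  qed
  from square_integrable_inner[OF this sq]
  have "integrable (M \<Otimes>\<^sub>M lborel) (\<lambda>y. (?R y *v ?x y) \<bullet> ?x y)" .
  also have "(\<lambda>y. (?R y *v ?x y) \<bullet> ?x y) = (\<lambda>(\<omega>, s). indicator {t..T} s * ((R s \<omega> *v x s \<omega>) \<bullet> x s \<omega>))"
    using t by (auto simp: fun_eq_iff indicator_def)
  finally show "integrable (M \<Otimes>\<^sub>M lborel) (\<lambda>(\<omega>, s). indicator {t..T} s * ((R s \<omega> *v x s \<omega>) \<bullet> x s \<omega>))" .
qed

text \<open>The cost is an iterated Bochner integral of the whole integrand. Integrability of the
  two quadratic terms allows splitting it, and Fubini puts the expectation inside, because the state
  is estimated at fixed times. The term with \<open>S\<close> vanishes almost everywhere.\<close>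

lemma cost_split:
  fixes Q :: "real \<Rightarrow> 'w \<Rightarrow> real^'n^'n" and S :: "real \<Rightarrow> 'w \<Rightarrow> real^'n^'m" and R :: "real \<Rightarrow> 'w \<Rightarrow> real^'m^'m"
  assumes t: "0 \<le> t" "t < T" and Q: "bounded_predictable M T \<F> Q" and R: "bounded_predictable M T \<F> R"
    and S: "bounded_predictable M T \<F> S" and S0: "AE \<omega> in M. AE s in lborel. s \<in> {0..T} \<longrightarrow> S s \<omega> = 0"
    and X: "(\<lambda>(\<omega>, s). indicator {t..T} s *\<^sub>R X s \<omega>) \<in> borel_measurable (M \<Otimes>\<^sub>M lborel)"
      "(\<integral>\<^sup>+\<omega>. (\<integral>\<^sup>+s\<in>{t..T}. ennreal ((norm (X s \<omega>))\<^sup>2) \<partial>lborel) \<partial>M) < \<infinity>"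
    and u: "(\<lambda>(\<omega>, s). indicator {t..T} s *\<^sub>R u s \<omega>) \<in> borel_measurable (M \<Otimes>\<^sub>M lborel)"
      "(\<integral>\<^sup>+\<omega>. (\<integral>\<^sup>+s\<in>{t..T}. ennreal ((norm (u s \<omega>))\<^sup>2) \<partial>lborel) \<partial>M) < \<infinity>"
    and GX: "integrable M (\<lambda>\<omega>. (G \<omega> *v X T \<omega>) \<bullet> X T \<omega>)"
  shows "cost M T Q S R G t u X = (\<integral>\<omega>. (G \<omega> *v X T \<omega>) \<bullet> X T \<omega> \<partial>M)
     + (\<integral>s. \<integral>\<omega>. indicator {t..T} s * ((Q s \<omega> *v X s \<omega>) \<bullet> X s \<omega>) \<partial>M \<partial>lborel)
     + (\<integral>s. \<integral>\<omega>. indicator {t..T} s * ((R s \<omega> *v u s \<omega>) \<bullet> u s \<omega>) \<partial>M \<partial>lborel)"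
proof -
  interpret MT: pair_sigma_finite M "lborel :: real measure" ..
  note iQ = quadratic_cost_integrable(1)[OF t(1) Q X] and iR = quadratic_cost_integrable(1)[OF t(1) R u]
  let ?q = "\<lambda>\<omega> s. indicator {t..T} s * ((Q s \<omega> *v X s \<omega>) \<bullet> X s \<omega>)" and ?r = "\<lambda>\<omega> s. indicator {t..T} s * ((R s \<omega> *v u s \<omega>) \<bullet> u s \<omega>)"
  let ?c = "\<lambda>\<omega> s. indicator {t..T} s *\<^sub>R ((Q s \<omega> *v X s \<omega>) \<bullet> X s \<omega> + 2 * ((S s \<omega> *v X s \<omega>) \<bullet> u s \<omega>) + (R s \<omega> *v u s \<omega>) \<bullet> u s \<omega>)"
  let ?s = "\<lambda>\<omega> s. indicator {t..T} s * ((S s \<omega> *v X s \<omega>) \<bullet> u s \<omega>)"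
  have sm: "(\<lambda>(\<omega>, s). ?s \<omega> s) \<in> borel_measurable (M \<Otimes>\<^sub>M lborel)"
  proof -
    have "(\<lambda>y. ((case y of (\<omega>, s) \<Rightarrow> indicator {0..T} s *\<^sub>R S s \<omega>) *v (case y of (\<omega>, s) \<Rightarrow> indicator {t..T} s *\<^sub>R X s \<omega>))
        \<bullet> (case y of (\<omega>, s) \<Rightarrow> indicator {t..T} s *\<^sub>R u s \<omega>)) \<in> borel_measurable (M \<Otimes>\<^sub>M lborel)"
      by (rule borel_measurable_inner[OF borel_measurable_matrix_vector_mult[OF bounded_predictable_joint[OF S] X(1)] u(1)])
    also have "(\<lambda>y. ((case y of (\<omega>, s) \<Rightarrow> indicator {0..T} s *\<^sub>R S s \<omega>) *v (case y of (\<omega>, s) \<Rightarrow> indicator {t..T} s *\<^sub>R X s \<omega>))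
        \<bullet> (case y of (\<omega>, s) \<Rightarrow> indicator {t..T} s *\<^sub>R u s \<omega>)) = (\<lambda>(\<omega>, s). ?s \<omega> s)"
      using t by (auto simp: fun_eq_iff indicator_def)
    finally show ?thesis .
  qed
  have c_eq: "(\<lambda>(\<omega>, s). ?c \<omega> s) = (\<lambda>y. ((case y of (\<omega>, s) \<Rightarrow> ?q \<omega> s) + 2 * (case y of (\<omega>, s) \<Rightarrow> ?s \<omega> s)) + (case y of (\<omega>, s) \<Rightarrow> ?r \<omega> s))"
    by (auto simp: fun_eq_iff algebra_simps)
  have cm: "(\<lambda>(\<omega>, s). ?c \<omega> s) \<in> borel_measurable (M \<Otimes>\<^sub>M lborel)"
    unfolding c_eq using iQ iR sm by (intro borel_measurable_add borel_measurable_times) auto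
  have Jm: "(\<lambda>\<omega>. \<integral>s. ?c \<omega> s \<partial>lborel) \<in> borel_measurable M"
    by (rule lborel.borel_measurable_lebesgue_integral[OF cm])
  have inner: "AE \<omega> in M. (\<integral>s. ?c \<omega> s \<partial>lborel) = (\<integral>s. ?q \<omega> s \<partial>lborel) + (\<integral>s. ?r \<omega> s \<partial>lborel)"
    using MT.AE_integrable_fst[OF iQ] MT.AE_integrable_fst[OF iR] S0 AE_space
  proof eventually_elim
    case (elim \<omega>)
    have "(\<integral>s. ?c \<omega> s \<partial>lborel) = (\<integral>s. ?q \<omega> s + ?r \<omega> s \<partial>lborel)"
    proof (rule integral_cong_AE)
      show "(\<lambda>s. ?c \<omega> s) \<in> borel_measurable lborel" using joint_section[OF cm elim(4)] by simp
      show "(\<lambda>s. ?q \<omega> s + ?r \<omega> s) \<in> borel_measurable lborel" using elim(1,2) by auto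
      show "AE s in lborel. ?c \<omega> s = ?q \<omega> s + ?r \<omega> s"
        using elim(3)
      proof eventually_elim
        case (elim s)
        then show ?case using t
          by (cases "s \<in> {t..T}") (auto simp: bounded_bilinear.zero_left[OF bounded_bilinear_matrix_vector_mult])
      qed
    qed
    then show ?case using elim(1,2) by simp
  qed
  have "cost M T Q S R G t u X = (\<integral>\<omega>. (G \<omega> *v X T \<omega>) \<bullet> X T \<omega> + (\<integral>s. ?c \<omega> s \<partial>lborel) \<partial>M)"
    by (simp add: cost_def set_lebesgue_integral_def)
  also have "\<dots> = (\<integral>\<omega>. (G \<omega> *v X T \<omega>) \<bullet> X T \<omega> + ((\<integral>s. ?q \<omega> s \<partial>lborel) + (\<integral>s. ?r \<omega> s \<partial>lborel)) \<partial>M)"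
  proof (rule integral_cong_AE)
    show "(\<lambda>\<omega>. (G \<omega> *v X T \<omega>) \<bullet> X T \<omega> + (\<integral>s. ?c \<omega> s \<partial>lborel)) \<in> borel_measurable M"
      using GX Jm by (intro borel_measurable_add) auto
    show "(\<lambda>\<omega>. (G \<omega> *v X T \<omega>) \<bullet> X T \<omega> + ((\<integral>s. ?q \<omega> s \<partial>lborel) + (\<integral>s. ?r \<omega> s \<partial>lborel))) \<in> borel_measurable M"
      using GX MT.integrable_fst[OF iQ] MT.integrable_fst[OF iR] by (intro borel_measurable_add) auto
  qed (use inner in \<open>auto elim: eventually_mono\<close>)
  also have "\<dots> = (\<integral>\<omega>. (G \<omega> *v X T \<omega>) \<bullet> X T \<omega> \<partial>M) + ((\<integral>\<omega>. \<integral>s. ?q \<omega> s \<partial>lborel \<partial>M) + (\<integral>\<omega>. \<integral>s. ?r \<omega> s \<partial>lborel \<partial>M))"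
    using GX MT.integrable_fst[OF iQ] MT.integrable_fst[OF iR] by simp
  finally show ?thesis using MT.Fubini_integral[OF iQ] MT.Fubini_integral[OF iR] by simp
qed

end

section \<open>From the matrix inequality to expectations\<close>

lemma integral_le_of_nn_integral_le_cmult:
  fixes f :: "'a \<Rightarrow> real"
  assumes f: "integrable M f" and le: "AE x in M. ennreal (f x) \<le> ennreal c * g x"
    and g: "(\<integral>\<^sup>+x. g x \<partial>M) = ennreal a" and nonneg: "0 \<le> c" "0 \<le> a"
  shows "(\<integral>x. f x \<partial>M) \<le> c * a"
\<comment> \<open>For \<open>c = 0\<close> one cannot divide by \<open>c\<close>, but then the bound
  is 0 even where \<open>g\<close> is infinite.\<close>
proof (cases "c = 0")
  case True
  have "(\<integral>x. f x \<partial>M) \<le> (\<integral>x. 0 \<partial>M)"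
    by (rule integral_mono_AE[OF f]) (use le True in \<open>auto elim: eventually_mono simp: ennreal_eq_0_iff\<close>)
  then show ?thesis using True by simp
next
  case False
  with nonneg have c: "0 < c" by simp
  have "(\<integral>\<^sup>+x. ennreal (f x / c) \<partial>M) \<le> (\<integral>\<^sup>+x. g x \<partial>M)"
  proof (rule nn_integral_mono_AE)
    show "AE x in M. ennreal (f x / c) \<le> g x"
      using le
    proof eventually_elim
      case (elim x)
      have "ennreal (f x) = ennreal c * ennreal (f x / c)" using c by (simp add: ennreal_mult'[symmetric])
      with elim c show ?case by (simp add: ennreal_mult_le_mult_iff)
    qed
  qed
  with f g nonneg have "(\<integral>x. f x / c \<partial>M) \<le> a"
    by (intro integral_le_of_nn_integral_le) auto
  with c show ?thesis by (simp add: field_simps)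
qed

text \<open>Where the matrix \<open>F\<^sup>T F\<close> is not integrable, its Bochner integral is \<open>0\<close>, so that only an inequality holds.\<close>

lemma integral_gram_le:
  fixes F :: "'z \<Rightarrow> real^'m^'n"
  shows "ennreal (((LINT z|\<Lambda>. transpose (F z) ** F z) *v u) \<bullet> u) \<le> (\<integral>\<^sup>+z. ennreal ((norm (F z *v u))\<^sup>2) \<partial>\<Lambda>)"
proof (cases "integrable \<Lambda> (\<lambda>z. transpose (F z) ** F z)")
  case True
  have bl: "bounded_linear (\<lambda>B :: real^'m^'m. (B *v u) \<bullet> u)"
    by (intro bounded_linear_compose[OF bounded_linear_inner_left] bounded_bilinear.bounded_linear_left[OF bounded_bilinear_matrix_vector_mult])
  have eq: "((transpose (F z) ** F z) *v u) \<bullet> u = (norm (F z *v u))\<^sup>2" for z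
    by (simp add: matrix_vector_mul_assoc[symmetric] dot_lmul_matrix[symmetric] transpose_matrix_vector power2_norm_eq_inner)
  have int: "integrable \<Lambda> (\<lambda>z. (norm (F z *v u))\<^sup>2)"
    using integrable_bounded_linear[OF bl True] by (simp add: eq)
  have "((LINT z|\<Lambda>. transpose (F z) ** F z) *v u) \<bullet> u = (LINT z|\<Lambda>. (norm (F z *v u))\<^sup>2)"
    using integral_bounded_linear[OF bl True] by (simp add: eq)
  then show ?thesis using nn_integral_eq_integral[OF int] by simp
qed (simp add: not_integrable_integral_eq bounded_bilinear.zero_left[OF bounded_bilinear_matrix_vector_mult])

text \<open>The terms with \<open>\<delta>\<close> and \<open>R\<close>, whose difference may have
  either sign, are gathered on the left. What remains on the right is \<open>c\<close> times the
  integrand whose expectation is the noise density.\<close>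

lemma loewner_le_gram:
  fixes F :: "'z \<Rightarrow> real^'m^'n" and D :: "real^'m^'k" and R :: "real^'m^'m"
  assumes c: "0 \<le> c"
    and le: "loewner_le (\<delta> *\<^sub>R mat 1) (c *\<^sub>R (transpose D ** D + (LINT z|\<Lambda>. transpose (F z) ** F z)) + R)"
  shows "ennreal (\<delta> * (norm u)\<^sup>2 - (R *v u) \<bullet> u)
    \<le> ennreal c * (ennreal ((norm (D *v u))\<^sup>2) + (\<integral>\<^sup>+z. ennreal ((norm (F z *v u))\<^sup>2) \<partial>\<Lambda>))"
proof -
  define K where "K = (LINT z|\<Lambda>. transpose (F z) ** F z)"
  have D: "((transpose D ** D) *v u) \<bullet> u = (norm (D *v u))\<^sup>2"
    by (simp add: matrix_vector_mul_assoc[symmetric] dot_lmul_matrix[symmetric] transpose_matrix_vector power2_norm_eq_inner)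
  have "0 \<le> ((c *\<^sub>R (transpose D ** D + K) + R - \<delta> *\<^sub>R mat 1) *v u) \<bullet> u"
    using le unfolding loewner_le_def K_def by blast
  also have "\<dots> = c * ((norm (D *v u))\<^sup>2 + (K *v u) \<bullet> u) + (R *v u) \<bullet> u - \<delta> * (norm u)\<^sup>2"
    by (simp add: matrix_vector_mult_diff_rdistrib matrix_vector_mult_add_rdistrib scaleR_matrix_vector_assoc[symmetric]
        inner_diff_left inner_add_left D power2_norm_eq_inner)
  finally have "ennreal (\<delta> * (norm u)\<^sup>2 - (R *v u) \<bullet> u) \<le> ennreal (c * ((norm (D *v u))\<^sup>2 + (K *v u) \<bullet> u))"
    by (intro ennreal_leI) simp
  also have "\<dots> = ennreal c * ennreal ((norm (D *v u))\<^sup>2 + (K *v u) \<bullet> u)" using c by (rule ennreal_mult')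
  also have "\<dots> \<le> ennreal c * (ennreal ((norm (D *v u))\<^sup>2) + ennreal ((K *v u) \<bullet> u))"
    by (intro mult_left_mono, cases "0 \<le> (K *v u) \<bullet> u") (auto simp: ennreal_neg intro: ennreal_leI)
  also have "\<dots> \<le> ennreal c * (ennreal ((norm (D *v u))\<^sup>2) + (\<integral>\<^sup>+z. ennreal ((norm (F z *v u))\<^sup>2) \<partial>\<Lambda>))"
    unfolding K_def by (intro mult_left_mono add_left_mono integral_gram_le) auto
  finally show ?thesis .
qed

section \<open>Lower bounds for the terminal, running and total cost\<close>

context lq_noise
begin

lemma terminal_cost_lower_bound:
  fixes G :: "'w \<Rightarrow> real^'n^'n" and x :: "'w \<Rightarrow> real^'n"
  assumes G: "G \<in> borel_measurable M" "AE \<omega> in M. norm (G \<omega>) \<le> c" "\<And>\<omega>. \<omega> \<in> space M \<Longrightarrow> symmetric_matrix (G \<omega>)"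
    and x: "square_integrable M x"
  shows "integrable M (\<lambda>\<omega>. (G \<omega> *v x \<omega>) \<bullet> x \<omega>)"
    and "essinf M (\<lambda>\<omega>. smallest_eigenvalue (G \<omega>)) * (\<integral>\<omega>. (norm (x \<omega>))\<^sup>2 \<partial>M) \<le> (\<integral>\<omega>. (G \<omega> *v x \<omega>) \<bullet> x \<omega> \<partial>M)"
proof -
  have Gx: "square_integrable M (\<lambda>\<omega>. G \<omega> *v x \<omega>)"
  proof (rule square_integrable_bound(1)[OF x])
    show "AE \<omega> in M. norm (G \<omega> *v x \<omega>) \<le> c * norm (x \<omega>)"
      using G(2) by eventually_elim (intro order_trans[OF norm_matrix_vector_mult_le] mult_right_mono, auto)
  qed (intro borel_measurable_matrix_vector_mult G(1) square_integrable_measurable[OF x])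
  show int: "integrable M (\<lambda>\<omega>. (G \<omega> *v x \<omega>) \<bullet> x \<omega>)" by (rule square_integrable_inner[OF Gx x])
  have m: "(\<lambda>\<omega>. smallest_eigenvalue (G \<omega>)) \<in> borel_measurable M"
    using borel_measurable_rayleigh_min[OF G(1)]
    by (subst measurable_cong[where g = "\<lambda>\<omega>. rayleigh_min (G \<omega>)"]) (auto simp: smallest_eigenvalue_eq_rayleigh_min[OF G(3)])
  have bnd: "AE \<omega> in M. \<bar>smallest_eigenvalue (G \<omega>)\<bar> \<le> c"
    using G(2) AE_space by eventually_elim (auto simp: smallest_eigenvalue_eq_rayleigh_min[OF G(3)] intro: order_trans[OF abs_rayleigh_min_le])
  have "(\<integral>\<omega>. essinf M (\<lambda>\<omega>. smallest_eigenvalue (G \<omega>)) * (norm (x \<omega>))\<^sup>2 \<partial>M) \<le> (\<integral>\<omega>. (G \<omega> *v x \<omega>) \<bullet> x \<omega> \<partial>M)"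
  proof (rule integral_mono_AE[OF _ int])
    show "AE \<omega> in M. essinf M (\<lambda>\<omega>. smallest_eigenvalue (G \<omega>)) * (norm (x \<omega>))\<^sup>2 \<le> (G \<omega> *v x \<omega>) \<bullet> x \<omega>"
      using essinf_bounds(1)[OF m bnd] AE_space
    proof eventually_elim
      case (elim \<omega>)
      then have "essinf M (\<lambda>\<omega>. smallest_eigenvalue (G \<omega>)) \<le> rayleigh_min (G \<omega>)"
        by (simp add: smallest_eigenvalue_eq_rayleigh_min[OF G(3)])
      from mult_right_mono[OF this] show ?case by (rule order_trans[OF _ rayleigh_min_le]) simp
    qed
  qed (use square_integrable_integrable[OF x] in simp)
  then show "essinf M (\<lambda>\<omega>. smallest_eigenvalue (G \<omega>)) * (\<integral>\<omega>. (norm (x \<omega>))\<^sup>2 \<partial>M) \<le> (\<integral>\<omega>. (G \<omega> *v x \<omega>) \<bullet> x \<omega> \<partial>M)" by simp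
qed

text \<open>At a fixed time \<open>Q\<close> is bounded below by the deterministic number
  \<open>l s\<close>, and since this is nonnegative the growth estimate can be inserted. Exchanging
  the order of integration leaves the tail integral of \<open>l s * w s\<close> as the weight of
  \<open>g\<close>.\<close>

lemma running_cost_lower_bound:
  fixes Q :: "real \<Rightarrow> 'w \<Rightarrow> real^'n^'n" and X :: "real \<Rightarrow> 'w \<Rightarrow> real^'n"
  assumes t: "0 \<le> t" "t < T" and Q: "bounded_predictable M T \<F> Q"
    and sym: "\<And>s \<omega>. s \<in> {0..T} \<Longrightarrow> \<omega> \<in> space M \<Longrightarrow> symmetric_matrix (Q s \<omega>)"
    and l_def: "\<And>s. l s = essinf M (\<lambda>\<omega>. smallest_eigenvalue (Q s \<omega>))" and l_nonneg: "AE s in lborel. s \<in> {0..T} \<longrightarrow> 0 \<le> l s"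
    and X: "(\<lambda>(\<omega>, s). indicator {t..T} s *\<^sub>R X s \<omega>) \<in> borel_measurable (M \<Otimes>\<^sub>M lborel)"
      "(\<integral>\<^sup>+\<omega>. (\<integral>\<^sup>+s\<in>{t..T}. ennreal ((norm (X s \<omega>))\<^sup>2) \<partial>lborel) \<partial>M) < \<infinity>"
      "\<And>s. s \<in> {t..T} \<Longrightarrow> square_integrable M (X s)"
    and w: "continuous_on {0..T} w" and g: "set_integrable lborel {t..T} g"
    and lower: "\<And>s. s \<in> {t..T} \<Longrightarrow> w s * (LINT r:{t..s}|lborel. g r) \<le> (\<integral>\<omega>. (norm (X s \<omega>))\<^sup>2 \<partial>M)"
  shows "set_integrable lborel {t..T} (\<lambda>r. (LINT s:{r..T}|lborel. l s * w s) * g r)"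
    and "(LINT r:{t..T}|lborel. (LINT s:{r..T}|lborel. l s * w s) * g r)
      \<le> (\<integral>s. \<integral>\<omega>. indicator {t..T} s * ((Q s \<omega> *v X s \<omega>) \<bullet> X s \<omega>) \<partial>M \<partial>lborel)"
proof -
  interpret MT: pair_sigma_finite M "lborel :: real measure" ..
  obtain c where c: "0 < c" "(\<lambda>s. indicator {0..T} s *\<^sub>R l s) \<in> borel_measurable lborel"
    "AE s in lborel. s \<in> {0..T} \<longrightarrow> \<bar>l s\<bar> \<le> c \<and> (AE \<omega> in M. l s \<le> rayleigh_min (Q s \<omega>))"
    using essinf_eigenvalue[OF Q sym] unfolding l_def by blast
  have lw: "set_integrable lborel {t..T} (\<lambda>s. l s * w s)"
  proof -
    obtain K where K: "\<forall>s\<in>{0..T}. \<bar>w s\<bar> \<le> K"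
      using compact_imp_bounded[OF compact_continuous_image[OF w]] by (auto simp: bounded_iff)
    have wm: "(\<lambda>s. indicator {0..T} s *\<^sub>R w s) \<in> borel_measurable lborel"
      using borel_measurable_continuous_on_indicator[OF _ w] by simp
    have m: "(\<lambda>s. indicator {t..T} s *\<^sub>R (l s * w s)) \<in> borel_measurable lborel"
    proof -
      have "(\<lambda>s. indicator {t..T} s * ((indicator {0..T} s *\<^sub>R l s) * (indicator {0..T} s *\<^sub>R w s))) \<in> borel_measurable lborel"
        using c(2) wm by (intro borel_measurable_times) auto
      also have "(\<lambda>s. indicator {t..T} s * ((indicator {0..T} s *\<^sub>R l s) * (indicator {0..T} s *\<^sub>R w s))) = (\<lambda>s. indicator {t..T} s *\<^sub>R (l s * w s))"
        using t by (auto simp: fun_eq_iff indicator_def)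
      finally show ?thesis .
    qed
    show ?thesis unfolding set_integrable_def
    proof (rule Bochner_Integration.integrable_bound[where f = "\<lambda>s. indicator {t..T} s *\<^sub>R (c * K)"])
      show "integrable lborel (\<lambda>s. indicator {t..T} s *\<^sub>R (c * K))"
        by (intro integrable_scaleR_left integrable_real_indicator) (auto simp: emeasure_lborel_Icc_eq)
      show "AE s in lborel. norm (indicator {t..T} s *\<^sub>R (l s * w s)) \<le> norm (indicator {t..T} s *\<^sub>R (c * K))"
        using c(3)
      proof eventually_elim
        case (elim s)
        show ?case
        proof (cases "s \<in> {t..T}")
          case True
          with t elim bspec[OF K, of s] have "\<bar>l s\<bar> * \<bar>w s\<bar> \<le> c * K" by (intro mult_mono) auto
          then show ?thesis using True by (simp add: abs_mult order_trans[OF _ abs_ge_self[of "c * K", unfolded abs_mult]])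
        qed simp
      qed
    qed (use m in simp)
  qed
  note swap = set_integrable_triangle_swap[OF lw g]
  show "set_integrable lborel {t..T} (\<lambda>r. (LINT s:{r..T}|lborel. l s * w s) * g r)" by (rule swap(2))
  note iQ = quadratic_cost_integrable(1)[OF t(1) Q X(1,2)]
  have "(LINT s:{t..T}|lborel. l s * w s * (LINT r:{t..s}|lborel. g r))
      \<le> (\<integral>s. \<integral>\<omega>. indicator {t..T} s * ((Q s \<omega> *v X s \<omega>) \<bullet> X s \<omega>) \<partial>M \<partial>lborel)"
    unfolding set_lebesgue_integral_def
  proof (rule integral_mono_AE)
    show "AE s in lborel. indicator {t..T} s *\<^sub>R (l s * w s * (\<integral>r. indicator {t..s} r *\<^sub>R g r \<partial>lborel))
        \<le> (\<integral>\<omega>. indicator {t..T} s * ((Q s \<omega> *v X s \<omega>) \<bullet> X s \<omega>) \<partial>M)"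
      using c(3) l_nonneg MT.AE_integrable_snd[OF iQ]
    proof eventually_elim
      case (elim s)
      show ?case
      proof (cases "s \<in> {t..T}")
        case True
        with t have s: "s \<in> {0..T}" by auto
        have "l s * (w s * (LINT r:{t..s}|lborel. g r)) \<le> l s * (\<integral>\<omega>. (norm (X s \<omega>))\<^sup>2 \<partial>M)"
          using lower[OF True] elim(2) s by (intro mult_left_mono) auto
        also have "\<dots> = (\<integral>\<omega>. l s * (norm (X s \<omega>))\<^sup>2 \<partial>M)" by simp
        also have "\<dots> \<le> (\<integral>\<omega>. (Q s \<omega> *v X s \<omega>) \<bullet> X s \<omega> \<partial>M)"
        proof (rule integral_mono_AE)
          show "AE \<omega> in M. l s * (norm (X s \<omega>))\<^sup>2 \<le> (Q s \<omega> *v X s \<omega>) \<bullet> X s \<omega>"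
            using elim(1)[rule_format, OF s, THEN conjunct2]
            by eventually_elim (intro order_trans[OF mult_right_mono rayleigh_min_le], auto)
        qed (use elim(3) True square_integrable_integrable[OF X(3)[OF True]] in auto)
        finally show ?thesis using True by (simp add: set_lebesgue_integral_def mult.assoc)
      qed simp
    qed
  qed (use swap(1) MT.integrable_snd[OF iQ] in \<open>simp_all add: set_integrable_def set_lebesgue_integral_def\<close>)
  then show "(LINT r:{t..T}|lborel. (LINT s:{r..T}|lborel. l s * w s) * g r)
      \<le> (\<integral>s. \<integral>\<omega>. indicator {t..T} s * ((Q s \<omega> *v X s \<omega>) \<bullet> X s \<omega>) \<partial>M \<partial>lborel)"
    unfolding swap(3) .
qed

text \<open>Tested with the control, the matrix inequality bounds the mean of \<open>\<delta> *
  (norm (u r \<omega>))\<^sup>2 - (R r \<omega> *v u r \<omega>) \<bullet> u r \<omega>\<close> by a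
  multiple of \<open>h r\<close>. Integrated over time, this multiple is at most the sum of the
  terminal and the running cost of the state.\<close>

lemma cost_lower_bound:
  fixes A C Q \<Phi> :: "real \<Rightarrow> 'w \<Rightarrow> real^'n^'n" and B D :: "real \<Rightarrow> 'w \<Rightarrow> real^'m^'n"
    and S :: "real \<Rightarrow> 'w \<Rightarrow> real^'n^'m" and R :: "real \<Rightarrow> 'w \<Rightarrow> real^'m^'m"
    and E :: "real \<Rightarrow> 'w \<Rightarrow> 'z \<Rightarrow> real^'n^'n" and F :: "real \<Rightarrow> 'w \<Rightarrow> 'z \<Rightarrow> real^'m^'n"
    and G :: "'w \<Rightarrow> real^'n^'n"
  assumes t: "0 \<le> t" "t < T"
    and bp: "bounded_predictable M T \<F> A" "bounded_predictable M T \<F> B" "bounded_predictable M T \<F> Q"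
      "bounded_predictable M T \<F> S" "bounded_predictable M T \<F> R"
    and G: "G \<in> borel_measurable (\<F> T)" "AE \<omega> in M. norm (G \<omega>) \<le> c"
    and symQ: "\<And>s \<omega>. s \<in> {0..T} \<Longrightarrow> \<omega> \<in> space M \<Longrightarrow> symmetric_matrix (Q s \<omega>)"
    and symG: "\<And>\<omega>. \<omega> \<in> space M \<Longrightarrow> symmetric_matrix (G \<omega>)"
    and zero: "AE (s, \<omega>) in time_measure T \<Otimes>\<^sub>M M. B s \<omega> = 0 \<and> C s \<omega> = 0"
      "AE (s, \<omega>) in time_measure T \<Otimes>\<^sub>M M. S s \<omega> = 0"
      "AE ((s, \<omega>), z) in (time_measure T \<Otimes>\<^sub>M M) \<Otimes>\<^sub>M \<Lambda>. E s \<omega> z = 0"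
    and \<Phi>: "fundamental_solution M T \<F> A \<Phi>"
    and lG: "lG = essinf M (\<lambda>\<omega>. smallest_eigenvalue (G \<omega>))" "0 \<le> lG"
    and lQ: "\<And>s. lQ s = essinf M (\<lambda>\<omega>. smallest_eigenvalue (Q s \<omega>))" "AE s in lborel. s \<in> {0..T} \<longrightarrow> 0 \<le> lQ s"
    and convex: "AE r in lborel. r \<in> {0..T} \<longrightarrow> (AE \<omega> in M.
           loewner_le (\<delta> *\<^sub>R mat 1)
             (((lG / (essnorm M (\<lambda>\<omega>. matrix_inv (\<Phi> T \<omega>)))\<^sup>2 +
                 (LINT s:{r..T}|lborel. lQ s / (essnorm M (\<lambda>\<omega>. matrix_inv (\<Phi> s \<omega>)))\<^sup>2))
                / (essnorm M (\<Phi> r))\<^sup>2) *\<^sub>R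
                (transpose (D r \<omega>) ** D r \<omega> + (LINT z|\<Lambda>. transpose (F r \<omega> z) ** F r \<omega> z)) + R r \<omega>))"
    and u: "u \<in> controls M T \<F> t"
    and X: "is_state M T \<Lambda> \<F> W N A B C D E F t (\<lambda>_. 0) u X"
  shows "\<delta> * (LINT \<omega>|M. (LINT s:{t..T}|lborel. (norm (u s \<omega>))\<^sup>2)) \<le> cost M T Q S R G t u X"
proof -
  interpret MT: pair_sigma_finite M "lborel :: real measure" ..
  define w where "w s = 1 / (essnorm M (\<lambda>\<omega>. matrix_inv (\<Phi> s \<omega>)))\<^sup>2" for s
  define p where "p r = 1 / (essnorm M (\<Phi> r))\<^sup>2" for r
  define k where "k r = (LINT s:{r..T}|lborel. lQ s * w s)" for r
  obtain h where h: "set_integrable lborel {t..T} h" "\<And>s. 0 \<le> h s"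
    "AE s in lborel. s \<in> {t..T} \<longrightarrow> ennreal (h s) =
        (\<integral>\<^sup>+\<omega>. (ennreal ((norm (D s \<omega> *v u s \<omega>))\<^sup>2) + (\<integral>\<^sup>+z. ennreal ((norm (F s \<omega> z *v u s \<omega>))\<^sup>2) \<partial>\<Lambda>)) \<partial>M)"
    and Xsq: "\<And>s. s \<in> {t..T} \<Longrightarrow> square_integrable M (X s)"
    and ph: "\<And>a b. t \<le> a \<Longrightarrow> b \<le> T \<Longrightarrow> set_integrable lborel {a..b} (\<lambda>r. p r * h r)"
    and lower: "\<And>s. s \<in> {t..T} \<Longrightarrow> w s * (LINT r:{t..s}|lborel. p r * h r) \<le> (\<integral>\<omega>. (norm (X s \<omega>))\<^sup>2 \<partial>M)"
    and w_cont: "continuous_on {0..T} w"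
    and Xj: "(\<lambda>(\<omega>, s). indicator {t..T} s *\<^sub>R X s \<omega>) \<in> borel_measurable (M \<Otimes>\<^sub>M lborel)"
    unfolding w_def[abs_def] p_def
  proof (rule state_lower_bound[OF t bp(1,2) zero(1,3) \<Phi> u X], goal_cases)
    case (1 h)
    show ?case by (rule 1(1); fact 1)
  qed
  have uj: "(\<lambda>(\<omega>, s). indicator {t..T} s *\<^sub>R u s \<omega>) \<in> borel_measurable (M \<Otimes>\<^sub>M lborel)"
    using u t unfolding controls_def by (intro predictable_joint_measurable) auto
  have u2: "(\<integral>\<^sup>+\<omega>. (\<integral>\<^sup>+s\<in>{t..T}. ennreal ((norm (u s \<omega>))\<^sup>2) \<partial>lborel) \<partial>M) < \<infinity>"
    using u unfolding controls_def by blast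
  have X2: "(\<integral>\<^sup>+\<omega>. (\<integral>\<^sup>+s\<in>{t..T}. ennreal ((norm (X s \<omega>))\<^sup>2) \<partial>lborel) \<partial>M) < \<infinity>"
    using X unfolding is_state_def by blast
  have GM: "G \<in> borel_measurable M" using measurable_\<F>_M[OF G(1)] T by simp
  have TT: "T \<in> {t..T}" using t by simp
  note terminal = terminal_cost_lower_bound[OF GM G(2) symG Xsq[OF TT]]
  note running = running_cost_lower_bound[OF t bp(3) symQ lQ Xj X2 Xsq w_cont ph[of t T] lower, folded k_def, simplified]
  note iR = quadratic_cost_integrable(1)[OF t(1) bp(5) uj u2] and iu = quadratic_cost_integrable(2)[OF t(1) bp(5) uj u2]
  have split: "cost M T Q S R G t u X = (\<integral>\<omega>. (G \<omega> *v X T \<omega>) \<bullet> X T \<omega> \<partial>M)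
     + (\<integral>s. \<integral>\<omega>. indicator {t..T} s * ((Q s \<omega> *v X s \<omega>) \<bullet> X s \<omega>) \<partial>M \<partial>lborel)
     + (\<integral>s. \<integral>\<omega>. indicator {t..T} s * ((R s \<omega> *v u s \<omega>) \<bullet> u s \<omega>) \<partial>M \<partial>lborel)"
    by (rule cost_split[OF t bp(3,5,4) AE_time_measure(1)[OF zero(2)] Xj X2 uj u2 terminal(1)])
  have w_nonneg: "0 \<le> w s" and p_nonneg: "0 \<le> p s" for s by (auto simp: w_def p_def)
  have k_nonneg: "0 \<le> k r" if "r \<in> {t..T}" for r
    unfolding k_def set_lebesgue_integral_def
  proof (rule integral_nonneg_AE)
    show "AE s in lborel. 0 \<le> indicator {r..T} s *\<^sub>R (lQ s * w s)"
      using lQ(2) by eventually_elim (use that t w_nonneg in \<open>auto simp: indicator_def\<close>)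
  qed
  have "AE r in lborel. \<delta> * (\<integral>\<omega>. indicator {t..T} r * (norm (u r \<omega>))\<^sup>2 \<partial>M)
     \<le> indicator {t..T} r *\<^sub>R (lG * w T * (p r * h r)) + indicator {t..T} r *\<^sub>R (k r * (p r * h r))
       + (\<integral>\<omega>. indicator {t..T} r * ((R r \<omega> *v u r \<omega>) \<bullet> u r \<omega>) \<partial>M)"
    using convex h(3) MT.AE_integrable_snd[OF iR] MT.AE_integrable_snd[OF iu]
  proof eventually_elim
    case (elim r)
    show ?case
    proof (cases "r \<in> {t..T}")
      case True
      with t have r: "r \<in> {0..T}" by auto
      \<comment> \<open>The scalar in front of the matrix \<open>H\<close> of the theorem:
        \<open>lG * w T\<close> comes from the terminal cost, \<open>k r\<close> from the running
        cost after time \<open>r\<close>, and \<open>p r\<close> from the transport of the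
        noise.\<close>
      define c' where "c' = (lG * w T + k r) * p r"
      have c': "0 \<le> c'" unfolding c'_def using lG(2) w_nonneg p_nonneg k_nonneg[OF True] by auto
      have int: "integrable M (\<lambda>\<omega>. (R r \<omega> *v u r \<omega>) \<bullet> u r \<omega>)" "integrable M (\<lambda>\<omega>. (norm (u r \<omega>))\<^sup>2)"
        using elim(3,4) True by simp_all
      have c'_eq: "(lG / (essnorm M (\<lambda>\<omega>. matrix_inv (\<Phi> T \<omega>)))\<^sup>2 +
          (LINT s:{r..T}|lborel. lQ s / (essnorm M (\<lambda>\<omega>. matrix_inv (\<Phi> s \<omega>)))\<^sup>2)) / (essnorm M (\<Phi> r))\<^sup>2 = c'"
        by (simp add: c'_def k_def w_def p_def)
      have "(\<integral>\<omega>. \<delta> * (norm (u r \<omega>))\<^sup>2 - (R r \<omega> *v u r \<omega>) \<bullet> u r \<omega> \<partial>M) \<le> c' * h r"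
      proof (rule integral_le_of_nn_integral_le_cmult[OF _ _ _ c' h(2)])
        show "AE \<omega> in M. ennreal (\<delta> * (norm (u r \<omega>))\<^sup>2 - (R r \<omega> *v u r \<omega>) \<bullet> u r \<omega>)
            \<le> ennreal c' * (ennreal ((norm (D r \<omega> *v u r \<omega>))\<^sup>2) + (\<integral>\<^sup>+z. ennreal ((norm (F r \<omega> z *v u r \<omega>))\<^sup>2) \<partial>\<Lambda>))"
          using elim(1)[rule_format, OF r] unfolding c'_eq by eventually_elim (rule loewner_le_gram[OF c'])
      qed (use int elim(2) True in auto)
      then show ?thesis using int True by (simp add: c'_def algebra_simps)
    qed simp
  qed
  then have "(\<integral>r. \<delta> * (\<integral>\<omega>. indicator {t..T} r * (norm (u r \<omega>))\<^sup>2 \<partial>M) \<partial>lborel)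
     \<le> (\<integral>r. indicator {t..T} r *\<^sub>R (lG * w T * (p r * h r)) + indicator {t..T} r *\<^sub>R (k r * (p r * h r))
       + (\<integral>\<omega>. indicator {t..T} r * ((R r \<omega> *v u r \<omega>) \<bullet> u r \<omega>) \<partial>M) \<partial>lborel)"
    using MT.integrable_snd[OF iR] MT.integrable_snd[OF iu] running(1) set_integrable_mult_right[OF ph[of t T], of "lG * w T"]
    by (intro integral_mono_AE) (auto simp: set_integrable_def)
  also have "\<dots> = (LINT r:{t..T}|lborel. lG * w T * (p r * h r)) + (LINT r:{t..T}|lborel. k r * (p r * h r))
       + (\<integral>r. \<integral>\<omega>. indicator {t..T} r * ((R r \<omega> *v u r \<omega>) \<bullet> u r \<omega>) \<partial>M \<partial>lborel)"
    using MT.integrable_snd[OF iR] running(1) set_integrable_mult_right[OF ph[of t T], of "lG * w T"]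
    unfolding set_integrable_def set_lebesgue_integral_def by simp
  also have "(LINT r:{t..T}|lborel. lG * w T * (p r * h r)) = lG * (w T * (LINT r:{t..T}|lborel. p r * h r))"
    by (simp add: mult.assoc)
  also have "\<dots> \<le> lG * (\<integral>\<omega>. (norm (X T \<omega>))\<^sup>2 \<partial>M)"
    by (rule mult_left_mono[OF lower[OF TT] lG(2)])
  also have "\<dots> \<le> (\<integral>\<omega>. (G \<omega> *v X T \<omega>) \<bullet> X T \<omega> \<partial>M)"
    using terminal(2) unfolding lG(1) .
  finally have "(\<integral>r. \<delta> * (\<integral>\<omega>. indicator {t..T} r * (norm (u r \<omega>))\<^sup>2 \<partial>M) \<partial>lborel) \<le> cost M T Q S R G t u X"
    using running(2) unfolding split by simp
  then show ?thesis using MT.Fubini_integral[OF iu] by (simp add: set_lebesgue_integral_def)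
qed

end

theorem theorem6p2:
  fixes M :: "'w measure" and T :: real and \<Lambda> :: "'z measure"
    and W :: "real \<Rightarrow> 'w \<Rightarrow> real" and N :: "'w \<Rightarrow> (real \<times> 'z) measure"
    and \<F> :: "real \<Rightarrow> 'w measure"
    and A C Q \<Phi> :: "real \<Rightarrow> 'w \<Rightarrow> real^'n^'n"
    and B D :: "real \<Rightarrow> 'w \<Rightarrow> real^'m^'n"
    and S :: "real \<Rightarrow> 'w \<Rightarrow> real^'n^'m"
    and R :: "real \<Rightarrow> 'w \<Rightarrow> real^'m^'m"
    and E :: "real \<Rightarrow> 'w \<Rightarrow> 'z \<Rightarrow> real^'n^'n"
    and F :: "real \<Rightarrow> 'w \<Rightarrow> 'z \<Rightarrow> real^'m^'n"
    and G :: "'w \<Rightarrow> real^'n^'n"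
    and H :: "real \<Rightarrow> 'w \<Rightarrow> real^'m^'m"
    and l\<^sub>G :: real and l\<^sub>Q :: "real \<Rightarrow> real" and \<delta> :: real
  assumes "prob_space M" and "complete_measure M" and "T > 0" and "finite_measure \<Lambda>"
    and "brownian_motion M T W" and "poisson_random_measure M T \<Lambda> N"
    and "independent_noises M T \<Lambda> W N"
    and "\<F> = augmented_filtration M T \<Lambda> W N"
    and "bounded_predictable M T \<F> A" and "bounded_predictable M T \<F> B"
    and "bounded_predictable M T \<F> C" and "bounded_predictable M T \<F> D"
    and "bounded_predictable M T \<F> Q" and "bounded_predictable M T \<F> S"
    and "bounded_predictable M T \<F> R"
    and "bounded_predictable_mark M T \<Lambda> \<F> E" and "bounded_predictable_mark M T \<Lambda> \<F> F"
    and "G \<in> borel_measurable (\<F> T)" and "\<exists>c. AE \<omega> in M. norm (G \<omega>) \<le> c"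
    and "\<forall>s\<in>{0..T}. \<forall>\<omega>\<in>space M. symmetric_matrix (Q s \<omega>) \<and> symmetric_matrix (R s \<omega>)"
    and "\<forall>\<omega>\<in>space M. symmetric_matrix (G \<omega>)"
    and "AE (s, \<omega>) in time_measure T \<Otimes>\<^sub>M M. B s \<omega> = 0 \<and> C s \<omega> = 0 \<and> S s \<omega> = 0"
    and "AE ((s, \<omega>), z) in (time_measure T \<Otimes>\<^sub>M M) \<Otimes>\<^sub>M \<Lambda>. E s \<omega> z = 0"
    and "fundamental_solution M T \<F> A \<Phi>"
    and "l\<^sub>G = essinf M (\<lambda>\<omega>. smallest_eigenvalue (G \<omega>))"
    and "\<And>s. l\<^sub>Q s = essinf M (\<lambda>\<omega>. smallest_eigenvalue (Q s \<omega>))"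
    and "l\<^sub>G \<ge> 0" and "AE s in lborel. s \<in> {0..T} \<longrightarrow> l\<^sub>Q s \<ge> 0"
    and "\<And>r \<omega>. H r \<omega> = transpose (D r \<omega>) ** D r \<omega> +
                        (LINT z|\<Lambda>. transpose (F r \<omega> z) ** F r \<omega> z)"
    and "\<delta> > 0"
    and "AE r in lborel. r \<in> {0..T} \<longrightarrow> (AE \<omega> in M.
           loewner_le (\<delta> *\<^sub>R mat 1)
             (((l\<^sub>G / (essnorm M (\<lambda>\<omega>. matrix_inv (\<Phi> T \<omega>)))\<^sup>2 +
                 (LINT s:{r..T}|lborel. l\<^sub>Q s / (essnorm M (\<lambda>\<omega>. matrix_inv (\<Phi> s \<omega>)))\<^sup>2))
                / (essnorm M (\<Phi> r))\<^sup>2) *\<^sub>R H r \<omega>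
              + R r \<omega>))"
  shows "\<forall>t\<in>{0..<T}. uniformly_convex_cost M T \<Lambda> \<F> W N A B C D E F Q S R G t"
proof
  fix t assume t: "t \<in> {0..<T}"
  note asms = assms[unfolded \<open>\<F> = augmented_filtration M T \<Lambda> W N\<close>]
  interpret lq_noise M T \<Lambda> W N
    using assms(1,3-7) by (intro lq_noise.intro lq_noise_axioms.intro)
  obtain c where c: "AE \<omega> in M. norm (G \<omega>) \<le> c" using assms(19) by blast
  have zero: "AE (s, \<omega>) in time_measure T \<Otimes>\<^sub>M M. B s \<omega> = 0 \<and> C s \<omega> = 0"
    "AE (s, \<omega>) in time_measure T \<Otimes>\<^sub>M M. S s \<omega> = 0"
    using assms(22) by (auto elim!: eventually_mono)
  have sym: "\<And>s \<omega>. s \<in> {0..T} \<Longrightarrow> \<omega> \<in> space M \<Longrightarrow> symmetric_matrix (Q s \<omega>)"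
    "\<And>\<omega>. \<omega> \<in> space M \<Longrightarrow> symmetric_matrix (G \<omega>)"
    using assms(20,21) by blast+
  note lower = cost_lower_bound[OF _ _ asms(9,10,13,14,15,18) c sym zero asms(23,24,25,27,26,28) asms(31)[unfolded assms(29)]]
  show "uniformly_convex_cost M T \<Lambda> \<F> W N A B C D E F Q S R G t"
    unfolding uniformly_convex_cost_def \<open>\<F> = augmented_filtration M T \<Lambda> W N\<close>
    using assms(30) t by (intro exI[of _ \<delta>]) (auto intro!: lower)
qed

end
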